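(* Consider a sequence of problem instances indexed by $n\to\infty$ (with $m,\mu_0,K$ depending on $n$ and $\sigma\in(0,\infty)$ fixed), where $K\subset\mathbb{R}^n$ is a closed convex set, $\mu_0\in K$, and $Y=X\mu_0+\xi\in\mathbb{R}^m$ is observed from the Gaussian linear measurement model described in the context. Suppose $m>\delta_K$ and let $r_n\in(0,\infty)$ be the unique solution of $$n^{-1}\,\mathbb{E}\,\mathrm{err}\big(\omega_{m/n}(r)\big)=r^2 .$$ Assume further: (R1) $r_n^2=\mathcal{O}(1)$ and $m/\mathfrak{L}_n\to\infty$; (R2) with $\omega_n=\omega_{m/n}(r_n)$, $$\limsup_{n\to\infty}\frac{1}{2n\sigma^2}\big(\mathbb{E}\,\mathrm{lrt}(\omega_n)-\mathbb{E}\,\mathrm{err}(\omega_n)\big)<1 .$$ Then for any sequence of near minimizers $\hat\mu(\sigma)\in K$ satisfying $$m^{-1}\|Y-X\hat\mu(\sigma)\|^2\le \min_{\mu\in K} m^{-1}\|Y-X\mu\|^2+\mathfrak{o}_{\mathbf P}(r_n^2),$$ it holds as $n\to\infty$ that $$n^{-1}\|\hat\mu(\sigma)-\mu_0\|^2=(1+\mathfrak{o}_{\mathbf P}(1))\big(r_n^2+\mathcal{O}_{\mathbf P}(\mathfrak{L}_n/m)\big),$$ i.e. there are random variables $Z_n=\mathcal{O}_{\mathbf P}(\mathfrak{L}_n/m)$ such that $n^{-1}\|\hat\mu(\sigma)-\mu_0\|^2=(1+\mathfrak{o}_{\mathbf P}(1))(r_n^2+Z_n)$.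
   Context: Model: $Y=X\mu_0+\xi$, where $X\in\mathbb{R}^{m\times n}$ has i.i.d. $\mathcal{N}(0,1/n)$ entries, and $\xi\in\mathbb{R}^m$ is independent of $X$ with i.i.d. coordinates of mean $0$ and variance $\sigma^2\in(0,\infty)$; the common law of the coordinates does not depend on $n$. $\|\cdot\|$ is the Euclidean norm. Sequence-model quantities: $\Pi_K$ is the metric projection onto $K$, $h\sim\mathcal{N}(0,I_n)$; for a noise level $\tau\ge 0$, $\hat\mu_K^{\mathrm{seq}}(\tau)=\Pi_K(\mu_0+\tau h)$, $\mathrm{err}(\tau)=\|\hat\mu_K^{\mathrm{seq}}(\tau)-\mu_0\|^2$, and $\mathrm{lrt}(\tau)=\|\tau h\|^2-\|\mu_0+\tau h-\hat\mu_K^{\mathrm{seq}}(\tau)\|^2$. Expectations of $\mathrm{err},\mathrm{lrt}$ are over $h$. $\omega_\delta(r)=\sqrt{(r^2+\sigma^2)/\delta}$. $\delta_K=\lim_{\tau\uparrow\infty}\mathbb{E}\|\Pi_K(\tau h)\|^2/\tau^2$ (generalized statistical dimension; equals $\mathbb{E}\|\Pi_K(h)\|^2$ when $K$ is a closed convex cone). $T_K(\mu_0)=\mathrm{cl}\{\alpha(\nu-\mu_0):\alpha\ge 0,\nu\in K\}$ is the tangent cone. $\mathfrak{L}_n=\log(1+\delta_{T_K(\mu_0)})+\log\log(16n)$. Known fact: if $K\neq\{\mu_0\}$, the fixed point equation has a solution in $(0,\infty)$ if and only if $m>\delta_K$, and it is then unique. *)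

theory Defs
  imports "HOL-Probability.Probability" "HOL-Library.Landau_Symbols"
begin

section \<open>The space of real n-vectors\<close>

text \<open>
  Since the dimension varies inside the statement, a vector of length \<open>n\<close> is a function on
  \<open>nat\<close> that vanishes from index \<open>n\<close> on, i.e. a point of \<^const>\<open>Euclidean_space\<close> \<open>n\<close>.
\<close>

definition vnorm :: "nat \<Rightarrow> (nat \<Rightarrow> real) \<Rightarrow> real" where
  "vnorm n x = L2_set x {..<n}"

definition closed_convex :: "nat \<Rightarrow> (nat \<Rightarrow> real) set \<Rightarrow> bool" where
  "closed_convex n K \<longleftrightarrow>
     closedin (Euclidean_space n) K \<and>
     (\<forall>x\<in>K. \<forall>y\<in>K. \<forall>t\<in>{0..1}. (\<lambda>i. (1 - t) * x i + t * y i) \<in> K)"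

definition metric_proj :: "nat \<Rightarrow> (nat \<Rightarrow> real) set \<Rightarrow> (nat \<Rightarrow> real) \<Rightarrow> (nat \<Rightarrow> real)" where
  "metric_proj n K x = arg_min_on (\<lambda>y. vnorm n (\<lambda>i. x i - y i)) K"

definition tangent_cone :: "nat \<Rightarrow> (nat \<Rightarrow> real) set \<Rightarrow> (nat \<Rightarrow> real) \<Rightarrow> (nat \<Rightarrow> real) set" where
  "tangent_cone n K \<mu>0 =
     Euclidean_space n closure_of {(\<lambda>i. \<alpha> * (\<nu> i - \<mu>0 i)) | \<alpha> \<nu>. \<alpha> \<ge> 0 \<and> \<nu> \<in> K}"

text \<open>
  The law of a standard Gaussian vector on \<^const>\<open>Euclidean_space\<close> \<open>n\<close>. The finite product
  measure lives on extensional functions (value \<^const>\<open>undefined\<close> from index \<open>n\<close> on); the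
  pushforward replaces these junk values by 0.
\<close>

definition std_gaussian :: "nat \<Rightarrow> (nat \<Rightarrow> real) measure" where
  "std_gaussian n =
     distr (Pi\<^sub>M {..<n} (\<lambda>_. density lborel std_normal_density)) (Pi\<^sub>M UNIV (\<lambda>_. borel))
       (\<lambda>h i. if i < n then h i else 0)"

section \<open>Sequence model quantities\<close>

definition seq_lse :: "nat \<Rightarrow> (nat \<Rightarrow> real) set \<Rightarrow> (nat \<Rightarrow> real) \<Rightarrow> real \<Rightarrow> (nat \<Rightarrow> real) \<Rightarrow> (nat \<Rightarrow> real)"
  where "seq_lse n K \<mu>0 \<tau> h = metric_proj n K (\<lambda>i. \<mu>0 i + \<tau> * h i)"

definition seq_err :: "nat \<Rightarrow> (nat \<Rightarrow> real) set \<Rightarrow> (nat \<Rightarrow> real) \<Rightarrow> real \<Rightarrow> (nat \<Rightarrow> real) \<Rightarrow> real" where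
  "seq_err n K \<mu>0 \<tau> h = (vnorm n (\<lambda>i. seq_lse n K \<mu>0 \<tau> h i - \<mu>0 i))\<^sup>2"

definition seq_lrt :: "nat \<Rightarrow> (nat \<Rightarrow> real) set \<Rightarrow> (nat \<Rightarrow> real) \<Rightarrow> real \<Rightarrow> (nat \<Rightarrow> real) \<Rightarrow> real" where
  "seq_lrt n K \<mu>0 \<tau> h =
     (vnorm n (\<lambda>i. \<tau> * h i))\<^sup>2 - (vnorm n (\<lambda>i. \<mu>0 i + \<tau> * h i - seq_lse n K \<mu>0 \<tau> h i))\<^sup>2"

definition E_err :: "nat \<Rightarrow> (nat \<Rightarrow> real) set \<Rightarrow> (nat \<Rightarrow> real) \<Rightarrow> real \<Rightarrow> real" where
  "E_err n K \<mu>0 \<tau> = (\<integral>h. seq_err n K \<mu>0 \<tau> h \<partial>std_gaussian n)"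

definition E_lrt :: "nat \<Rightarrow> (nat \<Rightarrow> real) set \<Rightarrow> (nat \<Rightarrow> real) \<Rightarrow> real \<Rightarrow> real" where
  "E_lrt n K \<mu>0 \<tau> = (\<integral>h. seq_lrt n K \<mu>0 \<tau> h \<partial>std_gaussian n)"

definition noise_level :: "real \<Rightarrow> real \<Rightarrow> real \<Rightarrow> real" where
  "noise_level \<sigma> \<delta> r = sqrt ((r\<^sup>2 + \<sigma>\<^sup>2) / \<delta>)"

definition stat_dim :: "nat \<Rightarrow> (nat \<Rightarrow> real) set \<Rightarrow> real" where
  "stat_dim n K =
     Lim at_top (\<lambda>\<tau>. (\<integral>h. (vnorm n (metric_proj n K (\<lambda>i. \<tau> * h i)))\<^sup>2 \<partial>std_gaussian n) / \<tau>\<^sup>2)"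

definition log_factor :: "nat \<Rightarrow> (nat \<Rightarrow> real) set \<Rightarrow> (nat \<Rightarrow> real) \<Rightarrow> real" where
  "log_factor n K \<mu>0 = ln (1 + stat_dim n (tangent_cone n K \<mu>0)) + ln (ln (16 * real n))"

section \<open>The Gaussian linear measurement model\<close>

text \<open>
  \<open>X \<omega> i j\<close> and \<open>\<xi> \<omega> i\<close> are only constrained for \<open>i < m\<close>, \<open>j < n\<close>; other entries are never used.
  Note that \<^const>\<open>normal_density\<close> takes the standard deviation, not the variance. Since
  \<open>prob_space.indep_var\<close> needs both variables to have the same type, independence of the
  matrix \<open>X\<close> and the vector \<open>\<xi>\<close> is that of the sigma-algebras they generate.
\<close>

definition gaussian_linear_model ::
  "'a measure \<Rightarrow> nat \<Rightarrow> nat \<Rightarrow> ('a \<Rightarrow> nat \<Rightarrow> nat \<Rightarrow> real) \<Rightarrow> ('a \<Rightarrow> nat \<Rightarrow> real) \<Rightarrow> real measure \<Rightarrow> bool"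
where
  "gaussian_linear_model P m n X \<xi> noise_law \<longleftrightarrow>
     prob_space P \<and>
     (\<forall>i<m. \<forall>j<n. distributed P lborel (\<lambda>\<omega>. X \<omega> i j) (normal_density 0 (1 / sqrt (real n)))) \<and>
     prob_space.indep_vars P (\<lambda>_. borel) (\<lambda>p \<omega>. X \<omega> (fst p) (snd p)) ({..<m} \<times> {..<n}) \<and>
     (\<forall>i<m. (\<lambda>\<omega>. \<xi> \<omega> i) \<in> borel_measurable P \<and> distr P borel (\<lambda>\<omega>. \<xi> \<omega> i) = noise_law) \<and>
     prob_space.indep_vars P (\<lambda>_. borel) (\<lambda>i \<omega>. \<xi> \<omega> i) {..<m} \<and>
     prob_space.indep_set P
       (sets (vimage_algebra (space P) (\<lambda>\<omega>. \<lambda>p\<in>{..<m} \<times> {..<n}. X \<omega> (fst p) (snd p))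
                (Pi\<^sub>M ({..<m} \<times> {..<n}) (\<lambda>_. borel))))
       (sets (vimage_algebra (space P) (\<lambda>\<omega>. \<lambda>i\<in>{..<m}. \<xi> \<omega> i) (Pi\<^sub>M {..<m} (\<lambda>_. borel))))"

definition mat_vec :: "nat \<Rightarrow> (nat \<Rightarrow> nat \<Rightarrow> real) \<Rightarrow> (nat \<Rightarrow> real) \<Rightarrow> (nat \<Rightarrow> real)" where
  "mat_vec n A x = (\<lambda>i. \<Sum>j<n. A i j * x j)"

definition sq_loss ::
  "nat \<Rightarrow> nat \<Rightarrow> (nat \<Rightarrow> nat \<Rightarrow> real) \<Rightarrow> (nat \<Rightarrow> real) \<Rightarrow> (nat \<Rightarrow> real) \<Rightarrow> real" where
  "sq_loss m n A y \<mu> = (vnorm m (\<lambda>i. y i - mat_vec n A \<mu> i))\<^sup>2 / real m"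

section \<open>Stochastic order symbols\<close>

text \<open>
  The underlying probability space may change with \<open>n\<close>. Measurability is part of the
  definitions, since \<^const>\<open>measure\<close> is 0 on non-measurable sets.
\<close>

definition small_o_P :: "(nat \<Rightarrow> 'a measure) \<Rightarrow> (nat \<Rightarrow> 'a \<Rightarrow> real) \<Rightarrow> (nat \<Rightarrow> real) \<Rightarrow> bool" where
  "small_o_P P Z a \<longleftrightarrow>
     (\<forall>n. Z n \<in> borel_measurable (P n)) \<and>
     (\<forall>\<epsilon>>0. (\<lambda>n. measure (P n) {\<omega> \<in> space (P n). \<bar>Z n \<omega>\<bar> > \<epsilon> * \<bar>a n\<bar>}) \<longlonglongrightarrow> 0)"

definition big_O_P :: "(nat \<Rightarrow> 'a measure) \<Rightarrow> (nat \<Rightarrow> 'a \<Rightarrow> real) \<Rightarrow> (nat \<Rightarrow> real) \<Rightarrow> bool" where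
  "big_O_P P Z a \<longleftrightarrow>
     (\<forall>n. Z n \<in> borel_measurable (P n)) \<and>
     (\<forall>\<epsilon>>0. \<exists>C>0. \<forall>\<^sub>F n in sequentially.
        measure (P n) {\<omega> \<in> space (P n). \<bar>Z n \<omega>\<bar> > C * \<bar>a n\<bar>} \<le> \<epsilon>)"

end

theory Submission
  imports Defs "HOL-Real_Asymp.Real_Asymp"
begin

text \<open>The proof is a convex Gaussian min-max argument. Every fluctuation is compared with the scale
  \<open>b\<^sup>2 = r\<^sup>2 + L / m\<close>. It suffices to show that \<open>V = \<parallel>\<mu>hat - \<mu>0\<parallel>\<^sup>2 / n\<close> satisfies
  \<open>\<bar>V - r\<^sup>2\<bar> \<le> e * b\<^sup>2\<close> with probability tending to 1 for each \<open>e > 0\<close>: with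
  \<open>\<theta> = (V - r\<^sup>2) / b\<^sup>2\<close> and \<open>a = L / m\<close> one has
  \<open>V = (1 + \<theta>) * (r\<^sup>2 + a * \<theta> / (1 + \<theta>))\<close>. Only \<open>m * b\<^sup>2 \<longlongrightarrow> \<infinity>\<close> is
  needed of the logarithmic factor, so Chebyshev bounds are enough.

  Conditionally on the noise, Gordon's inequality decouples \<open>\<parallel>X w - \<xi>\<parallel>\<close> into
  \<open>\<parallel>s g - \<xi>\<parallel> - h \<bullet> w / \<surd>n\<close> with \<open>s = \<parallel>w\<parallel> / \<surd>n\<close>. The projection property of
  the sequence model estimator at the noise level of the fixed point bounds \<open>h \<bullet> w\<close> by a
  function of \<open>s\<close>, \<open>err\<close> and \<open>lrt\<close>. As \<open>err\<close> and \<open>lrt\<close> concentrate, what is left is a strongly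
  convex function of \<open>s\<close>, minimal at \<open>s = r\<close>, whose minimum is bounded away from 0 by (R2).
  The upper bound uses the dual form of Gordon's inequality.\<close>

section \<open>Norm and metric projection\<close>

text \<open>The gap in the scalar problem is of order \<open>b\<^sup>2\<close>, so
  \<open>err\<close> and \<open>lrt\<close> per coordinate and the noise inner product need only be
  controlled up to small multiples of \<open>b\<close> or \<open>b\<^sup>2\<close>. At that scale
  Chebyshev gives failure probabilities of order \<open>1 / (m * b\<^sup>2)\<close>; two laws of
  large numbers cover the rest. The fixed point equation makes \<open>r\<close> the minimizer: the
  error of the sequence estimator concentrates at \<open>r\<close>, so the linear term in
  \<open>s\<close> has slope \<open>r / sqrt (r\<^sup>2 + \<sigma>\<^sup>2)\<close>, the derivative
  of \<open>sqrt (s\<^sup>2 + \<sigma>\<^sup>2)\<close> at \<open>r\<close>.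

  The set may be unbounded, so Gordon's inequality is used only in the ball of radius
  \<open>r + \<epsilon> * b\<close>, and convexity of the loss excludes everything beyond. Suprema
  run over countable dense sets, which keeps the events measurable.

  Gordon's inequality compares norms, while near minimality concerns squared norms. A minimum
  bounded away from 0 turns a gap in norm into a comparable gap in squares, large enough to absorb
  the slack.

  Gaussian interpolation and the Poincare inequality are discretized: many small steps with summable
  Taylor remainders replace derivatives of integrals.\<close>

definition ip :: "nat \<Rightarrow> (nat \<Rightarrow> real) \<Rightarrow> (nat \<Rightarrow> real) \<Rightarrow> real" where
  "ip n x y = (\<Sum>i<n. x i * y i)"

lemma vnorm_sq: "(vnorm n x)\<^sup>2 = ip n x x"
  by (simp add: vnorm_def L2_set_def ip_def sum_nonneg power2_eq_square)

lemma vnorm_nonneg [simp]: "0 \<le> vnorm n x"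
  by (simp add: vnorm_def)

lemma ip_nonneg [simp]: "0 \<le> ip n x x"
  by (simp flip: vnorm_sq)

lemma ip_commute: "ip n x y = ip n y x"
  by (simp add: ip_def mult.commute)

lemma ip_add_left: "ip n (\<lambda>i. x i + y i) z = ip n x z + ip n y z"
  and ip_diff_left: "ip n (\<lambda>i. x i - y i) z = ip n x z - ip n y z"
  and ip_scale_left: "ip n (\<lambda>i. c * x i) z = c * ip n x z"
  by (simp_all add: ip_def algebra_simps sum.distrib sum_subtractf sum_distrib_left)

lemma ip_add_right: "ip n z (\<lambda>i. x i + y i) = ip n z x + ip n z y"
  and ip_diff_right: "ip n z (\<lambda>i. x i - y i) = ip n z x - ip n z y"
  and ip_scale_right: "ip n z (\<lambda>i. c * x i) = c * ip n z x"
  by (simp_all add: ip_def algebra_simps sum.distrib sum_subtractf sum_distrib_left)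

lemmas ip_simps = ip_add_left ip_diff_left ip_scale_left ip_add_right ip_diff_right ip_scale_right

lemma ip_abs_le: "\<bar>ip n x y\<bar> \<le> vnorm n x * vnorm n y"
proof -
  have "\<bar>ip n x y\<bar> \<le> (\<Sum>i<n. \<bar>x i\<bar> * \<bar>y i\<bar>)"
    unfolding ip_def by (rule order_trans[OF sum_abs]) (simp add: abs_mult)
  also have "\<dots> \<le> vnorm n x * vnorm n y"
    unfolding vnorm_def by (rule L2_set_mult_ineq)
  finally show ?thesis .
qed

lemma ip_le: "ip n x y \<le> vnorm n x * vnorm n y"
  using ip_abs_le[of n x y] by linarith

lemma vnorm_cong: "(\<And>i. i < n \<Longrightarrow> x i = y i) \<Longrightarrow> vnorm n x = vnorm n y"
  by (auto simp: vnorm_def intro!: L2_set_cong)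

lemma ip_cong: "(\<And>i. i < n \<Longrightarrow> x i = x' i) \<Longrightarrow> (\<And>i. i < n \<Longrightarrow> y i = y' i) \<Longrightarrow> ip n x y = ip n x' y'"
  by (auto simp: ip_def intro!: sum.cong)

lemma vnorm_triangle: "vnorm n (\<lambda>i. x i + y i) \<le> vnorm n x + vnorm n y"
  unfolding vnorm_def by (rule L2_set_triangle_ineq)

lemma vnorm_scale: "vnorm n (\<lambda>i. c * x i) = \<bar>c\<bar> * vnorm n x"
proof -
  have "(vnorm n (\<lambda>i. c * x i))\<^sup>2 = (\<bar>c\<bar> * vnorm n x)\<^sup>2"
    by (simp add: vnorm_sq ip_simps power_mult_distrib power2_eq_square[of c])
  then show ?thesis by (simp add: power2_eq_iff_nonneg)
qed

lemma vnorm_minus_commute: "vnorm n (\<lambda>i. x i - y i) = vnorm n (\<lambda>i. y i - x i)"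
  using vnorm_scale[of n "-1" "\<lambda>i. x i - y i"] by simp

lemma vnorm_diff_triangle: "vnorm n x - vnorm n y \<le> vnorm n (\<lambda>i. x i - y i)"
  using vnorm_triangle[of n y "\<lambda>i. x i - y i"] by simp

lemma abs_vnorm_diff_le: "\<bar>vnorm n x - vnorm n y\<bar> \<le> vnorm n (\<lambda>i. x i - y i)"
  using vnorm_diff_triangle[of n x y] vnorm_diff_triangle[of n y x] vnorm_minus_commute[of n x y]
  by (simp add: abs_le_iff)

lemma vnorm_sq_diff: "(vnorm n (\<lambda>i. x i - y i))\<^sup>2 = (vnorm n x)\<^sup>2 - 2 * ip n x y + (vnorm n y)\<^sup>2"
  by (simp add: vnorm_sq ip_simps ip_commute[of n y x])

lemma vnorm_sq_add: "(vnorm n (\<lambda>i. x i + y i))\<^sup>2 = (vnorm n x)\<^sup>2 + 2 * ip n x y + (vnorm n y)\<^sup>2"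
  by (simp add: vnorm_sq ip_simps ip_commute[of n y x])

lemma abs_coord_le_vnorm: "i < n \<Longrightarrow> \<bar>x i\<bar> \<le> vnorm n x"
  using member_le_L2_set[of "{..<n}" i "\<lambda>i. \<bar>x i\<bar>"] by (simp add: vnorm_def L2_set_def)

lemma continuous_on_ip [continuous_intros]:
  assumes "\<And>i. i < n \<Longrightarrow> continuous_on S (\<lambda>x. f x i)" "\<And>i. i < n \<Longrightarrow> continuous_on S (\<lambda>x. g x i)"
  shows "continuous_on S (\<lambda>x. ip n (f x) (g x))"
  unfolding ip_def using assms by (intro continuous_intros) auto

lemma vnorm_eq_sqrt: "vnorm n x = sqrt (ip n x x)"
  using vnorm_sq[of n x] by (metis real_sqrt_unique vnorm_nonneg)

lemma continuous_on_vnorm [continuous_intros]: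
  assumes "\<And>i. i < n \<Longrightarrow> continuous_on S (\<lambda>x. f x i)"
  shows "continuous_on S (\<lambda>x. vnorm n (f x))"
  unfolding vnorm_eq_sqrt by (intro continuous_intros assms)

lemma measurable_ip [measurable (raw)]:
  assumes "\<And>i. i < n \<Longrightarrow> (\<lambda>x. f x i) \<in> borel_measurable M" "\<And>i. i < n \<Longrightarrow> (\<lambda>x. g x i) \<in> borel_measurable M"
  shows "(\<lambda>x. ip n (f x) (g x)) \<in> borel_measurable M"
  unfolding ip_def by (intro borel_measurable_sum borel_measurable_times assms) auto

lemma measurable_vnorm [measurable (raw)]:
  assumes "\<And>i. i < n \<Longrightarrow> (\<lambda>x. f x i) \<in> borel_measurable M"
  shows "(\<lambda>x. vnorm n (f x)) \<in> borel_measurable M"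
  unfolding vnorm_eq_sqrt by (rule measurable_compose[OF measurable_ip borel_measurable_sqrt]) (use assms in auto)

lemma continuous_on_coord [continuous_intros]: "continuous_on S (\<lambda>x::'i \<Rightarrow> 'b::topological_space. x i)"
  by (rule continuous_on_subset[OF continuous_on_product_coordinates]) simp

lemma tendsto_funI:
  fixes y :: "'b \<Rightarrow> 'i \<Rightarrow> real"
  assumes "\<And>i. ((\<lambda>k. y k i) \<longlongrightarrow> p i) F"
  shows "(y \<longlongrightarrow> p) F"
proof -
  have "limitin (product_topology (\<lambda>i. euclidean) UNIV) y p F"
    using assms by (simp add: limitin_componentwise limitin_canonical_iff)
  then show ?thesis
    by (simp add: euclidean_product_topology limitin_canonical_iff)
qed

section \<open>Metric projection onto a closed convex set\<close>

lemma closed_convexD: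
  assumes "closed_convex n K"
  shows "closed K" "\<And>x i. x \<in> K \<Longrightarrow> n \<le> i \<Longrightarrow> x i = 0"
    "\<And>x y t. x \<in> K \<Longrightarrow> y \<in> K \<Longrightarrow> 0 \<le> t \<Longrightarrow> t \<le> 1 \<Longrightarrow> (\<lambda>i. (1 - t) * x i + t * y i) \<in> K"
proof -
  have cl: "closedin (Euclidean_space n) K"
    using assms by (simp add: closed_convex_def)
  show "closed K" using cl by (rule closedin_Euclidean_imp_closed)
  show "\<And>x i. x \<in> K \<Longrightarrow> n \<le> i \<Longrightarrow> x i = 0"
    using closedin_subset[OF cl] by (auto simp: topspace_Euclidean_space)
  show "\<And>x y t. x \<in> K \<Longrightarrow> y \<in> K \<Longrightarrow> 0 \<le> t \<Longrightarrow> t \<le> 1 \<Longrightarrow> (\<lambda>i. (1 - t) * x i + t * y i) \<in> K"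
    using assms by (auto simp: closed_convex_def)
qed

text \<open>By the parallelogram law at midpoints, which stay in \<open>K\<close> by convexity, a
  minimizing sequence is Cauchy in every coordinate below \<open>n\<close>. The other coordinates
  vanish on \<open>K\<close>, so a limit exists in the whole function space and lies in
  \<open>K\<close> by closedness.\<close>

lemma proj_exists:
  assumes K: "closed_convex n K" and ne: "K \<noteq> {}"
  shows "\<exists>p\<in>K. \<forall>y\<in>K. vnorm n (\<lambda>i. x i - p i) \<le> vnorm n (\<lambda>i. x i - y i)"
proof -
  note KD = closed_convexD[OF K]
  define F where "F y = (vnorm n (\<lambda>i. x i - y i))\<^sup>2" for y
  define d where "d = (INF y\<in>K. F y)"
  have bdd: "bdd_below (F ` K)" by (rule bdd_belowI[of _ 0]) (auto simp: F_def)
  have dle: "d \<le> F y" if "y \<in> K" for y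
    unfolding d_def using that bdd by (simp add: cINF_lower)
  have "\<exists>y\<in>K. F y < d + 1 / real (Suc k)" for k
  proof (rule ccontr)
    assume "\<not> ?thesis"
    then have "d + 1 / real (Suc k) \<le> d" unfolding d_def using ne
      by (intro cINF_greatest) (auto simp: not_less d_def[symmetric])
    then show False by simp
  qed
  then have "\<forall>k. \<exists>y. y \<in> K \<and> F y < d + 1 / real (Suc k)" by blast
  then obtain y where y: "\<And>k. y k \<in> K" "\<And>k. F (y k) < d + 1 / real (Suc k)"
    by (auto dest!: choice)
  have par: "(vnorm n (\<lambda>i. y k i - y l i))\<^sup>2 \<le> 2 / real (Suc k) + 2 / real (Suc l)" for k l
  proof -
    have "(\<lambda>i. (1 - 1/2) * y k i + (1/2) * y l i) \<in> K" by (rule KD) (use y in auto)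
    then have "d \<le> F (\<lambda>i. (1 - 1/2) * y k i + (1/2) * y l i)" by (rule dle)
    also have "\<dots> = (F (y k) + F (y l)) / 2 - (vnorm n (\<lambda>i. y k i - y l i))\<^sup>2 / 4"
      unfolding F_def vnorm_sq ip_simps ip_commute[of n "y l" "y k"] ip_commute[of n "y l" x] ip_commute[of n "y k" x]
      by (simp add: field_simps)
    finally have *: "d \<le> (F (y k) + F (y l)) / 2 - (vnorm n (\<lambda>i. y k i - y l i))\<^sup>2 / 4" .
    define ek el where "ek = 1 / real (Suc k)" and "el = 1 / real (Suc l)"
    have "D \<le> 2 * ek + 2 * el" if "d \<le> (a + b) / 2 - D / 4" "a < d + ek" "b < d + el" for a b D :: real
      using that by (simp add: field_simps)
    from this[OF * y(2)[of k, folded ek_def] y(2)[of l, folded el_def]]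
    have "(vnorm n (\<lambda>i. y k i - y l i))\<^sup>2 \<le> 2 * ek + 2 * el" .
    then show ?thesis by (simp add: ek_def el_def)
  qed
  have "Cauchy (\<lambda>k. y k i)" for i
  proof (cases "i < n")
    case False
    then have "(\<lambda>k. y k i) = (\<lambda>k. 0)" using KD(2) y(1) by (auto simp: not_less)
    then show ?thesis using convergent_Cauchy[OF convergent_const[of 0]] by simp
  next
    case True
    show ?thesis
    proof (rule metric_CauchyI)
      fix e :: real assume e: "e > 0"
      obtain N where N: "4 / e\<^sup>2 < real N" using reals_Archimedean2 by blast
      have "dist (y k i) (y l i) < e" if kl: "k \<ge> N" "l \<ge> N" for k l
      proof -
        have "(y k i - y l i)\<^sup>2 \<le> (vnorm n (\<lambda>i. y k i - y l i))\<^sup>2"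
          using abs_coord_le_vnorm[OF True, of "\<lambda>i. y k i - y l i"] power_mono[of "\<bar>y k i - y l i\<bar>" "vnorm n (\<lambda>i. y k i - y l i)" 2] by simp
        also have "\<dots> \<le> 2 / real (Suc N) + 2 / real (Suc N)"
          by (rule order_trans[OF par]) (intro add_mono divide_left_mono, use kl in auto)
        also have "\<dots> = 4 / real (Suc N)" by simp
        also have "4 / real (Suc N) < e\<^sup>2"
        proof -
          have "4 < real N * e\<^sup>2" using N e by (simp add: pos_divide_less_eq)
          also have "\<dots> \<le> real (Suc N) * e\<^sup>2" by (intro mult_right_mono) auto
          finally show ?thesis by (simp add: pos_divide_less_eq mult.commute)
        qed
        finally have "\<bar>y k i - y l i\<bar>\<^sup>2 < e\<^sup>2" by simp
        then have "\<bar>y k i - y l i\<bar> < e" by (rule power2_less_imp_less) (use e in simp)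
        then show ?thesis by (simp add: dist_real_def)
      qed
      then show "\<exists>M. \<forall>m\<ge>M. \<forall>n\<ge>M. dist (y m i) (y n i) < e" by blast
    qed
  qed
  then have "\<forall>i. \<exists>q. (\<lambda>k. y k i) \<longlonglongrightarrow> q" by (simp add: real_Cauchy_convergent convergent_def[symmetric])
  then obtain p where p: "\<And>i. (\<lambda>k. y k i) \<longlonglongrightarrow> p i" by (auto dest!: choice)
  have pK: "p \<in> K"
    using KD(1) y(1) tendsto_funI[OF p] by (rule closed_sequentially)
  have lim: "(\<lambda>k. F (y k)) \<longlonglongrightarrow> F p"
    unfolding F_def vnorm_sq ip_def by (intro tendsto_intros p)
  have "(\<lambda>k. d + inverse (real (Suc k))) \<longlonglongrightarrow> d + 0" by (intro tendsto_add tendsto_const LIMSEQ_inverse_real_of_nat)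
  from LIMSEQ_le[OF lim this] have "F p \<le> d + 0" using y(2) by (auto simp: inverse_eq_divide intro: less_imp_le)
  then have "F p \<le> d" by simp
  then have "F p \<le> F z" if "z \<in> K" for z using dle[OF that] by linarith
  then have "vnorm n (\<lambda>i. x i - p i) \<le> vnorm n (\<lambda>i. x i - z i)" if "z \<in> K" for z
    unfolding F_def using that by (meson power2_le_imp_le vnorm_nonneg)
  then show ?thesis using pK by blast
qed

lemma metric_proj_in:
  assumes "closed_convex n K" "K \<noteq> {}"
  shows "metric_proj n K x \<in> K"
    "\<And>y. y \<in> K \<Longrightarrow> vnorm n (\<lambda>i. x i - metric_proj n K x i) \<le> vnorm n (\<lambda>i. x i - y i)"
proof -
  obtain p where "p \<in> K" "\<forall>y\<in>K. vnorm n (\<lambda>i. x i - p i) \<le> vnorm n (\<lambda>i. x i - y i)"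
    using proj_exists[OF assms] by blast
  then have "is_arg_min (\<lambda>y. vnorm n (\<lambda>i. x i - y i)) (\<lambda>y. y \<in> K) p"
    by (auto simp: is_arg_min_def not_less)
  then have "\<exists>p. is_arg_min (\<lambda>y. vnorm n (\<lambda>i. x i - y i)) (\<lambda>y. y \<in> K) p" by blast
  then have *: "is_arg_min (\<lambda>y. vnorm n (\<lambda>i. x i - y i)) (\<lambda>y. y \<in> K) (metric_proj n K x)"
    unfolding metric_proj_def arg_min_on_def arg_min_def by (rule someI_ex)
  then show "metric_proj n K x \<in> K"
    "\<And>y. y \<in> K \<Longrightarrow> vnorm n (\<lambda>i. x i - metric_proj n K x i) \<le> vnorm n (\<lambda>i. x i - y i)"
    by (auto simp: is_arg_min_def not_less)
qed

text \<open>Moving from the projection a fraction \<open>t\<close> towards \<open>y\<close> cannot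
  reduce the distance. The first-order term in \<open>t\<close> must therefore have the right
  sign.\<close>

lemma metric_proj_obtuse:
  assumes K: "closed_convex n K" "K \<noteq> {}" and y: "y \<in> K"
  shows "ip n (\<lambda>i. x i - metric_proj n K x i) (\<lambda>i. y i - metric_proj n K x i) \<le> 0"
proof (rule ccontr)
  define p where "p = metric_proj n K x"
  note P = metric_proj_in[OF K, where x = x, folded p_def]
  define a where "a = ip n (\<lambda>i. x i - p i) (\<lambda>i. y i - p i)"
  define b where "b = (vnorm n (\<lambda>i. y i - p i))\<^sup>2"
  assume "\<not> ?thesis"
  then have a: "a > 0" by (simp add: a_def p_def)
  have ineq: "2 * a \<le> t * b" if t: "0 < t" "t \<le> 1" for t
  proof -
    have "(\<lambda>i. (1 - t) * p i + t * y i) \<in> K" by (rule closed_convexD[OF K(1)]) (use P y t in auto)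
    then have "vnorm n (\<lambda>i. x i - p i) \<le> vnorm n (\<lambda>i. x i - ((1 - t) * p i + t * y i))"
      by (rule P(2))
    then have "(vnorm n (\<lambda>i. x i - p i))\<^sup>2 \<le> (vnorm n (\<lambda>i. x i - ((1 - t) * p i + t * y i)))\<^sup>2"
      by (simp add: power_mono)
    also have "(\<lambda>i. x i - ((1 - t) * p i + t * y i)) = (\<lambda>i. (x i - p i) - t * (y i - p i))"
      by (auto simp: algebra_simps)
    also have "(vnorm n (\<lambda>i. (x i - p i) - t * (y i - p i)))\<^sup>2 = (vnorm n (\<lambda>i. x i - p i))\<^sup>2 - 2 * t * a + t\<^sup>2 * b"
      by (subst vnorm_sq_diff) (simp add: a_def b_def ip_scale_right vnorm_scale power_mult_distrib)
    finally have "t * (2 * a) \<le> t * (t * b)" by (simp add: power2_eq_square algebra_simps)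
    then show ?thesis using t by simp
  qed
  have b0: "b \<ge> 0" by (simp add: b_def)
  \<comment> \<open>This choice gives \<open>t * b \<le> a\<close>, so
    \<open>2 * a \<le> t * b\<close> fails for positive \<open>a\<close>. The summand 1 covers
    \<open>b = 0\<close>.\<close>
  define t where "t = min 1 (a / (b + 1))"
  have t: "0 < t" "t \<le> 1" using a b0 by (auto simp: t_def)
  have "t * b \<le> a / (b + 1) * b" using b0 by (intro mult_right_mono) (auto simp: t_def)
  also have "\<dots> \<le> a" using a b0 by (simp add: field_simps)
  finally show False using ineq[OF t] a by linarith
qed

lemma eq_of_vnorm_diff_zero:
  assumes "closed_convex n K" "p \<in> K" "q \<in> K" "vnorm n (\<lambda>i. p i - q i) = 0"
  shows "p = q"
proof
  fix i show "p i = q i"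
    using abs_coord_le_vnorm[of i n "\<lambda>i. p i - q i"] closed_convexD(2)[OF assms(1,2), of i]
      closed_convexD(2)[OF assms(1,3), of i] assms(4)
    by (cases "i < n") (auto simp: not_less)
qed

lemma metric_proj_eqI:
  assumes K: "closed_convex n K" and p: "p \<in> K"
    and le: "\<And>y. y \<in> K \<Longrightarrow> vnorm n (\<lambda>i. x i - p i) \<le> vnorm n (\<lambda>i. x i - y i)"
  shows "metric_proj n K x = p"
proof -
  have ne: "K \<noteq> {}" using p by auto
  define q where "q = metric_proj n K x"
  note Q = metric_proj_in[OF K ne, where x = x, folded q_def]
  have "(vnorm n (\<lambda>i. x i - p i))\<^sup>2 \<le> (vnorm n (\<lambda>i. x i - q i))\<^sup>2"
    using le[OF Q(1)] by (simp add: power_mono)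
  moreover have "ip n (\<lambda>i. x i - q i) (\<lambda>i. p i - q i) \<le> 0"
    using metric_proj_obtuse[OF K ne p] by (simp add: q_def)
  moreover have "(vnorm n (\<lambda>i. x i - p i))\<^sup>2 =
    (vnorm n (\<lambda>i. x i - q i))\<^sup>2 - 2 * ip n (\<lambda>i. x i - q i) (\<lambda>i. p i - q i) + (vnorm n (\<lambda>i. p i - q i))\<^sup>2"
    using vnorm_sq_diff[of n "\<lambda>i. x i - q i" "\<lambda>i. p i - q i"] by simp
  ultimately have "(vnorm n (\<lambda>i. p i - q i))\<^sup>2 \<le> 0" by linarith
  then have "vnorm n (\<lambda>i. p i - q i) = 0" by simp
  then show ?thesis using eq_of_vnorm_diff_zero[OF K p Q(1)] by (simp add: q_def)
qed

text \<open>Add the two obtuse-angle inequalities, each tested with the other projection, and apply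
  Cauchy-Schwarz.\<close>

lemma metric_proj_nonexpansive:
  assumes K: "closed_convex n K" "K \<noteq> {}"
  shows "vnorm n (\<lambda>i. metric_proj n K x i - metric_proj n K y i) \<le> vnorm n (\<lambda>i. x i - y i)"
proof -
  define p q where "p = metric_proj n K x" and "q = metric_proj n K y"
  have 1: "ip n (\<lambda>i. x i - p i) (\<lambda>i. q i - p i) \<le> 0" "ip n (\<lambda>i. y i - q i) (\<lambda>i. p i - q i) \<le> 0"
    unfolding p_def q_def by (intro metric_proj_obtuse metric_proj_in K)+
  have "(vnorm n (\<lambda>i. p i - q i))\<^sup>2 \<le> ip n (\<lambda>i. x i - y i) (\<lambda>i. p i - q i)"
    using 1 by (simp add: vnorm_sq ip_simps)
  also have "\<dots> \<le> vnorm n (\<lambda>i. x i - y i) * vnorm n (\<lambda>i. p i - q i)" by (rule ip_le)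
  finally have *: "vnorm n (\<lambda>i. p i - q i) * vnorm n (\<lambda>i. p i - q i) \<le> vnorm n (\<lambda>i. x i - y i) * vnorm n (\<lambda>i. p i - q i)"
    by (simp add: power2_eq_square)
  show ?thesis unfolding p_def[symmetric] q_def[symmetric]
    by (cases "vnorm n (\<lambda>i. p i - q i) = 0") (use * vnorm_nonneg[of n "\<lambda>i. p i - q i"] in \<open>auto simp: mult_le_cancel_right\<close>)
qed

text \<open>Points of the finite product measures carry \<open>undefined\<close> outside the index
  set. This makes those values harmless in every quantity built from the projection.\<close>

lemma metric_proj_cong:
  "(\<And>i. i < n \<Longrightarrow> x i = y i) \<Longrightarrow> metric_proj n K x = metric_proj n K y"
  unfolding metric_proj_def
  by (rule arg_cong[where f = "\<lambda>f. arg_min_on f K"]) (auto intro!: vnorm_cong)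

lemma continuous_on_metric_proj:
  assumes K: "closed_convex n K" "K \<noteq> {}"
  shows "continuous_on UNIV (\<lambda>x. metric_proj n K x i)"
  unfolding continuous_on_def
proof
  fix x :: "nat \<Rightarrow> real"
  show "((\<lambda>x. metric_proj n K x i) \<longlongrightarrow> metric_proj n K x i) (at x within UNIV)"
  proof (cases "i < n")
    case False
    then have "metric_proj n K y i = 0" for y
      using closed_convexD(2)[OF K(1) metric_proj_in(1)[OF K]] by auto
    then show ?thesis by simp
  next
    case True
    have "continuous_on UNIV (\<lambda>y. vnorm n (\<lambda>i. y i - x i))"
      by (intro continuous_intros)
    from this[unfolded continuous_on_def, rule_format, of x]
    have *: "((\<lambda>y. vnorm n (\<lambda>i. y i - x i)) \<longlongrightarrow> 0) (at x)"
      using vnorm_scale[of n 0 x] by simp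
    have "\<bar>metric_proj n K y i - metric_proj n K x i\<bar> \<le> vnorm n (\<lambda>i. y i - x i)" for y
      using abs_coord_le_vnorm[OF True, of "\<lambda>i. metric_proj n K y i - metric_proj n K x i"]
        metric_proj_nonexpansive[OF K, of y x] by linarith
    then have "((\<lambda>y. metric_proj n K y i - metric_proj n K x i) \<longlongrightarrow> 0) (at x)"
      by (intro Lim_null_comparison[OF _ *]) auto
    then show ?thesis by (simp add: LIM_zero_iff)
  qed
qed

lemma measurable_metric_proj:
  assumes K: "closed_convex n K" "K \<noteq> {}"
    and f: "\<And>j. j < n \<Longrightarrow> (\<lambda>x. f x j) \<in> borel_measurable M"
  shows "(\<lambda>x. metric_proj n K (f x) i) \<in> borel_measurable M"
proof -
  have 1: "(\<lambda>x. metric_proj n K x i) \<in> borel_measurable borel"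
    using continuous_on_metric_proj[OF K] by (rule borel_measurable_continuous_onI)
  \<comment> \<open>Only the coordinates below \<open>n\<close> of \<open>f\<close> are known to be
    measurable; zeros elsewhere make the whole function measurable without changing the
    projection.\<close>
  have 2: "(\<lambda>x j. if j < n then f x j else 0) \<in> borel_measurable M"
  proof (rule measurable_coordinatewise_then_product)
    show "(\<lambda>x. if i < n then f x i else 0) \<in> borel_measurable M" for i
      using f by (cases "i < n") auto
  qed
  have "(\<lambda>x. metric_proj n K (\<lambda>j. if j < n then f x j else 0) i) \<in> borel_measurable M"
    using measurable_compose[OF 2 1] .
  moreover have "metric_proj n K (\<lambda>j. if j < n then f x j else 0) = metric_proj n K (f x)" for x
    by (rule metric_proj_cong) auto
  ultimately show ?thesis by simp
qed

section \<open>Gaussian product measures\<close>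

abbreviation N01 :: "real measure" where "N01 \<equiv> std_normal_distribution"

abbreviation gauss :: "'i set \<Rightarrow> ('i \<Rightarrow> real) measure" where
  "gauss I \<equiv> Pi\<^sub>M I (\<lambda>_. N01)"

lemma prob_space_N01: "prob_space N01"
  by (rule prob_space_normal_density) simp

lemma prob_space_gauss: "prob_space (gauss I)"
  by (intro prob_space_PiM prob_space_N01)

lemma sigma_finite_gauss: "sigma_finite_measure (gauss I)"
  by (rule prob_space_imp_sigma_finite[OF prob_space_gauss])

lemma pair_prob_space_gauss: "pair_prob_space (gauss I) (gauss J)"
  by (simp add: pair_prob_space_def pair_sigma_finite_def sigma_finite_gauss prob_space_gauss)

lemma product_sigma_finite_N01: "product_sigma_finite (\<lambda>_. N01)"
  by (simp add: product_sigma_finite_def prob_space_imp_sigma_finite[OF prob_space_N01])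

lemma sets_N01: "sets N01 = sets borel" by simp

lemma measurable_gauss_coord:
  "i \<in> I \<Longrightarrow> (\<lambda>x. x i) \<in> borel_measurable (gauss I)"
  using measurable_component_singleton[of i I "\<lambda>_. N01"] by simp

section \<open>Rotation invariance of Gaussian vectors\<close>

text \<open>The rotation is factored into two one-variable affine substitutions joined by Fubini:
  \<open>x' = c * x + s * y\<close> at fixed \<open>y\<close>, then a scaled shift of
  \<open>y\<close> at fixed \<open>x\<close>. Their factors \<open>c\<close> and
  \<open>1 / c\<close> cancel. Positivity of \<open>c\<close> allows the division, so a quarter turn
  is reached later only as a product of smaller turns.\<close>

lemma lborel_rotation:
  fixes f :: "real \<times> real \<Rightarrow> ennreal"
  assumes [measurable]: "f \<in> borel_measurable (borel \<Otimes>\<^sub>M borel)" and cs: "c\<^sup>2 + s\<^sup>2 = 1" and c: "c > 0"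
  shows "(\<integral>\<^sup>+x. \<integral>\<^sup>+y. f (c * x + s * y, - s * x + c * y) \<partial>lborel \<partial>lborel) = (\<integral>\<^sup>+x. \<integral>\<^sup>+y. f (x, y) \<partial>lborel \<partial>lborel)"
proof -
  have 1: "(\<integral>\<^sup>+x'. f (x', (y - s * x') / c) \<partial>lborel) = ennreal c * (\<integral>\<^sup>+x. f (c * x + s * y, - s * x + c * y) \<partial>lborel)" for y
  proof -
    have "(s * y + c * x, (y - s * (s * y + c * x)) / c) = (c * x + s * y, - s * x + c * y)" for x
    proof -
      have "y - s * (s * y + c * x) = (c\<^sup>2 + s\<^sup>2) * y - s * (s * y + c * x)" by (simp add: cs)
      also have "\<dots> = c * (- s * x + c * y)" by (simp add: algebra_simps power2_eq_square)
      finally show ?thesis using c by simp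
    qed
    then show ?thesis
      using nn_integral_real_affine[of "\<lambda>x'. f (x', (y - s * x') / c)" c "s * y"] c
      by (simp del: prod.inject)
  qed
  have 2: "(\<integral>\<^sup>+y. f (x, y) \<partial>lborel) = ennreal (1 / c) * (\<integral>\<^sup>+y. f (x, (y - s * x) / c) \<partial>lborel)" for x
    using nn_integral_real_affine[of "\<lambda>y. f (x, y)" "1 / c" "- s * x / c"] c
    by (simp add: diff_divide_distrib)
  have "ennreal c * (\<integral>\<^sup>+x. \<integral>\<^sup>+y. f (c * x + s * y, - s * x + c * y) \<partial>lborel \<partial>lborel)
      = ennreal c * (\<integral>\<^sup>+y. \<integral>\<^sup>+x. f (c * x + s * y, - s * x + c * y) \<partial>lborel \<partial>lborel)"
    by (subst lborel_pair.Fubini') auto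
  also have "\<dots> = (\<integral>\<^sup>+y. ennreal c * (\<integral>\<^sup>+x. f (c * x + s * y, - s * x + c * y) \<partial>lborel) \<partial>lborel)"
    by (subst nn_integral_cmult) auto
  also have "\<dots> = (\<integral>\<^sup>+y. (\<integral>\<^sup>+x'. f (x', (y - s * x') / c) \<partial>lborel) \<partial>lborel)" by (simp only: 1)
  also have "\<dots> = (\<integral>\<^sup>+x'. (\<integral>\<^sup>+y. f (x', (y - s * x') / c) \<partial>lborel) \<partial>lborel)"
    by (subst lborel_pair.Fubini') auto
  finally have 3: "ennreal c * (\<integral>\<^sup>+x. \<integral>\<^sup>+y. f (c * x + s * y, - s * x + c * y) \<partial>lborel \<partial>lborel) = (\<integral>\<^sup>+x'. (\<integral>\<^sup>+y. f (x', (y - s * x') / c) \<partial>lborel) \<partial>lborel)" .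
  have "(\<integral>\<^sup>+x. \<integral>\<^sup>+y. f (x, y) \<partial>lborel \<partial>lborel) = (\<integral>\<^sup>+x. ennreal (1 / c) * (\<integral>\<^sup>+y. f (x, (y - s * x) / c) \<partial>lborel) \<partial>lborel)"
    by (simp only: 2)
  also have "\<dots> = ennreal (1 / c) * (\<integral>\<^sup>+x. (\<integral>\<^sup>+y. f (x, (y - s * x) / c) \<partial>lborel) \<partial>lborel)"
    by (subst nn_integral_cmult) auto
  also have "\<dots> = (ennreal (1 / c) * ennreal c) * (\<integral>\<^sup>+x. \<integral>\<^sup>+y. f (c * x + s * y, - s * x + c * y) \<partial>lborel \<partial>lborel)"
    by (simp only: 3[symmetric] mult.assoc)
  also have "ennreal (1 / c) * ennreal c = 1" using c by (simp flip: ennreal_mult)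
  finally show ?thesis by simp
qed

lemma N01_rotation:
  fixes f :: "real \<times> real \<Rightarrow> ennreal"
  assumes [measurable]: "f \<in> borel_measurable (borel \<Otimes>\<^sub>M borel)" and cs: "c\<^sup>2 + s\<^sup>2 = 1" and c: "c > 0"
  shows "(\<integral>\<^sup>+x. \<integral>\<^sup>+y. f (c * x + s * y, - s * x + c * y) \<partial>N01 \<partial>N01) = (\<integral>\<^sup>+x. \<integral>\<^sup>+y. f (x, y) \<partial>N01 \<partial>N01)"
proof -
  define G where "G = (\<lambda>(x, y). ennreal (std_normal_density x) * ennreal (std_normal_density y) * f (x, y))"
  have [measurable]: "G \<in> borel_measurable (borel \<Otimes>\<^sub>M borel)" unfolding G_def by measurable
  have inv: "ennreal (std_normal_density x) * ennreal (std_normal_density y) =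
    ennreal (std_normal_density (c * x + s * y)) * ennreal (std_normal_density (- s * x + c * y))" for x y
  proof -
    have "(c * x + s * y)\<^sup>2 + (- s * x + c * y)\<^sup>2 = (c\<^sup>2 + s\<^sup>2) * (x\<^sup>2 + y\<^sup>2)"
      by (simp add: algebra_simps power2_eq_square)
    then have "x\<^sup>2 + y\<^sup>2 = (c * x + s * y)\<^sup>2 + (- s * x + c * y)\<^sup>2" by (simp add: cs)
    then have "exp (- (x\<^sup>2 / 2)) * exp (- (y\<^sup>2 / 2)) = exp (- ((c * x + s * y)\<^sup>2 / 2)) * exp (- ((- s * x + c * y)\<^sup>2 / 2))"
      by (simp add: exp_add[symmetric] field_simps)
    then show ?thesis
      by (simp add: std_normal_density_def flip: ennreal_mult)
  qed
  have Geq: "G (c * x + s * y, - s * x + c * y) =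
      ennreal (std_normal_density x) * ennreal (std_normal_density y) * f (c * x + s * y, - s * x + c * y)" for x y
    by (simp only: G_def split inv[of x y])
  have A: "(\<integral>\<^sup>+x. \<integral>\<^sup>+y. h x y \<partial>N01 \<partial>N01) = (\<integral>\<^sup>+x. \<integral>\<^sup>+y. ennreal (std_normal_density x) * ennreal (std_normal_density y) * h x y \<partial>lborel \<partial>lborel)"
    if [measurable]: "case_prod h \<in> borel_measurable (borel \<Otimes>\<^sub>M borel)" for h :: "real \<Rightarrow> real \<Rightarrow> ennreal"
  proof -
    have [measurable]: "h x \<in> borel_measurable borel" for x using measurable_Pair2[OF that] by simp
    have 1: "integral\<^sup>N N01 g = (\<integral>\<^sup>+y. ennreal (std_normal_density y) * g y \<partial>lborel)"
      if "g \<in> borel_measurable borel" for g :: "real \<Rightarrow> ennreal"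
      by (rule nn_integral_density) (use that in auto)
    have "(\<integral>\<^sup>+x. \<integral>\<^sup>+y. h x y \<partial>N01 \<partial>N01) = (\<integral>\<^sup>+x. (\<integral>\<^sup>+y. ennreal (std_normal_density y) * h x y \<partial>lborel) \<partial>N01)"
      by (intro nn_integral_cong 1) simp
    also have "\<dots> = (\<integral>\<^sup>+x. ennreal (std_normal_density x) * (\<integral>\<^sup>+y. ennreal (std_normal_density y) * h x y \<partial>lborel) \<partial>lborel)"
      by (rule 1) measurable
    also have "\<dots> = (\<integral>\<^sup>+x. \<integral>\<^sup>+y. ennreal (std_normal_density x) * ennreal (std_normal_density y) * h x y \<partial>lborel \<partial>lborel)"
      unfolding mult.assoc by (intro nn_integral_cong nn_integral_cmult[symmetric]) auto
    finally show ?thesis .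
  qed
  have "(\<integral>\<^sup>+x. \<integral>\<^sup>+y. f (c * x + s * y, - s * x + c * y) \<partial>N01 \<partial>N01) =
     (\<integral>\<^sup>+x. \<integral>\<^sup>+y. G (c * x + s * y, - s * x + c * y) \<partial>lborel \<partial>lborel)"
    unfolding Geq by (rule A) simp
  also have "\<dots> = (\<integral>\<^sup>+x. \<integral>\<^sup>+y. G (x, y) \<partial>lborel \<partial>lborel)"
    by (rule lborel_rotation) (use cs c in auto)
  also have "\<dots> = (\<integral>\<^sup>+x. \<integral>\<^sup>+y. f (x, y) \<partial>N01 \<partial>N01)"
    by (subst A) (simp_all add: G_def)
  finally show ?thesis .
qed

text \<open>The restriction keeps the result extensional, hence in the space of
  \<open>gauss I\<close>.\<close>

definition pw :: "'i set \<Rightarrow> ('i \<Rightarrow> real \<Rightarrow> real \<Rightarrow> real) \<Rightarrow> ('i \<Rightarrow> real) \<Rightarrow> ('i \<Rightarrow> real) \<Rightarrow> 'i \<Rightarrow> real" where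
  "pw I R x y = (\<lambda>i\<in>I. R i (x i) (y i))"

lemma measurable_pw:
  assumes R: "\<And>i. i \<in> I \<Longrightarrow> case_prod (R i) \<in> borel_measurable (borel \<Otimes>\<^sub>M borel)"
    and "f \<in> M \<rightarrow>\<^sub>M gauss I" "g \<in> M \<rightarrow>\<^sub>M gauss I"
  shows "(\<lambda>w. pw I R (f w) (g w)) \<in> M \<rightarrow>\<^sub>M gauss I"
  unfolding pw_def
proof (rule measurable_restrict)
  fix i assume i: "i \<in> I"
  have "(\<lambda>w. f w i) \<in> borel_measurable M"
    by (rule measurable_compose[OF assms(2) measurable_gauss_coord[OF i]])
  moreover have "(\<lambda>w. g w i) \<in> borel_measurable M"
    by (rule measurable_compose[OF assms(3) measurable_gauss_coord[OF i]])
  ultimately have "(\<lambda>w. (f w i, g w i)) \<in> M \<rightarrow>\<^sub>M borel \<Otimes>\<^sub>M borel"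
    by (rule measurable_Pair)
  from measurable_compose[OF this R[OF i]] have "(\<lambda>w. R i (f w i) (g w i)) \<in> borel_measurable M"
    by (simp only: prod.case)
  then show "(\<lambda>w. R i (f w i) (g w i)) \<in> M \<rightarrow>\<^sub>M N01"
    by (subst measurable_cong_sets[OF refl sets_N01])
qed

lemma pw_upd:
  assumes "i \<notin> I"
  shows "pw (insert i I) R (x(i := u)) (y(i := v)) = (pw I R x y)(i := R i u v)"
  using assms by (auto simp: pw_def fun_eq_iff restrict_def)

text \<open>Induction on the index set. Fubini isolates the pair of coordinates at the new index,
  the planar invariance acts on it with all others frozen, and the induction hypothesis treats the
  remaining integrand.\<close>

lemma gauss_pairwise_nn:
  fixes f :: "('i \<Rightarrow> real) \<times> ('i \<Rightarrow> real) \<Rightarrow> ennreal"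
  assumes I: "finite I"
    and R: "\<And>i. i \<in> I \<Longrightarrow> case_prod (R i) \<in> borel_measurable (borel \<Otimes>\<^sub>M borel)"
      "\<And>i. i \<in> I \<Longrightarrow> case_prod (R' i) \<in> borel_measurable (borel \<Otimes>\<^sub>M borel)"
    and inv: "\<And>i f :: real \<times> real \<Rightarrow> ennreal. i \<in> I \<Longrightarrow> f \<in> borel_measurable (borel \<Otimes>\<^sub>M borel) \<Longrightarrow>
        (\<integral>\<^sup>+x. \<integral>\<^sup>+y. f (R i x y, R' i x y) \<partial>N01 \<partial>N01) = (\<integral>\<^sup>+x. \<integral>\<^sup>+y. f (x, y) \<partial>N01 \<partial>N01)"
    and f: "f \<in> borel_measurable (gauss I \<Otimes>\<^sub>M gauss I)"
  shows "(\<integral>\<^sup>+x. \<integral>\<^sup>+y. f (pw I R x y, pw I R' x y) \<partial>gauss I \<partial>gauss I) = (\<integral>\<^sup>+x. \<integral>\<^sup>+y. f (x, y) \<partial>gauss I \<partial>gauss I)"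
  using I R inv f
proof (induction I arbitrary: f rule: finite_induct)
  case empty
  have "pw {} R x y = (\<lambda>_. undefined)" for R and x y :: "'i \<Rightarrow> real"
    by (simp add: pw_def restrict_def)
  then show ?case
    by (intro nn_integral_cong) (simp add: space_PiM)
next
  case (insert i I)
  note f [measurable] = insert.prems(4)
  note R = insert.prems(1,2) and inv = insert.prems(3)
  interpret product_sigma_finite "\<lambda>_::'i. N01" by (rule product_sigma_finite_N01)
  interpret G: sigma_finite_measure "gauss I" by (rule sigma_finite_gauss)
  interpret N: sigma_finite_measure N01 by (rule prob_space_imp_sigma_finite[OF prob_space_N01])
  interpret P: pair_sigma_finite N01 "gauss I" ..
  note N01m = sigma_finite_measure.borel_measurable_nn_integral[OF prob_space_imp_sigma_finite[OF prob_space_N01]]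
  have [measurable]: "(\<lambda>x. (h1 x)(i := h2 x)) \<in> M \<rightarrow>\<^sub>M gauss (insert i I)"
    if "h1 \<in> M \<rightarrow>\<^sub>M gauss I" "h2 \<in> M \<rightarrow>\<^sub>M borel" for h1 h2 and M :: "'c measure"
    by (rule measurable_fun_upd[where J = I]) (use that in auto)
  let ?I = "insert i I"
  have split: "(\<integral>\<^sup>+x. \<integral>\<^sup>+y. g x y \<partial>gauss ?I \<partial>gauss ?I) =
      (\<integral>\<^sup>+x. \<integral>\<^sup>+y. \<integral>\<^sup>+u. \<integral>\<^sup>+v. g (x(i := u)) (y(i := v)) \<partial>N01 \<partial>N01 \<partial>gauss I \<partial>gauss I)"
    if g [measurable]: "case_prod g \<in> borel_measurable (gauss ?I \<Otimes>\<^sub>M gauss ?I)" for g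
  proof -
    have gx: "g x \<in> borel_measurable (gauss ?I)" if "x \<in> space (gauss ?I)" for x
      using measurable_Pair2[OF g that] by simp
    interpret G': sigma_finite_measure "gauss ?I" by (rule sigma_finite_gauss)
    have "(\<integral>\<^sup>+x. \<integral>\<^sup>+y. g x y \<partial>gauss ?I \<partial>gauss ?I) =
      (\<integral>\<^sup>+x. \<integral>\<^sup>+u. \<integral>\<^sup>+y. g (x(i := u)) y \<partial>gauss ?I \<partial>N01 \<partial>gauss I)"
      by (subst product_nn_integral_insert[OF insert.hyps]) auto
    also have "\<dots> = (\<integral>\<^sup>+x. \<integral>\<^sup>+u. \<integral>\<^sup>+y. \<integral>\<^sup>+v. g (x(i := u)) (y(i := v)) \<partial>N01 \<partial>gauss I \<partial>N01 \<partial>gauss I)"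
    proof (intro nn_integral_cong)
      fix x u assume "x \<in> space (gauss I)"
      then have "x(i := u) \<in> space (gauss ?I)" by (auto simp: space_PiM PiE_iff extensional_def)
      then show "(\<integral>\<^sup>+y. g (x(i := u)) y \<partial>gauss ?I) = (\<integral>\<^sup>+y. \<integral>\<^sup>+v. g (x(i := u)) (y(i := v)) \<partial>N01 \<partial>gauss I)"
        by (subst product_nn_integral_insert[OF insert.hyps]) (auto intro: gx)
    qed
    also have "\<dots> = (\<integral>\<^sup>+x. \<integral>\<^sup>+y. \<integral>\<^sup>+u. \<integral>\<^sup>+v. g (x(i := u)) (y(i := v)) \<partial>N01 \<partial>N01 \<partial>gauss I \<partial>gauss I)"
    proof (intro nn_integral_cong)
      fix x assume x: "x \<in> space (gauss I)"
      have "(\<lambda>p. x(i := fst (fst p))) \<in> (N01 \<Otimes>\<^sub>M gauss I) \<Otimes>\<^sub>M N01 \<rightarrow>\<^sub>M gauss ?I"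
        by (rule measurable_fun_upd[where J = I]) (use x in auto)
      moreover have "(\<lambda>p. (snd (fst p))(i := snd p)) \<in> (N01 \<Otimes>\<^sub>M gauss I) \<Otimes>\<^sub>M N01 \<rightarrow>\<^sub>M gauss ?I"
        by (rule measurable_fun_upd[where J = I]) auto
      ultimately have "(\<lambda>p. (x(i := fst (fst p)), (snd (fst p))(i := snd p))) \<in> (N01 \<Otimes>\<^sub>M gauss I) \<Otimes>\<^sub>M N01 \<rightarrow>\<^sub>M gauss ?I \<Otimes>\<^sub>M gauss ?I"
        by (rule measurable_Pair)
      from measurable_compose[OF this g]
      have "(\<lambda>p. g (x(i := fst (fst p))) ((snd (fst p))(i := snd p))) \<in> borel_measurable ((N01 \<Otimes>\<^sub>M gauss I) \<Otimes>\<^sub>M N01)"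
        by simp
      then have "(\<lambda>q. \<integral>\<^sup>+v. g (x(i := fst q)) ((snd q)(i := v)) \<partial>N01) \<in> borel_measurable (N01 \<Otimes>\<^sub>M gauss I)"
        by (intro N01m) (simp add: split_beta')
      then show "(\<integral>\<^sup>+u. \<integral>\<^sup>+y. \<integral>\<^sup>+v. g (x(i := u)) (y(i := v)) \<partial>N01 \<partial>gauss I \<partial>N01) = (\<integral>\<^sup>+y. \<integral>\<^sup>+u. \<integral>\<^sup>+v. g (x(i := u)) (y(i := v)) \<partial>N01 \<partial>N01 \<partial>gauss I)"
        by (subst P.Fubini') (auto simp: split_beta')
    qed
    finally show ?thesis .
  qed
  have "(\<integral>\<^sup>+x. \<integral>\<^sup>+y. f (pw ?I R x y, pw ?I R' x y) \<partial>gauss ?I \<partial>gauss ?I) =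
    (\<integral>\<^sup>+x. \<integral>\<^sup>+y. \<integral>\<^sup>+u. \<integral>\<^sup>+v. f ((pw I R x y)(i := R i u v), (pw I R' x y)(i := R' i u v)) \<partial>N01 \<partial>N01 \<partial>gauss I \<partial>gauss I)"
  proof (subst split)
    have "(\<lambda>p. (pw ?I R (fst p) (snd p), pw ?I R' (fst p) (snd p))) \<in> gauss ?I \<Otimes>\<^sub>M gauss ?I \<rightarrow>\<^sub>M gauss ?I \<Otimes>\<^sub>M gauss ?I"
      by (intro measurable_Pair measurable_pw R) auto
    from measurable_compose[OF this f]
    show "(\<lambda>(x, y). f (pw ?I R x y, pw ?I R' x y)) \<in> borel_measurable (gauss ?I \<Otimes>\<^sub>M gauss ?I)"
      by (simp add: split_beta')
  qed (simp add: pw_upd[OF insert.hyps(2)])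
  also have "\<dots> = (\<integral>\<^sup>+x. \<integral>\<^sup>+y. \<integral>\<^sup>+u. \<integral>\<^sup>+v. f ((pw I R x y)(i := u), (pw I R' x y)(i := v)) \<partial>N01 \<partial>N01 \<partial>gauss I \<partial>gauss I)"
  proof (rule nn_integral_cong, rule nn_integral_cong)
    fix x y assume "x \<in> space (gauss I)" "y \<in> space (gauss I)"
    have sp: "pw I R x y \<in> space (gauss I)" for R by (simp add: pw_def space_PiM)
    have "(\<lambda>p. ((pw I R x y)(i := fst p), (pw I R' x y)(i := snd p))) \<in> borel \<Otimes>\<^sub>M borel \<rightarrow>\<^sub>M gauss ?I \<Otimes>\<^sub>M gauss ?I"
      by (intro measurable_Pair measurable_fun_upd[where J = I]) (use sp in auto)
    from inv[OF insertI1 measurable_compose[OF this f]]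
    show "(\<integral>\<^sup>+u. \<integral>\<^sup>+v. f ((pw I R x y)(i := R i u v), (pw I R' x y)(i := R' i u v)) \<partial>N01 \<partial>N01)
      = (\<integral>\<^sup>+u. \<integral>\<^sup>+v. f ((pw I R x y)(i := u), (pw I R' x y)(i := v)) \<partial>N01 \<partial>N01)" by simp
  qed
  also have "\<dots> = (\<integral>\<^sup>+x. \<integral>\<^sup>+y. \<integral>\<^sup>+u. \<integral>\<^sup>+v. f (x(i := u), y(i := v)) \<partial>N01 \<partial>N01 \<partial>gauss I \<partial>gauss I)"
  proof -
    have "(\<lambda>p. ((fst (fst (fst p)))(i := snd (fst p)), (snd (fst (fst p)))(i := snd p))) \<in>
       ((gauss I \<Otimes>\<^sub>M gauss I) \<Otimes>\<^sub>M N01) \<Otimes>\<^sub>M N01 \<rightarrow>\<^sub>M gauss ?I \<Otimes>\<^sub>M gauss ?I"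
      by (intro measurable_Pair measurable_fun_upd[where J = I]) auto
    from measurable_compose[OF this f]
    have "(\<lambda>q. \<integral>\<^sup>+u. \<integral>\<^sup>+v. f ((fst q)(i := u), (snd q)(i := v)) \<partial>N01 \<partial>N01) \<in> borel_measurable (gauss I \<Otimes>\<^sub>M gauss I)"
      by (intro N01m) (simp add: split_beta')
    note F = this
    define F where "F q = (\<integral>\<^sup>+ u. \<integral>\<^sup>+ v. f ((fst q)(i := u), (snd q)(i := v)) \<partial>N01 \<partial>N01)" for q
    have "(\<integral>\<^sup>+x. \<integral>\<^sup>+y. F (pw I R x y, pw I R' x y) \<partial>gauss I \<partial>gauss I) = (\<integral>\<^sup>+x. \<integral>\<^sup>+y. F (x, y) \<partial>gauss I \<partial>gauss I)"
    proof (rule insert.IH)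
      show "F \<in> borel_measurable (gauss I \<Otimes>\<^sub>M gauss I)" unfolding F_def[abs_def] by (rule F)
    qed (use R inv in blast)+
    then show ?thesis unfolding F_def fst_conv snd_conv .
  qed
  also have "\<dots> = (\<integral>\<^sup>+x. \<integral>\<^sup>+y. f (x, y) \<partial>gauss ?I \<partial>gauss ?I)"
    by (subst split) auto
  finally show ?case .
qed

lemma gauss_pairwise:
  fixes I :: "'i set"
  assumes I: "finite I"
    and R: "\<And>i. i \<in> I \<Longrightarrow> case_prod (R i) \<in> borel_measurable (borel \<Otimes>\<^sub>M borel)"
      "\<And>i. i \<in> I \<Longrightarrow> case_prod (R' i) \<in> borel_measurable (borel \<Otimes>\<^sub>M borel)"
    and inv: "\<And>i f :: real \<times> real \<Rightarrow> ennreal. i \<in> I \<Longrightarrow> f \<in> borel_measurable (borel \<Otimes>\<^sub>M borel) \<Longrightarrow>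
        (\<integral>\<^sup>+x. \<integral>\<^sup>+y. f (R i x y, R' i x y) \<partial>N01 \<partial>N01) = (\<integral>\<^sup>+x. \<integral>\<^sup>+y. f (x, y) \<partial>N01 \<partial>N01)"
  shows "distr (gauss I \<Otimes>\<^sub>M gauss I) (gauss I \<Otimes>\<^sub>M gauss I) (\<lambda>p. (pw I R (fst p) (snd p), pw I R' (fst p) (snd p)))
    = gauss I \<Otimes>\<^sub>M gauss I" (is "distr ?G ?G ?R = ?G")
proof (rule measure_eqI)
  fix A assume "A \<in> sets (distr ?G ?G ?R)"
  then have A [measurable]: "A \<in> sets ?G" by simp
  interpret G: sigma_finite_measure "gauss I" by (rule sigma_finite_gauss)
  have *: "emeasure ?G B = (\<integral>\<^sup>+x. \<integral>\<^sup>+y. indicator B (x, y) \<partial>gauss I \<partial>gauss I)"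
    if "B \<in> sets ?G" for B
    using that by (rule G.emeasure_pair_measure)
  have R': "?R \<in> ?G \<rightarrow>\<^sub>M ?G" by (intro measurable_Pair measurable_pw R) auto
  have "emeasure (distr ?G ?G ?R) A = emeasure ?G (?R -` A \<inter> space ?G)"
    by (rule emeasure_distr[OF R' A])
  also have "\<dots> = (\<integral>\<^sup>+x. \<integral>\<^sup>+y. indicator (?R -` A \<inter> space ?G) (x, y) \<partial>gauss I \<partial>gauss I)"
    by (rule *) (use measurable_sets[OF R' A] in simp)
  also have "\<dots> = (\<integral>\<^sup>+x. \<integral>\<^sup>+y. indicator A (pw I R x y, pw I R' x y) \<partial>gauss I \<partial>gauss I)"
    by (intro nn_integral_cong) (auto simp: indicator_def space_pair_measure)
  also have "\<dots> = (\<integral>\<^sup>+x. \<integral>\<^sup>+y. indicator A (x, y) \<partial>gauss I \<partial>gauss I)"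
    by (rule gauss_pairwise_nn[OF I R inv]) auto
  also have "\<dots> = emeasure ?G A" by (rule *[symmetric, OF A])
  finally show "emeasure (distr ?G ?G ?R) A = emeasure ?G A" .
qed simp

text \<open>Replaces the rotation by a right angle, which the condition \<open>c > 0\<close> of
  \<open>N01_rotation\<close> excludes.\<close>

lemma N01_swap:
  fixes f :: "real \<times> real \<Rightarrow> ennreal"
  assumes [measurable]: "f \<in> borel_measurable (borel \<Otimes>\<^sub>M borel)"
  shows "(\<integral>\<^sup>+x. \<integral>\<^sup>+y. f (y, x) \<partial>N01 \<partial>N01) = (\<integral>\<^sup>+x. \<integral>\<^sup>+y. f (x, y) \<partial>N01 \<partial>N01)"
proof -
  interpret pair_sigma_finite N01 N01
    by (simp add: pair_sigma_finite_def prob_space_imp_sigma_finite prob_space_N01)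
  have "(\<lambda>(x, y). f (x, y)) \<in> borel_measurable (borel \<Otimes>\<^sub>M borel)" by simp
  then have "(\<lambda>(x, y). f (x, y)) \<in> borel_measurable (N01 \<Otimes>\<^sub>M N01)"
    using measurable_cong_sets[OF sets_pair_measure_cong[OF sets_N01 sets_N01]] by blast
  from Fubini'[OF this] show ?thesis by simp
qed

definition lc :: "'i set \<Rightarrow> real \<Rightarrow> real \<Rightarrow> ('i \<Rightarrow> real) \<Rightarrow> ('i \<Rightarrow> real) \<Rightarrow> 'i \<Rightarrow> real" where
  "lc I a b = pw I (\<lambda>_ u v. a * u + b * v)"

lemma measurable_lc:
  assumes "f \<in> M \<rightarrow>\<^sub>M gauss I" "g \<in> M \<rightarrow>\<^sub>M gauss I"
  shows "(\<lambda>w. lc I a b (f w) (g w)) \<in> M \<rightarrow>\<^sub>M gauss I"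
  unfolding lc_def by (rule measurable_pw) (use assms in auto)

lemma gauss_rotation:
  assumes I: "finite I" and cs: "c\<^sup>2 + s\<^sup>2 = 1" and c: "c > 0"
  shows "distr (gauss I \<Otimes>\<^sub>M gauss I) (gauss I \<Otimes>\<^sub>M gauss I) (\<lambda>p. (lc I c s (fst p) (snd p), lc I (-s) c (fst p) (snd p)))
    = gauss I \<Otimes>\<^sub>M gauss I"
  unfolding lc_def
  by (rule gauss_pairwise[OF I]) (auto simp: N01_rotation[OF _ cs c, simplified])

lemma distr_gauss_fst: "distr (gauss I \<Otimes>\<^sub>M gauss J) (gauss I) fst = gauss I"
  by (rule prob_space.distr_pair_fst[OF prob_space_gauss])

lemma integral_gauss_fst:
  fixes f :: "_ \<Rightarrow> real"
  assumes "f \<in> borel_measurable (gauss I)"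
  shows "(\<integral>p. f (fst p) \<partial>(gauss I \<Otimes>\<^sub>M gauss J)) = (\<integral>x. f x \<partial>gauss I)"
  using integral_distr[OF measurable_fst assms, of "gauss J"] unfolding distr_gauss_fst by (rule sym)

text \<open>Stability of the normal law with coefficients that vary over the coordinates: each pair
  of coordinates is rotated by its own angle, and only the first vector of the rotated pair enters
  the integrand.\<close>

lemma gauss_stable:
  fixes f :: "('i \<Rightarrow> real) \<Rightarrow> real"
  assumes I: "finite I" and f: "f \<in> borel_measurable (gauss I)"
    and d: "\<And>i. d i \<ge> 0" "\<And>i. e i \<ge> 0"
  shows "(\<integral>p. f (pw I (\<lambda>i u v. d i * u + e i * v) (fst p) (snd p)) \<partial>(gauss I \<Otimes>\<^sub>M gauss I))
     = (\<integral>x. f (\<lambda>i\<in>I. sqrt ((d i)\<^sup>2 + (e i)\<^sup>2) * x i) \<partial>gauss I)"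
proof -
  define q where "q i = sqrt ((d i)\<^sup>2 + (e i)\<^sup>2)" for i
  have q0: "q i = 0 \<Longrightarrow> d i = 0 \<and> e i = 0" for i by (simp add: q_def add_nonneg_eq_0_iff)
  have qd: "d i = 0 \<Longrightarrow> q i = e i" for i by (simp add: q_def d)
  have qn: "q i \<ge> 0" for i by (simp add: q_def)
  have qs: "(q i)\<^sup>2 = (d i)\<^sup>2 + (e i)\<^sup>2" for i by (simp add: q_def)
  \<comment> \<open>The rotation takes \<open>(d i, e i)\<close> to \<open>(q i, 0)\<close>. For
    \<open>d i = 0\<close> its cosine would be 0, and the two coordinates are exchanged
    instead.\<close>
  define R where "R i u v = (if d i > 0 then d i / q i * u + e i / q i * v else v)" for i and u v :: real
  define R' where "R' i u v = (if d i > 0 then - (e i / q i) * u + d i / q i * v else u)" for i and u v :: real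
  let ?G = "gauss I \<Otimes>\<^sub>M gauss I"
  let ?R = "\<lambda>p. (pw I R (fst p) (snd p), pw I R' (fst p) (snd p))"
  have Rm: "case_prod (R i) \<in> borel_measurable (borel \<Otimes>\<^sub>M borel)" "case_prod (R' i) \<in> borel_measurable (borel \<Otimes>\<^sub>M borel)" for i
    unfolding R_def R'_def by (cases "d i > 0"; simp)+
  have inv: "(\<integral>\<^sup>+x. \<integral>\<^sup>+y. f (R i x y, R' i x y) \<partial>N01 \<partial>N01) = (\<integral>\<^sup>+x. \<integral>\<^sup>+y. f (x, y) \<partial>N01 \<partial>N01)"
    if f: "f \<in> borel_measurable (borel \<Otimes>\<^sub>M borel)" for i and f :: "real \<times> real \<Rightarrow> ennreal"
  proof (cases "d i > 0")
    case True
    then have qp: "q i > 0" using qn[of i] q0[of i] by force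
    have "(d i / q i)\<^sup>2 + (e i / q i)\<^sup>2 = 1"
    proof -
      have "(d i / q i)\<^sup>2 + (e i / q i)\<^sup>2 = ((d i)\<^sup>2 + (e i)\<^sup>2) / (q i)\<^sup>2"
        by (simp add: power_divide add_divide_distrib)
      then show ?thesis using qs[of i] qp True by simp
    qed
    from N01_rotation[OF f this] show ?thesis
      using True qp by (simp add: R_def R'_def)
  next
    case False
    then show ?thesis using N01_swap[OF f] by (simp add: R_def R'_def)
  qed
  have pweq: "pw I (\<lambda>i u v. d i * u + e i * v) x y = (\<lambda>i\<in>I. q i * pw I R x y i)" for x y
  proof -
    have "d i * x i + e i * y i = q i * R i (x i) (y i)" for i
      using q0[of i] qd[of i] d(1)[of i] by (cases "q i = 0") (auto simp: R_def field_simps)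
    then show ?thesis by (auto simp: pw_def fun_eq_iff restrict_def)
  qed
  have m: "(\<lambda>x. \<lambda>i\<in>I. q i * x i) \<in> gauss I \<rightarrow>\<^sub>M gauss I"
  proof (rule measurable_restrict)
    fix i assume i: "i \<in> I"
    have "(\<lambda>x. q i * x i) \<in> borel_measurable (gauss I)"
      by (intro borel_measurable_times borel_measurable_const measurable_gauss_coord i)
    then show "(\<lambda>x. q i * x i) \<in> gauss I \<rightarrow>\<^sub>M N01"
      by (subst measurable_cong_sets[OF refl sets_N01])
  qed
  have fm: "(\<lambda>x. f (\<lambda>i\<in>I. q i * x i)) \<in> borel_measurable (gauss I)"
    by (rule measurable_compose[OF m f])
  have "(\<integral>p. f (pw I (\<lambda>i u v. d i * u + e i * v) (fst p) (snd p)) \<partial>?G) = (\<integral>p. f (\<lambda>i\<in>I. q i * fst (?R p) i) \<partial>?G)"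
    by (simp add: pweq)
  also have "\<dots> = (\<integral>p. f (\<lambda>i\<in>I. q i * fst p i) \<partial>distr ?G ?G ?R)"
    by (rule integral_distr[symmetric]) (intro measurable_Pair measurable_pw Rm measurable_fst measurable_snd measurable_compose[OF measurable_fst fm])+
  also have "distr ?G ?G ?R = ?G"
    by (rule gauss_pairwise[OF I Rm inv])
  also have "(\<integral>p. f (\<lambda>i\<in>I. q i * fst p i) \<partial>?G) = (\<integral>x. f (\<lambda>i\<in>I. q i * x i) \<partial>gauss I)"
    by (rule integral_gauss_fst[OF fm])
  finally show ?thesis by (simp add: q_def)
qed

section \<open>Integrability and moments under the Gaussian product measure\<close>

text \<open>An integrable majorant of polynomial growth. Integrability of \<open>seq_err\<close>,
  \<open>seq_lrt\<close> and their squares is obtained by comparison with its powers.\<close>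

definition env :: "'i set \<Rightarrow> ('i \<Rightarrow> real) \<Rightarrow> real" where
  "env I x = 1 + (\<Sum>i\<in>I. \<bar>x i\<bar>)"

lemma env_ge1: "1 \<le> env I x"
  by (simp add: env_def sum_nonneg)

lemma measurable_env: "env I \<in> borel_measurable (gauss I)"
  unfolding env_def by (intro borel_measurable_add borel_measurable_sum borel_measurable_abs measurable_gauss_coord) auto

text \<open>The sum is dominated by the product of the factors \<open>1 + \<bar>x i\<bar>\<close>,
  whose integral factorizes over the coordinates.\<close>

lemma integrable_env_power:
  assumes I: "finite I"
  shows "integrable (gauss I) (\<lambda>x. env I x ^ p)"
proof (rule Bochner_Integration.integrable_bound)
  interpret product_sigma_finite "\<lambda>_. N01" by (rule product_sigma_finite_N01)
  have *: "integrable N01 (\<lambda>x. (1 + \<bar>x\<bar>) ^ p)"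
  proof -
    have "(1 + \<bar>x\<bar>) ^ p = (\<Sum>k\<le>p. of_nat (p choose k) * \<bar>x\<bar> ^ k)" for x :: real
      using binomial_ring[of "\<bar>x\<bar>" 1 p] by (simp add: add.commute)
    moreover have "integrable N01 (\<lambda>x. \<bar>x\<bar> ^ k)" for k
      using integrable_abs[OF integrable_std_normal_distribution_moment[of k]] by (simp add: power_abs)
    ultimately show ?thesis by simp
  qed
  show "integrable (gauss I) (\<lambda>x. \<Prod>i\<in>I. (1 + \<bar>x i\<bar>) ^ p)"
    by (rule product_integrable_prod[OF I *])
  have "env I x \<le> (\<Prod>i\<in>I. 1 + \<bar>x i\<bar>)" for x :: "'a \<Rightarrow> real"
    using I
  proof induction
    case (insert i I)
    have "env (insert i I) x = env I x + \<bar>x i\<bar>" using insert.hyps by (simp add: env_def)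
    also have "\<dots> \<le> env I x + \<bar>x i\<bar> * env I x" using mult_left_mono[OF env_ge1[of I x] abs_ge_zero[of "x i"]] by simp
    also have "\<dots> = (1 + \<bar>x i\<bar>) * env I x" by (simp add: algebra_simps)
    also have "\<dots> \<le> (1 + \<bar>x i\<bar>) * (\<Prod>i\<in>I. 1 + \<bar>x i\<bar>)" by (intro mult_left_mono insert.IH) auto
    finally show ?case using insert.hyps by simp
  qed (simp add: env_def)
  then have "env I x ^ p \<le> (\<Prod>i\<in>I. 1 + \<bar>x i\<bar>) ^ p" for x :: "'a \<Rightarrow> real"
    using env_ge1[of I x] by (intro power_mono) (auto intro: order_trans[OF zero_le_one])
  then show "AE x in gauss I. norm (env I x ^ p) \<le> norm (\<Prod>i\<in>I. (1 + \<bar>x i\<bar>) ^ p)"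
    using env_ge1[of I] by (intro AE_I2) (simp add: prod_power_distrib[symmetric] prod_nonneg order_trans[OF zero_le_one])
  show "(\<lambda>x. env I x ^ p) \<in> borel_measurable (gauss I)"
    using measurable_env by measurable
qed

lemma integrable_gauss_bound:
  fixes f :: "_ \<Rightarrow> real"
  assumes I: "finite I" and f: "f \<in> borel_measurable (gauss I)"
    and le: "\<And>x. \<bar>f x\<bar> \<le> C * env I x ^ p"
  shows "integrable (gauss I) f"
proof (rule Bochner_Integration.integrable_bound)
  show "integrable (gauss I) (\<lambda>x. C * env I x ^ p)"
    using integrable_env_power[OF I] by simp
  show "AE x in gauss I. norm (f x) \<le> norm (C * env I x ^ p)"
    using le by (intro AE_I2) (simp add: order_trans[OF _ abs_ge_self])
qed fact

lemma coord_le_env: "finite I \<Longrightarrow> i \<in> I \<Longrightarrow> \<bar>x i\<bar> \<le> env I x"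
  unfolding env_def using member_le_sum[of i I "\<lambda>i. \<bar>x i\<bar>"] by simp

lemma integral_gauss_coord:
  fixes f :: "real \<Rightarrow> real"
  assumes "i \<in> I" "f \<in> borel_measurable borel"
  shows "(\<integral>x. f (x i) \<partial>gauss I) = (\<integral>x. f x \<partial>N01)"
  using integral_distr[of "\<lambda>x. x i" "gauss I" N01 f] assms
    distr_PiM_component[of I "\<lambda>_. N01" i] prob_space_N01 by simp

lemma gauss_mean: "i \<in> I \<Longrightarrow> (\<integral>x. x i \<partial>gauss I) = 0"
  using integral_gauss_coord[of i I "\<lambda>x. x"] integral_std_normal_distribution_moment_odd[of 1] by simp

lemma gauss_cov:
  assumes I: "finite I" "i \<in> I" "j \<in> I"
  shows "(\<integral>x. x i * x j \<partial>gauss I) = (if i = j then 1 else 0)"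
proof (cases "i = j")
  case True
  then show ?thesis
    using integral_gauss_coord[of i I "\<lambda>x. x * x"] I std_normal_distribution_even_moments(1)[of 1]
    by (simp add: power2_eq_square)
next
  case False
  interpret product_sigma_finite "\<lambda>_. N01" by (rule product_sigma_finite_N01)
  interpret prob_space N01 by (rule prob_space_N01)
  \<comment> \<open>Factors equal to 1 away from \<open>i\<close> and \<open>j\<close> turn
    \<open>x i * x j\<close> into a product over all of \<open>I\<close>.\<close>
  define f :: "'a \<Rightarrow> real \<Rightarrow> real" where "f k x = (if k = i \<or> k = j then x else 1)" for k x
  have int: "integrable N01 (f k)" for k
    using integrable_std_normal_distribution_moment[of 1] by (cases "k = i \<or> k = j") (auto simp: f_def[abs_def])
  have "x i * x j = (\<Prod>k\<in>I. f k (x k))" for x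
  proof -
    have "(\<Prod>k\<in>I. f k (x k)) = (\<Prod>k\<in>{i, j}. f k (x k))"
      by (rule prod.mono_neutral_right) (use I in \<open>auto simp: f_def\<close>)
    also have "\<dots> = x i * x j" using False by (simp add: f_def)
    finally show ?thesis by simp
  qed
  then have "(\<integral>x. x i * x j \<partial>gauss I) = (\<Prod>k\<in>I. integral\<^sup>L N01 (f k))"
    using product_integral_prod[OF I(1), of f] int by simp
  also have "\<dots> = 0"
    using integral_std_normal_distribution_moment_odd[of 1] I
    by (intro prod_zero) (auto intro!: bexI[of _ i] simp: f_def[abs_def])
  finally show ?thesis using False by simp
qed

lemma integrable_gauss_coord: "finite I \<Longrightarrow> i \<in> I \<Longrightarrow> integrable (gauss I) (\<lambda>x. x i)"
  by (rule integrable_gauss_bound[where C = 1 and p = 1]) (auto simp: coord_le_env)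

lemma integrable_gauss_coord2:
  assumes "finite I" "i \<in> I" "j \<in> I" shows "integrable (gauss I) (\<lambda>x. x i * x j)"
proof (rule integrable_gauss_bound[where C = 1 and p = 2])
  show "\<bar>x i * x j\<bar> \<le> 1 * env I x ^ 2" for x
    unfolding abs_mult power2_eq_square mult_1 using assms env_ge1[of I x]
    by (intro mult_mono coord_le_env) auto
qed (use assms in auto)

definition lin :: "'i set \<Rightarrow> ('i \<Rightarrow> real) \<Rightarrow> ('i \<Rightarrow> real) \<Rightarrow> real" where
  "lin I a x = (\<Sum>i\<in>I. a i * x i)"

lemma measurable_lin [measurable]: "lin I a \<in> borel_measurable (gauss I)"
  unfolding lin_def by (intro borel_measurable_sum borel_measurable_times borel_measurable_const measurable_gauss_coord)

lemma lin_le_env: "finite I \<Longrightarrow> \<bar>lin I a x\<bar> \<le> (\<Sum>i\<in>I. \<bar>a i\<bar>) * env I x"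
  unfolding lin_def sum_distrib_right
  by (rule order_trans[OF sum_abs]) (auto simp: abs_mult intro!: sum_mono mult_left_mono coord_le_env)

lemma gauss_lin:
  assumes I: "finite I"
  shows "integrable (gauss I) (lin I a)" "(\<integral>x. lin I a x \<partial>gauss I) = 0"
    "integrable (gauss I) (\<lambda>x. lin I a x * lin I b x)"
    "(\<integral>x. lin I a x * lin I b x \<partial>gauss I) = (\<Sum>i\<in>I. a i * b i)"
proof -
  note [simp] = integrable_gauss_coord[OF I] integrable_gauss_coord2[OF I] gauss_mean gauss_cov[OF I]
  show "integrable (gauss I) (lin I a)" "(\<integral>x. lin I a x \<partial>gauss I) = 0"
    unfolding lin_def by (auto simp: Bochner_Integration.integral_sum)
  have e: "lin I a x * lin I b x = (\<Sum>i\<in>I. \<Sum>j\<in>I. a i * b j * (x i * x j))" for x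
    unfolding lin_def sum_product by (intro sum.cong refl) (simp add: algebra_simps)
  show "integrable (gauss I) (\<lambda>x. lin I a x * lin I b x)"
    unfolding e by (intro Bochner_Integration.integrable_sum Bochner_Integration.integrable_mult_right) simp
  show "(\<integral>x. lin I a x * lin I b x \<partial>gauss I) = (\<Sum>i\<in>I. a i * b i)"
  proof -
    have int: "integrable (gauss I) (\<lambda>x. a i * b j * (x i * x j))" if "i \<in> I" "j \<in> I" for i j
      using that by simp
    have "(\<integral>x. (\<Sum>i\<in>I. \<Sum>j\<in>I. a i * b j * (x i * x j)) \<partial>gauss I) = (\<Sum>i\<in>I. \<integral>x. (\<Sum>j\<in>I. a i * b j * (x i * x j)) \<partial>gauss I)"
      by (intro Bochner_Integration.integral_sum Bochner_Integration.integrable_sum int)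
    also have "\<dots> = (\<Sum>i\<in>I. \<Sum>j\<in>I. \<integral>x. a i * b j * (x i * x j) \<partial>gauss I)"
      by (intro sum.cong refl Bochner_Integration.integral_sum int)
    also have "\<dots> = (\<Sum>i\<in>I. \<Sum>j\<in>I. if i = j then a i * b j else 0)"
      by (intro sum.cong refl) simp
    also have "\<dots> = (\<Sum>i\<in>I. a i * b i)" using I by simp
    finally show ?thesis unfolding e .
  qed
qed

section \<open>Gordon's comparison inequality\<close>

definition lgs :: "real \<Rightarrow> real" where "lgs x = 1 / (1 + exp (- x))"

lemma lgs_bounds: "0 < lgs x" "lgs x < 1"
  by (simp_all add: lgs_def add_pos_pos)

lemma DERIV_lgs: "(lgs has_real_derivative lgs x * (1 - lgs x)) (at x)"
proof -
  have pos: "1 + exp (- x) > 0" by (simp add: add_pos_pos)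
  have "((\<lambda>x. 1 / (1 + exp (- x))) has_real_derivative exp (- x) / (1 + exp (- x))\<^sup>2) (at x)"
    using pos by (auto intro!: derivative_eq_intros simp: power2_eq_square)
  also have "exp (- x) / (1 + exp (- x))\<^sup>2 = lgs x * (1 - lgs x)"
    using pos by (simp add: lgs_def field_simps power2_eq_square)
  finally show ?thesis by (simp add: lgs_def[abs_def])
qed

text \<open>All derivatives of the logistic function are polynomials in the function itself, so they
  are bounded uniformly in the base point. The third one is at most 6 in absolute value before the
  scaling by \<open>k\<close>, which cancels \<open>3!\<close> in the remainder.\<close>

lemma lgs_taylor:
  fixes k l y x :: real
  defines "L \<equiv> lgs (k * (y - l))"
  shows "\<bar>lgs (k * (y + x - l)) - L - k * L * (1 - L) * x - k\<^sup>2 * L * (1 - L) * (1 - 2 * L) * x\<^sup>2 / 2\<bar> \<le> \<bar>k\<bar>^3 * \<bar>x\<bar>^3"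
proof (cases "x = 0")
  case False
  define S where "S t = lgs (k * (t - l))" for t
  define diff where "diff m t = (if m = 0 then S t else if m = 1 then k * S t * (1 - S t)
     else if m = 2 then k\<^sup>2 * (S t * (1 - S t) * (1 - 2 * S t)) else k^3 * (S t * (1 - S t) * (1 - 6 * S t + 6 * (S t)\<^sup>2)))" for m :: nat and t
  have S: "(S has_real_derivative k * (S t * (1 - S t))) (at t)" for t
    unfolding S_def by (rule DERIV_chain'[OF _ DERIV_lgs, THEN DERIV_cong]) (auto intro!: derivative_eq_intros)
  have D: "\<forall>m t. m < 3 \<and> min y (y + x) \<le> t \<and> t \<le> max y (y + x) \<longrightarrow> (diff m has_real_derivative diff (Suc m) t) (at t)"
  proof (intro allI impI)
    fix m :: nat and t assume "m < 3 \<and> min y (y + x) \<le> t \<and> t \<le> max y (y + x)"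
    then consider "m = 0" | "m = 1" | "m = 2" by linarith
    then show "(diff m has_real_derivative diff (Suc m) t) (at t)"
    proof cases
      case 1 then show ?thesis using S[of t] by (simp add: diff_def[abs_def] mult.assoc)
    next
      case 2 then show ?thesis
        by (auto simp: diff_def[abs_def] intro!: derivative_eq_intros S) (simp add: algebra_simps power2_eq_square)
    next
      case 3 then show ?thesis
        by (auto simp: diff_def[abs_def] intro!: derivative_eq_intros S) (simp add: algebra_simps power2_eq_square power3_eq_cube)
    qed
  qed
  obtain t where t: "S (y + x) = (\<Sum>m<3. diff m y / fact m * (y + x - y) ^ m) + diff 3 t / fact 3 * (y + x - y) ^ 3"
    using Taylor[of 3 diff S "min y (y + x)" "max y (y + x)" y "y + x", OF _ _ D] False
    by (auto simp: diff_def[abs_def])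
  have "S (y + x) - S y - k * S y * (1 - S y) * x - k\<^sup>2 * S y * (1 - S y) * (1 - 2 * S y) * x\<^sup>2 / 2 = diff 3 t / 6 * x ^ 3"
    unfolding t by (simp add: eval_nat_numeral diff_def algebra_simps)
  moreover have "\<bar>diff 3 t / 6 * x ^ 3\<bar> \<le> \<bar>k\<bar>^3 * \<bar>x\<bar>^3"
  proof -
    have b: "0 \<le> S t" "S t \<le> 1" using lgs_bounds[of "k * (t - l)"] by (auto simp: S_def)
    have "(S t)\<^sup>2 \<le> S t" "0 \<le> (S t)\<^sup>2" using b by (auto simp: power2_eq_square mult_left_le)
    then have "\<bar>1 - 6 * S t + 6 * (S t)\<^sup>2\<bar> \<le> 6" using b unfolding abs_le_iff by linarith
    moreover have "\<bar>S t * (1 - S t)\<bar> \<le> 1 * 1" unfolding abs_mult using b by (intro mult_mono) auto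
    ultimately have "\<bar>S t * (1 - S t)\<bar> * \<bar>1 - 6 * S t + 6 * (S t)\<^sup>2\<bar> \<le> 1 * 6"
      by (intro mult_mono) auto
    then have "\<bar>k\<bar>^3 * (\<bar>S t * (1 - S t)\<bar> * \<bar>1 - 6 * S t + 6 * (S t)\<^sup>2\<bar>) \<le> \<bar>k\<bar>^3 * 6"
      by (intro mult_left_mono) auto
    then have "\<bar>diff 3 t\<bar> \<le> \<bar>k\<bar>^3 * 6"
      by (simp add: diff_def abs_mult power_abs mult.assoc)
    then have "\<bar>diff 3 t\<bar> / 6 * \<bar>x\<bar>^3 \<le> \<bar>k\<bar>^3 * \<bar>x\<bar>^3" by (intro mult_right_mono) auto
    then show ?thesis by (simp add: abs_mult power_abs)
  qed
  ultimately have "\<bar>S (y + x) - S y - k * S y * (1 - S y) * x - k\<^sup>2 * S y * (1 - S y) * (1 - 2 * S y) * x\<^sup>2 / 2\<bar> \<le> \<bar>k\<bar>^3 * \<bar>x\<bar>^3"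
    by (simp only:)
  then show ?thesis unfolding S_def L_def .
qed (simp add: L_def)

abbreviation s1 :: "'p set \<Rightarrow> ('p \<Rightarrow> real) \<Rightarrow> real" where "s1 T x \<equiv> (\<Sum>p\<in>T. \<bar>x p\<bar>)"
abbreviation D1 :: "'p set \<Rightarrow> ('p \<Rightarrow> real) \<Rightarrow> ('p \<Rightarrow> real) \<Rightarrow> real" where "D1 T a x \<equiv> (\<Sum>p\<in>T. a p * x p)"
abbreviation D2 :: "'p set \<Rightarrow> ('p \<Rightarrow> 'p \<Rightarrow> real) \<Rightarrow> ('p \<Rightarrow> real) \<Rightarrow> real" where
  "D2 T a x \<equiv> (\<Sum>p\<in>T. \<Sum>q\<in>T. a p q * (x p * x q))"

text \<open>A substitute for three bounded derivatives in several variables: \<open>d1\<close> is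
  the gradient, \<open>d2\<close> the Hessian, and the remainder is cubic in the l1 norm of the
  increment. The notion is purely algebraic and closed under products, which is how
  \<open>gor\<close> is built.\<close>

definition tay :: "'p set \<Rightarrow> (('p \<Rightarrow> real) \<Rightarrow> real) \<Rightarrow> (('p \<Rightarrow> real) \<Rightarrow> 'p \<Rightarrow> real) \<Rightarrow> (('p \<Rightarrow> real) \<Rightarrow> 'p \<Rightarrow> 'p \<Rightarrow> real) \<Rightarrow> real \<Rightarrow> bool" where
  "tay T f d1 d2 C \<longleftrightarrow> C \<ge> 0 \<and> (\<forall>v. \<bar>f v\<bar> \<le> C) \<and> (\<forall>v p. \<bar>d1 v p\<bar> \<le> C) \<and> (\<forall>v p q. \<bar>d2 v p q\<bar> \<le> C) \<and>
     (\<forall>v x. s1 T x \<le> 1 \<longrightarrow> \<bar>f (\<lambda>p. v p + x p) - f v - D1 T (d1 v) x - D2 T (d2 v) x / 2\<bar> \<le> C * s1 T x ^ 3)"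

lemma D1_bound: "(\<And>p. \<bar>a p\<bar> \<le> C) \<Longrightarrow> \<bar>D1 T a x\<bar> \<le> C * s1 T x"
  unfolding sum_distrib_left by (rule order_trans[OF sum_abs]) (auto simp: abs_mult intro!: sum_mono mult_right_mono)

lemma D2_bound: assumes "\<And>p q. \<bar>a p q\<bar> \<le> C" shows "\<bar>D2 T a x\<bar> \<le> C * (s1 T x)\<^sup>2"
proof -
  have "\<bar>D2 T a x\<bar> \<le> (\<Sum>p\<in>T. \<Sum>q\<in>T. \<bar>a p q * (x p * x q)\<bar>)"
    by (rule order_trans[OF sum_abs]) (intro sum_mono sum_abs)
  also have "\<dots> \<le> (\<Sum>p\<in>T. \<Sum>q\<in>T. C * (\<bar>x p\<bar> * \<bar>x q\<bar>))"
    by (intro sum_mono) (auto simp: abs_mult intro!: mult_right_mono assms)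
  also have "\<dots> = C * (s1 T x)\<^sup>2"
    unfolding power2_eq_square sum_product by (simp only: sum_distrib_left)
  finally show ?thesis .
qed

lemma tay_mono:
  assumes "tay T f d1 d2 C" "C \<le> C'" shows "tay T f d1 d2 C'"
proof -
  have "C * s1 T x ^ 3 \<le> C' * s1 T x ^ 3" for x :: "'a \<Rightarrow> real"
    using assms(2) by (intro mult_right_mono) (auto simp: sum_nonneg)
  then show ?thesis using assms unfolding tay_def by (meson order_trans)
qed

lemma tay_1minus:
  assumes "tay T f d1 d2 C" shows "tay T (\<lambda>v. 1 - f v) (\<lambda>v p. - d1 v p) (\<lambda>v p q. - d2 v p q) (C + 1)"
proof -
  have C: "C \<ge> 0" and f: "\<bar>f v\<bar> \<le> C" for v using assms by (auto simp: tay_def)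
  have "\<bar>1 - f v\<bar> \<le> C + 1" for v using f[of v] by linarith
  moreover have "\<bar>1 - f (\<lambda>p. v p + x p) - (1 - f v) - D1 T (\<lambda>p. - d1 v p) x - D2 T (\<lambda>p q. - d2 v p q) x / 2\<bar> \<le> (C + 1) * s1 T x ^ 3"
    if "s1 T x \<le> 1" for v x
  proof -
    have "\<bar>f (\<lambda>p. v p + x p) - f v - D1 T (d1 v) x - D2 T (d2 v) x / 2\<bar> \<le> C * s1 T x ^ 3"
      using assms that by (auto simp: tay_def)
    moreover have "C * s1 T x ^ 3 \<le> (C + 1) * s1 T x ^ 3" by (intro mult_right_mono) (auto simp: sum_nonneg)
    ultimately show ?thesis by (simp add: sum_negf)
  qed
  moreover have "\<bar>d1 v p\<bar> \<le> C + 1" "\<bar>d2 v p q\<bar> \<le> C + 1" for v p q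
    using assms by (auto simp: tay_def intro: order_trans[where y = C])
  ultimately show ?thesis using C unfolding tay_def by simp
qed

lemma tay_const: "\<bar>c\<bar> \<le> C \<Longrightarrow> tay T (\<lambda>v. c) (\<lambda>v p. 0) (\<lambda>v p q. 0) C"
  by (auto simp: tay_def sum_nonneg)

text \<open>Multiplying the two expansions gives the product rule up to second order. Every other
  term is a product of quantities whose combined degree in \<open>s\<close> is at least 3, and
  \<open>s \<le> 1\<close> reduces all of them to \<open>s ^ 3\<close>.\<close>

lemma tay_mult:
  assumes f: "tay T f d1 d2 C" and g: "tay T g e1 e2 C"
  shows "tay T (\<lambda>v. f v * g v) (\<lambda>v p. f v * e1 v p + g v * d1 v p)
     (\<lambda>v p q. f v * e2 v p q + g v * d2 v p q + (d1 v p * e1 v q + d1 v q * e1 v p)) (5 * C\<^sup>2)"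
  unfolding tay_def
proof (intro conjI allI impI)
  have C: "C \<ge> 0" and F: "\<bar>f v\<bar> \<le> C" "\<bar>d1 v p\<bar> \<le> C" "\<bar>d2 v p q\<bar> \<le> C"
    and G: "\<bar>g v\<bar> \<le> C" "\<bar>e1 v p\<bar> \<le> C" "\<bar>e2 v p q\<bar> \<le> C" for v p q
    using f g by (auto simp: tay_def)
  have m: "\<bar>a * b\<bar> \<le> C\<^sup>2" if "\<bar>a\<bar> \<le> C" "\<bar>b\<bar> \<le> C" for a b
    using mult_mono[OF that C] by (simp add: abs_mult power2_eq_square)
  have C2: "C\<^sup>2 \<ge> 0" by simp
  show "5 * C\<^sup>2 \<ge> 0" by simp
  show "\<bar>f v * g v\<bar> \<le> 5 * C\<^sup>2" for v using m[OF F(1) G(1), of v v] C2 by linarith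
  show "\<bar>f v * e1 v p + g v * d1 v p\<bar> \<le> 5 * C\<^sup>2" for v p
    using m[OF F(1)[of v] G(2)[of v p]] m[OF G(1)[of v] F(2)[of v p]] C2 by linarith
  show "\<bar>f v * e2 v p q + g v * d2 v p q + (d1 v p * e1 v q + d1 v q * e1 v p)\<bar> \<le> 5 * C\<^sup>2" for v p q
    using m[OF F(1)[of v] G(3)[of v p q]] m[OF G(1)[of v] F(3)[of v p q]]
      m[OF F(2)[of v p] G(2)[of v q]] m[OF F(2)[of v q] G(2)[of v p]] C2 by linarith
  fix v x :: "'a \<Rightarrow> real" assume s: "s1 T x \<le> 1"
  define s where "s = s1 T x"
  have s01: "0 \<le> s" "s \<le> 1" using s by (auto simp: s_def sum_nonneg)
  define a b a1 b1 a2 b2 where "a = f v" and "b = g v" and "a1 = D1 T (d1 v) x" and "b1 = D1 T (e1 v) x"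
    and "a2 = D2 T (d2 v) x" and "b2 = D2 T (e2 v) x"
  define F' G' where "F' = f (\<lambda>p. v p + x p)" and "G' = g (\<lambda>p. v p + x p)"
  define R S where "R = F' - a - a1 - a2 / 2" and "S = G' - b - b1 - b2 / 2"
  have R: "\<bar>R\<bar> \<le> C * s ^ 3" "\<bar>S\<bar> \<le> C * s ^ 3"
    using f g s unfolding tay_def R_def S_def F'_def G'_def a_def b_def a1_def b1_def a2_def b2_def s_def by blast+
  have ab: "\<bar>a1\<bar> \<le> C * s" "\<bar>b1\<bar> \<le> C * s" "\<bar>a2\<bar> \<le> C * s\<^sup>2" "\<bar>b2\<bar> \<le> C * s\<^sup>2"
    unfolding a1_def b1_def a2_def b2_def s_def by (intro D1_bound D2_bound F G)+
  have d1: "D1 T (\<lambda>p. f v * e1 v p + g v * d1 v p) x = a * b1 + b * a1"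
    by (simp add: a_def b_def a1_def b1_def sum.distrib sum_distrib_left algebra_simps)
  have x1: "(\<Sum>p\<in>T. \<Sum>q\<in>T. d1 v p * e1 v q * (x p * x q)) = a1 * b1"
    by (simp add: a1_def b1_def sum_product mult_ac)
  have x2: "(\<Sum>p\<in>T. \<Sum>q\<in>T. d1 v q * e1 v p * (x p * x q)) = a1 * b1"
    by (subst sum.swap) (simp add: a1_def b1_def sum_product mult_ac)
  have d2: "D2 T (\<lambda>p q. f v * e2 v p q + g v * d2 v p q + (d1 v p * e1 v q + d1 v q * e1 v p)) x = a * b2 + b * a2 + 2 * (a1 * b1)"
  proof -
    have "D2 T (\<lambda>p q. f v * e2 v p q + g v * d2 v p q + (d1 v p * e1 v q + d1 v q * e1 v p)) x
      = (\<Sum>p\<in>T. \<Sum>q\<in>T. a * (e2 v p q * (x p * x q)) + b * (d2 v p q * (x p * x q))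
          + (d1 v p * e1 v q * (x p * x q) + d1 v q * e1 v p * (x p * x q)))"
      by (intro sum.cong refl) (simp add: a_def b_def algebra_simps)
    also have "\<dots> = a * b2 + b * a2 + (a1 * b1 + a1 * b1)"
      by (simp only: sum.distrib sum_distrib_left[symmetric] x1 x2) (simp add: a2_def b2_def)
    finally show ?thesis by simp
  qed
  have key: "F' * G' - a * b - (a * b1 + b * a1) - (a * b2 + b * a2 + 2 * (a1 * b1)) / 2
     = a1 * b2 / 2 + a2 * b1 / 2 + a2 * b2 / 4 + F' * S + R * G' - R * S"
    unfolding R_def S_def by (simp add: field_simps)
  have p: "s ^ 4 \<le> s ^ 3" "s ^ 6 \<le> s ^ 3" using s01 by (auto intro!: power_decreasing)
  have mm: "\<bar>u * w\<bar> \<le> C\<^sup>2 * s ^ 3" if "\<bar>u\<bar> \<le> C * s ^ i" "\<bar>w\<bar> \<le> C * s ^ j" "i + j \<ge> 3" for u w i j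
  proof -
    have "\<bar>u * w\<bar> \<le> (C * s ^ i) * (C * s ^ j)" unfolding abs_mult
      using that C s01 by (intro mult_mono) auto
    also have "\<dots> = C\<^sup>2 * s ^ (i + j)" by (simp add: power2_eq_square power_add)
    also have "\<dots> \<le> C\<^sup>2 * s ^ 3" using s01 that(3) by (intro mult_left_mono power_decreasing) auto
    finally show ?thesis .
  qed
  have 1: "\<bar>a1 * b2\<bar> \<le> C\<^sup>2 * s ^ 3" by (rule mm[of _ 1 _ 2]) (use ab in auto)
  have 2: "\<bar>a2 * b1\<bar> \<le> C\<^sup>2 * s ^ 3" by (rule mm[of _ 2 _ 1]) (use ab in auto)
  have 3: "\<bar>a2 * b2\<bar> \<le> C\<^sup>2 * s ^ 3" by (rule mm[of _ 2 _ 2]) (use ab in auto)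
  have 4: "\<bar>F' * S\<bar> \<le> C\<^sup>2 * s ^ 3" by (rule mm[of _ 0 _ 3]) (use R F in \<open>auto simp: F'_def\<close>)
  have 5: "\<bar>R * G'\<bar> \<le> C\<^sup>2 * s ^ 3" by (rule mm[of _ 3 _ 0]) (use R G in \<open>auto simp: G'_def\<close>)
  have 6: "\<bar>R * S\<bar> \<le> C\<^sup>2 * s ^ 3" by (rule mm[of _ 3 _ 3]) (use R in auto)
  \<comment> \<open>The six terms of \<open>key\<close> carry the weights 1/2, 1/2, 1/4, 1, 1 and 1,
    with total 17/4.\<close>
  have "\<bar>F' * G' - a * b - (a * b1 + b * a1) - (a * b2 + b * a2 + 2 * (a1 * b1)) / 2\<bar> \<le> 5 * (C\<^sup>2 * s ^ 3)"
    unfolding key using 1 2 3 4 5 6 by linarith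
  then show "\<bar>f (\<lambda>p. v p + x p) * g (\<lambda>p. v p + x p) - f v * g v
      - D1 T (\<lambda>p. f v * e1 v p + g v * d1 v p) x
      - D2 T (\<lambda>p q. f v * e2 v p q + g v * d2 v p q + (d1 v p * e1 v q + d1 v q * e1 v p)) x / 2\<bar> \<le> 5 * C\<^sup>2 * s1 T x ^ 3"
    unfolding d1 d2 by (simp add: F'_def G'_def a_def b_def s_def)
qed

lemma tay_mult':
  assumes f: "tay T f d1 d2 C" and g: "tay T g e1 e2 C'"
  shows "\<exists>C. tay T (\<lambda>v. f v * g v) (\<lambda>v p. f v * e1 v p + g v * d1 v p)
     (\<lambda>v p q. f v * e2 v p q + g v * d2 v p q + (d1 v p * e1 v q + d1 v q * e1 v p)) C"
  using tay_mult[OF tay_mono[OF f, of "max C C'"] tay_mono[OF g, of "max C C'"]] by auto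

lemma tay_lgs:
  assumes T: "finite T" "r \<in> T" and k: "k \<ge> 0"
  shows "\<exists>d1 d2 C. tay T (\<lambda>v. lgs (k * (v r - l))) d1 d2 C \<and> (\<forall>v p. d1 v p \<ge> 0) \<and>
     (\<forall>v p. p \<noteq> r \<longrightarrow> d1 v p = 0) \<and> (\<forall>v p q. p \<noteq> r \<or> q \<noteq> r \<longrightarrow> d2 v p q = 0)"
proof -
  let ?L = "\<lambda>v::'a\<Rightarrow>real. lgs (k * (v r - l))"
  define d1 where "d1 v p = (if p = r then k * ?L v * (1 - ?L v) else 0)" for v p
  define d2 where "d2 v p q = (if p = r \<and> q = r then k\<^sup>2 * ?L v * (1 - ?L v) * (1 - 2 * ?L v) else 0)" for v p q
  have L: "0 \<le> ?L v" "?L v \<le> 1" "\<bar>1 - ?L v\<bar> \<le> 1" "\<bar>1 - 2 * ?L v\<bar> \<le> 1" for v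
    using lgs_bounds[of "k * (v r - l)"] by auto
  define C where "C = 1 + k + k\<^sup>2 + k^3"
  have C: "1 \<le> C" "k \<le> C" "k\<^sup>2 \<le> C" "k^3 \<le> C" using k by (auto simp: C_def)
  have LL: "\<bar>?L v * (1 - ?L v)\<bar> \<le> 1" for v
    unfolding abs_mult using mult_mono[of "\<bar>?L v\<bar>" 1 "\<bar>1 - ?L v\<bar>" 1] L[of v] by auto
  have "tay T ?L d1 d2 C"
    unfolding tay_def
  proof (intro conjI allI impI)
    show "\<bar>?L v\<bar> \<le> C" for v using L[of v] C by auto
    show "\<bar>d1 v p\<bar> \<le> C" for v p
    proof -
      have "\<bar>k * ?L v * (1 - ?L v)\<bar> = k * \<bar>?L v * (1 - ?L v)\<bar>" using k by (simp only: abs_mult mult.assoc abs_of_nonneg)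
      also have "\<dots> \<le> k * 1" by (intro mult_left_mono LL k)
      finally have "\<bar>k * ?L v * (1 - ?L v)\<bar> \<le> C" using C by linarith
      then show ?thesis using C by (simp add: d1_def)
    qed
    show "\<bar>d2 v p q\<bar> \<le> C" for v p q
    proof -
      have "\<bar>?L v * (1 - ?L v)\<bar> * \<bar>1 - 2 * ?L v\<bar> \<le> 1 * 1" by (intro mult_mono LL L) auto
      then have "k\<^sup>2 * (\<bar>?L v * (1 - ?L v)\<bar> * \<bar>1 - 2 * ?L v\<bar>) \<le> k\<^sup>2 * 1" by (intro mult_left_mono) auto
      moreover have "\<bar>k\<^sup>2 * ?L v * (1 - ?L v) * (1 - 2 * ?L v)\<bar> = k\<^sup>2 * (\<bar>?L v * (1 - ?L v)\<bar> * \<bar>1 - 2 * ?L v\<bar>)"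
        by (simp only: abs_mult mult.assoc abs_of_nonneg[OF zero_le_power2])
      ultimately have "\<bar>k\<^sup>2 * ?L v * (1 - ?L v) * (1 - 2 * ?L v)\<bar> \<le> C" using C by linarith
      then show ?thesis using C by (simp add: d2_def)
    qed
    fix v x :: "'a \<Rightarrow> real"
    have e1: "D1 T (d1 v) x = k * ?L v * (1 - ?L v) * x r"
      using T by (simp add: d1_def if_distrib[of "\<lambda>t. t * _"] cong: if_cong)
    have e2: "D2 T (d2 v) x = k\<^sup>2 * ?L v * (1 - ?L v) * (1 - 2 * ?L v) * (x r)\<^sup>2"
    proof -
      have "D2 T (d2 v) x = (\<Sum>p\<in>T. if p = r then (\<Sum>q\<in>T. if q = r then k\<^sup>2 * ?L v * (1 - ?L v) * (1 - 2 * ?L v) * (x r)\<^sup>2 else 0) else 0)"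
        by (intro sum.cong refl) (auto simp: d2_def power2_eq_square intro!: sum.cong sum.neutral)
      then show ?thesis using T by simp
    qed
    have "\<bar>x r\<bar> \<le> s1 T x" using T member_le_sum[of r T "\<lambda>p. \<bar>x p\<bar>"] by auto
    then have "\<bar>k\<bar>^3 * \<bar>x r\<bar>^3 \<le> C * s1 T x ^ 3" using C k by (intro mult_mono power_mono) (auto simp: sum_nonneg)
    with lgs_taylor[of k "v r" "x r" l]
    show "\<bar>?L (\<lambda>p. v p + x p) - ?L v - D1 T (d1 v) x - D2 T (d2 v) x / 2\<bar> \<le> C * s1 T x ^ 3"
      unfolding e1 e2 by linarith
  qed (use C in auto)
  moreover have "d1 v p \<ge> 0" for v p using L[of v] k by (auto simp: d1_def)
  ultimately show ?thesis
    by (intro exI[of _ d1] exI[of _ d2] exI[of _ C]) (auto simp: d1_def d2_def)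
qed

text \<open>\<open>gor W U k l\<close> is a smooth version of the indicator of the event that for every \<open>w\<close> in \<open>W\<close> some
  \<open>u\<close> in \<open>U\<close> has \<open>v (w, u) > l w u\<close>. Its mixed second derivatives have the signs that Gordon's
  comparison needs, and it tends to the indicator as the steepness \<open>k\<close> grows.\<close>

definition gq :: "'b set \<Rightarrow> real \<Rightarrow> ('a \<Rightarrow> 'b \<Rightarrow> real) \<Rightarrow> 'a \<Rightarrow> ('a \<times> 'b \<Rightarrow> real) \<Rightarrow> real" where
  "gq U k l w v = (\<Prod>u\<in>U. 1 - lgs (k * (v (w, u) - l w u)))"

definition gor :: "'a set \<Rightarrow> 'b set \<Rightarrow> real \<Rightarrow> ('a \<Rightarrow> 'b \<Rightarrow> real) \<Rightarrow> ('a \<times> 'b \<Rightarrow> real) \<Rightarrow> real" where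
  "gor W U k l v = (\<Prod>w\<in>W. 1 - gq U k l w v)"

lemma gq_bounds: "0 \<le> gq U k l w v" "gq U k l w v \<le> 1"
proof -
  have "0 \<le> 1 - lgs x" "1 - lgs x \<le> 1" for x using lgs_bounds[of x] by auto
  then show "0 \<le> gq U k l w v" "gq U k l w v \<le> 1" unfolding gq_def by (auto intro!: prod_nonneg prod_le_1)
qed

lemma gor_bounds: "0 \<le> gor W U k l v" "gor W U k l v \<le> 1"
  using gq_bounds[of U k l] unfolding gor_def by (auto intro!: prod_nonneg prod_le_1)

text \<open>Each factor decreases in its own coordinate and the other factors are positive, which
  fixes the sign of the gradient. Only coordinates of the row \<open>w\<close> occur, so all
  derivatives in other rows vanish.\<close>

lemma tay_gq:
  assumes T: "finite T" and U: "finite U" "{w} \<times> U \<subseteq> T" and k: "k \<ge> 0"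
  shows "\<exists>d1 d2 C. tay T (gq U k l w) d1 d2 C \<and> (\<forall>v p. d1 v p \<le> 0) \<and>
     (\<forall>v p. fst p \<noteq> w \<longrightarrow> d1 v p = 0) \<and> (\<forall>v p q. fst p \<noteq> w \<or> fst q \<noteq> w \<longrightarrow> d2 v p q = 0)"
  using U
proof (induction U rule: finite_induct)
  case empty
  show ?case unfolding gq_def prod.empty using tay_const[of 1 1 T] by (intro exI[of _ "\<lambda>_ _. 0"] exI[of _ "\<lambda>_ _ _. 0"]) auto
next
  case (insert u U)
  obtain d1 d2 C where 1: "tay T (gq U k l w) d1 d2 C" "\<And>v p. d1 v p \<le> 0"
    "\<And>v p. fst p \<noteq> w \<Longrightarrow> d1 v p = 0" "\<And>v p q. fst p \<noteq> w \<or> fst q \<noteq> w \<Longrightarrow> d2 v p q = 0"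
    using insert.IH[OF order_trans[OF Sigma_mono[OF subset_refl subset_insertI] insert.prems]] by blast
  have "(w, u) \<in> T" using insert.prems by auto
  from tay_lgs[OF T this k, of "l w u"] obtain e1 e2 C' where 2: "tay T (\<lambda>v. lgs (k * (v (w, u) - l w u))) e1 e2 C'"
    "\<And>v p. e1 v p \<ge> 0" "\<And>v p. p \<noteq> (w, u) \<Longrightarrow> e1 v p = 0" "\<And>v p q. p \<noteq> (w, u) \<or> q \<noteq> (w, u) \<Longrightarrow> e2 v p q = 0"
    by blast
  from tay_mult'[OF tay_1minus[OF 2(1)] 1(1)] obtain C'' where
    3: "tay T (\<lambda>v. (1 - lgs (k * (v (w, u) - l w u))) * gq U k l w v)
      (\<lambda>v p. (1 - lgs (k * (v (w, u) - l w u))) * d1 v p + gq U k l w v * - e1 v p)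
      (\<lambda>v p q. (1 - lgs (k * (v (w, u) - l w u))) * d2 v p q + gq U k l w v * - e2 v p q +
           (- e1 v p * d1 v q + - e1 v q * d1 v p)) C''" by (rule exE)
  have eq: "gq (insert u U) k l w = (\<lambda>v. (1 - lgs (k * (v (w, u) - l w u))) * gq U k l w v)"
    using insert.hyps by (auto simp: gq_def)
  have "(1 - lgs (k * (v (w, u) - l w u))) * d1 v p + gq U k l w v * - e1 v p \<le> 0" for v p
  proof -
    have "(1 - lgs (k * (v (w, u) - l w u))) * d1 v p \<le> 0"
      using lgs_bounds(2)[of "k * (v (w, u) - l w u)"] by (intro mult_nonneg_nonpos 1) simp
    moreover have "0 \<le> gq U k l w v * e1 v p" by (intro mult_nonneg_nonneg gq_bounds 2)
    ultimately show ?thesis by simp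
  qed
  then show ?case unfolding eq
    by (intro exI conjI allI impI) (rule 3, auto simp: 1 2)
qed

text \<open>Factors of different rows depend on disjoint coordinates. A second derivative across two
  rows is therefore a product of two first derivatives, both nonnegative, times nonnegative factors.
  Within one row the sign is arbitrary, which is why Gordon's theorem asks for equal covariances
  there.\<close>

lemma tay_gor:
  assumes W: "finite W" and U: "finite U" and k: "k \<ge> 0" and T: "finite T" and sub: "W \<times> U \<subseteq> T"
  shows "\<exists>d1 d2 C. tay T (gor W U k l) d1 d2 C \<and> (\<forall>v p. d1 v p \<ge> 0) \<and>
      (\<forall>v p q. fst p \<noteq> fst q \<longrightarrow> d2 v p q \<ge> 0)"
  using W sub
proof (induction W rule: finite_induct)
  case empty
  show ?case unfolding gor_def prod.empty using tay_const[of 1 1 T] by (intro exI[of _ "\<lambda>_ _. 0"] exI[of _ "\<lambda>_ _ _. 0"]) auto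
next
  case (insert w W)
  obtain d1 d2 C where 1: "tay T (gor W U k l) d1 d2 C" "\<And>v p. d1 v p \<ge> 0"
    "\<And>v p q. fst p \<noteq> fst q \<Longrightarrow> d2 v p q \<ge> 0"
    using insert.IH[OF order_trans[OF Sigma_mono[OF subset_insertI subset_refl] insert.prems]] by blast
  have "{w} \<times> U \<subseteq> T" using insert.prems by auto
  from tay_gq[OF T U this k, of l] obtain e1 e2 C' where 2: "tay T (gq U k l w) e1 e2 C'"
    "\<And>v p. e1 v p \<le> 0" "\<And>v p. fst p \<noteq> w \<Longrightarrow> e1 v p = 0" "\<And>v p q. fst p \<noteq> w \<or> fst q \<noteq> w \<Longrightarrow> e2 v p q = 0"
    by blast
  from tay_mult'[OF tay_1minus[OF 2(1)] 1(1)] obtain C'' where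
    3: "tay T (\<lambda>v. (1 - gq U k l w v) * gor W U k l v)
      (\<lambda>v p. (1 - gq U k l w v) * d1 v p + gor W U k l v * - e1 v p)
      (\<lambda>v p q. (1 - gq U k l w v) * d2 v p q + gor W U k l v * - e2 v p q +
           (- e1 v p * d1 v q + - e1 v q * d1 v p)) C''" by (rule exE)
  have eq: "gor (insert w W) U k l = (\<lambda>v. (1 - gq U k l w v) * gor W U k l v)"
    using insert.hyps by (auto simp: gor_def)
  have a: "0 \<le> - e1 v p * d1 v q" for v p q
    using mult_nonpos_nonneg[OF 2(2)[of v p] 1(2)[of v q]] by simp
  have b: "0 \<le> (1 - gq U k l w v) * x" if "x \<ge> 0" for v x using gq_bounds(2)[of U k l w v] that by simp
  have "0 \<le> (1 - gq U k l w v) * d1 v p + gor W U k l v * - e1 v p" for v p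
    using b[OF 1(2), of v v p] mult_nonneg_nonpos[OF gor_bounds(1) 2(2)[of v p], of W U k l v] by linarith
  moreover have "0 \<le> (1 - gq U k l w v) * d2 v p q + gor W U k l v * - e2 v p q + (- e1 v p * d1 v q + - e1 v q * d1 v p)"
    if "fst p \<noteq> fst q" for v p q
  proof -
    have "e2 v p q = 0" using that by (intro 2(4)) auto
    then show ?thesis using b[OF 1(3)[OF that], of v v] a[of v p q] a[of v q p] by simp
  qed
  ultimately show ?case unfolding eq
    by (intro exI conjI allI impI) (rule 3, auto)
qed

text \<open>For increments of size above 1 nothing needs to cancel: two function values and the
  linear and quadratic terms are each at most \<open>C * s ^ 3\<close>. Hence the factor 4.\<close>

lemma tay_global:
  assumes "tay T f d1 d2 C"
  shows "\<bar>f (\<lambda>p. v p + x p) - f v - D1 T (d1 v) x - D2 T (d2 v) x / 2\<bar> \<le> 4 * C * s1 T x ^ 3"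
proof (cases "s1 T x \<le> 1")
  case True
  then have "\<bar>f (\<lambda>p. v p + x p) - f v - D1 T (d1 v) x - D2 T (d2 v) x / 2\<bar> \<le> C * s1 T x ^ 3"
    using assms by (auto simp: tay_def)
  moreover have "0 \<le> C * s1 T x ^ 3" using assms by (auto simp: tay_def sum_nonneg)
  ultimately show ?thesis by linarith
next
  case False
  define s where "s = s1 T x"
  have s: "s \<ge> 1" using False by (simp add: s_def)
  have C: "C \<ge> 0" "\<bar>f v\<bar> \<le> C" "\<bar>f (\<lambda>p. v p + x p)\<bar> \<le> C" using assms by (auto simp: tay_def)
  have "\<bar>D1 T (d1 v) x\<bar> \<le> C * s" unfolding s_def by (rule D1_bound) (use assms in \<open>auto simp: tay_def\<close>)
  moreover have "\<bar>D2 T (d2 v) x\<bar> \<le> C * s\<^sup>2" unfolding s_def by (rule D2_bound) (use assms in \<open>auto simp: tay_def\<close>)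
  moreover have "C * 1 \<le> C * s ^ 3" "C * s \<le> C * s ^ 3" "C * s\<^sup>2 \<le> C * s ^ 3"
    using s C by (auto intro!: mult_left_mono one_le_power power_increasing self_le_power simp del: mult_1_right)
  ultimately show ?thesis using C unfolding s_def[symmetric] by linarith
qed

lemma measurable_gq:
  assumes "\<And>u. u \<in> U \<Longrightarrow> (\<lambda>x. \<phi> x (w, u)) \<in> borel_measurable M"
  shows "(\<lambda>x. gq U k l w (\<phi> x)) \<in> borel_measurable M"
proof -
  have [measurable]: "lgs \<in> borel_measurable borel"
    unfolding lgs_def[abs_def] by measurable
  show ?thesis unfolding gq_def
    by (intro borel_measurable_prod borel_measurable_diff borel_measurable_const
        measurable_compose[OF _ \<open>lgs \<in> borel_measurable borel\<close>] borel_measurable_times assms)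
qed

lemma measurable_gor:
  assumes "\<And>w u. w \<in> W \<Longrightarrow> u \<in> U \<Longrightarrow> (\<lambda>x. \<phi> x (w, u)) \<in> borel_measurable M"
  shows "(\<lambda>x. gor W U k l (\<phi> x)) \<in> borel_measurable M"
  unfolding gor_def
  by (intro borel_measurable_prod borel_measurable_diff borel_measurable_const measurable_gq assms)

section \<open>Comparison of Gaussian expectations\<close>

text \<open>Measurability is expressed through composition with coordinatewise measurable families.
  Thus no sigma-algebra on the functions over the type \<open>'p\<close> has to be chosen, and the
  same notion serves \<open>gauss I\<close> and its square.\<close>

definition mfun :: "'m measure \<Rightarrow> (('p \<Rightarrow> real) \<Rightarrow> real) \<Rightarrow> bool" where
  "mfun M f \<longleftrightarrow> (\<forall>\<phi>. (\<forall>p. (\<lambda>x. \<phi> x p) \<in> borel_measurable M) \<longrightarrow> (\<lambda>x. f (\<phi> x)) \<in> borel_measurable M)"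

lemma mfunD: "mfun M f \<Longrightarrow> (\<And>p. (\<lambda>x. \<phi> x p) \<in> borel_measurable M) \<Longrightarrow> (\<lambda>x. f (\<phi> x)) \<in> borel_measurable M"
  by (simp add: mfun_def)

lemma mfun_gor: "mfun M (gor W U k l)"
  by (simp add: mfun_def measurable_gor)

definition gcov :: "'i set \<Rightarrow> ('p \<Rightarrow> 'i \<Rightarrow> real) \<Rightarrow> 'p \<Rightarrow> 'p \<Rightarrow> real" where
  "gcov I a p q = (\<Sum>i\<in>I. a p i * a q i)"

text \<open>In the expansion around \<open>v\<close> the linear term has mean zero and the quadratic
  term has the covariances \<open>gcov\<close> as its expectation. The third absolute moment bounds
  the remainder.\<close>

lemma gauss_perturb:
  assumes I: "finite I" and T: "finite T" and f: "tay T f d1 d2 C"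
    and fm: "(\<lambda>x. f (\<lambda>p. v p + \<eta> * lin I (a p) x)) \<in> borel_measurable (gauss I)" and eta: "\<eta> \<ge> 0"
  shows "\<bar>(\<integral>x. f (\<lambda>p. v p + \<eta> * lin I (a p) x) \<partial>gauss I) - f v - \<eta>\<^sup>2 / 2 * (\<Sum>p\<in>T. \<Sum>q\<in>T. d2 v p q * gcov I a p q)\<bar>
     \<le> 4 * C * \<eta>^3 * (\<integral>x. (\<Sum>p\<in>T. \<bar>lin I (a p) x\<bar>)^3 \<partial>gauss I)"
proof -
  interpret prob_space "gauss I" by (rule prob_space_gauss)
  note [simp] = gauss_lin[OF I]
  define S where "S x = (\<Sum>p\<in>T. \<bar>lin I (a p) x\<bar>)" for x
  have C: "C \<ge> 0" and fC: "\<bar>f v\<bar> \<le> C" for v using f by (auto simp: tay_def)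
  have int: "integrable (gauss I) (\<lambda>x. f (\<lambda>p. v p + \<eta> * lin I (a p) x))"
    by (rule integrable_const_bound[where B = C]) (use fC fm in auto)
  define Q1 where "Q1 x = D1 T (d1 v) (\<lambda>p. \<eta> * lin I (a p) x)" for x
  define Q2 where "Q2 x = D2 T (d2 v) (\<lambda>p. \<eta> * lin I (a p) x)" for x
  have Q1: "integrable (gauss I) Q1" "(\<integral>x. Q1 x \<partial>gauss I) = 0"
    unfolding Q1_def by (auto simp: Bochner_Integration.integral_sum)
  have Q2e: "Q2 x = (\<Sum>p\<in>T. \<Sum>q\<in>T. (d2 v p q * \<eta>\<^sup>2) * (lin I (a p) x * lin I (a q) x))" for x
    unfolding Q2_def by (intro sum.cong refl) (simp add: power2_eq_square)
  have i2: "integrable (gauss I) (\<lambda>x. (d2 v p q * \<eta>\<^sup>2) * (lin I (a p) x * lin I (a q) x))" for p q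
    by (intro Bochner_Integration.integrable_mult_right) simp
  have Q2: "integrable (gauss I) Q2"
    unfolding Q2e by (intro Bochner_Integration.integrable_sum i2)
  have Q2i: "(\<integral>x. Q2 x \<partial>gauss I) = \<eta>\<^sup>2 * (\<Sum>p\<in>T. \<Sum>q\<in>T. d2 v p q * gcov I a p q)"
  proof -
    have "(\<integral>x. Q2 x \<partial>gauss I) = (\<Sum>p\<in>T. \<Sum>q\<in>T. \<integral>x. (d2 v p q * \<eta>\<^sup>2) * (lin I (a p) x * lin I (a q) x) \<partial>gauss I)"
      unfolding Q2e by (simp only: Bochner_Integration.integral_sum Bochner_Integration.integrable_sum i2)
    also have "\<dots> = (\<Sum>p\<in>T. \<Sum>q\<in>T. \<eta>\<^sup>2 * (d2 v p q * gcov I a p q))"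
      by (intro sum.cong refl) (simp add: gcov_def)
    finally show ?thesis by (simp add: sum_distrib_left)
  qed
  have Si: "integrable (gauss I) (\<lambda>x. S x ^ 3)"
  proof (rule integrable_gauss_bound[where C = "(\<Sum>p\<in>T. \<Sum>i\<in>I. \<bar>a p i\<bar>)^3" and p = 3])
    show "(\<lambda>x. S x ^ 3) \<in> borel_measurable (gauss I)"
      unfolding S_def by (intro borel_measurable_power borel_measurable_sum borel_measurable_abs measurable_lin)
    fix x
    have "S x \<le> (\<Sum>p\<in>T. \<Sum>i\<in>I. \<bar>a p i\<bar>) * env I x"
      unfolding S_def sum_distrib_right[of _ T] by (intro sum_mono lin_le_env I)
    then have "S x ^ 3 \<le> ((\<Sum>p\<in>T. \<Sum>i\<in>I. \<bar>a p i\<bar>) * env I x) ^ 3"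
      by (intro power_mono) (auto simp: S_def sum_nonneg)
    moreover have "0 \<le> S x ^ 3" by (simp add: S_def sum_nonneg)
    ultimately show "\<bar>S x ^ 3\<bar> \<le> (\<Sum>p\<in>T. \<Sum>i\<in>I. \<bar>a p i\<bar>)^3 * env I x ^ 3" by (simp add: power_mult_distrib)
  qed (rule I)
  have R: "\<bar>f (\<lambda>p. v p + \<eta> * lin I (a p) x) - f v - Q1 x - Q2 x / 2\<bar> \<le> 4 * C * \<eta>^3 * S x ^ 3" for x
  proof -
    have "s1 T (\<lambda>p. \<eta> * lin I (a p) x) = \<eta> * S x"
      using eta by (simp add: S_def abs_mult sum_distrib_left)
    then show ?thesis
      using tay_global[OF f, of v "\<lambda>p. \<eta> * lin I (a p) x"] by (simp add: Q1_def Q2_def power_mult_distrib)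
  qed
  define G where "G x = f (\<lambda>p. v p + \<eta> * lin I (a p) x)" for x
  define D where "D = (\<Sum>p\<in>T. \<Sum>q\<in>T. d2 v p q * gcov I a p q)"
  have G: "integrable (gauss I) G" using int by (simp add: G_def[abs_def])
  have "(\<integral>x. G x - f v - Q1 x - Q2 x / 2 \<partial>gauss I) = (\<integral>x. G x \<partial>gauss I) - f v - \<eta>\<^sup>2 / 2 * D"
  proof -
    have "(\<integral>x. G x - f v - Q1 x - Q2 x / 2 \<partial>gauss I) = (\<integral>x. G x \<partial>gauss I) - (\<integral>x. f v \<partial>gauss I) - (\<integral>x. Q1 x \<partial>gauss I) - (\<integral>x. Q2 x / 2 \<partial>gauss I)"
      by (intro Bochner_Integration.integral_diff[THEN trans] arg_cong2[where f = "(-)"] refl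
          Bochner_Integration.integrable_diff G Q1(1) integrable_const Bochner_Integration.integrable_divide[OF Q2])
    then show ?thesis using Q1(2) Q2i by (simp add: prob_space D_def)
  qed
  then have "\<bar>(\<integral>x. G x \<partial>gauss I) - f v - \<eta>\<^sup>2 / 2 * D\<bar> = \<bar>\<integral>x. G x - f v - Q1 x - Q2 x / 2 \<partial>gauss I\<bar>" by simp
  also have "\<dots> \<le> (\<integral>x. \<bar>G x - f v - Q1 x - Q2 x / 2\<bar> \<partial>gauss I)"
    by (rule integral_abs_bound)
  also have "\<dots> \<le> (\<integral>x. 4 * C * \<eta>^3 * S x ^ 3 \<partial>gauss I)"
    by (intro integral_mono R[folded G_def] Bochner_Integration.integrable_abs Bochner_Integration.integrable_mult_right Si
          Bochner_Integration.integrable_diff G Q1(1) integrable_const Bochner_Integration.integrable_divide[OF Q2])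
  also have "\<dots> = 4 * C * \<eta>^3 * (\<integral>x. S x ^ 3 \<partial>gauss I)" by simp
  finally show ?thesis unfolding S_def G_def D_def .
qed

lemma lin_scale: "(\<And>i. i \<in> I \<Longrightarrow> a i \<noteq> 0 \<Longrightarrow> d i = c) \<Longrightarrow> lin I a (\<lambda>i\<in>I. d i * x i) = c * lin I a x"
  unfolding lin_def sum_distrib_left by (intro sum.cong refl) force

lemma lin_pw: 
  assumes "\<And>i. i \<in> I \<Longrightarrow> a i \<noteq> 0 \<Longrightarrow> d i = c" "\<And>i. i \<in> I \<Longrightarrow> a i \<noteq> 0 \<Longrightarrow> e i = c'"
  shows "lin I a (pw I (\<lambda>i u v. d i * u + e i * v) x y) = c * lin I a x + c' * lin I a y"
proof -
  have "lin I a (pw I (\<lambda>i u v. d i * u + e i * v) x y) = (\<Sum>i\<in>I. c * (a i * x i) + c' * (a i * y i))"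
    unfolding lin_def pw_def
    by (intro sum.cong refl) (use assms in \<open>force simp: algebra_simps\<close>)
  then show ?thesis by (simp add: lin_def sum.distrib sum_distrib_left)
qed

text \<open>The two processes use disjoint blocks of coordinates, \<open>\<alpha>\<close> those in
  \<open>J\<close> and \<open>\<beta>\<close> the others. Rescaling a process is therefore rescaling
  its block, and \<open>gauss_stable\<close> splits each variance into the contributions of two
  independent vectors \<open>x\<close> and \<open>y\<close>.\<close>

lemma gauss_interpolate:
  fixes f :: "('p \<Rightarrow> real) \<Rightarrow> real"
  assumes I: "finite I" and disj: "\<And>p i. i \<in> J \<Longrightarrow> \<beta> p i = 0" "\<And>p i. i \<notin> J \<Longrightarrow> \<alpha> p i = 0"
    and fm: "mfun (gauss I) f" "mfun (gauss I \<Otimes>\<^sub>M gauss I) f"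
    and bd: "\<And>v. \<bar>f v\<bar> \<le> C" and ab: "a \<ge> 0" "b \<ge> 0" "\<eta> \<ge> 0" "\<theta> \<ge> 0"
  shows "(\<integral>x. f (\<lambda>p. sqrt (a\<^sup>2 + \<eta>\<^sup>2) * lin I (\<alpha> p) x + sqrt (b\<^sup>2 + \<theta>\<^sup>2) * lin I (\<beta> p) x) \<partial>gauss I)
    = (\<integral>x. \<integral>y. f (\<lambda>p. (a * lin I (\<alpha> p) x + b * lin I (\<beta> p) x) + (\<eta> * lin I (\<alpha> p) y + \<theta> * lin I (\<beta> p) y)) \<partial>gauss I \<partial>gauss I)"
proof -
  interpret P: pair_prob_space "gauss I" "gauss I" by (rule pair_prob_space_gauss)
  define F where "F x = f (\<lambda>p. lin I (\<alpha> p) x + lin I (\<beta> p) x)" for x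
  have Fm: "F \<in> borel_measurable (gauss I)"
    unfolding F_def by (intro fm[THEN mfunD] borel_measurable_add measurable_lin)
  define d e where "d i = (if i \<in> J then a else b)" and "e i = (if i \<in> J then \<eta> else \<theta>)" for i
  have sc: "F (\<lambda>i\<in>I. sqrt ((d i)\<^sup>2 + (e i)\<^sup>2) * x i) = f (\<lambda>p. sqrt (a\<^sup>2 + \<eta>\<^sup>2) * lin I (\<alpha> p) x + sqrt (b\<^sup>2 + \<theta>\<^sup>2) * lin I (\<beta> p) x)" for x
  proof -
    have "lin I (\<alpha> p) (\<lambda>i\<in>I. sqrt ((d i)\<^sup>2 + (e i)\<^sup>2) * x i) = sqrt (a\<^sup>2 + \<eta>\<^sup>2) * lin I (\<alpha> p) x"
      "lin I (\<beta> p) (\<lambda>i\<in>I. sqrt ((d i)\<^sup>2 + (e i)\<^sup>2) * x i) = sqrt (b\<^sup>2 + \<theta>\<^sup>2) * lin I (\<beta> p) x" for p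
      using disj by (intro lin_scale; force simp: d_def e_def)+
    then show ?thesis by (simp add: F_def)
  qed
  have pw: "F (pw I (\<lambda>i u v. d i * u + e i * v) x y)
     = f (\<lambda>p. (a * lin I (\<alpha> p) x + b * lin I (\<beta> p) x) + (\<eta> * lin I (\<alpha> p) y + \<theta> * lin I (\<beta> p) y))" for x y
  proof -
    have "lin I (\<alpha> p) (pw I (\<lambda>i u v. d i * u + e i * v) x y) = a * lin I (\<alpha> p) x + \<eta> * lin I (\<alpha> p) y"
      "lin I (\<beta> p) (pw I (\<lambda>i u v. d i * u + e i * v) x y) = b * lin I (\<beta> p) x + \<theta> * lin I (\<beta> p) y" for p
      using disj by (intro lin_pw; force simp: d_def e_def)+
    then show ?thesis by (simp add: F_def algebra_simps)
  qed
  let ?g = "\<lambda>q. f (\<lambda>p. (a * lin I (\<alpha> p) (fst q) + b * lin I (\<beta> p) (fst q)) + (\<eta> * lin I (\<alpha> p) (snd q) + \<theta> * lin I (\<beta> p) (snd q)))"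
  have gm: "?g \<in> borel_measurable (gauss I \<Otimes>\<^sub>M gauss I)"
    by (intro fm[THEN mfunD] borel_measurable_add borel_measurable_times borel_measurable_const
        measurable_compose[OF measurable_fst measurable_lin] measurable_compose[OF measurable_snd measurable_lin])
  have gi: "integrable (gauss I \<Otimes>\<^sub>M gauss I) ?g"
    by (rule P.integrable_const_bound[where B = C]) (use bd gm in auto)
  have "(\<integral>x. F (\<lambda>i\<in>I. sqrt ((d i)\<^sup>2 + (e i)\<^sup>2) * x i) \<partial>gauss I)
     = (\<integral>q. F (pw I (\<lambda>i u v. d i * u + e i * v) (fst q) (snd q)) \<partial>(gauss I \<Otimes>\<^sub>M gauss I))"
    by (rule gauss_stable[symmetric, OF I Fm]) (use ab in \<open>auto simp: d_def e_def\<close>)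
  also have "\<dots> = (\<integral>q. ?g q \<partial>(gauss I \<Otimes>\<^sub>M gauss I))" unfolding pw ..
  also have "\<dots> = (\<integral>x. \<integral>y. ?g (x, y) \<partial>gauss I \<partial>gauss I)" by (rule P.integral_fst'[symmetric, OF gi])
  finally show ?thesis unfolding sc by simp
qed

text \<open>Lindeberg replacement: the variance moves from \<open>\<alpha>\<close> to \<open>\<beta>\<close> in \<open>N\<close> portions of size \<open>1 / N\<close>, each
  with an error of third order. No differentiation under the integral is required.\<close>

lemma gauss_compare:
  fixes f :: "('p \<Rightarrow> real) \<Rightarrow> real"
  assumes I: "finite I" and T: "finite T" and disj: "\<And>p i. i \<in> J \<Longrightarrow> \<beta> p i = 0" "\<And>p i. i \<notin> J \<Longrightarrow> \<alpha> p i = 0"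
    and f: "tay T f d1 d2 C"
    and fm: "mfun (gauss I) f" "mfun (gauss I \<Otimes>\<^sub>M gauss I) f"
    and pos: "\<And>v. (\<Sum>p\<in>T. \<Sum>q\<in>T. d2 v p q * gcov I \<beta> p q) \<le> (\<Sum>p\<in>T. \<Sum>q\<in>T. d2 v p q * gcov I \<alpha> p q)"
  shows "(\<integral>x. f (\<lambda>p. lin I (\<beta> p) x) \<partial>gauss I) \<le> (\<integral>x. f (\<lambda>p. lin I (\<alpha> p) x) \<partial>gauss I)"
proof -
  interpret prob_space "gauss I" by (rule prob_space_gauss)
  have C: "C \<ge> 0" and fC: "\<bar>f v\<bar> \<le> C" for v using f by (auto simp: tay_def)
  define Ma Mb where "Ma = (\<integral>x. (\<Sum>p\<in>T. \<bar>lin I (\<alpha> p) x\<bar>)^3 \<partial>gauss I)" and "Mb = (\<integral>x. (\<Sum>p\<in>T. \<bar>lin I (\<beta> p) x\<bar>)^3 \<partial>gauss I)"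
  define \<Psi> where "\<Psi> a b = (\<integral>x. f (\<lambda>p. sqrt a * lin I (\<alpha> p) x + sqrt b * lin I (\<beta> p) x) \<partial>gauss I)" for a b
  \<comment> \<open>Both sides add an independent perturbation of size \<open>\<eta>\<close> to the
    same base point, on the left along \<open>\<beta>\<close> and on the right along
    \<open>\<alpha>\<close>. They agree up to the second-order term, and its sign is the hypothesis
    \<open>pos\<close>.\<close>
  have step: "\<Psi> a (b + \<eta>\<^sup>2) \<le> \<Psi> (a + \<eta>\<^sup>2) b + 4 * C * \<eta>^3 * (Ma + Mb)" if ab: "a \<ge> 0" "b \<ge> 0" "\<eta> \<ge> 0" for a b \<eta>
  proof -
    let ?u = "\<lambda>x p. sqrt a * lin I (\<alpha> p) x + sqrt b * lin I (\<beta> p) x"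
    have 1: "\<Psi> a (b + \<eta>\<^sup>2) = (\<integral>x. \<integral>y. f (\<lambda>p. ?u x p + \<eta> * lin I (\<beta> p) y) \<partial>gauss I \<partial>gauss I)"
      using gauss_interpolate[where f = f and I = I and J = J and \<alpha> = \<alpha> and \<beta> = \<beta> and C = C and a = "sqrt a" and b = "sqrt b" and \<eta> = 0 and \<theta> = \<eta>, OF I disj fm fC] ab
      by (simp add: \<Psi>_def)
    have 2: "\<Psi> (a + \<eta>\<^sup>2) b = (\<integral>x. \<integral>y. f (\<lambda>p. ?u x p + \<eta> * lin I (\<alpha> p) y) \<partial>gauss I \<partial>gauss I)"
      using gauss_interpolate[where f = f and I = I and J = J and \<alpha> = \<alpha> and \<beta> = \<beta> and C = C and a = "sqrt a" and b = "sqrt b" and \<eta> = \<eta> and \<theta> = 0, OF I disj fm fC] ab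
      by (simp add: \<Psi>_def)
    interpret P: pair_prob_space "gauss I" "gauss I" by (rule pair_prob_space_gauss)
    have int: "integrable (gauss I) (\<lambda>x. \<integral>y. f (\<lambda>p. ?u x p + \<eta> * lin I (\<gamma> p) y) \<partial>gauss I)" for \<gamma>
    proof -
      have m: "(\<lambda>q. f (\<lambda>p. ?u (fst q) p + \<eta> * lin I (\<gamma> p) (snd q))) \<in> borel_measurable (gauss I \<Otimes>\<^sub>M gauss I)"
        by (intro fm[THEN mfunD] borel_measurable_add borel_measurable_times borel_measurable_const
            measurable_compose[OF measurable_fst measurable_lin] measurable_compose[OF measurable_snd measurable_lin])
      have "integrable (gauss I \<Otimes>\<^sub>M gauss I) (\<lambda>q. f (\<lambda>p. ?u (fst q) p + \<eta> * lin I (\<gamma> p) (snd q)))"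
        by (rule P.integrable_const_bound[where B = C]) (use fC m in auto)
      from P.integrable_fst'[OF this] show ?thesis by simp
    qed
    have pt: "(\<integral>y. f (\<lambda>p. ?u x p + \<eta> * lin I (\<beta> p) y) \<partial>gauss I)
       \<le> (\<integral>y. f (\<lambda>p. ?u x p + \<eta> * lin I (\<alpha> p) y) \<partial>gauss I) + 4 * C * \<eta>^3 * (Ma + Mb)" for x
    proof -
      have m: "(\<lambda>y. f (\<lambda>p. ?u x p + \<eta> * lin I (\<gamma> p) y)) \<in> borel_measurable (gauss I)" for \<gamma>
        by (intro fm[THEN mfunD] borel_measurable_add borel_measurable_times borel_measurable_const measurable_lin)
      define Da Db where "Da = (\<Sum>p\<in>T. \<Sum>q\<in>T. d2 (?u x) p q * gcov I \<alpha> p q)"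
        and "Db = (\<Sum>p\<in>T. \<Sum>q\<in>T. d2 (?u x) p q * gcov I \<beta> p q)"
      have "\<eta>\<^sup>2 / 2 * Db \<le> \<eta>\<^sup>2 / 2 * Da"
        using pos[of "?u x"] by (intro mult_left_mono) (auto simp: Da_def Db_def)
      moreover have "4 * C * \<eta>^3 * (Ma + Mb) = 4 * C * \<eta>^3 * Ma + 4 * C * \<eta>^3 * Mb" by (simp add: distrib_left)
      ultimately show ?thesis
        using gauss_perturb[OF I T f m ab(3), where a = \<alpha>] gauss_perturb[OF I T f m ab(3), where a = \<beta>]
        unfolding abs_le_iff Ma_def[symmetric] Mb_def[symmetric] Da_def[symmetric] Db_def[symmetric] by linarith
    qed
    have "\<Psi> a (b + \<eta>\<^sup>2) \<le> (\<integral>x. (\<integral>y. f (\<lambda>p. ?u x p + \<eta> * lin I (\<alpha> p) y) \<partial>gauss I) + 4 * C * \<eta>^3 * (Ma + Mb) \<partial>gauss I)"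
      unfolding 1 by (intro integral_mono int pt Bochner_Integration.integrable_add) simp
    also have "\<dots> = \<Psi> (a + \<eta>\<^sup>2) b + 4 * C * \<eta>^3 * (Ma + Mb)"
      unfolding 2 by (subst Bochner_Integration.integral_add[OF int]) (simp_all add: prob_space)
    finally show ?thesis .
  qed
  \<comment> \<open>With \<open>\<eta> = 1 / sqrt (real N)\<close> each of the \<open>N\<close>
    steps costs a multiple of \<open>\<eta>^3\<close>, so the total error is of order
    \<open>1 / sqrt (real N)\<close>.\<close>
  have tel: "\<Psi> 0 1 \<le> \<Psi> 1 0 + 4 * C * (Ma + Mb) / sqrt (real N)" if N: "N > 0" for N :: nat
  proof -
    define \<eta> where "\<eta> = 1 / sqrt (real N)"
    have eta: "\<eta> \<ge> 0" "\<eta>\<^sup>2 = 1 / real N" by (auto simp: \<eta>_def power_divide)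
    have "\<Psi> 0 1 \<le> \<Psi> (real k / real N) (1 - real k / real N) + real k * (4 * C * \<eta>^3 * (Ma + Mb))" if "k \<le> N" for k
      using that
    proof (induction k)
      case (Suc k)
      have "\<Psi> (real k / real N) ((1 - real (Suc k) / real N) + \<eta>\<^sup>2) \<le> \<Psi> (real k / real N + \<eta>\<^sup>2) (1 - real (Suc k) / real N) + 4 * C * \<eta>^3 * (Ma + Mb)"
        using Suc.prems N eta by (intro step) auto
      moreover have "(1 - real (Suc k) / real N) + \<eta>\<^sup>2 = 1 - real k / real N" "real k / real N + \<eta>\<^sup>2 = real (Suc k) / real N"
        unfolding eta by (simp_all add: add_divide_distrib)
      ultimately have "\<Psi> (real k / real N) (1 - real k / real N) \<le> \<Psi> (real (Suc k) / real N) (1 - real (Suc k) / real N) + 4 * C * \<eta>^3 * (Ma + Mb)"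
        by (simp only:)
      moreover have "\<Psi> 0 1 \<le> \<Psi> (real k / real N) (1 - real k / real N) + real k * (4 * C * \<eta>^3 * (Ma + Mb))"
        using Suc by simp
      moreover have "real (Suc k) * (4 * C * \<eta>^3 * (Ma + Mb)) = real k * (4 * C * \<eta>^3 * (Ma + Mb)) + 4 * C * \<eta>^3 * (Ma + Mb)"
        by (simp add: algebra_simps)
      ultimately show ?case by linarith
    qed simp
    from this[of N] have "\<Psi> 0 1 \<le> \<Psi> 1 0 + real N * (4 * C * \<eta>^3 * (Ma + Mb))" using N by simp
    also have "real N * (4 * C * \<eta>^3 * (Ma + Mb)) = (real N * \<eta>\<^sup>2) * (4 * C * (Ma + Mb) * \<eta>)"
      by (simp add: power2_eq_square power3_eq_cube)
    also have "real N * \<eta>\<^sup>2 = 1" using N by (simp add: eta)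
    finally show ?thesis by (simp add: \<eta>_def)
  qed
  have "(\<lambda>N. \<Psi> 1 0 + 4 * C * (Ma + Mb) / sqrt (real N)) \<longlonglongrightarrow> \<Psi> 1 0 + 0"
    by (intro tendsto_add tendsto_const tendsto_divide_0[OF tendsto_const]
        filterlim_at_top_imp_at_infinity filterlim_compose[OF sqrt_at_top] filterlim_real_sequentially)
  then have "\<Psi> 0 1 \<le> \<Psi> 1 0 + 0"
    by (rule tendsto_lowerbound[where F = sequentially]) (auto intro!: eventually_sequentiallyI[of 1] tel)
  then show ?thesis by (simp add: \<Psi>_def)
qed

section \<open>Gordon's inequality for finite and countable index sets\<close>

lemma gor_limit_1:
  assumes W: "finite W" and U: "finite U" and v: "\<And>w. w \<in> W \<Longrightarrow> \<exists>u\<in>U. l w u < v (w, u)"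
  shows "(\<lambda>k. gor W U (real k) l v) \<longlonglongrightarrow> 1"
proof -
  have lim1: "(\<lambda>k. lgs (real k * c)) \<longlonglongrightarrow> 1" if "c > 0" for c
  proof -
    have "filterlim (\<lambda>k. real k * c) at_top sequentially"
      by (intro filterlim_at_top_mult_tendsto_pos[OF tendsto_const that filterlim_real_sequentially])
    then have "(\<lambda>k. exp (- (real k * c))) \<longlonglongrightarrow> 0"
      by (intro filterlim_compose[OF exp_at_bot]) (simp add: filterlim_uminus_at_bot)
    then have "(\<lambda>k. 1 / (1 + exp (- (real k * c)))) \<longlonglongrightarrow> 1 / (1 + 0)"
      by (intro tendsto_intros) auto
    then show ?thesis by (simp add: lgs_def)
  qed
  have "(\<lambda>k. gq U (real k) l w v) \<longlonglongrightarrow> 0" if w: "w \<in> W" for w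
  proof -
    obtain u where u: "u \<in> U" "l w u < v (w, u)" using v[OF w] by blast
    have "gq U (real k) l w v \<le> 1 - lgs (real k * (v (w, u) - l w u))" for k
    proof -
      have b: "0 \<le> 1 - lgs x" "1 - lgs x \<le> 1" for x using lgs_bounds[of x] by auto
      have "gq U (real k) l w v = (1 - lgs (real k * (v (w, u) - l w u))) * gq (U - {u}) (real k) l w v"
        unfolding gq_def by (rule prod.remove[OF U u(1)])
      also have "\<dots> \<le> (1 - lgs (real k * (v (w, u) - l w u))) * 1"
        by (intro mult_left_mono gq_bounds b)
      finally show ?thesis by simp
    qed
    moreover have "(\<lambda>k. 1 - lgs (real k * (v (w, u) - l w u))) \<longlonglongrightarrow> 1 - 1"
      using u by (intro tendsto_diff tendsto_const lim1) simp
    ultimately have le: "\<And>k. gq U (real k) l w v \<le> 1 - lgs (real k * (v (w, u) - l w u))"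
      and lim: "(\<lambda>k. 1 - lgs (real k * (v (w, u) - l w u))) \<longlonglongrightarrow> 0" by simp_all
    show ?thesis
    proof (rule tendsto_sandwich[OF _ _ tendsto_const lim])
      show "\<forall>\<^sub>F k in sequentially. 0 \<le> gq U (real k) l w v" by (intro always_eventually allI gq_bounds)
      show "\<forall>\<^sub>F k in sequentially. gq U (real k) l w v \<le> 1 - lgs (real k * (v (w, u) - l w u))" by (intro always_eventually allI le)
    qed
  qed
  then have "(\<lambda>k. gor W U (real k) l v) \<longlonglongrightarrow> (\<Prod>w\<in>W. 1 - 0)"
    unfolding gor_def by (intro tendsto_prod tendsto_diff tendsto_const)
  then show ?thesis by simp
qed

lemma gor_limit_0:
  assumes W: "finite W" and U: "finite U" and w: "w \<in> W" and v: "\<And>u. u \<in> U \<Longrightarrow> v (w, u) < l w u"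
  shows "(\<lambda>k. gor W U (real k) l v) \<longlonglongrightarrow> 0"
proof -
  have lim0: "(\<lambda>k. lgs (real k * c)) \<longlonglongrightarrow> 0" if "c < 0" for c
  proof -
    have "filterlim (\<lambda>k. real k * (- c)) at_top sequentially"
      using that by (intro filterlim_at_top_mult_tendsto_pos[OF tendsto_const _ filterlim_real_sequentially]) simp
    then have "filterlim (\<lambda>k. exp (- (real k * c))) at_top sequentially"
      by (intro filterlim_compose[OF exp_at_top]) simp
    then have "filterlim (\<lambda>k. 1 + exp (- (real k * c))) at_top sequentially"
      by (intro filterlim_tendsto_add_at_top[OF tendsto_const])
    then have "(\<lambda>k. 1 / (1 + exp (- (real k * c)))) \<longlonglongrightarrow> 0"
      by (intro tendsto_divide_0[OF tendsto_const] filterlim_at_top_imp_at_infinity)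
    then show ?thesis by (simp add: lgs_def)
  qed
  have "(\<lambda>k. gq U (real k) l w v) \<longlonglongrightarrow> (\<Prod>u\<in>U. 1 - 0)"
    unfolding gq_def using v by (intro tendsto_prod tendsto_diff tendsto_const lim0) simp
  then have "(\<lambda>k. 1 - gq U (real k) l w v) \<longlonglongrightarrow> 1 - (\<Prod>u\<in>U. 1 - 0)"
    by (intro tendsto_diff tendsto_const)
  then have 1: "(\<lambda>k. 1 - gq U (real k) l w v) \<longlonglongrightarrow> 0" by simp
  have "gor W U (real k) l v \<le> 1 - gq U (real k) l w v" for k
  proof -
    have "gor W U (real k) l v = (1 - gq U (real k) l w v) * gor (W - {w}) U (real k) l v"
      unfolding gor_def by (rule prod.remove[OF W w])
    also have "\<dots> \<le> (1 - gq U (real k) l w v) * 1"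
      by (intro mult_left_mono gor_bounds) (simp add: gq_bounds)
    finally show ?thesis by simp
  qed
  then have le: "\<And>k. gor W U (real k) l v \<le> 1 - gq U (real k) l w v" .
  show ?thesis
  proof (rule tendsto_sandwich[OF _ _ tendsto_const 1])
    show "\<forall>\<^sub>F k in sequentially. 0 \<le> gor W U (real k) l v" by (intro always_eventually allI gor_bounds)
    show "\<forall>\<^sub>F k in sequentially. gor W U (real k) l v \<le> 1 - gq U (real k) l w v" by (intro always_eventually allI le)
  qed
qed

text \<open>\<open>J\<close> splits the coordinates of one Gaussian vector into the two independent halves that drive the two processes.\<close>

lemma gordon_finite:
  fixes \<alpha> \<beta> :: "'a \<times> 'b \<Rightarrow> 'i \<Rightarrow> real"
  assumes I: "finite I" and disj: "\<And>p i. i \<in> J \<Longrightarrow> \<beta> p i = 0" "\<And>p i. i \<notin> J \<Longrightarrow> \<alpha> p i = 0"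
    and W: "finite W" and U: "finite U"
    and cov1: "\<And>w u u'. w \<in> W \<Longrightarrow> u \<in> U \<Longrightarrow> u' \<in> U \<Longrightarrow> gcov I \<alpha> (w, u) (w, u') = gcov I \<beta> (w, u) (w, u')"
    and cov2: "\<And>w w' u u'. w \<in> W \<Longrightarrow> w' \<in> W \<Longrightarrow> u \<in> U \<Longrightarrow> u' \<in> U \<Longrightarrow> gcov I \<beta> (w, u) (w', u') \<le> gcov I \<alpha> (w, u) (w', u')"
  shows "measure (gauss I) {x \<in> space (gauss I). \<forall>w\<in>W. \<exists>u\<in>U. l w u < lin I (\<beta> (w, u)) x}
     \<le> measure (gauss I) {x \<in> space (gauss I). \<forall>w\<in>W. \<exists>u\<in>U. l w u \<le> lin I (\<alpha> (w, u)) x}"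
proof -
  interpret prob_space "gauss I" by (rule prob_space_gauss)
  let ?A = "{x \<in> space (gauss I). \<forall>w\<in>W. \<exists>u\<in>U. l w u \<le> lin I (\<alpha> (w, u)) x}"
  let ?B = "{x \<in> space (gauss I). \<forall>w\<in>W. \<exists>u\<in>U. l w u < lin I (\<beta> (w, u)) x}"
  have mA: "?A \<in> sets (gauss I)" and mB: "?B \<in> sets (gauss I)" using W U by measurable
  have E: "(\<integral>x. gor W U (real k) l (\<lambda>p. lin I (\<beta> p) x) \<partial>gauss I) \<le> (\<integral>x. gor W U (real k) l (\<lambda>p. lin I (\<alpha> p) x) \<partial>gauss I)" for k :: nat
  proof -
    obtain d1 d2 C where t: "tay (W \<times> U) (gor W U (real k) l) d1 d2 C"
      and d2: "\<And>v p q. fst p \<noteq> fst q \<Longrightarrow> d2 v p q \<ge> 0"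
      using tay_gor[OF W U _ finite_cartesian_product[OF W U] subset_refl, of "real k" l] by auto
    show ?thesis
    proof (rule gauss_compare[where J = J, OF I finite_cartesian_product[OF W U] disj t])
      show "(\<Sum>p\<in>W \<times> U. \<Sum>q\<in>W \<times> U. d2 v p q * gcov I \<beta> p q) \<le> (\<Sum>p\<in>W \<times> U. \<Sum>q\<in>W \<times> U. d2 v p q * gcov I \<alpha> p q)" for v
      proof (intro sum_mono)
        fix p q assume pq: "p \<in> W \<times> U" "q \<in> W \<times> U"
        show "d2 v p q * gcov I \<beta> p q \<le> d2 v p q * gcov I \<alpha> p q"
        proof (cases "fst p = fst q")
          case True then show ?thesis using cov1[of "fst p" "snd p" "snd q"] pq by (cases p; cases q) auto
        next
          case False then show ?thesis using cov2[of "fst p" "fst q" "snd p" "snd q"] pq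
            by (cases p; cases q) (auto intro!: mult_left_mono d2)
        qed
      qed
    qed (assumption | rule mfun_gor)+
  qed
  have gm: "(\<lambda>x. gor W U (real k) l (\<lambda>p. lin I (\<gamma> p) x)) \<in> borel_measurable (gauss I)" for k \<gamma>
    by (intro measurable_gor measurable_lin)
  have gi: "integrable (gauss I) (\<lambda>x. gor W U (real k) l (\<lambda>p. lin I (\<gamma> p) x))" for k \<gamma>
    by (rule integrable_const_bound[where B = 1]) (use gm gor_bounds[of W U "real k" l] in auto)
  have iS: "integrable (gauss I) (\<lambda>x. indicator S x * gor W U (real k) l (\<lambda>p. lin I (\<gamma> p) x))"
    if "S \<in> sets (gauss I)" for S k \<gamma>
  proof (rule integrable_const_bound[where B = 1])
    show "(\<lambda>x. indicator S x * gor W U (real k) l (\<lambda>p. lin I (\<gamma> p) x)) \<in> borel_measurable (gauss I)"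
      by (intro borel_measurable_times borel_measurable_indicator gm that)
    show "AE x in gauss I. norm (indicator S x * gor W U (real k) l (\<lambda>p. lin I (\<gamma> p) x)) \<le> 1"
      using gor_bounds[of W U "real k" l] by (intro AE_I2) (auto simp: indicator_def)
  qed
  have bd: "norm (indicator S x * gor W U (real k) l v) \<le> 1" for S and x :: "'i \<Rightarrow> real" and k v
    using gor_bounds[of W U "real k" l v] by (auto simp: indicator_def)
  have iI: "integrable (gauss I) (\<lambda>x. indicator ?A x :: real)"
    using mA by (intro integrable_real_indicator) (auto simp: less_top[symmetric])
  note iB = iS[OF mB] and iA = iS[OF sets.compl_sets[OF mA]]
  have limB: "(\<lambda>k. \<integral>x. indicator ?B x * gor W U (real k) l (\<lambda>p. lin I (\<beta> p) x) \<partial>gauss I) \<longlonglongrightarrow> (\<integral>x. indicator ?B x \<partial>gauss I)"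
  proof (rule integral_dominated_convergence[where w = "\<lambda>_. 1"])
    show "AE x in gauss I. (\<lambda>k. indicator ?B x * gor W U (real k) l (\<lambda>p. lin I (\<beta> p) x)) \<longlonglongrightarrow> indicator ?B x"
    proof (rule AE_I2)
      fix x show "(\<lambda>k. indicator ?B x * gor W U (real k) l (\<lambda>p. lin I (\<beta> p) x)) \<longlonglongrightarrow> (indicator ?B x :: real)"
      proof (cases "x \<in> ?B")
        case True
        then have "(\<lambda>k. gor W U (real k) l (\<lambda>p. lin I (\<beta> p) x)) \<longlonglongrightarrow> 1"
          by (intro gor_limit_1 W U) auto
        then show ?thesis using True by simp
      qed simp
    qed
    show "(\<lambda>x. indicator ?B x * gor W U (real k) l (\<lambda>p. lin I (\<beta> p) x)) \<in> borel_measurable (gauss I)" for k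
      by (rule borel_measurable_integrable[OF iB])
    show "AE x in gauss I. norm (indicator ?B x * gor W U (real k) l (\<lambda>p. lin I (\<beta> p) x)) \<le> 1" for k
      by (rule AE_I2) (rule bd)
  qed (use mB in auto)
  have limA: "(\<lambda>k. \<integral>x. indicator (space (gauss I) - ?A) x * gor W U (real k) l (\<lambda>p. lin I (\<alpha> p) x) \<partial>gauss I) \<longlonglongrightarrow> (\<integral>x. 0 \<partial>gauss I)"
  proof (rule integral_dominated_convergence[where w = "\<lambda>_. 1"])
    show "AE x in gauss I. (\<lambda>k. indicator (space (gauss I) - ?A) x * gor W U (real k) l (\<lambda>p. lin I (\<alpha> p) x)) \<longlonglongrightarrow> 0"
    proof (rule AE_I2)
      fix x show "(\<lambda>k. indicator (space (gauss I) - ?A) x * gor W U (real k) l (\<lambda>p. lin I (\<alpha> p) x)) \<longlonglongrightarrow> (0 :: real)"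
      proof (cases "x \<in> space (gauss I) - ?A")
        case True
        then obtain w where "w \<in> W" "\<And>u. u \<in> U \<Longrightarrow> lin I (\<alpha> (w, u)) x < l w u" by (auto simp: not_le)
        then have "(\<lambda>k. gor W U (real k) l (\<lambda>p. lin I (\<alpha> p) x)) \<longlonglongrightarrow> 0"
          by (intro gor_limit_0[OF W U]) auto
        then show ?thesis using True by simp
      qed simp
    qed
    show "(\<lambda>x. indicator (space (gauss I) - ?A) x * gor W U (real k) l (\<lambda>p. lin I (\<alpha> p) x)) \<in> borel_measurable (gauss I)" for k
      by (rule borel_measurable_integrable[OF iA])
    show "AE x in gauss I. norm (indicator (space (gauss I) - ?A) x * gor W U (real k) l (\<lambda>p. lin I (\<alpha> p) x)) \<le> 1" for k
      by (rule AE_I2) (rule bd)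
  qed auto
  \<comment> \<open>As \<open>k\<close> grows, \<open>gor\<close> tends to 1 on \<open>?B\<close>
    and to 0 off \<open>?A\<close>. The strict inequality in \<open>?B\<close> and the weak one in
    \<open>?A\<close> keep ties, where the logistic factor stays at 1/2, out of both limits.\<close>
  have "(\<integral>x. indicator ?B x * gor W U (real k) l (\<lambda>p. lin I (\<beta> p) x) \<partial>gauss I)
     \<le> measure (gauss I) ?A + (\<integral>x. indicator (space (gauss I) - ?A) x * gor W U (real k) l (\<lambda>p. lin I (\<alpha> p) x) \<partial>gauss I)" for k
  proof -
    have "(\<integral>x. indicator ?B x * gor W U (real k) l (\<lambda>p. lin I (\<beta> p) x) \<partial>gauss I) \<le> (\<integral>x. gor W U (real k) l (\<lambda>p. lin I (\<beta> p) x) \<partial>gauss I)"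
      by (intro integral_mono iB gi) (auto simp: indicator_def gor_bounds)
    also have "\<dots> \<le> (\<integral>x. gor W U (real k) l (\<lambda>p. lin I (\<alpha> p) x) \<partial>gauss I)" by (rule E)
    also have "\<dots> \<le> (\<integral>x. indicator ?A x + indicator (space (gauss I) - ?A) x * gor W U (real k) l (\<lambda>p. lin I (\<alpha> p) x) \<partial>gauss I)"
      by (intro integral_mono gi Bochner_Integration.integrable_add iA iI)
        (use gor_bounds in \<open>auto simp: indicator_def\<close>)
    also have "\<dots> = measure (gauss I) ?A + (\<integral>x. indicator (space (gauss I) - ?A) x * gor W U (real k) l (\<lambda>p. lin I (\<alpha> p) x) \<partial>gauss I)"
      using mA by (subst Bochner_Integration.integral_add[OF iI iA]) simp
    finally show ?thesis .
  qed
  from LIMSEQ_le[OF limB tendsto_add[OF tendsto_const limA]] this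
  have "(\<integral>x. indicator ?B x \<partial>gauss I) \<le> measure (gauss I) ?A + (\<integral>x. 0 \<partial>gauss I)" by blast
  then show ?thesis using mB by simp
qed

text \<open>The two limits are taken one after the other. For a fixed finite set of rows the columns
  exhaust \<open>U\<close> and the events increase; then the rows exhaust \<open>W\<close> and the
  events decrease. Both are monotone limits of probabilities. Empty index sets are treated apart
  because the enumeration needs an element.\<close>

lemma gordon_countable:
  fixes \<alpha> \<beta> :: "'a \<times> 'b \<Rightarrow> 'i \<Rightarrow> real"
  assumes I: "finite I" and disj: "\<And>p i. i \<in> J \<Longrightarrow> \<beta> p i = 0" "\<And>p i. i \<notin> J \<Longrightarrow> \<alpha> p i = 0"
    and W: "countable W" and U: "countable U"
    and cov1: "\<And>w u u'. w \<in> W \<Longrightarrow> u \<in> U \<Longrightarrow> u' \<in> U \<Longrightarrow> gcov I \<alpha> (w, u) (w, u') = gcov I \<beta> (w, u) (w, u')"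
    and cov2: "\<And>w w' u u'. w \<in> W \<Longrightarrow> w' \<in> W \<Longrightarrow> u \<in> U \<Longrightarrow> u' \<in> U \<Longrightarrow> gcov I \<beta> (w, u) (w', u') \<le> gcov I \<alpha> (w, u) (w', u')"
  shows "measure (gauss I) {x \<in> space (gauss I). \<forall>w\<in>W. \<exists>u\<in>U. l w u < lin I (\<beta> (w, u)) x}
     \<le> measure (gauss I) {x \<in> space (gauss I). \<forall>w\<in>W. \<exists>u\<in>U. l w u \<le> lin I (\<alpha> (w, u)) x}"
proof -
  interpret prob_space "gauss I" by (rule prob_space_gauss)
  let ?A = "\<lambda>W U. {x \<in> space (gauss I). \<forall>w\<in>W. \<exists>u\<in>U. l w u \<le> lin I (\<alpha> (w, u)) x}"
  let ?B = "\<lambda>W U. {x \<in> space (gauss I). \<forall>w\<in>W. \<exists>u\<in>U. l w u < lin I (\<beta> (w, u)) x}"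
  have m: "?A W U \<in> sets (gauss I)" "?B W U \<in> sets (gauss I)" if [measurable]: "countable W" "countable U" for W U
    by measurable
  show ?thesis
  proof (cases "W = {} \<or> U = {}")
    case True
    then have "?B W U \<subseteq> ?A W U" by auto
    then show ?thesis by (intro finite_measure_mono m W U)
  next
    case False
    define Wn Vn where "Wn n = from_nat_into W ` {..n}" and "Vn n = from_nat_into U ` {..n}" for n
    have WU: "finite (Wn n)" "finite (Vn n)" "Wn n \<subseteq> W" "Vn n \<subseteq> U" for n
      using False from_nat_into[of W] from_nat_into[of U] by (auto simp: Wn_def Vn_def)
    have mono: "Wn i \<subseteq> Wn j" "Vn i \<subseteq> Vn j" if "i \<le> j" for i j using that by (auto simp: Wn_def Vn_def)
    have UnW: "(\<Union>n. Wn n) = W" and VnU: "(\<Union>n. Vn n) = U"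
    proof -
      have "\<exists>n. w \<in> Wn n" if "w \<in> W" for w
        using from_nat_into_to_nat_on[OF W that] unfolding Wn_def by (metis atMost_iff image_eqI order_refl)
      then show "(\<Union>n. Wn n) = W" using WU(3) by auto
      have "\<exists>n. u \<in> Vn n" if "u \<in> U" for u
        using from_nat_into_to_nat_on[OF U that] unfolding Vn_def by (metis atMost_iff image_eqI order_refl)
      then show "(\<Union>n. Vn n) = U" using WU(4) by auto
    qed
    have step: "measure (gauss I) (?B W U) \<le> measure (gauss I) (?A (Wn n) U)" for n
    proof -
      have lim: "(\<lambda>k. measure (gauss I) (?B (Wn n) (Vn k))) \<longlonglongrightarrow> measure (gauss I) (\<Union>k. ?B (Wn n) (Vn k))"
      proof (rule finite_Lim_measure_incseq)
        show "range (\<lambda>k. ?B (Wn n) (Vn k)) \<subseteq> sets (gauss I)"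
          using m(2)[OF countable_finite[OF WU(1)] countable_finite[OF WU(2)]] by blast
        show "incseq (\<lambda>k. ?B (Wn n) (Vn k))"
        proof (rule incseq_SucI)
          fix k show "?B (Wn n) (Vn k) \<subseteq> ?B (Wn n) (Vn (Suc k))"
            using mono(2)[of k "Suc k"] by fastforce
        qed
      qed
      have sub: "?B W U \<subseteq> (\<Union>k. ?B (Wn n) (Vn k))"
      proof
        fix x assume x: "x \<in> ?B W U"
        then have "\<forall>w\<in>Wn n. \<exists>k. \<exists>u\<in>Vn k. l w u < lin I (\<beta> (w, u)) x" using WU(3) VnU by blast
        \<comment> \<open>Finitely many rows need finitely many columns, so one stage of the
          exhaustion, the maximum of the stages \<open>K w\<close>, serves all rows.\<close>
        from bchoice[OF this] obtain K where K: "\<forall>w\<in>Wn n. \<exists>u\<in>Vn (K w). l w u < lin I (\<beta> (w, u)) x" ..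
        have "\<exists>u\<in>Vn (Max (K ` Wn n)). l w u < lin I (\<beta> (w, u)) x" if "w \<in> Wn n" for w
        proof -
          have "K w \<le> Max (K ` Wn n)" using WU(1) that by (intro Max_ge) auto
          from mono(2)[OF this] show ?thesis using K that by blast
        qed
        then show "x \<in> (\<Union>k. ?B (Wn n) (Vn k))" using x by blast
      qed
      have "measure (gauss I) (?B (Wn n) (Vn k)) \<le> measure (gauss I) (?A (Wn n) U)" for k
      proof -
        have "measure (gauss I) (?B (Wn n) (Vn k)) \<le> measure (gauss I) (?A (Wn n) (Vn k))"
          by (rule gordon_finite[where J = J, OF I disj WU(1) WU(2)])
            (use WU(3)[of n] WU(4)[of k] in \<open>auto intro!: cov1 cov2\<close>)
        also have "\<dots> \<le> measure (gauss I) (?A (Wn n) U)"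
          using WU(4) by (intro finite_measure_mono m U countable_finite WU) blast
        finally show ?thesis .
      qed
      then have "measure (gauss I) (\<Union>k. ?B (Wn n) (Vn k)) \<le> measure (gauss I) (?A (Wn n) U)"
        by (intro LIMSEQ_le_const2[OF lim]) blast
      moreover have "measure (gauss I) (?B W U) \<le> measure (gauss I) (\<Union>k. ?B (Wn n) (Vn k))"
        using m(2)[OF countable_finite[OF WU(1)] countable_finite[OF WU(2)]] by (intro finite_measure_mono sub) blast
      ultimately show ?thesis by linarith
    qed
    have lim: "(\<lambda>n. measure (gauss I) (?A (Wn n) U)) \<longlonglongrightarrow> measure (gauss I) (\<Inter>n. ?A (Wn n) U)"
    proof (rule finite_Lim_measure_decseq)
      show "range (\<lambda>n. ?A (Wn n) U) \<subseteq> sets (gauss I)"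
        using m(1)[OF countable_finite[OF WU(1)] U] by blast
      show "decseq (\<lambda>n. ?A (Wn n) U)"
      proof (rule decseq_SucI)
        fix k show "?A (Wn (Suc k)) U \<subseteq> ?A (Wn k) U"
          using mono(1)[of k "Suc k"] by fastforce
      qed
    qed
    have "(\<Inter>n. ?A (Wn n) U) = ?A W U" using UnW by blast
    with LIMSEQ_le_const[OF lim] step show ?thesis by auto
  qed
qed

section \<open>Countable dense sets and separation of convex sets\<close>

text \<open>Countable dense subsets keep the comparison events measurable. The last clause is the only
  form in which density is used.\<close>

definition dense_in :: "(nat \<Rightarrow> real) set \<Rightarrow> (nat \<Rightarrow> real) set \<Rightarrow> bool" where
  "dense_in T S \<longleftrightarrow> countable T \<and> T \<subseteq> S \<and>
     (\<forall>f c. \<forall>w\<in>S. continuous_on UNIV f \<longrightarrow> f w < (c::real) \<longrightarrow> (\<exists>t\<in>T. f t < c))"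

lemma dense_inD:
  assumes "dense_in T S"
  shows "countable T" "T \<subseteq> S" "continuous_on UNIV f \<Longrightarrow> w \<in> S \<Longrightarrow> f w < (c::real) \<Longrightarrow> \<exists>t\<in>T. f t < c"
  using assms unfolding dense_in_def by blast+

lemma dense_in_exists: "\<exists>T. dense_in T S"
proof -
  obtain T where T: "countable T" "T \<subseteq> S" "S \<subseteq> closure T" by (rule separable)
  have "\<exists>t\<in>T. f t < c" if f: "continuous_on UNIV f" and w: "w \<in> S" "f w < c" for f w and c :: real
  proof -
    have op: "open {x. f x < c}"
      by (rule open_Collect_less[OF f continuous_on_const])
    have "w \<in> {x. f x < c} \<inter> closure T" using w T by auto
    then have "{x. f x < c} \<inter> T \<noteq> {}" using open_Int_closure_eq_empty[OF op, of T] by blast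
    then show ?thesis by blast
  qed
  then have "dense_in T S" unfolding dense_in_def using T(1,2) by (intro conjI allI ballI impI) auto
  then show ?thesis ..
qed

definition dense_sphere :: "nat \<Rightarrow> (nat \<Rightarrow> real) set \<Rightarrow> bool" where
  "dense_sphere m U \<longleftrightarrow> countable U \<and> (\<forall>u\<in>U. vnorm m u = 1) \<and>
     (\<forall>v \<delta>. vnorm m v = 1 \<longrightarrow> \<delta> > 0 \<longrightarrow> (\<exists>u\<in>U. vnorm m (\<lambda>i. u i - v i) < \<delta>))"

lemma dense_sphere_exists: "\<exists>U. dense_sphere m U"
proof -
  obtain T where T: "dense_in T {u. vnorm m u = 1}" using dense_in_exists by blast
  have "\<exists>u\<in>T. vnorm m (\<lambda>i. u i - v i) < \<delta>" if v: "vnorm m v = 1" "\<delta> > 0" for v \<delta>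
  proof (rule dense_inD(3)[OF T])
    show "continuous_on UNIV (\<lambda>u. vnorm m (\<lambda>i. u i - v i))" by (intro continuous_intros)
    show "v \<in> {u. vnorm m u = 1}" using v by simp
    show "vnorm m (\<lambda>i. v i - v i) < \<delta>" using v vnorm_scale[of m 0 v] by simp
  qed
  then show ?thesis using dense_inD(1,2)[OF T] by (intro exI[of _ T]) (auto simp: dense_sphere_def)
qed

text \<open>The norm is the supremum of \<open>ip m u y\<close> over unit vectors, and the
  maximizing direction may be moved to a nearby point of the dense set. If \<open>y\<close> vanishes
  there is no such direction, but every point of \<open>U\<close> works; \<open>m \<ge> 1\<close>
  provides a unit vector and hence a point of \<open>U\<close>.\<close>

lemma dense_sphere_attain:
  assumes U: "dense_sphere m U" and m: "m \<ge> 1" and c: "c < vnorm m y"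
  shows "\<exists>u\<in>U. c < ip m u y"
proof (cases "vnorm m y = 0")
  case True
  define e :: "nat \<Rightarrow> real" where "e i = (if i = 0 then 1 else 0)" for i
  have "(vnorm m e)\<^sup>2 = 1" using m by (simp add: vnorm_sq ip_def e_def if_distrib[of "\<lambda>t. t * _"] cong: if_cong)
  then have "vnorm m e = 1" using vnorm_nonneg[of m e] by (auto simp: power2_eq_1_iff simp del: vnorm_nonneg)
  then obtain u where u: "u \<in> U" using U unfolding dense_sphere_def by (meson zero_less_one)
  have "\<bar>ip m u y\<bar> \<le> 0" using ip_abs_le[of m u y] True by simp
  then have "c < ip m u y" using c True by linarith
  then show ?thesis using u by blast
next
  case False
  then have pos: "vnorm m y > 0" using vnorm_nonneg[of m y] by linarith
  define v where "v = (\<lambda>i. inverse (vnorm m y) * y i)"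
  have v: "vnorm m v = 1" unfolding v_def vnorm_scale using pos by simp
  have vy: "ip m v y = vnorm m y" unfolding v_def ip_scale_left using pos by (simp add: vnorm_sq[symmetric] power2_eq_square)
  define \<delta> where "\<delta> = (vnorm m y - c) / vnorm m y"
  have "\<delta> > 0" using c pos by (simp add: \<delta>_def)
  then obtain u where u: "u \<in> U" "vnorm m (\<lambda>i. u i - v i) < \<delta>"
    using U v unfolding dense_sphere_def by blast
  have "\<bar>ip m (\<lambda>i. u i - v i) y\<bar> \<le> vnorm m (\<lambda>i. u i - v i) * vnorm m y" by (rule ip_abs_le)
  also have "\<dots> < \<delta> * vnorm m y" using u pos by (intro mult_strict_right_mono)
  also have "\<dots> = vnorm m y - c" using pos by (simp add: \<delta>_def)
  finally have "c < ip m u y" by (simp add: ip_diff_left vy)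
  then show ?thesis using u by blast
qed

text \<open>Separation of a bounded convex set from a ball, tested on a dense set of directions only;
  a near minimizer of the norm replaces the projection, so that no closedness is needed.\<close>

lemma convex_small_norm:
  assumes U: "dense_sphere m U" and ne: "Y \<noteq> {}"
    and cv: "\<And>x y t. x \<in> Y \<Longrightarrow> y \<in> Y \<Longrightarrow> 0 \<le> t \<Longrightarrow> t \<le> 1 \<Longrightarrow> (\<lambda>i. x i + t * (y i - x i)) \<in> Y"
    and bd: "\<And>y. y \<in> Y \<Longrightarrow> vnorm m y \<le> B"
    and low: "\<And>u. u \<in> U \<Longrightarrow> \<exists>y\<in>Y. ip m u y \<le> c" and c: "c \<ge> 0" and e: "e > 0"
  shows "\<exists>y\<in>Y. vnorm m y \<le> c + e"
proof (rule ccontr)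
  assume "\<not> ?thesis"
  then have big: "c + e < vnorm m y" if "y \<in> Y" for y using that by force
  define d where "d = (INF y\<in>Y. vnorm m y)"
  have bdd: "bdd_below (vnorm m ` Y)" by (rule bdd_belowI[of _ 0]) auto
  have dle: "d \<le> vnorm m y" if "y \<in> Y" for y unfolding d_def using that bdd by (simp add: cINF_lower)
  have d: "c + e \<le> d" unfolding d_def using ne big by (intro cINF_greatest) (auto intro: less_imp_le)
  have dB: "d \<le> B" using ne dle bd by (meson ex_in_conv order_trans)
  have B0: "B > 0" using d dB c e by linarith
  \<comment> \<open>The step \<open>t\<close> makes the second-order term
    \<open>t\<^sup>2 * D\<close> at most \<open>t * (e * e / 4)\<close>, and \<open>\<eta>\<close>
    below makes the loss from near minimality at most the same. Together they give
    \<open>key\<close>: every \<open>y\<close> in \<open>Y\<close> has inner product at least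
    \<open>N * N - e * e / 4\<close> with \<open>y0\<close>.\<close>
  define t where "t = min 1 (e * e / (16 * B\<^sup>2))"
  have t: "0 < t" "t \<le> 1" using e B0 by (auto simp: t_def)
  have tB: "2 * t * B\<^sup>2 \<le> e * e / 8"
  proof -
    have "t * (16 * B\<^sup>2) \<le> e * e / (16 * B\<^sup>2) * (16 * B\<^sup>2)" by (intro mult_right_mono) (auto simp: t_def)
    also have "\<dots> = e * e" using B0 by simp
    finally show ?thesis by simp
  qed
  define \<eta> where "\<eta> = t * e * e / (8 * B)"
  have eta: "\<eta> > 0" using t e B0 by (simp add: \<eta>_def)
  obtain y0 where y0: "y0 \<in> Y" "vnorm m y0 < d + min \<eta> B"
  proof -
    have "\<exists>y\<in>Y. vnorm m y < d + min \<eta> B"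
    proof (rule ccontr)
      assume "\<not> ?thesis"
      then have "d + min \<eta> B \<le> d" unfolding d_def using ne by (intro cINF_greatest) (auto simp: not_less d_def[symmetric])
      then show False using eta B0 by auto
    qed
    then show ?thesis using that by blast
  qed
  define N where "N = vnorm m y0"
  have N: "c + e < N" "N \<le> B" "d \<le> N" "N < d + \<eta>" using big[OF y0(1)] bd[OF y0(1)] dle[OF y0(1)] y0 by (auto simp: N_def)
  have N0: "N > 0" using N c e by linarith
  have key: "N * N - e * e / 4 \<le> ip m y0 y" if y: "y \<in> Y" for y
  proof -
    define D where "D = (vnorm m (\<lambda>i. y i - y0 i))\<^sup>2"
    have "vnorm m (\<lambda>i. y i - y0 i) \<le> vnorm m y + vnorm m (\<lambda>i. - y0 i)"
      using vnorm_triangle[of m y "\<lambda>i. - y0 i"] by simp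
    also have "vnorm m (\<lambda>i. - y0 i) = vnorm m y0" using vnorm_scale[of m "-1" y0] by simp
    finally have "vnorm m (\<lambda>i. y i - y0 i) \<le> 2 * B" using bd[OF y] N by (simp add: N_def)
    then have "D \<le> (2 * B)\<^sup>2" unfolding D_def by (intro power_mono) auto
    then have D: "D \<le> 4 * B\<^sup>2" by simp
    have "d\<^sup>2 \<le> (vnorm m (\<lambda>i. y0 i + t * (y i - y0 i)))\<^sup>2"
      using dle[OF cv[OF y0(1) y less_imp_le[OF t(1)] t(2)]] d c e by (intro power_mono) auto
    also have "\<dots> = N\<^sup>2 + 2 * t * (ip m y0 y - N\<^sup>2) + t\<^sup>2 * D"
      by (subst vnorm_sq_add) (simp add: N_def D_def ip_simps vnorm_scale power_mult_distrib vnorm_sq[of m y0])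
    finally have 1: "d\<^sup>2 - N\<^sup>2 \<le> 2 * t * (ip m y0 y - N\<^sup>2) + t\<^sup>2 * D" by simp
    have "N\<^sup>2 - d\<^sup>2 = (N - d) * (N + d)" by (simp add: power2_eq_square algebra_simps)
    also have "\<dots> \<le> \<eta> * (2 * B)" using N dB d c e by (intro mult_mono) auto
    also have "\<dots> = t * (e * e / 4)" using B0 by (simp add: \<eta>_def)
    finally have 2: "N\<^sup>2 - d\<^sup>2 \<le> t * (e * e / 4)" .
    have "t\<^sup>2 * D \<le> t\<^sup>2 * (4 * B\<^sup>2)" using D by (intro mult_left_mono) auto
    also have "\<dots> = t * (2 * (2 * t * B\<^sup>2))" by (simp add: power2_eq_square)
    also have "\<dots> \<le> t * (2 * (e * e / 8))" using tB t by (intro mult_left_mono) auto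
    finally have 3: "t\<^sup>2 * D \<le> t * (e * e / 4)" by simp
    have "t * (2 * (N\<^sup>2 - ip m y0 y)) \<le> t * (e * e / 2)"
      using 1 2 3 by (simp add: algebra_simps)
    then have "2 * (N\<^sup>2 - ip m y0 y) \<le> e * e / 2" using t by simp
    then show ?thesis by (simp add: power2_eq_square)
  qed
  define v where "v = (\<lambda>i. inverse N * y0 i)"
  have v: "vnorm m v = 1" unfolding v_def vnorm_scale using N0 by (simp add: N_def)
  \<comment> \<open>Moving the direction into \<open>U\<close> costs another \<open>e / 4\<close>,
    so \<open>ip m u y\<close> is at least \<open>N - e / 2\<close>, which still exceeds
    \<open>c\<close>.\<close>
  have "e / (4 * B) > 0" using e B0 by simp
  then obtain u where u: "u \<in> U" "vnorm m (\<lambda>i. u i - v i) < e / (4 * B)"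
    using U v unfolding dense_sphere_def by blast
  obtain y where y: "y \<in> Y" "ip m u y \<le> c" using low[OF u(1)] by blast
  have "\<bar>ip m (\<lambda>i. u i - v i) y\<bar> \<le> vnorm m (\<lambda>i. u i - v i) * vnorm m y" by (rule ip_abs_le)
  also have "\<dots> \<le> e / (4 * B) * B" using u bd[OF y(1)] e B0 by (intro mult_mono) auto
  also have "\<dots> = e / 4" using B0 by simp
  finally have 1: "ip m v y - e / 4 \<le> ip m u y" unfolding ip_diff_left by linarith
  have eN: "e \<le> N" using N c by linarith
  have "N - e / 4 \<le> ip m v y"
  proof -
    have "N * (N - e / 4) \<le> N * N - e * e / 4"
      using mult_right_mono[OF eN, of "e / 4"] e by (simp add: algebra_simps)
    also have "\<dots> \<le> ip m y0 y" by (rule key[OF y(1)])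
    also have "\<dots> = N * ip m v y" unfolding v_def ip_scale_left using N0 by simp
    finally show ?thesis using N0 by simp
  qed
  then show False using 1 y(2) N(1) e by linarith
qed

section \<open>The two Gaussian processes and both directions of the comparison\<close>

text \<open>One \<open>(m + 1) \<times> (n + 1)\<close> Gaussian array carries everything: the top left block is the
  design matrix, the corner is the auxiliary scalar, the last column and row are the two vectors
  of the decoupled process.\<close>

definition arr :: "nat \<Rightarrow> nat \<Rightarrow> (nat \<times> nat) set" where "arr m n = {..m} \<times> {..n}"

text \<open>Coefficients of the bilinear process: the form \<open>ip m u\<close> applied to the
  matrix times \<open>w\<close>, plus the corner scalar times both norms. Its counterpart
  \<open>cb\<close> gives the decoupled process. The sign \<open>e\<close> is 1 or -1; reversing it
  turns lower bounds of the form into upper bounds, as the dual comparison requires.\<close>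

definition ca :: "real \<Rightarrow> nat \<Rightarrow> nat \<Rightarrow> (nat \<Rightarrow> real) \<Rightarrow> (nat \<Rightarrow> real) \<Rightarrow> nat \<times> nat \<Rightarrow> real" where
  "ca e m n u w k = (if fst k < m \<and> snd k < n then e * (u (fst k) * w (snd k))
     else if k = (m, n) then vnorm m u * vnorm n w else 0)"

definition cb :: "real \<Rightarrow> nat \<Rightarrow> nat \<Rightarrow> (nat \<Rightarrow> real) \<Rightarrow> (nat \<Rightarrow> real) \<Rightarrow> nat \<times> nat \<Rightarrow> real" where
  "cb e m n u w k = (if fst k < m \<and> snd k = n then e * (vnorm n w * u (fst k))
     else if fst k = m \<and> snd k < n then - e * (vnorm m u * w (snd k)) else 0)"

lemma ca_simps:
  "i < m \<Longrightarrow> j < n \<Longrightarrow> ca e m n u w (i, j) = e * (u i * w j)"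
  "i < m \<Longrightarrow> ca e m n u w (i, n) = 0" "j < n \<Longrightarrow> ca e m n u w (m, j) = 0"
  "ca e m n u w (m, n) = vnorm m u * vnorm n w"
  by (auto simp: ca_def)

lemma cb_simps:
  "i < m \<Longrightarrow> j < n \<Longrightarrow> cb e m n u w (i, j) = 0"
  "i < m \<Longrightarrow> cb e m n u w (i, n) = e * (vnorm n w * u i)" "j < n \<Longrightarrow> cb e m n u w (m, j) = - e * (vnorm m u * w j)"
  "cb e m n u w (m, n) = 0"
  by (auto simp: cb_def)

lemma finite_arr [simp]: "finite (arr m n)" by (simp add: arr_def)

lemma sum_arr:
  "(\<Sum>k\<in>arr m n. f k) = (\<Sum>i<m. \<Sum>j<n. f (i, j)) + (\<Sum>i<m. f (i, n)) + (\<Sum>j<n. f (m, j)) + (f (m, n) :: real)"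
proof -
  have "(\<Sum>k\<in>arr m n. f k) = (\<Sum>i\<le>m. \<Sum>j\<le>n. f (i, j))"
    by (simp add: arr_def sum.cartesian_product)
  then show ?thesis by (simp add: lessThan_Suc_atMost[symmetric] sum.distrib)
qed

lemma lin_ca:
  "lin (arr m n) (ca e m n u w) x = e * ip m u (mat_vec n (\<lambda>i j. x (i, j)) w) + x (m, n) * (vnorm m u * vnorm n w)"
  unfolding lin_def sum_arr
  by (simp add: ca_simps ip_def mat_vec_def sum_distrib_left sum_distrib_right mult_ac cong: sum.cong_simp)

lemma lin_cb:
  "lin (arr m n) (cb e m n u w) x = e * (vnorm n w * ip m u (\<lambda>i. x (i, n)) - vnorm m u * ip n (\<lambda>j. x (m, j)) w)"
  unfolding lin_def sum_arr
  by (simp add: cb_simps ip_def sum_distrib_left sum_subtractf right_diff_distrib sum_negf mult_ac cong: sum.cong_simp)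

lemma cov_ca:
  assumes "e\<^sup>2 = 1"
  shows "(\<Sum>k\<in>arr m n. ca e m n u w k * ca e m n u' w' k) = ip m u u' * ip n w w' + (vnorm m u * vnorm m u') * (vnorm n w * vnorm n w')"
proof -
  have "e * (a * b) * (e * (c * d)) = (a * c) * (b * d)" for a b c d
  proof -
    have "e * (a * b) * (e * (c * d)) = e\<^sup>2 * ((a * c) * (b * d))" by (simp add: power2_eq_square mult_ac)
    then show ?thesis by (simp only: assms mult_1_left)
  qed
  note * = this
  have "(\<Sum>k\<in>arr m n. ca e m n u w k * ca e m n u' w' k) =
     (\<Sum>i<m. \<Sum>j<n. e * (u i * w j) * (e * (u' i * w' j))) + vnorm m u * vnorm n w * (vnorm m u' * vnorm n w')"
    unfolding sum_arr by (simp add: ca_simps cong: sum.cong_simp)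
  also have "\<dots> = ip m u u' * ip n w w' + (vnorm m u * vnorm m u') * (vnorm n w * vnorm n w')"
    unfolding * by (simp add: ip_def sum_product mult_ac)
  finally show ?thesis .
qed

lemma cov_cb:
  assumes "e\<^sup>2 = 1"
  shows "(\<Sum>k\<in>arr m n. cb e m n u w k * cb e m n u' w' k) = (vnorm n w * vnorm n w') * ip m u u' + (vnorm m u * vnorm m u') * ip n w w'"
proof -
  have *: "e * (a * b) * (e * (c * d)) = (a * c) * (b * d)" for a b c d
  proof -
    have "e * (a * b) * (e * (c * d)) = e\<^sup>2 * ((a * c) * (b * d))" by (simp add: power2_eq_square mult_ac)
    then show ?thesis by (simp only: assms mult_1_left)
  qed
  have "(\<Sum>k\<in>arr m n. cb e m n u w k * cb e m n u' w' k) =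
     (\<Sum>i<m. e * (vnorm n w * u i) * (e * (vnorm n w' * u' i))) + (\<Sum>j<n. e * (vnorm m u * w j) * (e * (vnorm m u' * w' j)))"
    unfolding sum_arr by (simp add: cb_simps cong: sum.cong_simp)
  also have "\<dots> = (vnorm n w * vnorm n w') * ip m u u' + (vnorm m u * vnorm m u') * ip n w w'"
    unfolding * by (simp add: ip_def sum_distrib_left)
  finally show ?thesis .
qed

text \<open>The difference of the covariances factors into two Cauchy-Schwarz deficits, one for
  \<open>u, u'\<close> and one for \<open>w, w'\<close>. The corner scalar supplies the product of
  the four norms that makes this factorization exact. The difference vanishes as soon as either pair
  coincides, so both \<open>w\<close> and \<open>u\<close> can index the rows.\<close>

lemma cov_le:
  assumes "e\<^sup>2 = 1"
  shows "(\<Sum>k\<in>arr m n. cb e m n u w k * cb e m n u' w' k) \<le> (\<Sum>k\<in>arr m n. ca e m n u w k * ca e m n u' w' k)"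
proof -
  have "0 \<le> (vnorm m u * vnorm m u' - ip m u u') * (vnorm n w * vnorm n w' - ip n w w')"
    by (intro mult_nonneg_nonneg) (simp_all add: ip_le)
  then show ?thesis unfolding cov_ca[OF assms] cov_cb[OF assms] by (simp add: algebra_simps)
qed

lemma cov_eq:
  assumes "e\<^sup>2 = 1" "u = u' \<or> w = w'"
  shows "(\<Sum>k\<in>arr m n. ca e m n u w k * ca e m n u' w' k) = (\<Sum>k\<in>arr m n. cb e m n u w k * cb e m n u' w' k)"
  using assms(2) unfolding cov_ca[OF assms(1)] cov_cb[OF assms(1)]
  by (auto simp: vnorm_sq[symmetric] power2_eq_square)

abbreviation arrJ :: "nat \<Rightarrow> nat \<Rightarrow> (nat \<times> nat) set" where
  "arrJ m n \<equiv> {k. (fst k < m \<and> snd k < n) \<or> k = (m, n)}"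

text \<open>The norm is a supremum over directions, so a lower bound for all \<open>w\<close> has
  the form "for all \<open>w\<close> some \<open>u\<close>", with \<open>w\<close> as rows and
  \<open>u\<close> as columns. The corner scalar survives as an error term in the
  conclusion.\<close>

lemma gordon_lower:
  assumes S: "countable S" and m: "m \<ge> 1"
  shows "measure (gauss (arr m n)) {x \<in> space (gauss (arr m n)). \<forall>w\<in>S.
        c < vnorm m (\<lambda>i. vnorm n w * x (i, n) - \<xi> i) - ip n (\<lambda>j. x (m, j)) w}
    \<le> measure (gauss (arr m n)) {x \<in> space (gauss (arr m n)). \<forall>w\<in>S.
        c \<le> vnorm m (\<lambda>i. mat_vec n (\<lambda>i j. x (i, j)) w i - \<xi> i) + x (m, n) * vnorm n w}"
proof -
  obtain U where U: "dense_sphere m U" using dense_sphere_exists by blast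
  have Uc: "countable U" and U1: "\<And>u. u \<in> U \<Longrightarrow> vnorm m u = 1" using U by (auto simp: dense_sphere_def)
  interpret prob_space "gauss (arr m n)" by (rule prob_space_gauss)
  let ?\<alpha> = "\<lambda>(w, u). ca 1 m n u w" and ?\<beta> = "\<lambda>(w, u). cb 1 m n u w"
  let ?G = "gauss (arr m n)"
  note [measurable] = S Uc
  have [measurable]: "lin (arr m n) a \<in> borel_measurable ?G" for a by (rule measurable_lin)
  have main: "measure ?G {x \<in> space ?G. \<forall>w\<in>S. \<exists>u\<in>U. c + ip m u \<xi> < lin (arr m n) (?\<beta> (w, u)) x}
     \<le> measure ?G {x \<in> space ?G. \<forall>w\<in>S. \<exists>u\<in>U. c + ip m u \<xi> \<le> lin (arr m n) (?\<alpha> (w, u)) x}"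
  proof (rule gordon_countable[where J = "arrJ m n" and \<alpha> = ?\<alpha> and \<beta> = ?\<beta>, OF finite_arr _ _ S Uc])
    show "?\<beta> p i = 0" if "i \<in> arrJ m n" for p i
      using that by (cases p) (auto simp: cb_def)
    show "?\<alpha> p i = 0" if "i \<notin> arrJ m n" for p i
      using that by (cases p) (auto simp: ca_def)
  qed (simp_all add: gcov_def cov_eq cov_le)
  have "{x \<in> space ?G. \<forall>w\<in>S. c < vnorm m (\<lambda>i. vnorm n w * x (i, n) - \<xi> i) - ip n (\<lambda>j. x (m, j)) w}
     \<subseteq> {x \<in> space ?G. \<forall>w\<in>S. \<exists>u\<in>U. c + ip m u \<xi> < lin (arr m n) (?\<beta> (w, u)) x}"
  proof (rule Collect_mono, intro impI conjI ballI, elim conjE, assumption, elim conjE)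
    fix x w assume w: "w \<in> S" and *: "\<forall>w\<in>S. c < vnorm m (\<lambda>i. vnorm n w * x (i, n) - \<xi> i) - ip n (\<lambda>j. x (m, j)) w"
    then have "c + ip n (\<lambda>j. x (m, j)) w < vnorm m (\<lambda>i. vnorm n w * x (i, n) - \<xi> i)" by force
    from dense_sphere_attain[OF U m this] obtain u where
      u: "u \<in> U" "c + ip n (\<lambda>j. x (m, j)) w < ip m u (\<lambda>i. vnorm n w * x (i, n) - \<xi> i)" by blast
    then have "c + ip m u \<xi> < lin (arr m n) (?\<beta> (w, u)) x"
      by (simp add: lin_cb U1 ip_simps)
    then show "\<exists>u\<in>U. c + ip m u \<xi> < lin (arr m n) (?\<beta> (w, u)) x" using u by blast
  qed
  then have "measure ?G {x \<in> space ?G. \<forall>w\<in>S. c < vnorm m (\<lambda>i. vnorm n w * x (i, n) - \<xi> i) - ip n (\<lambda>j. x (m, j)) w}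
     \<le> measure ?G {x \<in> space ?G. \<forall>w\<in>S. \<exists>u\<in>U. c + ip m u \<xi> < lin (arr m n) (?\<beta> (w, u)) x}"
    by (rule finite_measure_mono) measurable
  also note main
  also have "measure ?G {x \<in> space ?G. \<forall>w\<in>S. \<exists>u\<in>U. c + ip m u \<xi> \<le> lin (arr m n) (?\<alpha> (w, u)) x}
    \<le> measure ?G {x \<in> space ?G. \<forall>w\<in>S.
        c \<le> vnorm m (\<lambda>i. mat_vec n (\<lambda>i j. x (i, j)) w i - \<xi> i) + x (m, n) * vnorm n w}"
  proof (rule finite_measure_mono)
    show "{x \<in> space ?G. \<forall>w\<in>S. \<exists>u\<in>U. c + ip m u \<xi> \<le> lin (arr m n) (?\<alpha> (w, u)) x}
      \<subseteq> {x \<in> space ?G. \<forall>w\<in>S. c \<le> vnorm m (\<lambda>i. mat_vec n (\<lambda>i j. x (i, j)) w i - \<xi> i) + x (m, n) * vnorm n w}"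
    proof (rule Collect_mono, intro impI conjI ballI, elim conjE, assumption, elim conjE)
      fix x w assume w: "w \<in> S" and *: "\<forall>w\<in>S. \<exists>u\<in>U. c + ip m u \<xi> \<le> lin (arr m n) (?\<alpha> (w, u)) x"
      then obtain u where u: "u \<in> U" "c + ip m u \<xi> \<le> lin (arr m n) (ca 1 m n u w) x" by auto
      have "c \<le> ip m u (\<lambda>i. mat_vec n (\<lambda>i j. x (i, j)) w i - \<xi> i) + x (m, n) * vnorm n w"
        using u by (simp add: lin_ca U1 ip_simps)
      also have "ip m u (\<lambda>i. mat_vec n (\<lambda>i j. x (i, j)) w i - \<xi> i) \<le> vnorm m (\<lambda>i. mat_vec n (\<lambda>i j. x (i, j)) w i - \<xi> i)"
        using ip_le[of m u "\<lambda>i. mat_vec n (\<lambda>i j. x (i, j)) w i - \<xi> i"] U1[OF u(1)] by simp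
      finally show "c \<le> vnorm m (\<lambda>i. mat_vec n (\<lambda>i j. x (i, j)) w i - \<xi> i) + x (m, n) * vnorm n w" by simp
    qed
    have cm: "(\<lambda>x. x (i, j)) \<in> borel_measurable ?G" if "i \<le> m" "j \<le> n" for i j
      using that by (intro measurable_gauss_coord) (auto simp: arr_def)
    have "(\<lambda>x. vnorm m (\<lambda>i. mat_vec n (\<lambda>i j. x (i, j)) w i - \<xi> i) + x (m, n) * vnorm n w) \<in> borel_measurable ?G" for w
      unfolding mat_vec_def
      by (intro borel_measurable_add measurable_vnorm borel_measurable_diff borel_measurable_sum
          borel_measurable_times borel_measurable_const cm) auto
    then show "{x \<in> space ?G. \<forall>w\<in>S. c \<le> vnorm m (\<lambda>i. mat_vec n (\<lambda>i j. x (i, j)) w i - \<xi> i) + x (m, n) * vnorm n w} \<in> events"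
      using S by measurable
  qed
  finally show ?thesis .
qed

text \<open>Here the directions \<open>u\<close> are the rows and the points \<open>w\<close> the
  columns, with sign -1. The conclusion only provides a \<open>w\<close> that depends on
  \<open>u\<close>; \<open>convex_small_norm\<close> later exchanges the two quantifiers.\<close>

lemma gordon_upper:
  assumes S: "countable S" and U: "dense_sphere m U"
  shows "measure (gauss (arr m n)) {x \<in> space (gauss (arr m n)). \<exists>w\<in>S.
        vnorm m (\<lambda>i. vnorm n w * x (i, n) - \<xi> i) - ip n (\<lambda>j. x (m, j)) w < c}
    \<le> measure (gauss (arr m n)) {x \<in> space (gauss (arr m n)). \<forall>u\<in>U. \<exists>w\<in>S.
        ip m u (\<lambda>i. mat_vec n (\<lambda>i j. x (i, j)) w i - \<xi> i) \<le> c + x (m, n) * vnorm n w}"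
proof -
  have Uc: "countable U" and U1: "\<And>u. u \<in> U \<Longrightarrow> vnorm m u = 1" using U by (auto simp: dense_sphere_def)
  interpret prob_space "gauss (arr m n)" by (rule prob_space_gauss)
  let ?\<alpha> = "\<lambda>(u, w). ca (-1) m n u w" and ?\<beta> = "\<lambda>(u, w). cb (-1) m n u w"
  let ?G = "gauss (arr m n)"
  note [measurable] = S Uc
  have [measurable]: "lin (arr m n) a \<in> borel_measurable ?G" for a by (rule measurable_lin)
  have main: "measure ?G {x \<in> space ?G. \<forall>u\<in>U. \<exists>w\<in>S. - c - ip m u \<xi> < lin (arr m n) (?\<beta> (u, w)) x}
     \<le> measure ?G {x \<in> space ?G. \<forall>u\<in>U. \<exists>w\<in>S. - c - ip m u \<xi> \<le> lin (arr m n) (?\<alpha> (u, w)) x}"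
  proof (rule gordon_countable[where J = "arrJ m n" and \<alpha> = ?\<alpha> and \<beta> = ?\<beta>, OF finite_arr _ _ Uc S])
    show "?\<beta> p i = 0" if "i \<in> arrJ m n" for p i
      using that by (cases p) (auto simp: cb_def)
    show "?\<alpha> p i = 0" if "i \<notin> arrJ m n" for p i
      using that by (cases p) (auto simp: ca_def)
  qed (simp_all add: gcov_def cov_eq cov_le)
  have "{x \<in> space ?G. \<exists>w\<in>S. vnorm m (\<lambda>i. vnorm n w * x (i, n) - \<xi> i) - ip n (\<lambda>j. x (m, j)) w < c}
     \<subseteq> {x \<in> space ?G. \<forall>u\<in>U. \<exists>w\<in>S. - c - ip m u \<xi> < lin (arr m n) (?\<beta> (u, w)) x}"
  proof (rule Collect_mono, intro impI conjI ballI, elim conjE, assumption, elim conjE bexE)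
    fix x w u assume w: "w \<in> S" and *: "vnorm m (\<lambda>i. vnorm n w * x (i, n) - \<xi> i) - ip n (\<lambda>j. x (m, j)) w < c"
      and u: "u \<in> U"
    have "ip m u (\<lambda>i. vnorm n w * x (i, n) - \<xi> i) \<le> vnorm m (\<lambda>i. vnorm n w * x (i, n) - \<xi> i)"
      using ip_le[of m u "\<lambda>i. vnorm n w * x (i, n) - \<xi> i"] U1[OF u] by simp
    then have "- c - ip m u \<xi> < lin (arr m n) (?\<beta> (u, w)) x"
      using * by (simp add: lin_cb U1[OF u] ip_simps)
    then show "\<exists>w\<in>S. - c - ip m u \<xi> < lin (arr m n) (?\<beta> (u, w)) x" using w by blast
  qed
  then have "measure ?G {x \<in> space ?G. \<exists>w\<in>S. vnorm m (\<lambda>i. vnorm n w * x (i, n) - \<xi> i) - ip n (\<lambda>j. x (m, j)) w < c}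
     \<le> measure ?G {x \<in> space ?G. \<forall>u\<in>U. \<exists>w\<in>S. - c - ip m u \<xi> < lin (arr m n) (?\<beta> (u, w)) x}"
    by (rule finite_measure_mono) measurable
  also note main
  also have "{x \<in> space ?G. \<forall>u\<in>U. \<exists>w\<in>S. - c - ip m u \<xi> \<le> lin (arr m n) (?\<alpha> (u, w)) x}
    = {x \<in> space ?G. \<forall>u\<in>U. \<exists>w\<in>S.
        ip m u (\<lambda>i. mat_vec n (\<lambda>i j. x (i, j)) w i - \<xi> i) \<le> c + x (m, n) * vnorm n w}"
  proof -
    have "(- c - ip m u \<xi> \<le> lin (arr m n) (?\<alpha> (u, w)) x) \<longleftrightarrow>
        (ip m u (\<lambda>i. mat_vec n (\<lambda>i j. x (i, j)) w i - \<xi> i) \<le> c + x (m, n) * vnorm n w)" if "u \<in> U" for u w x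
      using U1[OF that] by (auto simp: lin_ca ip_simps)
    then show ?thesis by (intro Collect_cong conj_cong refl ball_cong bex_cong) blast
  qed
  finally show ?thesis .
qed

section \<open>Concentration of the sequence model\<close>

definition dis :: "nat \<Rightarrow> (nat \<Rightarrow> real) set \<Rightarrow> (nat \<Rightarrow> real) \<Rightarrow> real \<Rightarrow> (nat \<Rightarrow> real) \<Rightarrow> nat \<Rightarrow> real" where
  "dis n K \<mu> \<tau> h = (\<lambda>i. seq_lse n K \<mu> \<tau> h i - \<mu> i)"

lemma seq_err_dis: "seq_err n K \<mu> \<tau> h = (vnorm n (dis n K \<mu> \<tau> h))\<^sup>2"
  by (simp add: seq_err_def dis_def)

lemma seq_lrt_dis: "seq_lrt n K \<mu> \<tau> h = 2 * \<tau> * ip n h (dis n K \<mu> \<tau> h) - (vnorm n (dis n K \<mu> \<tau> h))\<^sup>2"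
proof -
  have "(\<lambda>i. \<mu> i + \<tau> * h i - seq_lse n K \<mu> \<tau> h i) = (\<lambda>i. \<tau> * h i - dis n K \<mu> \<tau> h i)" by (auto simp: dis_def)
  then show ?thesis unfolding seq_lrt_def by (simp add: vnorm_sq_diff ip_scale_left)
qed

section \<open>Optimality and stability of the sequence model estimator\<close>

context
  fixes n :: nat and K :: "(nat \<Rightarrow> real) set" and \<mu> :: "nat \<Rightarrow> real"
  assumes K: "closed_convex n K" and \<mu>: "\<mu> \<in> K"
begin

lemma Kne: "K \<noteq> {}" using \<mu> by auto

lemma dis_in: "\<exists>\<nu>\<in>K. dis n K \<mu> \<tau> h = (\<lambda>i. \<nu> i - \<mu> i)"
  using metric_proj_in(1)[OF K Kne] unfolding dis_def seq_lse_def by blast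

text \<open>The obtuse-angle inequality says that \<open>seq_lrt\<close> is the maximum of
  \<open>2 * \<tau> * ip n h u - (vnorm n u)\<^sup>2\<close> over \<open>u\<close> in the translate
  of \<open>K\<close> by \<open>- \<mu>\<close>, attained at \<open>dis\<close>, with a quadratic
  gap away from the maximizer. In particular \<open>seq_lrt\<close> is convex in \<open>h\<close>,
  as a supremum of affine functions.\<close>

lemma dis_optimal:
  assumes "\<nu> \<in> K"
  shows "2 * \<tau> * ip n h (\<lambda>i. \<nu> i - \<mu> i) - (vnorm n (\<lambda>i. \<nu> i - \<mu> i))\<^sup>2
    \<le> seq_lrt n K \<mu> \<tau> h - (vnorm n (\<lambda>i. (\<nu> i - \<mu> i) - dis n K \<mu> \<tau> h i))\<^sup>2"
proof -
  define u w where "u = (\<lambda>i. \<nu> i - \<mu> i)" and "w = dis n K \<mu> \<tau> h"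
  have "ip n (\<lambda>i. \<mu> i + \<tau> * h i - seq_lse n K \<mu> \<tau> h i) (\<lambda>i. \<nu> i - seq_lse n K \<mu> \<tau> h i) \<le> 0"
    unfolding seq_lse_def by (rule metric_proj_obtuse[OF K Kne assms])
  moreover have "(\<lambda>i. \<mu> i + \<tau> * h i - seq_lse n K \<mu> \<tau> h i) = (\<lambda>i. \<tau> * h i - w i)"
    "(\<lambda>i. \<nu> i - seq_lse n K \<mu> \<tau> h i) = (\<lambda>i. u i - w i)" by (auto simp: u_def w_def dis_def)
  ultimately have "ip n (\<lambda>i. \<tau> * h i - w i) (\<lambda>i. u i - w i) \<le> 0" by simp
  then have "2 * \<tau> * ip n h u - (vnorm n u)\<^sup>2 \<le> 2 * \<tau> * ip n h w - (vnorm n w)\<^sup>2 - (vnorm n (\<lambda>i. u i - w i))\<^sup>2"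
    unfolding vnorm_sq_diff by (simp add: ip_simps vnorm_sq ip_commute[of n w u] algebra_simps)
  then show ?thesis unfolding u_def w_def seq_lrt_dis .
qed

lemma dis_optimal':
  assumes "\<nu> \<in> K" "u = (\<lambda>i. \<nu> i - \<mu> i)"
  shows "2 * \<tau> * ip n h u - (vnorm n u)\<^sup>2 \<le> seq_lrt n K \<mu> \<tau> h - (vnorm n (\<lambda>i. u i - dis n K \<mu> \<tau> h i))\<^sup>2"
    "2 * \<tau> * ip n h u - (vnorm n u)\<^sup>2 \<le> seq_lrt n K \<mu> \<tau> h"
proof -
  show 1: "2 * \<tau> * ip n h u - (vnorm n u)\<^sup>2 \<le> seq_lrt n K \<mu> \<tau> h - (vnorm n (\<lambda>i. u i - dis n K \<mu> \<tau> h i))\<^sup>2"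
    unfolding assms(2) by (rule dis_optimal[OF assms(1)])
  show "2 * \<tau> * ip n h u - (vnorm n u)\<^sup>2 \<le> seq_lrt n K \<mu> \<tau> h"
    using 1 zero_le_power2[of "vnorm n (\<lambda>i. u i - dis n K \<mu> \<tau> h i)"] by linarith
qed

lemma dis_lipschitz: "vnorm n (\<lambda>i. dis n K \<mu> \<tau> h i - dis n K \<mu> \<tau> h' i) \<le> \<bar>\<tau>\<bar> * vnorm n (\<lambda>i. h i - h' i)"
proof -
  have "vnorm n (\<lambda>i. dis n K \<mu> \<tau> h i - dis n K \<mu> \<tau> h' i) \<le> vnorm n (\<lambda>i. (\<mu> i + \<tau> * h i) - (\<mu> i + \<tau> * h' i))"
    using metric_proj_nonexpansive[OF K Kne, of "\<lambda>i. \<mu> i + \<tau> * h i" "\<lambda>i. \<mu> i + \<tau> * h' i"]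
    by (simp add: dis_def seq_lse_def)
  also have "(\<lambda>i. (\<mu> i + \<tau> * h i) - (\<mu> i + \<tau> * h' i)) = (\<lambda>i. \<tau> * (h i - h' i))" by (auto simp: algebra_simps)
  finally show ?thesis by (simp add: vnorm_scale)
qed

lemma dis_0: "dis n K \<mu> \<tau> (\<lambda>_. 0) = (\<lambda>_. 0)"
proof -
  have "metric_proj n K \<mu> = \<mu>"
  proof (rule metric_proj_eqI[OF K \<mu>])
    have "vnorm n (\<lambda>i. \<mu> i - \<mu> i) = 0" using vnorm_scale[of n 0 \<mu>] by simp
    then show "vnorm n (\<lambda>i. \<mu> i - \<mu> i) \<le> vnorm n (\<lambda>i. \<mu> i - y i)" for y by (simp only: vnorm_nonneg)
  qed
  then show ?thesis by (simp add: dis_def seq_lse_def)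
qed

lemma dis_bound: "vnorm n (dis n K \<mu> \<tau> h) \<le> \<bar>\<tau>\<bar> * vnorm n h"
  using dis_lipschitz[of \<tau> h "\<lambda>_. 0"] by (simp add: dis_0)

text \<open>Envelope principle: testing each maximizer in the problem of the other noise vector
  bounds the increment by the same linear form at the two maximizers. These differ by at most
  \<open>\<bar>\<tau>\<bar> * vnorm n v\<close>, so \<open>2 * \<tau> * dis\<close> acts as the
  gradient with a quadratic error.\<close>

lemma lrt_expand:
  "\<bar>seq_lrt n K \<mu> \<tau> (\<lambda>i. h i + v i) - seq_lrt n K \<mu> \<tau> h - 2 * \<tau> * ip n v (dis n K \<mu> \<tau> h)\<bar> \<le> 2 * \<tau>\<^sup>2 * (vnorm n v)\<^sup>2"
proof -
  define w w' where "w = dis n K \<mu> \<tau> h" and "w' = dis n K \<mu> \<tau> (\<lambda>i. h i + v i)"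
  have "2 * \<tau> * ip n (\<lambda>i. h i + v i) w - (vnorm n w)\<^sup>2 \<le> seq_lrt n K \<mu> \<tau> (\<lambda>i. h i + v i)"
  proof -
    obtain \<nu> where "\<nu> \<in> K" "w = (\<lambda>i. \<nu> i - \<mu> i)" using dis_in unfolding w_def by blast
    then show ?thesis by (rule dis_optimal'(2))
  qed
  then have 1: "seq_lrt n K \<mu> \<tau> h + 2 * \<tau> * ip n v w \<le> seq_lrt n K \<mu> \<tau> (\<lambda>i. h i + v i)"
    by (simp add: seq_lrt_dis[of n K \<mu> \<tau> h] w_def[symmetric] ip_simps algebra_simps)
  have "2 * \<tau> * ip n h w' - (vnorm n w')\<^sup>2 \<le> seq_lrt n K \<mu> \<tau> h"
  proof -
    obtain \<nu> where "\<nu> \<in> K" "w' = (\<lambda>i. \<nu> i - \<mu> i)" using dis_in unfolding w'_def by blast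
    then show ?thesis by (rule dis_optimal'(2))
  qed
  then have 2: "seq_lrt n K \<mu> \<tau> (\<lambda>i. h i + v i) \<le> seq_lrt n K \<mu> \<tau> h + 2 * \<tau> * ip n v w'"
    by (simp add: seq_lrt_dis[of n K \<mu> \<tau> "\<lambda>i. h i + v i"] w'_def[symmetric] ip_simps algebra_simps)
  have "\<tau> * ip n v w' - \<tau> * ip n v w \<le> \<bar>\<tau>\<bar> * \<bar>ip n v (\<lambda>i. w' i - w i)\<bar>"
    by (simp add: ip_simps right_diff_distrib[symmetric] abs_mult[symmetric])
  also have "\<dots> \<le> \<bar>\<tau>\<bar> * (vnorm n v * vnorm n (\<lambda>i. w' i - w i))"
    by (intro mult_left_mono ip_abs_le) auto
  also have "\<dots> \<le> \<bar>\<tau>\<bar> * (vnorm n v * (\<bar>\<tau>\<bar> * vnorm n v))"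
    using dis_lipschitz[of \<tau> "\<lambda>i. h i + v i" h] unfolding w_def w'_def by (intro mult_left_mono) auto
  also have "\<dots> = \<tau>\<^sup>2 * (vnorm n v)\<^sup>2" by (simp add: power2_eq_square abs_mult_self mult_ac) 
  finally show ?thesis using 1 2 unfolding w_def[symmetric] abs_le_iff by (auto simp: algebra_simps) 
qed

text \<open>\<open>(1 + \<kappa>) * seq_lrt n K \<mu> (\<tau> / (1 + \<kappa>)) h\<close> is the
  maximum of the same functional with the quadratic penalty raised from 1 to
  \<open>1 + \<kappa>\<close>. The drop \<open>A\<close> of the maximum is thus a difference
  quotient of a convex function with slope \<open>seq_err\<close>. Testing the old maximizer bounds
  it above; the quadratic gap, combined with \<open>a \<le> b + c\<close> and
  \<open>(c - \<kappa> * b)\<^sup>2 \<ge> 0\<close>, bounds it below.\<close>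

lemma dis_shrink:
  fixes \<tau> \<kappa> :: real and h :: "nat \<Rightarrow> real"
  assumes k: "\<kappa> > 0"
  defines "A \<equiv> seq_lrt n K \<mu> \<tau> h - (1 + \<kappa>) * seq_lrt n K \<mu> (\<tau> / (1 + \<kappa>)) h"
  shows "\<kappa> / (1 + \<kappa>) * seq_err n K \<mu> \<tau> h \<le> A" "A \<le> \<kappa> * seq_err n K \<mu> \<tau> h"
    "seq_err n K \<mu> (\<tau> / (1 + \<kappa>)) h \<le> seq_err n K \<mu> \<tau> h"
proof -
  define w1 w2 where "w1 = dis n K \<mu> \<tau> h" and "w2 = dis n K \<mu> (\<tau> / (1 + \<kappa>)) h"
  define a b c where "a = vnorm n w1" and "b = vnorm n w2" and "c = vnorm n (\<lambda>i. w2 i - w1 i)"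
  define i1 i2 where "i1 = ip n h w1" and "i2 = ip n h w2"
  define T1 where "T1 = 2 * \<tau> * i1 - a\<^sup>2"
  define T2 where "T2 = 2 * \<tau> * i2 - (1 + \<kappa>) * b\<^sup>2"
  have L1: "seq_lrt n K \<mu> \<tau> h = T1" by (simp add: seq_lrt_dis T1_def w1_def a_def i1_def)
  have L2: "(1 + \<kappa>) * seq_lrt n K \<mu> (\<tau> / (1 + \<kappa>)) h = T2"
    using k by (simp add: seq_lrt_dis T2_def w2_def b_def i2_def field_simps)
  obtain \<nu>1 where n1: "\<nu>1 \<in> K" "w1 = (\<lambda>i. \<nu>1 i - \<mu> i)" using dis_in unfolding w1_def by blast
  obtain \<nu>2 where n2: "\<nu>2 \<in> K" "w2 = (\<lambda>i. \<nu>2 i - \<mu> i)" using dis_in unfolding w2_def by blast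
  have A1: "2 * \<tau> * i2 - b\<^sup>2 \<le> T1 - c\<^sup>2"
    using dis_optimal'(1)[OF n2, of \<tau> h] unfolding L1 w1_def[symmetric] i2_def b_def c_def .
  have "2 * (\<tau> / (1 + \<kappa>)) * i1 - a\<^sup>2 \<le> seq_lrt n K \<mu> (\<tau> / (1 + \<kappa>)) h"
    using dis_optimal'(2)[OF n1, of "\<tau> / (1 + \<kappa>)" h] unfolding i1_def a_def .
  then have "(1 + \<kappa>) * (2 * (\<tau> / (1 + \<kappa>)) * i1 - a\<^sup>2) \<le> T2"
    unfolding L2[symmetric] using k by (intro mult_left_mono) auto
  moreover have "(1 + \<kappa>) * (2 * (\<tau> / (1 + \<kappa>)) * i1 - a\<^sup>2) = 2 * \<tau> * i1 - (1 + \<kappa>) * a\<^sup>2"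
    using k by (simp add: field_simps)
  ultimately have A2: "T1 - \<kappa> * a\<^sup>2 \<le> T2" by (simp add: T1_def algebra_simps)
  have A3: "T2 + \<kappa> * b\<^sup>2 \<le> T1 - c\<^sup>2" using A1 by (simp add: T2_def algebra_simps)
  have abc: "a \<le> b + c"
    using vnorm_diff_triangle[of n w1 w2] vnorm_minus_commute[of n w1 w2] by (simp add: a_def b_def c_def)
  have e1: "seq_err n K \<mu> \<tau> h = a\<^sup>2" and e2: "seq_err n K \<mu> (\<tau> / (1 + \<kappa>)) h = b\<^sup>2"
    by (simp_all add: seq_err_dis a_def b_def w1_def w2_def)
  show "A \<le> \<kappa> * seq_err n K \<mu> \<tau> h" unfolding A_def L1 L2 e1 using A2 by simp
  have "\<kappa> * b\<^sup>2 \<le> \<kappa> * a\<^sup>2" using A2 A3 zero_le_power2[of c] by linarith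
  then show "seq_err n K \<mu> (\<tau> / (1 + \<kappa>)) h \<le> seq_err n K \<mu> \<tau> h" unfolding e1 e2 using k by simp
  have "a\<^sup>2 \<le> (b + c)\<^sup>2" using abc by (intro power_mono) (auto simp: a_def)
  also have "\<kappa> * (b + c)\<^sup>2 \<le> (1 + \<kappa>) * (c\<^sup>2 + \<kappa> * b\<^sup>2)"
    using zero_le_power2[of "c - \<kappa> * b"] by (simp add: power2_eq_square algebra_simps)
  finally have "\<kappa> * a\<^sup>2 \<le> (1 + \<kappa>) * (c\<^sup>2 + \<kappa> * b\<^sup>2)" using k by (simp add: mult_left_mono)
  then have "\<kappa> / (1 + \<kappa>) * a\<^sup>2 \<le> c\<^sup>2 + \<kappa> * b\<^sup>2" using k by (simp add: field_simps)
  then show "\<kappa> / (1 + \<kappa>) * seq_err n K \<mu> \<tau> h \<le> A" unfolding A_def L1 L2 e1 using A3 by linarith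
qed

section \<open>Measurability and integrability of the sequence model quantities\<close>

lemma measurable_dis:
  assumes "\<And>j. j < n \<Longrightarrow> (\<lambda>x. f x j) \<in> borel_measurable M"
  shows "(\<lambda>x. dis n K \<mu> \<tau> (f x) i) \<in> borel_measurable M"
  unfolding dis_def seq_lse_def
  by (intro borel_measurable_diff borel_measurable_const measurable_metric_proj[OF K Kne]
      borel_measurable_add borel_measurable_times assms)

lemma measurable_seq_err:
  assumes "\<And>j. j < n \<Longrightarrow> (\<lambda>x. f x j) \<in> borel_measurable M"
  shows "(\<lambda>x. seq_err n K \<mu> \<tau> (f x)) \<in> borel_measurable M"
  unfolding seq_err_dis by (intro borel_measurable_power measurable_vnorm measurable_dis assms)

lemma measurable_seq_lrt:
  assumes "\<And>j. j < n \<Longrightarrow> (\<lambda>x. f x j) \<in> borel_measurable M"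
  shows "(\<lambda>x. seq_lrt n K \<mu> \<tau> (f x)) \<in> borel_measurable M"
  unfolding seq_lrt_dis
  by (intro borel_measurable_diff borel_measurable_power measurable_vnorm measurable_dis measurable_ip
      borel_measurable_times borel_measurable_const assms)

lemma vnorm_le_env: "vnorm n h \<le> env {..<n} h"
  unfolding vnorm_def env_def using L2_set_le_sum_abs[of h "{..<n}"] by linarith

lemma seq_err_le_env: "\<bar>seq_err n K \<mu> \<tau> h\<bar> \<le> \<tau>\<^sup>2 * env {..<n} h ^ 2"
proof -
  have "vnorm n (dis n K \<mu> \<tau> h) \<le> \<bar>\<tau>\<bar> * env {..<n} h"
    using dis_bound[of \<tau> h] mult_left_mono[OF vnorm_le_env[of h], of "\<bar>\<tau>\<bar>"] by linarith
  then have "(vnorm n (dis n K \<mu> \<tau> h))\<^sup>2 \<le> (\<bar>\<tau>\<bar> * env {..<n} h)\<^sup>2" by (intro power_mono) auto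
  then show ?thesis by (simp add: seq_err_dis power_mult_distrib)
qed

lemma seq_lrt_bounds: "0 \<le> seq_lrt n K \<mu> \<tau> h" "seq_lrt n K \<mu> \<tau> h \<le> \<tau>\<^sup>2 * env {..<n} h ^ 2"
proof -
  have z: "vnorm n (\<lambda>i. 0) = 0" using vnorm_scale[of n 0 h] by simp
  show "0 \<le> seq_lrt n K \<mu> \<tau> h"
    using dis_optimal'(2)[OF \<mu>, of "\<lambda>_. 0" \<tau> h] by (simp add: z ip_def)
  have "seq_lrt n K \<mu> \<tau> h \<le> (vnorm n (\<lambda>i. \<tau> * h i))\<^sup>2" by (simp add: seq_lrt_def)
  also have "\<dots> = \<tau>\<^sup>2 * (vnorm n h)\<^sup>2" by (simp add: vnorm_scale power_mult_distrib)
  also have "\<dots> \<le> \<tau>\<^sup>2 * env {..<n} h ^ 2" using vnorm_le_env[of h] by (intro mult_left_mono power_mono) auto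
  finally show "seq_lrt n K \<mu> \<tau> h \<le> \<tau>\<^sup>2 * env {..<n} h ^ 2" .
qed

lemma coord_meas: "j < n \<Longrightarrow> (\<lambda>h. h j) \<in> borel_measurable (gauss {..<n})"
  by (intro measurable_gauss_coord) simp

lemma integrable_seq_err: "integrable (gauss {..<n}) (seq_err n K \<mu> \<tau>)"
  by (rule integrable_gauss_bound[OF finite_lessThan measurable_seq_err[OF coord_meas] seq_err_le_env])

lemma integrable_seq_lrt: "integrable (gauss {..<n}) (seq_lrt n K \<mu> \<tau>)"
proof (rule integrable_gauss_bound[OF finite_lessThan measurable_seq_lrt[OF coord_meas]])
  show "\<bar>seq_lrt n K \<mu> \<tau> h\<bar> \<le> \<tau>\<^sup>2 * env {..<n} h ^ 2" for h
    using seq_lrt_bounds[of \<tau> h] by (simp only: abs_of_nonneg)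
qed

lemma integrable_seq_lrt2: "integrable (gauss {..<n}) (\<lambda>h. (seq_lrt n K \<mu> \<tau> h)\<^sup>2)"
proof (rule integrable_gauss_bound[OF finite_lessThan, where C = "\<tau>^4" and p = 4])
  show "(\<lambda>h. (seq_lrt n K \<mu> \<tau> h)\<^sup>2) \<in> borel_measurable (gauss {..<n})"
    by (intro borel_measurable_power measurable_seq_lrt coord_meas)
  have "(seq_lrt n K \<mu> \<tau> h)\<^sup>2 \<le> (\<tau>\<^sup>2 * env {..<n} h ^ 2)\<^sup>2" for h
    using seq_lrt_bounds by (intro power_mono) auto
  then show "\<bar>(seq_lrt n K \<mu> \<tau> h)\<^sup>2\<bar> \<le> \<tau>^4 * env {..<n} h ^ 4" for h
    by (simp add: power_mult_distrib power_mult[symmetric])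
qed

text \<open>Connects the zero-padded Gaussian law of the statement with the extensional product
  measure of the proof. The two differ only beyond coordinate \<open>n\<close>, which
  \<open>f\<close> does not see by \<open>loc\<close>.\<close>

lemma E_std_gaussian:
  fixes f :: "(nat \<Rightarrow> real) \<Rightarrow> real"
  assumes f: "\<And>(M :: (nat \<Rightarrow> real) measure) g. (\<And>j. j < n \<Longrightarrow> (\<lambda>x. g x j) \<in> borel_measurable M) \<Longrightarrow> (\<lambda>x. f (g x)) \<in> borel_measurable M"
    and loc: "\<And>h h'. (\<And>i. i < n \<Longrightarrow> h i = h' i) \<Longrightarrow> f h = f h'"
  shows "(\<integral>h. f h \<partial>std_gaussian n) = (\<integral>h. f h \<partial>gauss {..<n})"
proof -
  have m: "(\<lambda>h i. if i < n then h i else 0) \<in> gauss {..<n} \<rightarrow>\<^sub>M Pi\<^sub>M UNIV (\<lambda>_. borel)"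
  proof (rule measurable_PiM_single')
    show "(\<lambda>h. if i < n then h i else 0) \<in> borel_measurable (gauss {..<n})" for i
      using coord_meas by (cases "i < n") auto
  qed auto
  have fm: "f \<in> borel_measurable (Pi\<^sub>M UNIV (\<lambda>_. borel))"
    using f[where g = "\<lambda>x. x"] by simp
  have "(\<integral>h. f h \<partial>std_gaussian n) = (\<integral>h. f (\<lambda>i. if i < n then h i else 0) \<partial>gauss {..<n})"
    unfolding std_gaussian_def by (rule integral_distr[OF m fm])
  also have "\<dots> = (\<integral>h. f h \<partial>gauss {..<n})"
    by (intro Bochner_Integration.integral_cong refl loc) simp
  finally show ?thesis .
qed

lemma dis_cong: "(\<And>i. i < n \<Longrightarrow> h i = h' i) \<Longrightarrow> dis n K \<mu> \<tau> h = dis n K \<mu> \<tau> h'"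
  unfolding dis_def seq_lse_def by (subst metric_proj_cong[of n "\<lambda>i. \<mu> i + \<tau> * h i" "\<lambda>i. \<mu> i + \<tau> * h' i"]) auto

lemma seq_err_cong: "(\<And>i. i < n \<Longrightarrow> h i = h' i) \<Longrightarrow> seq_err n K \<mu> \<tau> h = seq_err n K \<mu> \<tau> h'"
  unfolding seq_err_dis using dis_cong[of h h'] by simp

lemma seq_lrt_cong: "(\<And>i. i < n \<Longrightarrow> h i = h' i) \<Longrightarrow> seq_lrt n K \<mu> \<tau> h = seq_lrt n K \<mu> \<tau> h'"
  unfolding seq_lrt_dis using dis_cong[of h h'] ip_cong[of n h h'] by simp

lemma E_err_gauss: "E_err n K \<mu> \<tau> = (\<integral>h. seq_err n K \<mu> \<tau> h \<partial>gauss {..<n})"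
  unfolding E_err_def by (rule E_std_gaussian[OF measurable_seq_err seq_err_cong])

lemma E_lrt_gauss: "E_lrt n K \<mu> \<tau> = (\<integral>h. seq_lrt n K \<mu> \<tau> h \<partial>gauss {..<n})"
  unfolding E_lrt_def by (rule E_std_gaussian[OF measurable_seq_lrt seq_lrt_cong])

section \<open>Variance bounds for \<open>seq_lrt\<close> and \<open>seq_err\<close>\<close>

lemma lin_ip: "lin {..<n} a h = ip n a h"
  by (simp add: lin_def ip_def)

lemma integrable_env_pair:
  "integrable (gauss {..<n} \<Otimes>\<^sub>M gauss {..<n}) (\<lambda>q. env {..<n} (fst q) ^ p * env {..<n} (snd q) ^ p')"
proof -
  interpret P: pair_prob_space "gauss {..<n}" "gauss {..<n}" by (rule pair_prob_space_gauss)
  note i = integrable_env_power[OF finite_lessThan]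
  have n: "norm (env {..<n} x ^ p * env {..<n} y ^ p') = env {..<n} x ^ p * env {..<n} y ^ p'" for x y
    using order_trans[OF zero_le_one env_ge1[of "{..<n}" x]] order_trans[OF zero_le_one env_ge1[of "{..<n}" y]] by simp
  show ?thesis
  proof (rule P.Fubini_integrable)
    show "(\<lambda>q. env {..<n} (fst q) ^ p * env {..<n} (snd q) ^ p') \<in> borel_measurable (gauss {..<n} \<Otimes>\<^sub>M gauss {..<n})"
      by (intro borel_measurable_times borel_measurable_power measurable_compose[OF measurable_fst measurable_env]
          measurable_compose[OF measurable_snd measurable_env])
    show "integrable (gauss {..<n}) (\<lambda>x. \<integral>y. norm (env {..<n} (fst (x, y)) ^ p * env {..<n} (snd (x, y)) ^ p') \<partial>gauss {..<n})"
      unfolding fst_conv snd_conv n using i by simp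
    show "AE x in gauss {..<n}. integrable (gauss {..<n}) (\<lambda>y. env {..<n} (fst (x, y)) ^ p * env {..<n} (snd (x, y)) ^ p')"
      using i by simp
  qed
qed

lemma integrable_pair_bound:
  fixes f :: "_ \<Rightarrow> real"
  assumes f: "f \<in> borel_measurable (gauss {..<n} \<Otimes>\<^sub>M gauss {..<n})"
    and le: "\<And>x y. \<bar>f (x, y)\<bar> \<le> C * (env {..<n} x ^ p * env {..<n} y ^ p')"
  shows "integrable (gauss {..<n} \<Otimes>\<^sub>M gauss {..<n}) f"
proof (rule Bochner_Integration.integrable_bound)
  show "integrable (gauss {..<n} \<Otimes>\<^sub>M gauss {..<n}) (\<lambda>q. C * (env {..<n} (fst q) ^ p * env {..<n} (snd q) ^ p'))"
    by (intro Bochner_Integration.integrable_mult_right integrable_env_pair)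
  show "AE q in gauss {..<n} \<Otimes>\<^sub>M gauss {..<n}. norm (f q) \<le> norm (C * (env {..<n} (fst q) ^ p * env {..<n} (snd q) ^ p'))"
    by (intro AE_I2) (metis le abs_ge_self order_trans prod.collapse real_norm_def)
qed fact

text \<open>To first order a rotation by \<open>\<delta>\<close> adds \<open>\<delta>\<close> times
  the independent copy, so the increment is close to
  \<open>2 * \<tau> * \<delta> * ip n h' (dis n K \<mu> \<tau> h)\<close>, with second moment
  \<open>4 * \<tau>\<^sup>2 * \<delta>\<^sup>2 * E_err n K \<mu> \<tau>\<close>. The inequality for
  the square of a sum is used twice, which raises 4 to 16; all other terms are of fourth order in
  \<open>\<delta>\<close>.\<close>

lemma lrt_step:
  assumes d: "0 \<le> \<delta>" "\<delta> \<le> 1"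
  shows "(\<integral>q. (seq_lrt n K \<mu> \<tau> (\<lambda>i. cos \<delta> * fst q i + sin \<delta> * snd q i) - seq_lrt n K \<mu> \<tau> (fst q))\<^sup>2 \<partial>(gauss {..<n} \<Otimes>\<^sub>M gauss {..<n}))
     \<le> 16 * \<tau>\<^sup>2 * \<delta>\<^sup>2 * E_err n K \<mu> \<tau> + \<delta>^4 * (132 * \<tau>^4 * (\<integral>q. env {..<n} (fst q) ^ 4 * env {..<n} (snd q) ^ 4 \<partial>(gauss {..<n} \<Otimes>\<^sub>M gauss {..<n})))"
proof -
  let ?g = "gauss {..<n}" and ?G = "gauss {..<n} \<Otimes>\<^sub>M gauss {..<n}"
  interpret P: pair_prob_space "?g" "?g" by (rule pair_prob_space_gauss)
  define T where "T = seq_lrt n K \<mu> \<tau>"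
  define w where "w = dis n K \<mu> \<tau>"
  define e where "e = env {..<n}"
  have e1: "1 \<le> e x" for x by (simp add: e_def env_ge1)
  have cf: "(\<lambda>q. fst q j) \<in> borel_measurable ?G" "(\<lambda>q. snd q j) \<in> borel_measurable ?G" if "j < n" for j
    by (rule measurable_compose[OF measurable_fst coord_meas[OF that]], rule measurable_compose[OF measurable_snd coord_meas[OF that]])
  define B where "B q = e (fst q) ^ 4 * e (snd q) ^ 4" for q
  have Bi: "integrable ?G B" unfolding B_def e_def by (rule integrable_env_pair)
  define Q where "Q q = (ip n (w (fst q)) (snd q))\<^sup>2" for q
  have vw: "vnorm n (w x) \<le> \<bar>\<tau>\<bar> * e x" for x
    using dis_bound[of \<tau> x] mult_left_mono[OF vnorm_le_env[of x], of "\<bar>\<tau>\<bar>"] by (simp add: w_def e_def)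
  have ve: "vnorm n x \<le> e x" for x by (simp add: vnorm_le_env e_def)
  have Qm: "Q \<in> borel_measurable ?G"
    unfolding Q_def w_def by (intro borel_measurable_power measurable_ip measurable_dis cf)
  have Qi: "integrable ?G Q"
  proof (rule integrable_pair_bound[OF Qm, where C = "\<tau>\<^sup>2" and p = 2 and p' = 2])
    fix x y
    have "\<bar>ip n (w x) y\<bar> \<le> (\<bar>\<tau>\<bar> * e x) * e y"
      using e1[of x] by (intro order_trans[OF ip_abs_le] mult_mono vw ve) auto
    then have "\<bar>ip n (w x) y\<bar>\<^sup>2 \<le> ((\<bar>\<tau>\<bar> * e x) * e y)\<^sup>2" by (intro power_mono) auto
    then show "\<bar>Q (x, y)\<bar> \<le> \<tau>\<^sup>2 * (env {..<n} x ^ 2 * env {..<n} y ^ 2)"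
      by (simp add: Q_def e_def power_mult_distrib mult.assoc)
  qed
  \<comment> \<open>For fixed first component the inner product is a centred Gaussian linear form in
    the second one, with variance \<open>seq_err\<close>.\<close>
  have QE: "(\<integral>q. Q q \<partial>?G) = E_err n K \<mu> \<tau>"
  proof -
    have "(\<integral>q. Q q \<partial>?G) = (\<integral>x. \<integral>y. Q (x, y) \<partial>?g \<partial>?g)" by (rule P.integral_fst'[symmetric, OF Qi])
    also have "\<dots> = (\<integral>x. seq_err n K \<mu> \<tau> x \<partial>?g)"
    proof (intro Bochner_Integration.integral_cong refl)
      fix x
      have "(\<integral>y. Q (x, y) \<partial>?g) = (\<integral>y. lin {..<n} (w x) y * lin {..<n} (w x) y \<partial>?g)"
        by (simp add: Q_def lin_ip power2_eq_square)
      also have "\<dots> = (\<Sum>i<n. w x i * w x i)" by (rule gauss_lin(4)) simp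
      finally show "(\<integral>y. Q (x, y) \<partial>?g) = seq_err n K \<mu> \<tau> x" by (simp add: seq_err_dis vnorm_sq ip_def w_def)
    qed
    finally show ?thesis by (simp add: E_err_gauss)
  qed
  have pt: "(T (\<lambda>i. cos \<delta> * fst q i + sin \<delta> * snd q i) - T (fst q))\<^sup>2 \<le> 16 * \<tau>\<^sup>2 * \<delta>\<^sup>2 * Q q + \<delta>^4 * (132 * \<tau>^4) * B q" for q
  proof -
    define x y where "x = fst q" and "y = snd q"
    define v where "v = (\<lambda>i. (cos \<delta> - 1) * x i + sin \<delta> * y i)"
    define X where "X = ip n v (w x)"
    define R where "R = T (\<lambda>i. x i + v i) - T x - 2 * \<tau> * X"
    have xv: "(\<lambda>i. cos \<delta> * x i + sin \<delta> * y i) = (\<lambda>i. x i + v i)" by (auto simp: v_def algebra_simps)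
    have c1: "\<bar>cos \<delta> - 1\<bar> \<le> \<delta>\<^sup>2 / 2"
    proof -
      have "cos \<delta> - 1 = - 2 * (sin (\<delta> / 2))\<^sup>2" using cos_double_sin[of "\<delta> / 2"] by simp
      moreover have "\<bar>sin (\<delta> / 2)\<bar>\<^sup>2 \<le> (\<delta> / 2)\<^sup>2"
        using abs_sin_x_le_abs_x[of "\<delta> / 2"] d by (intro power_mono) auto
      ultimately show ?thesis by (simp add: power_divide)
    qed
    have s1: "\<bar>sin \<delta>\<bar> \<le> \<delta>" using abs_sin_x_le_abs_x[of \<delta>] d by simp
    have d2: "\<delta>\<^sup>2 / 2 \<le> \<delta>" using mult_right_mono[OF d(2) d(1)] d(1) by (simp add: power2_eq_square)
    have "vnorm n v \<le> \<bar>cos \<delta> - 1\<bar> * vnorm n x + \<bar>sin \<delta>\<bar> * vnorm n y"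
      unfolding v_def using vnorm_triangle[of n "\<lambda>i. (cos \<delta> - 1) * x i" "\<lambda>i. sin \<delta> * y i"] by (simp add: vnorm_scale)
    also have "\<dots> \<le> \<delta> * e x + \<delta> * e y"
      using c1 d2 s1 d e1 by (intro add_mono mult_mono ve) auto
    also have "\<dots> \<le> \<delta> * (2 * (e x * e y))"
    proof -
      have "e x \<le> e x * e y" "e y \<le> e x * e y"
        using mult_left_mono[OF e1[of y], of "e x"] mult_right_mono[OF e1[of x], of "e y"] e1[of x] e1[of y] by auto
      then have "e x + e y \<le> 2 * (e x * e y)" by linarith
      from mult_left_mono[OF this d(1)] show ?thesis by (simp add: distrib_left)
    qed
    finally have "(vnorm n v)^4 \<le> (\<delta> * (2 * (e x * e y)))^4" by (intro power_mono) auto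
    then have v4: "(vnorm n v)^4 \<le> 16 * \<delta>^4 * B q" by (simp add: B_def x_def y_def power_mult_distrib)
    have R: "\<bar>R\<bar> \<le> 2 * \<tau>\<^sup>2 * (vnorm n v)\<^sup>2"
      using lrt_expand[of \<tau> x v] by (simp add: R_def T_def X_def w_def)
    have "R\<^sup>2 \<le> (2 * \<tau>\<^sup>2 * (vnorm n v)\<^sup>2)\<^sup>2" using power_mono[OF R, of 2] by simp
    also have "\<dots> = 4 * \<tau>^4 * (vnorm n v)^4" by (simp add: power_mult_distrib power_mult[symmetric])
    also have "\<dots> \<le> 4 * \<tau>^4 * (16 * \<delta>^4 * B q)" using v4 by (intro mult_left_mono) auto
    finally have R2: "R\<^sup>2 \<le> 64 * (\<tau>^4 * \<delta>^4 * B q)" by simp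
    define i1 i2 where "i1 = ip n x (w x)" and "i2 = ip n y (w x)"
    have Xe: "X = (cos \<delta> - 1) * i1 + sin \<delta> * i2" by (simp add: X_def v_def ip_simps i1_def i2_def)
    have sq2: "(a + b)\<^sup>2 \<le> 2 * a\<^sup>2 + 2 * b\<^sup>2" for a b :: real
      using zero_le_power2[of "a - b"] by (simp add: power2_eq_square algebra_simps)
    have i1b: "\<bar>i1\<bar> \<le> e x * (\<bar>\<tau>\<bar> * e x)"
      unfolding i1_def using e1[of x] by (intro order_trans[OF ip_abs_le] mult_mono ve vw) auto
    have "((cos \<delta> - 1) * i1)\<^sup>2 \<le> (\<delta>\<^sup>2 / 2 * (e x * (\<bar>\<tau>\<bar> * e x)))\<^sup>2"
    proof -
      have "\<bar>(cos \<delta> - 1) * i1\<bar> \<le> \<delta>\<^sup>2 / 2 * (e x * (\<bar>\<tau>\<bar> * e x))"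
        unfolding abs_mult by (intro mult_mono c1 i1b) auto
      from power_mono[OF this, of 2] show ?thesis by simp
    qed
    also have "\<dots> = \<delta>^4 / 4 * (\<tau>\<^sup>2 * e x ^ 4)" by (simp add: power_mult_distrib power_divide power_mult[symmetric] power2_eq_square eval_nat_numeral)
    also have "\<dots> \<le> \<delta>^4 / 4 * (\<tau>\<^sup>2 * B q)"
    proof -
      have "1 \<le> e y ^ 4" by (rule one_le_power[OF e1])
      then have "e x ^ 4 * 1 \<le> e x ^ 4 * e y ^ 4" by (intro mult_left_mono) auto
      then show ?thesis by (intro mult_left_mono) (auto simp: B_def x_def y_def)
    qed
    finally have a: "((cos \<delta> - 1) * i1)\<^sup>2 \<le> \<delta>^4 / 4 * (\<tau>\<^sup>2 * B q)" .
    have "(sin \<delta> * i2)\<^sup>2 = \<bar>sin \<delta>\<bar>\<^sup>2 * Q q" by (simp add: Q_def i2_def x_def y_def power_mult_distrib ip_commute)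
    also have "\<dots> \<le> \<delta>\<^sup>2 * Q q" using s1 by (intro mult_right_mono power_mono) (auto simp: Q_def)
    finally have b: "(sin \<delta> * i2)\<^sup>2 \<le> \<delta>\<^sup>2 * Q q" .
    have X2: "X\<^sup>2 \<le> \<delta>^4 / 2 * (\<tau>\<^sup>2 * B q) + 2 * (\<delta>\<^sup>2 * Q q)"
      unfolding Xe using sq2[of "(cos \<delta> - 1) * i1" "sin \<delta> * i2"] a b by linarith
    have "T (\<lambda>i. cos \<delta> * fst q i + sin \<delta> * snd q i) - T (fst q) = 2 * \<tau> * X + R"
      unfolding x_def[symmetric] y_def[symmetric] xv by (simp add: R_def)
    then have "(T (\<lambda>i. cos \<delta> * fst q i + sin \<delta> * snd q i) - T (fst q))\<^sup>2 \<le> 2 * (2 * \<tau> * X)\<^sup>2 + 2 * R\<^sup>2"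
      using sq2[of "2 * \<tau> * X" R] by simp
    also have "2 * (2 * \<tau> * X)\<^sup>2 = 8 * \<tau>\<^sup>2 * X\<^sup>2" by (simp add: power_mult_distrib)
    also have "8 * \<tau>\<^sup>2 * X\<^sup>2 + 2 * R\<^sup>2 \<le> 8 * \<tau>\<^sup>2 * (\<delta>^4 / 2 * (\<tau>\<^sup>2 * B q) + 2 * (\<delta>\<^sup>2 * Q q)) + 2 * (64 * (\<tau>^4 * \<delta>^4 * B q))"
      using X2 R2 by (intro add_mono mult_left_mono) auto
    \<comment> \<open>The constant 132 is 4, from the change in the cosine, plus 128, from the
      quadratic error \<open>R\<close>.\<close>
    also have "\<dots> = 16 * \<tau>\<^sup>2 * \<delta>\<^sup>2 * Q q + \<delta>^4 * (132 * \<tau>^4) * B q"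
      by (simp add: field_simps power2_eq_square eval_nat_numeral)
    finally show ?thesis .
  qed
  have Dm: "(\<lambda>q. (T (\<lambda>i. cos \<delta> * fst q i + sin \<delta> * snd q i) - T (fst q))\<^sup>2) \<in> borel_measurable ?G"
    unfolding T_def
    by (intro borel_measurable_power borel_measurable_diff measurable_seq_lrt borel_measurable_add borel_measurable_times borel_measurable_const cf)
  have Ri: "integrable ?G (\<lambda>q. 16 * \<tau>\<^sup>2 * \<delta>\<^sup>2 * Q q + \<delta>^4 * (132 * \<tau>^4) * B q)"
    by (intro Bochner_Integration.integrable_add Bochner_Integration.integrable_mult_right Qi Bi)
  have "(\<integral>q. (T (\<lambda>i. cos \<delta> * fst q i + sin \<delta> * snd q i) - T (fst q))\<^sup>2 \<partial>?G) \<le> (\<integral>q. 16 * \<tau>\<^sup>2 * \<delta>\<^sup>2 * Q q + \<delta>^4 * (132 * \<tau>^4) * B q \<partial>?G)"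
    by (intro integral_mono' Ri pt order_trans[OF zero_le_power2 pt])
  also have "\<dots> = 16 * \<tau>\<^sup>2 * \<delta>\<^sup>2 * E_err n K \<mu> \<tau> + \<delta>^4 * (132 * \<tau>^4 * (\<integral>q. B q \<partial>?G))"
    using Qi Bi by (simp add: QE)
  finally show ?thesis unfolding T_def B_def e_def .
qed

text \<open>Poincare inequality for the convex function \<open>seq_lrt\<close>: rotate the pair \<open>(h, h')\<close> by a right
  angle in \<open>N\<close> equal steps. All increments have the same second moment by rotation invariance, and
  each is linear in the step up to second order, so no derivative has to be taken.\<close>

lemma lrt_diff_sq:
  "(\<integral>q. (seq_lrt n K \<mu> \<tau> (snd q) - seq_lrt n K \<mu> \<tau> (fst q))\<^sup>2 \<partial>(gauss {..<n} \<Otimes>\<^sub>M gauss {..<n})) \<le> 40 * \<tau>\<^sup>2 * E_err n K \<mu> \<tau>"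
proof -
  let ?g = "gauss {..<n}" and ?G = "gauss {..<n} \<Otimes>\<^sub>M gauss {..<n}"
  interpret P: pair_prob_space "?g" "?g" by (rule pair_prob_space_gauss)
  define T where "T = seq_lrt n K \<mu> \<tau>"
  define V where "V = E_err n K \<mu> \<tau>"
  define B where "B = 132 * \<tau>^4 * (\<integral>q. env {..<n} (fst q) ^ 4 * env {..<n} (snd q) ^ 4 \<partial>?G)"
  have V0: "V \<ge> 0" unfolding V_def E_err_gauss by (intro Bochner_Integration.integral_nonneg) (simp add: seq_err_dis)
  have cf: "(\<lambda>q. fst q j) \<in> borel_measurable ?G" "(\<lambda>q. snd q j) \<in> borel_measurable ?G" if "j < n" for j
    by (rule measurable_compose[OF measurable_fst coord_meas[OF that]], rule measurable_compose[OF measurable_snd coord_meas[OF that]])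
  define H where "H a q = (\<lambda>i. cos a * fst q i + sin a * snd q i)" for a and q :: "(nat \<Rightarrow> real) \<times> (nat \<Rightarrow> real)"
  have Tm: "(\<lambda>q. T (H a q)) \<in> borel_measurable ?G" for a
    unfolding T_def H_def by (intro measurable_seq_lrt borel_measurable_add borel_measurable_times borel_measurable_const cf)
  have Hi: "integrable ?G (\<lambda>q. (T (H a q) - T (H b q))\<^sup>2)" for a b
  proof (rule integrable_pair_bound[where C = "16 * \<tau>^4" and p = 4 and p' = 4])
    show "(\<lambda>q. (T (H a q) - T (H b q))\<^sup>2) \<in> borel_measurable ?G"
      by (intro borel_measurable_power borel_measurable_diff Tm)
    fix x y
    define e where "e = env {..<n}"
    have e1: "1 \<le> e x" for x by (simp add: e_def env_ge1)
    have "\<bar>T (H a (x, y))\<bar> \<le> 4 * \<tau>\<^sup>2 * (e x * e y)\<^sup>2" for a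
    proof -
      have "T (H a (x, y)) \<le> (vnorm n (\<lambda>i. \<tau> * H a (x, y) i))\<^sup>2" by (simp add: T_def seq_lrt_def)
      also have "\<dots> = \<tau>\<^sup>2 * (vnorm n (H a (x, y)))\<^sup>2" by (simp add: vnorm_scale power_mult_distrib)
      also have "\<dots> \<le> \<tau>\<^sup>2 * (2 * (e x * e y))\<^sup>2"
      proof (intro mult_left_mono power_mono)
        have "vnorm n (H a (x, y)) \<le> \<bar>cos a\<bar> * vnorm n x + \<bar>sin a\<bar> * vnorm n y"
          unfolding H_def using vnorm_triangle[of n "\<lambda>i. cos a * x i" "\<lambda>i. sin a * y i"] by (simp add: vnorm_scale)
        also have "\<dots> \<le> 1 * e x + 1 * e y"
          using vnorm_le_env by (intro add_mono mult_mono) (auto simp: e_def)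
        also have "\<dots> \<le> 2 * (e x * e y)"
        proof -
          have "0 \<le> (e x - 1) * (e y - 1)" using e1[of x] e1[of y] by (intro mult_nonneg_nonneg) auto
          moreover have "1 * 1 \<le> e x * e y" using e1[of x] e1[of y] by (intro mult_mono) auto
          ultimately show ?thesis by (simp add: algebra_simps)
        qed
        finally show "vnorm n (H a (x, y)) \<le> 2 * (e x * e y)" .
      qed auto
      finally show ?thesis using seq_lrt_bounds(1)[of \<tau> "H a (x, y)"] by (simp add: T_def power_mult_distrib)
    qed
    moreover have "T (H a (x, y)) \<ge> 0" for a by (simp add: T_def seq_lrt_bounds)
    ultimately have "\<bar>T (H a (x, y)) - T (H b (x, y))\<bar> \<le> 4 * \<tau>\<^sup>2 * (e x * e y)\<^sup>2" by (smt (verit))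
    then have "\<bar>T (H a (x, y)) - T (H b (x, y))\<bar>\<^sup>2 \<le> (4 * \<tau>\<^sup>2 * (e x * e y)\<^sup>2)\<^sup>2" by (intro power_mono) auto
    then show "\<bar>(T (H a (x, y)) - T (H b (x, y)))\<^sup>2\<bar> \<le> 16 * \<tau>^4 * (env {..<n} x ^ 4 * env {..<n} y ^ 4)"
      by (simp add: power_mult_distrib power_mult[symmetric] e_def)
  qed
  \<comment> \<open>Rotating the pair by \<open>a\<close> preserves its joint law and turns the
    increment at angle 0 into the increment at angle \<open>a\<close>. All angles used lie below a
    right angle, so the cosine is positive.\<close>
  have rot: "(\<integral>q. (T (H (a + \<delta>) q) - T (H a q))\<^sup>2 \<partial>?G) = (\<integral>q. (T (H \<delta> q) - T (H 0 q))\<^sup>2 \<partial>?G)"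
    if a: "cos a > 0" for a \<delta>
  proof -
    let ?R = "\<lambda>p. (lc {..<n} (cos a) (sin a) (fst p) (snd p), lc {..<n} (- sin a) (cos a) (fst p) (snd p))"
    have Rm: "?R \<in> ?G \<rightarrow>\<^sub>M ?G" by (intro measurable_Pair measurable_lc) auto
    have "(\<integral>q. (T (H \<delta> q) - T (H 0 q))\<^sup>2 \<partial>?G) = (\<integral>q. (T (H \<delta> q) - T (H 0 q))\<^sup>2 \<partial>distr ?G ?G ?R)"
      by (subst gauss_rotation[OF finite_lessThan _ a]) auto
    also have "\<dots> = (\<integral>q. (T (H \<delta> (?R q)) - T (H 0 (?R q)))\<^sup>2 \<partial>?G)"
      by (rule integral_distr[OF Rm]) (intro borel_measurable_power borel_measurable_diff Tm)
    also have "\<dots> = (\<integral>q. (T (H (a + \<delta>) q) - T (H a q))\<^sup>2 \<partial>?G)"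
    proof -
      have "T (H \<delta> (?R q)) = T (H (a + \<delta>) q)" for \<delta> q
        unfolding T_def H_def
        by (rule seq_lrt_cong) (simp add: lc_def pw_def cos_add sin_add algebra_simps)
      from this[of \<delta>] this[of 0] show ?thesis by simp
    qed
    finally show ?thesis by simp
  qed
  \<comment> \<open>Cauchy-Schwarz over \<open>N\<close> increments yields
    \<open>16 * (real N * \<delta>)\<^sup>2\<close>, which is \<open>4 * pi\<^sup>2\<close> and
    hence below 40. The fourth-order terms sum to a multiple of \<open>1 / (real N)\<^sup>2\<close>
    and vanish in the limit.\<close>
  have bound: "(\<integral>q. (T (snd q) - T (fst q))\<^sup>2 \<partial>?G) \<le> 4 * pi\<^sup>2 * \<tau>\<^sup>2 * V + (pi / 2)^4 * B / (real N)\<^sup>2" if N: "N \<ge> 2" for N :: nat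
  proof -
    define \<delta> where "\<delta> = pi / (2 * real N)"
    have N0: "real N > 0" "real N \<ge> 2" using N by auto
    have d: "0 < \<delta>" "\<delta> \<le> 1" using N0 pi_less_4 by (auto simp: \<delta>_def pos_divide_le_eq)
    have Nd: "real N * \<delta> = pi / 2" using N0 by (simp add: \<delta>_def)
    have st: "(\<integral>q. (T (H (real k * \<delta> + \<delta>) q) - T (H (real k * \<delta>) q))\<^sup>2 \<partial>?G) \<le> 16 * \<tau>\<^sup>2 * \<delta>\<^sup>2 * V + \<delta>^4 * B" if k: "k < N" for k
    proof -
      have "real k * \<delta> < real N * \<delta>" using k d by (intro mult_strict_right_mono) auto
      then have "cos (real k * \<delta>) > 0" using Nd d by (intro cos_gt_zero_pi) (auto intro: order.strict_trans2[of _ 0])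
      from rot[OF this, of \<delta>] lrt_step[of \<delta> \<tau>] d show ?thesis by (simp add: T_def V_def B_def H_def)
    qed
    have "(\<integral>q. (T (snd q) - T (fst q))\<^sup>2 \<partial>?G) \<le> (\<integral>q. real N * (\<Sum>k<N. (T (H (real k * \<delta> + \<delta>) q) - T (H (real k * \<delta>) q))\<^sup>2) \<partial>?G)"
    proof (intro integral_mono' Bochner_Integration.integrable_mult_right Bochner_Integration.integrable_sum Hi)
      fix q
      have "T (snd q) - T (fst q) = T (H (real N * \<delta>) q) - T (H (real 0 * \<delta>) q)"
        unfolding Nd by (simp add: H_def)
      also have "\<dots> = (\<Sum>k<N. T (H (real (Suc k) * \<delta>) q) - T (H (real k * \<delta>) q))"
        by (rule sum_lessThan_telescope[symmetric])
      also have "\<dots> = (\<Sum>k<N. T (H (real k * \<delta> + \<delta>) q) - T (H (real k * \<delta>) q))"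
        by (intro sum.cong refl) (simp add: algebra_simps)
      finally have "T (snd q) - T (fst q) = (\<Sum>k<N. T (H (real k * \<delta> + \<delta>) q) - T (H (real k * \<delta>) q))" .
      then show "(T (snd q) - T (fst q))\<^sup>2 \<le> real N * (\<Sum>k<N. (T (H (real k * \<delta> + \<delta>) q) - T (H (real k * \<delta>) q))\<^sup>2)"
        using sum_squared_le_sum_of_squares[of "\<lambda>k. T (H (real k * \<delta> + \<delta>) q) - T (H (real k * \<delta>) q)" "{..<N}"]
        by (simp add: mult.commute)
    qed (auto intro!: mult_nonneg_nonneg sum_nonneg)
    also have "\<dots> = real N * (\<Sum>k<N. \<integral>q. (T (H (real k * \<delta> + \<delta>) q) - T (H (real k * \<delta>) q))\<^sup>2 \<partial>?G)"
      using Hi by simp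
    also have "\<dots> \<le> real N * (\<Sum>k<N. 16 * \<tau>\<^sup>2 * \<delta>\<^sup>2 * V + \<delta>^4 * B)"
      by (intro mult_left_mono sum_mono st) auto
    also have "\<dots> = 16 * \<tau>\<^sup>2 * (real N * \<delta>)\<^sup>2 * V + (real N * \<delta>)^4 * B / (real N)\<^sup>2"
      using N0 by (simp add: field_simps power2_eq_square eval_nat_numeral)
    finally show ?thesis unfolding Nd by (simp add: power_divide)
  qed
  have "(\<lambda>N. 4 * pi\<^sup>2 * \<tau>\<^sup>2 * V + (pi / 2)^4 * B / (real N)\<^sup>2) \<longlonglongrightarrow> 4 * pi\<^sup>2 * \<tau>\<^sup>2 * V + 0"
    by (intro tendsto_add tendsto_const tendsto_divide_0[OF tendsto_const] filterlim_at_top_imp_at_infinity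
        filterlim_pow_at_top filterlim_real_sequentially) simp
  then have "(\<integral>q. (T (snd q) - T (fst q))\<^sup>2 \<partial>?G) \<le> 4 * pi\<^sup>2 * \<tau>\<^sup>2 * V + 0"
    by (rule tendsto_lowerbound) (use bound in \<open>auto intro!: eventually_sequentiallyI[of 2]\<close>)
  also have "\<dots> \<le> 40 * \<tau>\<^sup>2 * V"
  proof -
    have "pi\<^sup>2 \<le> 3.15\<^sup>2" using pi_approx by (intro power_mono) auto
    then have "4 * pi\<^sup>2 \<le> 40" by (simp add: power2_eq_square)
    then have "4 * pi\<^sup>2 * (\<tau>\<^sup>2 * V) \<le> 40 * (\<tau>\<^sup>2 * V)" using V0 by (intro mult_right_mono) auto
    then show ?thesis by (simp add: mult.assoc)
  qed
  finally show ?thesis by (simp add: T_def V_def)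
qed

text \<open>The mean squared difference of two independent copies is twice the variance, so
  \<open>lrt_diff_sq\<close> feeds Chebyshev's inequality with 20.\<close>

lemma lrt_deviation:
  assumes t: "t > 0"
  shows "measure (gauss {..<n}) {h \<in> space (gauss {..<n}). \<bar>seq_lrt n K \<mu> \<tau> h - E_lrt n K \<mu> \<tau>\<bar> \<ge> t} \<le> 20 * \<tau>\<^sup>2 * E_err n K \<mu> \<tau> / t\<^sup>2"
proof -
  let ?g = "gauss {..<n}" and ?G = "gauss {..<n} \<Otimes>\<^sub>M gauss {..<n}"
  interpret prob_space ?g by (rule prob_space_gauss)
  interpret P: pair_prob_space "?g" "?g" by (rule pair_prob_space_gauss)
  define T where "T = seq_lrt n K \<mu> \<tau>"
  define a where "a = (\<integral>h. T h \<partial>?g)"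
  define b where "b = (\<integral>h. (T h)\<^sup>2 \<partial>?g)"
  have Ti: "integrable ?g T" "integrable ?g (\<lambda>h. (T h)\<^sup>2)" by (simp_all add: T_def integrable_seq_lrt integrable_seq_lrt2)
  have Tm: "T \<in> borel_measurable ?g" using Ti(1) by (rule borel_measurable_integrable)
  have TG: "integrable ?G (\<lambda>q. (T (snd q) - T (fst q))\<^sup>2)"
  proof (rule P.Fubini_integrable)
    show "(\<lambda>q. (T (snd q) - T (fst q))\<^sup>2) \<in> borel_measurable ?G"
      by (intro borel_measurable_power borel_measurable_diff measurable_compose[OF measurable_fst Tm] measurable_compose[OF measurable_snd Tm])
    have e: "(T y - T x)\<^sup>2 = (T y)\<^sup>2 - 2 * T x * T y + (T x)\<^sup>2" for x y by (simp add: power2_eq_square algebra_simps)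
    have nrm: "norm ((T y - T x)\<^sup>2) = (T y - T x)\<^sup>2" for x y by simp
    show "integrable ?g (\<lambda>x. \<integral>y. norm ((T (snd (x, y)) - T (fst (x, y)))\<^sup>2) \<partial>?g)"
      unfolding fst_conv snd_conv nrm unfolding e using Ti by simp
    show "AE x in ?g. integrable ?g (\<lambda>y. (T (snd (x, y)) - T (fst (x, y)))\<^sup>2)"
      using Ti by (simp add: e)
  qed
  have "(\<integral>q. (T (snd q) - T (fst q))\<^sup>2 \<partial>?G) = (\<integral>x. \<integral>y. (T y - T x)\<^sup>2 \<partial>?g \<partial>?g)"
    using P.integral_fst'[OF TG] by simp
  also have "\<dots> = (\<integral>x. b - 2 * a * T x + (T x)\<^sup>2 \<partial>?g)"
  proof (intro Bochner_Integration.integral_cong refl)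
    fix x
    have e: "(T y - T x)\<^sup>2 = (T y)\<^sup>2 - 2 * T x * T y + (T x)\<^sup>2" for y by (simp add: power2_eq_square algebra_simps)
    show "(\<integral>y. (T y - T x)\<^sup>2 \<partial>?g) = b - 2 * a * T x + (T x)\<^sup>2"
      unfolding e using Ti by (simp add: prob_space a_def b_def)
  qed
  also have "\<dots> = 2 * (b - a\<^sup>2)" using Ti by (simp add: prob_space a_def[symmetric] b_def[symmetric]) (simp add: power2_eq_square)
  also have "b - a\<^sup>2 = variance T" unfolding b_def a_def using variance_eq[OF Ti] by simp
  finally have var: "variance T \<le> 20 * \<tau>\<^sup>2 * E_err n K \<mu> \<tau>" using lrt_diff_sq[of \<tau>] unfolding T_def[symmetric] by linarith
  have "prob {h \<in> space ?g. \<bar>T h - a\<bar> \<ge> t} \<le> variance T / t\<^sup>2"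
    unfolding a_def by (rule Chebyshev_inequality[OF Tm Ti(2) t])
  also have "\<dots> \<le> 20 * \<tau>\<^sup>2 * E_err n K \<mu> \<tau> / t\<^sup>2" using var by (intro divide_right_mono) auto
  finally show ?thesis by (simp add: T_def a_def E_lrt_gauss)
qed

text \<open>\<open>seq_err\<close> inherits the concentration of \<open>seq_lrt\<close>, being squeezed between difference quotients
  of \<open>seq_lrt\<close> in the noise level.\<close>

lemma err_deviation:
  assumes t: "t > 0" and k: "\<kappa> > 0" "\<kappa> \<le> 1"
  shows "measure (gauss {..<n}) {h \<in> space (gauss {..<n}). \<bar>seq_err n K \<mu> \<tau> h - E_err n K \<mu> \<tau>\<bar> \<ge> \<kappa> * E_err n K \<mu> \<tau> + 4 * t / \<kappa>}
     \<le> 40 * \<tau>\<^sup>2 * E_err n K \<mu> \<tau> / t\<^sup>2"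
proof -
  let ?g = "gauss {..<n}"
  interpret prob_space ?g by (rule prob_space_gauss)
  define \<tau>' where "\<tau>' = \<tau> / (1 + \<kappa>)"
  define V T1 T2 E1 E2 where "V = E_err n K \<mu> \<tau>" and "T1 = seq_lrt n K \<mu> \<tau>" and "T2 = seq_lrt n K \<mu> \<tau>'"
    and "E1 = E_lrt n K \<mu> \<tau>" and "E2 = E_lrt n K \<mu> \<tau>'"
  define f where "f = seq_err n K \<mu> \<tau>"
  have V0: "V \<ge> 0" unfolding V_def E_err_gauss by (intro Bochner_Integration.integral_nonneg) (simp add: seq_err_dis)
  have fi: "integrable ?g f" unfolding f_def by (rule integrable_seq_err)
  have Ti: "integrable ?g T1" "integrable ?g T2" unfolding T1_def T2_def by (rule integrable_seq_lrt)+
  note sh = dis_shrink[OF k(1), where \<tau> = \<tau>, folded \<tau>'_def, folded T1_def T2_def f_def]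
  have V': "E_err n K \<mu> \<tau>' \<le> V"
    unfolding V_def E_err_gauss by (intro integral_mono integrable_seq_err) (use sh(3) in \<open>simp add: f_def\<close>)
  define ED where "ED = E1 - (1 + \<kappa>) * E2"
  have EDe: "ED = (\<integral>h. T1 h - (1 + \<kappa>) * T2 h \<partial>?g)"
    unfolding ED_def E1_def E2_def E_lrt_gauss T1_def[symmetric] T2_def[symmetric] using Ti by simp
  have Vf: "V = (\<integral>h. f h \<partial>?g)" by (simp add: V_def E_err_gauss f_def)
  have ED1: "ED \<le> \<kappa> * V"
  proof -
    have "ED \<le> (\<integral>h. \<kappa> * f h \<partial>?g)" unfolding EDe using Ti fi sh(2) by (intro integral_mono) auto
    then show ?thesis by (simp add: Vf)
  qed
  have ED2: "\<kappa> / (1 + \<kappa>) * V \<le> ED"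
  proof -
    have "(\<integral>h. \<kappa> / (1 + \<kappa>) * f h \<partial>?g) \<le> ED" unfolding EDe using Ti fi sh(1) by (intro integral_mono) auto
    moreover have "(\<integral>h. \<kappa> / (1 + \<kappa>) * f h \<partial>?g) = \<kappa> / (1 + \<kappa>) * V" unfolding Vf by (rule integral_mult_right_zero)
    ultimately show ?thesis by (simp only:)
  qed
  let ?S1 = "{h \<in> space ?g. \<bar>T1 h - E1\<bar> \<ge> t}" and ?S2 = "{h \<in> space ?g. \<bar>T2 h - E2\<bar> \<ge> t / (1 + \<kappa>)}"
  have Tm: "T1 \<in> borel_measurable ?g" "T2 \<in> borel_measurable ?g" using Ti by (auto intro: borel_measurable_integrable)
  have S: "?S1 \<in> events" "?S2 \<in> events" using Tm by measurable
  \<comment> \<open>Off \<open>?S1\<close> and \<open>?S2\<close> the drop \<open>D\<close> is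
    within \<open>2 * t\<close> of its mean \<open>ED\<close>. Dividing by \<open>\<kappa>\<close>,
    with \<open>1 + \<kappa> \<le> 2\<close>, gives \<open>4 * t / \<kappa>\<close>, and the
    mismatch of the slopes \<open>\<kappa>\<close> and \<open>\<kappa> / (1 + \<kappa>)\<close> in
    \<open>dis_shrink\<close> gives \<open>\<kappa> * V\<close>.\<close>
  have "{h \<in> space ?g. \<bar>f h - V\<bar> \<ge> \<kappa> * V + 4 * t / \<kappa>} \<subseteq> ?S1 \<union> ?S2"
  proof
    fix h assume h: "h \<in> {h \<in> space ?g. \<bar>f h - V\<bar> \<ge> \<kappa> * V + 4 * t / \<kappa>}"
    show "h \<in> ?S1 \<union> ?S2"
    proof (rule ccontr)
      assume "h \<notin> ?S1 \<union> ?S2"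
      then have c1: "\<bar>T1 h - E1\<bar> < t" and "\<bar>T2 h - E2\<bar> < t / (1 + \<kappa>)" using h by auto
      then have c2: "\<bar>(1 + \<kappa>) * T2 h - (1 + \<kappa>) * E2\<bar> < t"
      proof -
        have "\<bar>(1 + \<kappa>) * T2 h - (1 + \<kappa>) * E2\<bar> = (1 + \<kappa>) * \<bar>T2 h - E2\<bar>"
          unfolding right_diff_distrib[symmetric] abs_mult using k by simp
        then show ?thesis using k \<open>\<bar>T2 h - E2\<bar> < t / (1 + \<kappa>)\<close> by (simp add: pos_less_divide_eq mult.commute)
      qed
      define D where "D = T1 h - (1 + \<kappa>) * T2 h"
      have D: "\<bar>D - ED\<bar> < 2 * t" using c1 c2 unfolding D_def ED_def by linarith
      have s1: "\<kappa> / (1 + \<kappa>) * f h \<le> D" and s2: "D \<le> \<kappa> * f h" using sh(1,2) by (auto simp: D_def)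
      have up: "f h < V + (\<kappa> * V + 4 * t / \<kappa>)"
      proof -
        have "\<kappa> * f h \<le> (1 + \<kappa>) * D" using s1 k by (simp add: field_simps)
        also have "\<dots> < (1 + \<kappa>) * (\<kappa> * V + 2 * t)" using D ED1 k by (intro mult_strict_left_mono) auto
        also have "\<dots> \<le> (1 + \<kappa>) * (\<kappa> * V) + 2 * (2 * t)"
          unfolding distrib_left using k t by (intro add_left_mono mult_right_mono) auto
        also have "\<dots> = \<kappa> * (V + (\<kappa> * V + 4 * t / \<kappa>))" using k by (simp add: field_simps)
        finally show ?thesis using k by simp
      qed
      have lo: "V - (\<kappa> * V + 4 * t / \<kappa>) < f h"
      proof -
        have "V * (1 - \<kappa>) \<le> V / (1 + \<kappa>)"
        proof -
          have "V * (1 - \<kappa>) * (1 + \<kappa>) \<le> V"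
            using mult_nonneg_nonneg[OF V0 zero_le_power2[of \<kappa>]] by (simp add: algebra_simps power2_eq_square)
          then show ?thesis using k by (simp add: pos_le_divide_eq)
        qed
        then have "\<kappa> * (V * (1 - \<kappa>)) \<le> \<kappa> * (V / (1 + \<kappa>))" using k by (intro mult_left_mono) auto
        also have "\<dots> = \<kappa> / (1 + \<kappa>) * V" by simp
        also have "\<dots> < D + 2 * t" using ED2 D by linarith
        also have "\<dots> \<le> \<kappa> * f h + 4 * t" using s2 t by simp
        also have "\<dots> = \<kappa> * (f h + 4 * t / \<kappa>)" using k by (simp add: field_simps)
        finally have "V * (1 - \<kappa>) < f h + 4 * t / \<kappa>" using k by simp
        then show ?thesis by (simp add: algebra_simps)
      qed
      show False using h up lo by auto
    qed
  qed
  then have "prob {h \<in> space ?g. \<bar>f h - V\<bar> \<ge> \<kappa> * V + 4 * t / \<kappa>} \<le> prob (?S1 \<union> ?S2)"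
    using S by (intro finite_measure_mono) auto
  also have "\<dots> \<le> prob ?S1 + prob ?S2" using S by (intro measure_Un_le)
  also have "prob ?S1 \<le> 20 * \<tau>\<^sup>2 * V / t\<^sup>2" unfolding T1_def E1_def V_def by (rule lrt_deviation[OF t])
  also have "prob ?S2 \<le> 20 * \<tau>\<^sup>2 * V / t\<^sup>2"
  proof -
    have "prob ?S2 \<le> 20 * \<tau>'\<^sup>2 * E_err n K \<mu> \<tau>' / (t / (1 + \<kappa>))\<^sup>2"
      unfolding T2_def E2_def by (rule lrt_deviation) (use t k in auto)
    \<comment> \<open>The factors \<open>1 + \<kappa>\<close> in the noise level and in the
      threshold cancel.\<close>
    also have "\<dots> = 20 * \<tau>\<^sup>2 * E_err n K \<mu> \<tau>' / t\<^sup>2"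
      using k t by (simp add: \<tau>'_def power_divide)
    also have "\<dots> \<le> 20 * \<tau>\<^sup>2 * V / t\<^sup>2" using V' by (intro divide_right_mono mult_left_mono) auto
    finally show ?thesis .
  qed
  also have "20 * \<tau>\<^sup>2 * V / t\<^sup>2 + 20 * \<tau>\<^sup>2 * V / t\<^sup>2 = 40 * \<tau>\<^sup>2 * V / t\<^sup>2" by simp
  finally show ?thesis by (simp only: f_def V_def)
qed

end

section \<open>A weak law of large numbers\<close>

lemma PiM_second_moment:
  fixes \<nu> :: "real measure" and f g :: "real \<Rightarrow> real"
  assumes nu: "prob_space \<nu>" "sets \<nu> = sets borel" and I: "finite I" and ij: "i \<in> I" "j \<in> I" "i \<noteq> j"
    and fi: "integrable \<nu> f" and gi: "integrable \<nu> g"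
  shows "integrable (Pi\<^sub>M I (\<lambda>_. \<nu>)) (\<lambda>x. f (x i) * g (x j))"
    "(\<integral>x. f (x i) * g (x j) \<partial>Pi\<^sub>M I (\<lambda>_. \<nu>)) = (\<integral>x. f x \<partial>\<nu>) * (\<integral>x. g x \<partial>\<nu>)"
proof -
  interpret prob_space \<nu> by (rule nu)
  interpret product_sigma_finite "\<lambda>_. \<nu>"
    by (simp add: product_sigma_finite_def prob_space_imp_sigma_finite nu)
  define F where "F k x = (if k = i then f x else if k = j then g x else 1)" for k and x :: real
  have Fi: "integrable \<nu> (F k)" for k
    using fi gi by (cases "k = i"; cases "k = j") (auto simp: F_def[abs_def])
  have *: "f (x i) * g (x j) = (\<Prod>k\<in>I. F k (x k))" for x
  proof -
    have "(\<Prod>k\<in>I. F k (x k)) = (\<Prod>k\<in>{i, j}. F k (x k))"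
      by (rule prod.mono_neutral_right) (use I ij in \<open>auto simp: F_def\<close>)
    then show ?thesis using ij(3) by (simp add: F_def)
  qed
  show "integrable (Pi\<^sub>M I (\<lambda>_. \<nu>)) (\<lambda>x. f (x i) * g (x j))"
    unfolding * by (rule product_integrable_prod[OF I Fi])
  have "(\<integral>x. f (x i) * g (x j) \<partial>Pi\<^sub>M I (\<lambda>_. \<nu>)) = (\<Prod>k\<in>I. integral\<^sup>L \<nu> (F k))"
    unfolding * by (rule product_integral_prod[OF I Fi])
  also have "\<dots> = (\<Prod>k\<in>{i, j}. integral\<^sup>L \<nu> (F k))"
    by (rule prod.mono_neutral_right) (use I ij prob_space in \<open>auto simp: F_def[abs_def]\<close>)
  also have "\<dots> = (\<integral>x. f x \<partial>\<nu>) * (\<integral>x. g x \<partial>\<nu>)" using ij(3) by (simp add: F_def[abs_def])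
  finally show "(\<integral>x. f (x i) * g (x j) \<partial>Pi\<^sub>M I (\<lambda>_. \<nu>)) = (\<integral>x. f x \<partial>\<nu>) * (\<integral>x. g x \<partial>\<nu>)" .
qed

lemma PiM_coord_integral:
  fixes \<nu> :: "real measure" and f :: "real \<Rightarrow> real"
  assumes nu: "prob_space \<nu>" "sets \<nu> = sets borel" and i: "i \<in> I" and f: "f \<in> borel_measurable borel"
  shows "(\<integral>x. f (x i) \<partial>Pi\<^sub>M I (\<lambda>_. \<nu>)) = (\<integral>x. f x \<partial>\<nu>)"
    "integrable \<nu> f \<Longrightarrow> integrable (Pi\<^sub>M I (\<lambda>_. \<nu>)) (\<lambda>x. f (x i))"
proof -
  have m: "(\<lambda>x. x i) \<in> Pi\<^sub>M I (\<lambda>_. \<nu>) \<rightarrow>\<^sub>M \<nu>" using i by (rule measurable_component_singleton)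
  have fm: "f \<in> borel_measurable \<nu>" using f measurable_cong_sets[OF nu(2) refl] by blast
  have d: "distr (Pi\<^sub>M I (\<lambda>_. \<nu>)) \<nu> (\<lambda>x. x i) = \<nu>" using i nu(1) by (intro distr_PiM_component)
  show "(\<integral>x. f (x i) \<partial>Pi\<^sub>M I (\<lambda>_. \<nu>)) = (\<integral>x. f x \<partial>\<nu>)"
    using integral_distr[OF m fm] unfolding d by simp
  show "integrable \<nu> f \<Longrightarrow> integrable (Pi\<^sub>M I (\<lambda>_. \<nu>)) (\<lambda>x. f (x i))"
    using integrable_distr_eq[OF m fm] unfolding d by simp
qed

text \<open>After centring, the summands are bounded by \<open>2 * B\<close> and uncorrelated under
  the product measure, so Chebyshev applies with second moment \<open>4 * B\<^sup>2\<close>.\<close>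

lemma mean_bounded_deviation:
  fixes \<nu> :: "real measure" and f :: "real \<Rightarrow> real"
  assumes nu: "prob_space \<nu>" "sets \<nu> = sets borel" and f: "f \<in> borel_measurable borel"
    and B: "\<And>x. \<bar>f x\<bar> \<le> B" and k: "k > 0" and e: "e > 0"
  shows "measure (Pi\<^sub>M {..<k} (\<lambda>_. \<nu>)) {x \<in> space (Pi\<^sub>M {..<k} (\<lambda>_. \<nu>)).
     \<bar>(\<Sum>i<k. f (x i)) / real k - (\<integral>x. f x \<partial>\<nu>)\<bar> \<ge> e} \<le> 4 * B\<^sup>2 / (real k * e\<^sup>2)"
proof -
  let ?P = "Pi\<^sub>M {..<k} (\<lambda>_. \<nu>)"
  interpret N: prob_space \<nu> by (rule nu)
  interpret prob_space ?P by (intro prob_space_PiM nu)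
  have fm: "f \<in> borel_measurable \<nu>" using f measurable_cong_sets[OF nu(2) refl] by blast
  define c where "c = (\<integral>x. f x \<partial>\<nu>)"
  have fi: "integrable \<nu> f" by (rule N.integrable_const_bound[where B = B]) (use B fm in auto)
  have cB: "\<bar>c\<bar> \<le> B"
  proof -
    have "\<bar>c\<bar> \<le> (\<integral>x. \<bar>f x\<bar> \<partial>\<nu>)" unfolding c_def by (rule integral_abs_bound)
    also have "\<dots> \<le> (\<integral>x. B \<partial>\<nu>)" using fi B by (intro integral_mono) auto
    finally show ?thesis by (simp add: N.prob_space)
  qed
  define g where "g x = f x - c" for x
  have gm: "g \<in> borel_measurable borel" unfolding g_def using f by simp
  have gi: "integrable \<nu> g" unfolding g_def using fi by simp
  have g0: "(\<integral>x. g x \<partial>\<nu>) = 0" unfolding g_def using fi by (simp add: N.prob_space c_def)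
  have gB: "\<bar>g x\<bar> \<le> 2 * B" for x using B[of x] cB by (simp add: g_def)
  have B0: "B \<ge> 0" using B[of 0] by simp
  have gg: "g x * g x \<le> 4 * B\<^sup>2" for x
    using mult_mono[OF gB[of x] gB[of x]] B0 by (simp add: power2_eq_square abs_mult[symmetric])
  have ggi: "integrable \<nu> (\<lambda>x. g x * g x)"
    by (rule N.integrable_const_bound[where B = "4 * B\<^sup>2"]) (use gg gi in \<open>auto intro: borel_measurable_times borel_measurable_integrable\<close>)
  have ggE: "(\<integral>x. g x * g x \<partial>\<nu>) \<le> 4 * B\<^sup>2"
  proof -
    have "(\<integral>x. g x * g x \<partial>\<nu>) \<le> (\<integral>x. 4 * B\<^sup>2 \<partial>\<nu>)" using ggi gg by (intro integral_mono) auto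
    then show ?thesis by (simp add: N.prob_space)
  qed
  define S where "S x = (\<Sum>i<k. g (x i))" for x
  have gS: "(S x)\<^sup>2 = (\<Sum>i<k. \<Sum>j<k. g (x i) * g (x j))" for x by (simp add: S_def power2_eq_square sum_product)
  have ij: "integrable ?P (\<lambda>x. g (x i) * g (x j))" "(\<integral>x. g (x i) * g (x j) \<partial>?P) = (if i = j then (\<integral>x. g x * g x \<partial>\<nu>) else 0)"
    if "i < k" "j < k" for i j
  proof -
    have "integrable ?P (\<lambda>x. g (x i) * g (x j)) \<and> (\<integral>x. g (x i) * g (x j) \<partial>?P) = (if i = j then (\<integral>x. g x * g x \<partial>\<nu>) else 0)"
    proof (cases "i = j")
      case True
      have "(\<lambda>x. g x * g x) \<in> borel_measurable borel" by (intro borel_measurable_times gm)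
      from PiM_coord_integral[OF nu _ this, of i "{..<k}"] ggi that True show ?thesis by simp
    next
      case False
      have "i \<in> {..<k}" "j \<in> {..<k}" using that by auto
      from PiM_second_moment[OF nu finite_lessThan this False gi gi] g0 False show ?thesis by simp
    qed
    then show "integrable ?P (\<lambda>x. g (x i) * g (x j))" "(\<integral>x. g (x i) * g (x j) \<partial>?P) = (if i = j then (\<integral>x. g x * g x \<partial>\<nu>) else 0)"
      by blast+
  qed
  have Si: "integrable ?P (\<lambda>x. (S x)\<^sup>2)" unfolding gS by (intro Bochner_Integration.integrable_sum ij) auto
  have "(\<integral>x. (S x)\<^sup>2 \<partial>?P) = (\<Sum>i<k. \<Sum>j<k. \<integral>x. g (x i) * g (x j) \<partial>?P)"
  proof -
    have "(\<integral>x. (S x)\<^sup>2 \<partial>?P) = (\<Sum>i<k. \<integral>x. (\<Sum>j<k. g (x i) * g (x j)) \<partial>?P)"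
      unfolding gS by (intro Bochner_Integration.integral_sum Bochner_Integration.integrable_sum ij(1)) auto
    also have "\<dots> = (\<Sum>i<k. \<Sum>j<k. \<integral>x. g (x i) * g (x j) \<partial>?P)"
      by (intro sum.cong refl Bochner_Integration.integral_sum ij(1)) auto
    finally show ?thesis .
  qed
  also have "\<dots> = (\<Sum>i<k. \<Sum>j<k. if i = j then (\<integral>x. g x * g x \<partial>\<nu>) else 0)"
    by (intro sum.cong refl ij) auto
  also have "\<dots> = real k * (\<integral>x. g x * g x \<partial>\<nu>)" by simp
  also have "\<dots> \<le> real k * (4 * B\<^sup>2)" using ggE by (intro mult_left_mono) auto
  finally have SE: "(\<integral>x. (S x)\<^sup>2 \<partial>?P) \<le> real k * (4 * B\<^sup>2)" .
  have Sk: "(\<Sum>i<k. f (x i)) / real k - c = S x / real k" for x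
    using k by (simp add: S_def g_def sum_subtractf field_simps)
  have "prob {x \<in> space ?P. \<bar>(\<Sum>i<k. f (x i)) / real k - c\<bar> \<ge> e} = prob {x \<in> space ?P. (S x)\<^sup>2 \<ge> (real k * e)\<^sup>2}"
  proof -
    have "\<bar>(\<Sum>i<k. f (x i)) / real k - c\<bar> \<ge> e \<longleftrightarrow> (S x)\<^sup>2 \<ge> (real k * e)\<^sup>2" for x
      unfolding Sk abs_le_square_iff[symmetric] using k e by (simp add: abs_mult pos_le_divide_eq mult.commute)
    then show ?thesis by simp
  qed
  also have "\<dots> \<le> (\<integral>x. (S x)\<^sup>2 \<partial>?P) / (real k * e)\<^sup>2"
    by (rule integral_Markov_inequality_measure[OF Si sets.empty_sets]) (use k e in auto)
  also have "\<dots> \<le> real k * (4 * B\<^sup>2) / (real k * e)\<^sup>2" using SE by (intro divide_right_mono) auto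
  also have "\<dots> = 4 * B\<^sup>2 / (real k * e\<^sup>2)" using k by (simp add: power2_eq_square)
  finally show ?thesis by (simp add: c_def)
qed

text \<open>Only the second moment is assumed, so the squares are truncated before Chebyshev is applied.\<close>

lemma weak_law_squares:
  fixes \<nu> :: "real measure"
  assumes nu: "prob_space \<nu>" "sets \<nu> = sets borel" and sq: "integrable \<nu> (\<lambda>x. x\<^sup>2)" and e: "e > 0"
  shows "(\<lambda>k. measure (Pi\<^sub>M {..<k} (\<lambda>_. \<nu>)) {x \<in> space (Pi\<^sub>M {..<k} (\<lambda>_. \<nu>)).
     \<bar>(\<Sum>i<k. (x i)\<^sup>2) / real k - (\<integral>x. x\<^sup>2 \<partial>\<nu>)\<bar> \<ge> e}) \<longlonglongrightarrow> 0"
proof -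
  interpret N: prob_space \<nu> by (rule nu)
  define tr where "tr b x = min (x\<^sup>2) (real b)" for b :: nat and x :: real
  have trm: "tr b \<in> borel_measurable borel" for b unfolding tr_def by measurable
  have sm: "(\<lambda>x::real. x\<^sup>2) \<in> borel_measurable borel" by measurable
  have mc: "f \<in> borel_measurable borel \<Longrightarrow> f \<in> borel_measurable \<nu>" for f :: "real \<Rightarrow> real"
    using measurable_cong_sets[OF nu(2) refl] by blast
  have trB: "\<bar>tr b x\<bar> \<le> real b" "0 \<le> tr b x" "tr b x \<le> x\<^sup>2" for b x by (auto simp: tr_def)
  have tri: "integrable \<nu> (tr b)" for b
    by (rule N.integrable_const_bound[where B = "real b"]) (use trB mc[OF trm] in auto)
  have lim: "(\<lambda>b. \<integral>x. x\<^sup>2 - tr b x \<partial>\<nu>) \<longlonglongrightarrow> (\<integral>x. 0 \<partial>\<nu>)"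
  proof (rule integral_dominated_convergence[where w = "\<lambda>x. x\<^sup>2"])
    show "AE x in \<nu>. (\<lambda>b. x\<^sup>2 - tr b x) \<longlonglongrightarrow> 0"
    proof (rule AE_I2)
      fix x :: real
      obtain b0 :: nat where "x\<^sup>2 \<le> real b0" using real_arch_simple by blast
      then have "\<forall>\<^sub>F b in sequentially. x\<^sup>2 - tr b x = 0"
        by (intro eventually_sequentiallyI[of b0]) (auto simp: tr_def min_def intro: order_trans)
      then show "(\<lambda>b. x\<^sup>2 - tr b x) \<longlonglongrightarrow> 0" by (rule tendsto_eventually)
    qed
    show "AE x in \<nu>. norm (x\<^sup>2 - tr b x) \<le> x\<^sup>2" for b using trB(2,3)[of b] by (intro AE_I2) (simp add: abs_le_iff algebra_simps add_increasing)
    show "(\<lambda>x. x\<^sup>2 - tr b x) \<in> borel_measurable \<nu>" for b by (intro borel_measurable_diff mc sm trm)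
  qed (use sq in auto)
  show ?thesis
  proof (rule LIMSEQ_I)
    fix \<eta> :: real assume eta: "\<eta> > 0"
    \<comment> \<open>The first bound places the mean of the truncated part \<open>R\<close> below
      \<open>e / 3\<close>; the second makes its Markov bound at threshold \<open>e / 3\<close> at
      most \<open>\<eta> / 2\<close>.\<close>
    define d where "d = min (e / 3) (\<eta> * e / 6)"
    have d: "d > 0" using eta e by (simp add: d_def)
    obtain b where b: "\<bar>\<integral>x. x\<^sup>2 - tr b x \<partial>\<nu>\<bar> < d"
      using LIMSEQ_D[OF lim d] by auto
    define R where "R x = x\<^sup>2 - tr b x" for x
    have Rm: "R \<in> borel_measurable borel" unfolding R_def by (intro borel_measurable_diff sm trm)
    have Ri: "integrable \<nu> R" unfolding R_def using sq tri by simp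
    have R0: "R x \<ge> 0" for x using trB(3)[of b x] by (simp add: R_def)
    have RE: "(\<integral>x. R x \<partial>\<nu>) < d" using b by (simp add: R_def)
    have sqE: "(\<integral>x. x\<^sup>2 \<partial>\<nu>) = (\<integral>x. tr b x \<partial>\<nu>) + (\<integral>x. R x \<partial>\<nu>)" unfolding R_def using sq tri by simp
    obtain k0 :: nat where k0: "4 * (real b)\<^sup>2 / ((e/3)\<^sup>2 * (\<eta> / 2)) < real k0" using reals_Archimedean2 by blast
    have "norm (measure (Pi\<^sub>M {..<k} (\<lambda>_. \<nu>)) {x \<in> space (Pi\<^sub>M {..<k} (\<lambda>_. \<nu>)).
       \<bar>(\<Sum>i<k. (x i)\<^sup>2) / real k - (\<integral>x. x\<^sup>2 \<partial>\<nu>)\<bar> \<ge> e} - 0) < \<eta>" if k: "k \<ge> Suc k0" for k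
    proof -
      let ?P = "Pi\<^sub>M {..<k} (\<lambda>_. \<nu>)"
      have kp: "k > 0" using k by simp
      interpret prob_space ?P by (intro prob_space_PiM nu)
      have cm: "(\<lambda>x. f (x i)) \<in> borel_measurable ?P" if "i < k" "f \<in> borel_measurable borel" for i and f :: "real \<Rightarrow> real"
        using measurable_compose[OF measurable_component_singleton[of i "{..<k}" "\<lambda>_. \<nu>"] mc[OF that(2)]] that(1) by simp
      let ?A = "{x \<in> space ?P. \<bar>(\<Sum>i<k. tr b (x i)) / real k - (\<integral>x. tr b x \<partial>\<nu>)\<bar> \<ge> e/3}"
      let ?B = "{x \<in> space ?P. (\<Sum>i<k. R (x i)) / real k \<ge> e/3}"
      have SR: "integrable ?P (\<lambda>x. (\<Sum>i<k. R (x i)) / real k)"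
        by (intro integrable_divide Bochner_Integration.integrable_sum PiM_coord_integral(2)[OF nu]) (use Rm Ri in auto)
      have trs: "(\<lambda>x. (\<Sum>i<k. tr b (x i)) / real k) \<in> borel_measurable ?P"
      proof (intro borel_measurable_divide borel_measurable_sum borel_measurable_const)
        fix i assume "i \<in> {..<k}"
        then show "(\<lambda>x. tr b (x i)) \<in> borel_measurable ?P" by (intro cm trm) simp
      qed
      have AB: "?A \<in> events" "?B \<in> events"
        using trs borel_measurable_integrable[OF SR] by measurable
      have "{x \<in> space ?P. \<bar>(\<Sum>i<k. (x i)\<^sup>2) / real k - (\<integral>x. x\<^sup>2 \<partial>\<nu>)\<bar> \<ge> e} \<subseteq> ?A \<union> ?B"
      proof
        fix x assume x: "x \<in> {x \<in> space ?P. \<bar>(\<Sum>i<k. (x i)\<^sup>2) / real k - (\<integral>x. x\<^sup>2 \<partial>\<nu>)\<bar> \<ge> e}"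
        have s: "(\<Sum>i<k. (x i)\<^sup>2) / real k = (\<Sum>i<k. tr b (x i)) / real k + (\<Sum>i<k. R (x i)) / real k"
          by (simp add: R_def add_divide_distrib[symmetric] sum.distrib[symmetric])
        have r: "(\<Sum>i<k. R (x i)) / real k \<ge> 0" using R0 by (simp add: sum_nonneg)
        have RE0: "0 \<le> (\<integral>x. R x \<partial>\<nu>)" "(\<integral>x. R x \<partial>\<nu>) < e / 3" using R0 RE by (auto simp: d_def intro: Bochner_Integration.integral_nonneg)
        show "x \<in> ?A \<union> ?B"
        proof (rule ccontr)
          assume "x \<notin> ?A \<union> ?B"
          then have "\<bar>(\<Sum>i<k. tr b (x i)) / real k - (\<integral>x. tr b x \<partial>\<nu>)\<bar> < e/3" "(\<Sum>i<k. R (x i)) / real k < e/3"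
            using x by auto
          moreover have "\<bar>(\<Sum>i<k. (x i)\<^sup>2) / real k - (\<integral>x. x\<^sup>2 \<partial>\<nu>)\<bar> \<ge> e" using x by simp
          ultimately show False using r RE0 unfolding s sqE by linarith
        qed
      qed
      then have "prob {x \<in> space ?P. \<bar>(\<Sum>i<k. (x i)\<^sup>2) / real k - (\<integral>x. x\<^sup>2 \<partial>\<nu>)\<bar> \<ge> e} \<le> prob (?A \<union> ?B)"
        using AB by (intro finite_measure_mono) auto
      also have "\<dots> \<le> prob ?A + prob ?B" using AB by (intro measure_Un_le)
      also have "prob ?A \<le> 4 * (real b)\<^sup>2 / (real k * (e/3)\<^sup>2)"
        by (rule mean_bounded_deviation[OF nu trm trB(1) kp]) (use e in simp)
      also have "\<dots> < \<eta> / 2"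
      proof -
        have "4 * (real b)\<^sup>2 < real k0 * ((e/3)\<^sup>2 * (\<eta> / 2))" using k0 e eta by (simp add: pos_divide_less_eq)
        also have "\<dots> \<le> real k * ((e/3)\<^sup>2 * (\<eta> / 2))" using k e eta by (intro mult_right_mono) auto
        finally show ?thesis using kp e by (simp add: pos_divide_less_eq mult_ac)
      qed
      also have "prob ?B \<le> (\<integral>x. (\<Sum>i<k. R (x i)) / real k \<partial>?P) / (e/3)"
        by (rule integral_Markov_inequality_measure[OF SR sets.empty_sets]) (use R0 e in \<open>auto simp: sum_nonneg\<close>)
      also have "(\<integral>x. (\<Sum>i<k. R (x i)) / real k \<partial>?P) = (\<integral>x. R x \<partial>\<nu>)"
      proof -
        have "(\<integral>x. (\<Sum>i<k. R (x i)) \<partial>?P) = (\<Sum>i<k. \<integral>x. R (x i) \<partial>?P)"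
          by (intro Bochner_Integration.integral_sum PiM_coord_integral(2)[OF nu]) (use Rm Ri in auto)
        also have "\<dots> = real k * (\<integral>x. R x \<partial>\<nu>)" using PiM_coord_integral(1)[OF nu _ Rm, of _ "{..<k}"] by simp
        finally show ?thesis using kp by simp
      qed
      also have "(\<integral>x. R x \<partial>\<nu>) / (e/3) \<le> \<eta> / 2"
      proof -
        have "(\<integral>x. R x \<partial>\<nu>) \<le> \<eta> * e / 6" using RE by (simp add: d_def)
        then show ?thesis using e by (simp add: field_simps)
      qed
      finally show ?thesis by simp
    qed
    then show "\<exists>no. \<forall>k\<ge>no. norm (measure (Pi\<^sub>M {..<k} (\<lambda>_. \<nu>)) {x \<in> space (Pi\<^sub>M {..<k} (\<lambda>_. \<nu>)).
       \<bar>(\<Sum>i<k. (x i)\<^sup>2) / real k - (\<integral>x. x\<^sup>2 \<partial>\<nu>)\<bar> \<ge> e} - 0) < \<eta>" by blast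
  qed
qed

section \<open>The scalar auxiliary problem\<close>

lemma sqrt_diff_le:
  assumes "a \<ge> 0" "b \<ge> c\<^sup>2" "c > 0"
  shows "\<bar>sqrt a - sqrt b\<bar> \<le> \<bar>a - b\<bar> / c"
proof -
  have b: "b > 0" using assms by (meson less_le_trans zero_less_power)
  have sb: "c \<le> sqrt b" using assms by (intro real_le_rsqrt)
  have "(sqrt a - sqrt b) * (sqrt a + sqrt b) = a - b" using assms b by (simp add: algebra_simps)
  then have "\<bar>sqrt a - sqrt b\<bar> * \<bar>sqrt a + sqrt b\<bar> = \<bar>a - b\<bar>" by (metis abs_mult)
  moreover have "c \<le> \<bar>sqrt a + sqrt b\<bar>" using sb real_sqrt_ge_zero[OF assms(1)] by linarith
  ultimately have "\<bar>sqrt a - sqrt b\<bar> * c \<le> \<bar>a - b\<bar>" by (metis abs_ge_zero mult_left_mono)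
  then show ?thesis using assms by (simp add: pos_le_divide_eq)
qed

text \<open>The second derivative of \<open>q\<close> is \<open>v / q^3\<close>, which explains the
  constant. The proof is algebraic: multiplying by the conjugates \<open>a + b\<close> and
  \<open>s * b + r * a\<close> turns the gap into \<open>v * (s - r)\<^sup>2 * (s + r)\<close>, and
  the same factor \<open>s + r\<close> comes out of the bound for the multiplier.\<close>

lemma sqrt_tangent_gap:
  fixes q :: "real \<Rightarrow> real"
  assumes Q: "0 < v" "\<And>s. q s = sqrt (s\<^sup>2 + v)" and s: "s \<ge> 0" "r > 0" "q s \<le> Q" "q r \<le> Q"
  shows "q s - q r - r * (s - r) / q r \<ge> v * (s - r)\<^sup>2 / (2 * Q^3)"
proof -
  have qp: "q x > 0" for x using Q by (simp add: add_nonneg_pos)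
  have q2: "(q x)\<^sup>2 = x\<^sup>2 + v" for x using Q by simp
  define a b where "a = q s" and "b = q r"
  have a: "a > 0" "a\<^sup>2 = s\<^sup>2 + v" "a \<le> Q" and b: "b > 0" "b\<^sup>2 = r\<^sup>2 + v" "b \<le> Q"
    using qp q2 s by (auto simp: a_def b_def)
  have p1: "s * b + r * a > 0" using s a b by (simp add: add_nonneg_pos)
  have e1: "(s * b - r * a) * (s * b + r * a) = v * (s - r) * (s + r)"
  proof -
    have "(s * b - r * a) * (s * b + r * a) = s\<^sup>2 * b\<^sup>2 - r\<^sup>2 * a\<^sup>2" by (simp add: power2_eq_square algebra_simps)
    also have "\<dots> = v * (s - r) * (s + r)" unfolding a b by (simp add: power2_eq_square algebra_simps)
    finally show ?thesis .
  qed
  have e2: "(a - b) * (a + b) = (s - r) * (s + r)"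
  proof -
    have "(a - b) * (a + b) = a\<^sup>2 - b\<^sup>2" by (simp add: power2_eq_square algebra_simps)
    then show ?thesis unfolding a b by (simp add: power2_eq_square algebra_simps)
  qed
  have ab: "a + b > 0" using a b by simp
  have e3: "(a - b - r * (s - r) / b) * ((a + b) * b) = (s - r) * (s * b - r * a)"
  proof -
    have "(a - b - r * (s - r) / b) * ((a + b) * b) = ((a - b) * (a + b)) * b - r * (s - r) * (a + b)"
      using b by (simp add: field_simps)
    then show ?thesis unfolding e2 by (simp add: algebra_simps)
  qed
  define G where "G = a - b - r * (s - r) / b"
  have e4: "G * ((a + b) * b * (s * b + r * a)) = v * (s - r)\<^sup>2 * (s + r)"
  proof -
    have "G * ((a + b) * b * (s * b + r * a)) = (G * ((a + b) * b)) * (s * b + r * a)" by simp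
    also have "\<dots> = (s - r) * ((s * b - r * a) * (s * b + r * a))" unfolding G_def e3 by simp
    also have "\<dots> = v * (s - r)\<^sup>2 * (s + r)" unfolding e1 by (simp add: power2_eq_square)
    finally show ?thesis .
  qed
  have Qp: "Q > 0" using a by linarith
  have pos: "(a + b) * b * (s * b + r * a) > 0" using ab b p1 by simp
  have G0: "G \<ge> 0"
  proof (rule ccontr)
    assume "\<not> 0 \<le> G"
    then have "G * ((a + b) * b * (s * b + r * a)) < 0" using pos by (simp add: mult_neg_pos)
    moreover have "0 \<le> v * (s - r)\<^sup>2 * (s + r)" using Q s by simp
    ultimately show False unfolding e4 by simp
  qed
  have "(a + b) * b * (s * b + r * a) \<le> (Q + Q) * Q * (s * Q + r * Q)"
    using a b s Qp by (intro mult_mono add_mono mult_nonneg_nonneg add_nonneg_nonneg) auto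
  also have "\<dots> = 2 * Q^3 * (s + r)" by (simp add: power3_eq_cube algebra_simps)
  finally have "v * (s - r)\<^sup>2 * (s + r) \<le> G * (2 * Q^3 * (s + r))"
    unfolding e4[symmetric] using G0 by (intro mult_left_mono)
  then have "v * (s - r)\<^sup>2 \<le> G * (2 * Q^3)" using s by (simp add: mult.assoc[symmetric])
  then show ?thesis using Qp by (simp add: G_def a_def b_def pos_divide_le_eq)
qed

text \<open>Here \<open>b\<close> is the precision scale, \<open>s\<close> the normalized distance to \<open>\<mu>0\<close>, \<open>v\<close> the
  empirical noise variance, and \<open>p\<close>, \<open>l\<close>, \<open>G\<close>, \<open>x\<close> are the random quantities entering the decoupled
  problem; all their fluctuations are a small multiple \<open>k\<close> of the scale.\<close>

definition aux_good :: "real \<Rightarrow> real \<Rightarrow> real \<Rightarrow> real \<Rightarrow> real \<Rightarrow> real \<Rightarrow> real \<Rightarrow> real \<Rightarrow> real \<Rightarrow> real \<Rightarrow> bool" where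
  "aux_good k \<sigma> r b l0 v p l G x \<longleftrightarrow> \<bar>v - \<sigma>\<^sup>2\<bar> \<le> k \<and> p \<ge> 0 \<and> \<bar>p - r\<bar> \<le> k * b \<and> \<bar>l - l0\<bar> \<le> k * b\<^sup>2 \<and>
     \<bar>G - 1\<bar> \<le> k \<and> \<bar>x\<bar> \<le> k * b"

text \<open>The value of the scalar objective at \<open>s = r\<close> when the random inputs
  \<open>p\<close>, \<open>l\<close>, \<open>G\<close>, \<open>x\<close> take their limits
  \<open>r\<close>, \<open>l0\<close>, 1, 0. The empirical noise variance \<open>v\<close> is kept,
  so that the upper and the lower bound refer to the same random value.\<close>

definition aux_min :: "real \<Rightarrow> real \<Rightarrow> real \<Rightarrow> real \<Rightarrow> real" where
  "aux_min \<sigma> r l0 v = sqrt (r\<^sup>2 + v) - (l0 + r\<^sup>2) / (2 * sqrt (r\<^sup>2 + \<sigma>\<^sup>2))"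

text \<open>On the range \<open>s \<le> 3 * b\<close> an error \<open>k\<close> in \<open>G\<close>
  is multiplied by \<open>s\<^sup>2\<close> and an error \<open>k * b\<close> in \<open>x\<close> by
  \<open>s\<close>, so both count as multiples of \<open>k * b\<^sup>2\<close>. Since
  \<open>v \<ge> (\<sigma> / 2)\<^sup>2\<close>, taking the root preserves this order.\<close>

lemma aux_perturb:
  assumes sg: "\<sigma> > 0" and k: "0 < k" "k \<le> \<sigma>\<^sup>2 / 2" and good: "\<bar>v - \<sigma>\<^sup>2\<bar> \<le> k" "\<bar>G - 1\<bar> \<le> k" "\<bar>x\<bar> \<le> k * b"
    and s: "0 \<le> s" "s \<le> 3 * b" and n: "s\<^sup>2 * G - 2 * s * x + v \<ge> 0"
  shows "\<bar>sqrt (s\<^sup>2 * G - 2 * s * x + v) - sqrt (s\<^sup>2 + v)\<bar> \<le> 30 * k * b\<^sup>2 / \<sigma>"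
proof -
  have v: "v \<ge> (\<sigma> / 2)\<^sup>2" using good(1) k by (simp add: power2_eq_square abs_le_iff)
  have b0: "b \<ge> 0" using s by linarith
  have "\<bar>sqrt (s\<^sup>2 * G - 2 * s * x + v) - sqrt (s\<^sup>2 + v)\<bar> \<le> \<bar>(s\<^sup>2 * G - 2 * s * x + v) - (s\<^sup>2 + v)\<bar> / (\<sigma> / 2)"
    by (rule sqrt_diff_le[OF n add_increasing[OF zero_le_power2 v]]) (use sg in simp)
  also have "(s\<^sup>2 * G - 2 * s * x + v) - (s\<^sup>2 + v) = s\<^sup>2 * (G - 1) - 2 * (s * x)" by (simp add: algebra_simps)
  also have "\<bar>s\<^sup>2 * (G - 1) - 2 * (s * x)\<bar> \<le> 15 * k * b\<^sup>2"
  proof -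
    have "s\<^sup>2 \<le> (3 * b)\<^sup>2" using s by (intro power_mono) auto
    then have "\<bar>s\<^sup>2 * (G - 1)\<bar> \<le> (3 * b)\<^sup>2 * k" unfolding abs_mult using good k by (intro mult_mono) auto
    moreover have "\<bar>s * x\<bar> \<le> (3 * b) * (k * b)" unfolding abs_mult using s good b0 by (intro mult_mono) auto
    ultimately have "\<bar>s\<^sup>2 * (G - 1) - 2 * (s * x)\<bar> \<le> (3 * b)\<^sup>2 * k + 2 * ((3 * b) * (k * b))" by linarith
    then show ?thesis by (simp add: power2_eq_square algebra_simps)
  qed
  then have "\<bar>s\<^sup>2 * (G - 1) - 2 * (s * x)\<bar> / (\<sigma> / 2) \<le> 15 * k * b\<^sup>2 / (\<sigma> / 2)" using sg by (intro divide_right_mono) auto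
  finally show ?thesis by simp
qed

text \<open>At \<open>s = r\<close> the slope of the linear part is \<open>r / D\<close>, the
  derivative of the root at \<open>v = \<sigma>\<^sup>2\<close>. Strong convexity then gives a gap
  of \<open>16 * \<gamma> * b\<^sup>2\<close> at distance \<open>\<epsilon> * b\<close>. Replacing
  \<open>\<sigma>\<^sup>2\<close> by \<open>v\<close> in the slope costs at most half of it, and the
  other fluctuations at most \<open>\<gamma> * b\<^sup>2 / 2\<close>. Both \<open>\<gamma>\<close>
  and \<open>k\<close> depend only on \<open>\<sigma>\<close>, \<open>M\<close> and
  \<open>\<epsilon>\<close>, hence serve all large \<open>n\<close>.\<close>

lemma aux_separation:
  fixes \<sigma> M \<epsilon> :: real
  assumes sg: "\<sigma> > 0" and M: "M > 0" and eps: "0 < \<epsilon>" "\<epsilon> \<le> 1"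
  shows "\<exists>\<gamma>>0. \<exists>k>0. k \<le> \<epsilon> \<and> (\<forall>r b l0 v p l G x. 0 < r \<and> r \<le> b \<and> b \<le> M \<and> aux_good k \<sigma> r b l0 v p l G x \<longrightarrow>
     (\<forall>s. 0 \<le> s \<and> s \<le> r + \<epsilon> * b \<and> \<bar>s - r\<bar> \<ge> \<epsilon> * b \<and> s\<^sup>2 * G - 2 * s * x + v \<ge> 0 \<longrightarrow>
        aux_min \<sigma> r l0 v + 4 * \<gamma> * b\<^sup>2 \<le> sqrt (s\<^sup>2 * G - 2 * s * x + v) - (l + 2 * s * p - p\<^sup>2) / (2 * sqrt (r\<^sup>2 + \<sigma>\<^sup>2))) \<and>
     (p\<^sup>2 * G - 2 * p * x + v \<ge> 0 \<longrightarrow>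
        sqrt (p\<^sup>2 * G - 2 * p * x + v) - (l + p\<^sup>2) / (2 * sqrt (r\<^sup>2 + \<sigma>\<^sup>2)) \<le> aux_min \<sigma> r l0 v + \<gamma> * b\<^sup>2))"
proof -
  \<comment> \<open>\<open>Q\<close> bounds the root \<open>q\<close> on the range up to
    \<open>2 * b\<close>, and \<open>c\<close> is \<open>v / (2 * Q^3)\<close> with \<open>v\<close>
    replaced by its lower bound \<open>\<sigma>\<^sup>2 / 2\<close>.\<close>
  define Q where "Q = 2 * M + 2 * \<sigma>"
  define c where "c = \<sigma>\<^sup>2 / (4 * Q^3)"
  define \<gamma> where "\<gamma> = c * \<epsilon>\<^sup>2 / 16"
  \<comment> \<open>The bound \<open>\<sigma>\<^sup>2 / 2\<close> keeps \<open>v\<close> comparable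
    to \<open>\<sigma>\<^sup>2\<close>. The third entry bounds the perturbations of the root and of
    the linear part (\<open>k2\<close>), the last one the change of slope
    (\<open>k3\<close>).\<close>
  define k where "k = min (min \<epsilon> (\<sigma>\<^sup>2 / 2)) (min (\<gamma> / (60 / \<sigma> + 8 / \<sigma>)) (\<gamma> * \<sigma>^3 / 8))"
  have Qp: "Q > 0" using sg M by (simp add: Q_def)
  have cp: "c > 0" using sg Qp by (simp add: c_def)
  have gp: "\<gamma> > 0" using cp eps by (simp add: \<gamma>_def)
  have den: "60 / \<sigma> + 8 / \<sigma> > 0" using sg by (simp add: add_pos_pos)
  have kp: "k > 0" using sg gp den eps by (simp add: k_def)
  have k1: "k \<le> 1" "k \<le> \<sigma>\<^sup>2 / 2" "k \<le> \<epsilon>" using eps by (auto simp: k_def)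
  have k2: "30 * k / \<sigma> + 4 * k / \<sigma> \<le> \<gamma> / 2"
  proof -
    have "k * (60 / \<sigma> + 8 / \<sigma>) \<le> \<gamma>" using den by (subst pos_le_divide_eq[symmetric]) (auto simp: k_def)
    then show ?thesis by (simp add: field_simps)
  qed
  have k3: "k / \<sigma>^3 \<le> \<gamma> / 8"
  proof -
    have "k \<le> \<gamma> * \<sigma>^3 / 8" by (simp add: k_def)
    then show ?thesis using sg by (simp add: field_simps)
  qed
  show ?thesis
  proof (rule exI[of _ \<gamma>], intro conjI, rule gp, rule exI[of _ k], intro conjI allI impI)
    fix r b l0 v p l G x :: real
    assume "0 < r \<and> r \<le> b \<and> b \<le> M \<and> aux_good k \<sigma> r b l0 v p l G x"
    then have r: "0 < r" "r \<le> b" and b: "b \<le> M" "0 < b" and v: "\<bar>v - \<sigma>\<^sup>2\<bar> \<le> k" and p: "p \<ge> 0" "\<bar>p - r\<bar> \<le> k * b"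
      and l: "\<bar>l - l0\<bar> \<le> k * b\<^sup>2" and G: "\<bar>G - 1\<bar> \<le> k" and x: "\<bar>x\<bar> \<le> k * b"
      by (auto simp: aux_good_def)
    define D where "D = sqrt (r\<^sup>2 + \<sigma>\<^sup>2)"
    define q where "q s = sqrt (s\<^sup>2 + v)" for s
    have D: "\<sigma> \<le> D" unfolding D_def using sg by (intro real_le_rsqrt) simp
    then have D0: "D > 0" using sg by linarith
    have v0: "\<sigma>\<^sup>2 / 2 \<le> v" "v \<le> 2 * \<sigma>\<^sup>2" "v > 0"
      using v k1 sg zero_less_power[OF sg, of 2] unfolding abs_le_iff by linarith+
    have v4: "v \<ge> (\<sigma> / 2)\<^sup>2" using v0 by (simp add: power_divide)
    have kb: "k * b \<le> b" using mult_right_mono[OF k1(1), of b] b by simp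
    have p2: "p \<le> 2 * b" using p kb r by linarith
    have e6: "D1 / (2 * D) \<le> D2 / (2 * \<sigma>)" if "D1 \<le> D2" "0 \<le> D2" for D1 D2 :: real
    proof -
      have "D1 / (2 * D) \<le> D2 / (2 * D)" using that D0 by (intro divide_right_mono) auto
      also have "\<dots> \<le> D2 / (2 * \<sigma>)" using that D sg by (intro divide_left_mono) auto
      finally show ?thesis .
    qed
    have bb: "b\<^sup>2 > 0" using b by simp
    have kb2: "k * b * b = k * b\<^sup>2" by (simp add: power2_eq_square)
    {
      fix s assume "0 \<le> s \<and> s \<le> r + \<epsilon> * b \<and> \<bar>s - r\<bar> \<ge> \<epsilon> * b \<and> s\<^sup>2 * G - 2 * s * x + v \<ge> 0"
      then have s: "0 \<le> s" "s \<le> r + \<epsilon> * b" "\<bar>s - r\<bar> \<ge> \<epsilon> * b" "s\<^sup>2 * G - 2 * s * x + v \<ge> 0" by auto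
      have s2: "s \<le> 2 * b" using s(2) r mult_left_le_one_le[of b \<epsilon>] eps b by linarith
      have P: "sqrt (s\<^sup>2 + v) - 30 * k * b\<^sup>2 / \<sigma> \<le> sqrt (s\<^sup>2 * G - 2 * s * x + v)"
        using aux_perturb[OF sg kp k1(2) v G x s(1) _ s(4)] s2 b unfolding abs_le_iff by linarith
      have q0: "q y \<le> Q" if "0 \<le> y" "y \<le> 2 * b" for y
      proof -
        have "y\<^sup>2 \<le> (2 * M)\<^sup>2" using that b by (intro power_mono) auto
        then have "y\<^sup>2 + v \<le> Q\<^sup>2"
        proof -
          have "Q\<^sup>2 = (2 * M)\<^sup>2 + 8 * M * \<sigma> + 4 * \<sigma>\<^sup>2" by (simp add: Q_def power2_eq_square algebra_simps)
          moreover have "0 \<le> 8 * M * \<sigma>" using M sg by simp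
          ultimately show ?thesis using \<open>y\<^sup>2 \<le> (2 * M)\<^sup>2\<close> v0 zero_le_power2[of \<sigma>] by linarith
        qed
        then show ?thesis unfolding q_def using Qp by (intro real_le_lsqrt) (auto simp: v0 less_imp_le)
      qed
      have gap: "v * (s - r)\<^sup>2 / (2 * Q^3) \<le> q s - q r - r * (s - r) / q r"
        by (rule sqrt_tangent_gap) (use v0 q0 s s2 r b in \<open>auto simp: q_def\<close>)
      have "16 * \<gamma> * b\<^sup>2 = c * (\<epsilon> * b)\<^sup>2" by (simp add: \<gamma>_def power_mult_distrib)
      also have "\<dots> \<le> c * (s - r)\<^sup>2" 
        using s(3) eps b cp by (intro mult_left_mono) (auto simp: abs_le_square_iff[symmetric])
      also have "\<dots> \<le> v * (s - r)\<^sup>2 / (2 * Q^3)"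
      proof -
        have "(\<sigma>\<^sup>2 / 2) * (s - r)\<^sup>2 / (2 * Q^3) \<le> v * (s - r)\<^sup>2 / (2 * Q^3)"
          using v0 Qp by (intro divide_right_mono mult_right_mono) auto
        then show ?thesis by (simp add: c_def)
      qed
      also note gap
      finally have g1: "16 * \<gamma> * b\<^sup>2 \<le> q s - q r - r * (s - r) / q r" .
      have g2: "\<bar>r * (s - r) / q r - r * (s - r) / D\<bar> \<le> 8 * \<gamma> * b\<^sup>2"
      proof -
        have qr: "\<sigma> / 2 \<le> q r" unfolding q_def using v4 by (intro real_le_rsqrt) (simp add: add_increasing)
        have q0: "q r > 0" using qr sg by linarith
        have "\<bar>D - q r\<bar> \<le> \<bar>(r\<^sup>2 + \<sigma>\<^sup>2) - (r\<^sup>2 + v)\<bar> / (\<sigma> / 2)"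
          unfolding D_def q_def using v4 sg by (intro sqrt_diff_le) (auto simp: add_increasing)
        also have "\<dots> \<le> k / (\<sigma> / 2)" using v sg by (intro divide_right_mono) (auto simp: abs_minus_commute)
        finally have Dq: "\<bar>D - q r\<bar> \<le> 2 * k / \<sigma>" by (simp add: mult.commute)
        have "r * (s - r) / q r - r * (s - r) / D = r * (s - r) * (D - q r) / (q r * D)"
          using q0 D0 by (simp add: field_simps)
        also have "\<bar>\<dots>\<bar> = r * \<bar>s - r\<bar> * \<bar>D - q r\<bar> / (q r * D)" using r q0 D0 by (simp add: abs_mult)
        also have "\<dots> \<le> b * (2 * b) * (2 * k / \<sigma>) / (\<sigma> / 2 * \<sigma>)"
          using r b s s2 Dq qr D sg kp q0 D0 by (intro frac_le mult_mono mult_nonneg_nonneg) (auto simp: abs_le_iff)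
        also have "\<dots> = 8 * (k / \<sigma>^3) * b\<^sup>2" using sg by (simp add: field_simps power2_eq_square power3_eq_cube)
        also have "\<dots> \<le> 8 * (\<gamma> / 8) * b\<^sup>2" using k3 by (intro mult_right_mono mult_left_mono) auto
        also have "\<dots> \<le> 8 * \<gamma> * b\<^sup>2" using gp by (intro mult_right_mono) auto
        finally show ?thesis .
      qed
      \<comment> \<open>The numerator is concave in \<open>p\<close> with maximum at
        \<open>s\<close>, not at \<open>r\<close>, so replacing \<open>p\<close> by \<open>r\<close>
        costs the product of \<open>p - r\<close> and a factor of order \<open>b\<close>.\<close>
      have g3: "(l + 2 * s * p - p\<^sup>2) / (2 * D) \<le> (l0 + 2 * s * r - r\<^sup>2) / (2 * D) + 4 * k * b\<^sup>2 / \<sigma>"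
      proof -
        have pb: "\<bar>p - r\<bar> \<le> k * b" "\<bar>2 * s - p - r\<bar> \<le> 7 * b" using p s s2 p2 r b by linarith+
        have "\<bar>(p - r) * (2 * s - p - r)\<bar> \<le> (k * b) * (7 * b)"
          unfolding abs_mult using kp b by (intro mult_mono pb) auto
        also have "\<dots> = 7 * (k * b\<^sup>2)" by (simp add: power2_eq_square)
        finally have "(p - r) * (2 * s - p - r) \<le> 7 * (k * b\<^sup>2)" by linarith
        moreover have "(l + 2 * s * p - p\<^sup>2) - (l0 + 2 * s * r - r\<^sup>2) = (l - l0) + (p - r) * (2 * s - p - r)"
          by (simp add: power2_eq_square algebra_simps)
        ultimately have "(l + 2 * s * p - p\<^sup>2) - (l0 + 2 * s * r - r\<^sup>2) \<le> 8 * (k * b\<^sup>2)" using l by linarith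
        from e6[OF this] kp have "((l + 2 * s * p - p\<^sup>2) - (l0 + 2 * s * r - r\<^sup>2)) / (2 * D) \<le> 8 * (k * b\<^sup>2) / (2 * \<sigma>)" by simp
        then show ?thesis by (simp add: diff_divide_distrib)
      qed
      have k2b: "30 * k * b\<^sup>2 / \<sigma> + 4 * k * b\<^sup>2 / \<sigma> \<le> \<gamma> / 2 * b\<^sup>2"
        using mult_right_mono[OF k2, of "b\<^sup>2"] by (simp add: distrib_right)
      have lin: "(l0 + 2 * s * r - r\<^sup>2) / (2 * D) = (l0 + r\<^sup>2) / (2 * D) + r * (s - r) / D"
        using D0 by (simp add: field_simps power2_eq_square)
      have arith: "qr - L0 + 4 * e \<le> S - L" if "q0 - A \<le> S" "16 * e \<le> q0 - qr - R1" "R2 - R1 \<le> 8 * e"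
        "L \<le> L0 + R2 + B" "A + B \<le> 1 / 2 * e" "0 \<le> e" for q0 qr A B S R1 R2 L L0 e :: real
        using that by linarith
      have "q r - (l0 + r\<^sup>2) / (2 * D) + 4 * (\<gamma> * b\<^sup>2) \<le> sqrt (s\<^sup>2 * G - 2 * s * x + v) - (l + 2 * s * p - p\<^sup>2) / (2 * D)"
      proof (rule arith)
        show "q s - 30 * k * b\<^sup>2 / \<sigma> \<le> sqrt (s\<^sup>2 * G - 2 * s * x + v)" using P by (simp only: q_def)
        show "16 * (\<gamma> * b\<^sup>2) \<le> q s - q r - r * (s - r) / q r" using g1 by (simp only: mult.assoc)
        show "r * (s - r) / D - r * (s - r) / q r \<le> 8 * (\<gamma> * b\<^sup>2)" using abs_le_D2[OF g2] by (simp only: mult.assoc minus_diff_eq)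
        show "(l + 2 * s * p - p\<^sup>2) / (2 * D) \<le> (l0 + r\<^sup>2) / (2 * D) + r * (s - r) / D + 4 * k * b\<^sup>2 / \<sigma>" using g3 by (simp only: lin)
        show "30 * k * b\<^sup>2 / \<sigma> + 4 * k * b\<^sup>2 / \<sigma> \<le> 1 / 2 * (\<gamma> * b\<^sup>2)" using k2b by simp
        show "0 \<le> \<gamma> * b\<^sup>2" using gp bb by simp
      qed
      then show "aux_min \<sigma> r l0 v + 4 * \<gamma> * b\<^sup>2 \<le> sqrt (s\<^sup>2 * G - 2 * s * x + v) - (l + 2 * s * p - p\<^sup>2) / (2 * sqrt (r\<^sup>2 + \<sigma>\<^sup>2))"
        unfolding aux_min_def q_def D_def mult.assoc .
    }
    {
      assume n: "p\<^sup>2 * G - 2 * p * x + v \<ge> 0"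
      have P: "sqrt (p\<^sup>2 * G - 2 * p * x + v) \<le> q p + 30 * k * b\<^sup>2 / \<sigma>"
        using aux_perturb[OF sg kp k1(2) v G x p(1) _ n] p2 b unfolding abs_le_iff q_def by linarith
      have pr: "\<bar>p\<^sup>2 - r\<^sup>2\<bar> \<le> 3 * (k * b\<^sup>2)"
      proof -
        have "\<bar>(p - r) * (p + r)\<bar> \<le> (k * b) * (3 * b)"
          unfolding abs_mult using p p2 r b by (intro mult_mono) auto
        then show ?thesis by (simp add: power2_eq_square algebra_simps)
      qed
      have "\<bar>q p - q r\<bar> \<le> \<bar>(p\<^sup>2 + v) - (r\<^sup>2 + v)\<bar> / (\<sigma> / 2)"
        unfolding q_def using v4 v0 sg by (intro sqrt_diff_le) (auto simp: add_increasing less_imp_le)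
      also have "\<dots> \<le> 3 * (k * b\<^sup>2) / (\<sigma> / 2)" using pr sg by (intro divide_right_mono) auto
      finally have "q p - q r \<le> 3 * (k * b\<^sup>2) / (\<sigma> / 2)" by linarith
      then have q1: "q p \<le> q r + 6 * k * b\<^sup>2 / \<sigma>" by simp
      have "(l0 + r\<^sup>2) - (l + p\<^sup>2) \<le> 4 * (k * b\<^sup>2)" using l pr by linarith
      from e6[OF this] kp have "((l0 + r\<^sup>2) - (l + p\<^sup>2)) / (2 * D) \<le> 4 * (k * b\<^sup>2) / (2 * \<sigma>)" by simp
      then have q2: "(l0 + r\<^sup>2) / (2 * D) - (l + p\<^sup>2) / (2 * D) \<le> 2 * k * b\<^sup>2 / \<sigma>" by (simp add: diff_divide_distrib)
      have "60 * k * b\<^sup>2 / \<sigma> + 8 * k * b\<^sup>2 / \<sigma> \<le> \<gamma> * b\<^sup>2"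
        using mult_right_mono[OF k2, of "b\<^sup>2"] by (simp add: distrib_right)
      then have "60 * (k * b\<^sup>2 / \<sigma>) + 8 * (k * b\<^sup>2 / \<sigma>) \<le> \<gamma> * b\<^sup>2" by simp
      moreover have "0 \<le> k * b\<^sup>2 / \<sigma>" using kp sg by simp
      moreover have "sqrt (p\<^sup>2 * G - 2 * p * x + v) \<le> q p + 30 * (k * b\<^sup>2 / \<sigma>)" using P by simp
      moreover have "q p \<le> q r + 6 * (k * b\<^sup>2 / \<sigma>)" using q1 by simp
      moreover have "(l0 + r\<^sup>2) / (2 * D) - (l + p\<^sup>2) / (2 * D) \<le> 2 * (k * b\<^sup>2 / \<sigma>)" using q2 by simp
      moreover have "S - L \<le> qr - L0 + g" if "60 * e + 8 * e \<le> g" "0 \<le> e" "S \<le> qp + 30 * e" "qp \<le> qr + 6 * e" "L0 - L \<le> 2 * e"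
        for S L qr L0 g e qp :: real using that by linarith
      ultimately have "sqrt (p\<^sup>2 * G - 2 * p * x + v) - (l + p\<^sup>2) / (2 * D) \<le> q r - (l0 + r\<^sup>2) / (2 * D) + \<gamma> * b\<^sup>2"
        by blast
      then show "sqrt (p\<^sup>2 * G - 2 * p * x + v) - (l + p\<^sup>2) / (2 * sqrt (r\<^sup>2 + \<sigma>\<^sup>2)) \<le> aux_min \<sigma> r l0 v + \<gamma> * b\<^sup>2"
        by (simp add: aux_min_def q_def D_def)
    }
  qed (use kp k1 in auto)
qed

section \<open>Localization of near minimizers\<close>

text \<open>Reads the vector \<open>h\<close> off the last row, \<open>g\<close> off the last
  column, and the design off the top left block of the Gaussian array.\<close>

lemma gauss_marginal:
  assumes inj: "inj_on f J" and sub: "f ` J \<subseteq> I" and Q: "{y \<in> space (gauss J). Q y} \<in> sets (gauss J)"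
  shows "measure (gauss I) {x \<in> space (gauss I). Q (\<lambda>j\<in>J. x (f j))} = measure (gauss J) {y \<in> space (gauss J). Q y}"
    "{x \<in> space (gauss I). Q (\<lambda>j\<in>J. x (f j))} \<in> sets (gauss I)"
proof -
  have d: "distr (gauss I) (gauss J) (\<lambda>x. \<lambda>j\<in>J. x (f j)) = gauss J"
    using distr_PiM_reindex[of I "\<lambda>_. N01" f J] prob_space_N01 inj sub by auto
  have m: "(\<lambda>x. \<lambda>j\<in>J. x (f j)) \<in> gauss I \<rightarrow>\<^sub>M gauss J"
    by (rule measurable_restrict, rule measurable_component_singleton) (use sub in auto)
  have e: "(\<lambda>x. \<lambda>j\<in>J. x (f j)) -` {y \<in> space (gauss J). Q y} \<inter> space (gauss I) = {x \<in> space (gauss I). Q (\<lambda>j\<in>J. x (f j))}"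
    using measurable_space[OF m] by auto
  show "measure (gauss I) {x \<in> space (gauss I). Q (\<lambda>j\<in>J. x (f j))} = measure (gauss J) {y \<in> space (gauss J). Q y}"
    using measure_distr[OF m Q] unfolding d e by simp
  show "{x \<in> space (gauss I). Q (\<lambda>j\<in>J. x (f j))} \<in> sets (gauss I)"
    using measurable_sets[OF m Q] unfolding e .
qed

text \<open>The scaling moves the factor \<open>sqrt (real n)\<close> to the design, which becomes
  standard Gaussian, and makes \<open>(vnorm n w)\<^sup>2\<close> the estimation error per
  coordinate.\<close>

definition ndis :: "nat \<Rightarrow> (nat \<Rightarrow> real) \<Rightarrow> (nat \<Rightarrow> real) \<Rightarrow> nat \<Rightarrow> real" where
  "ndis n \<mu> \<nu> = (\<lambda>i. (\<nu> i - \<mu> i) / sqrt (real n))"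

lemma vnorm_ndis: "vnorm n (ndis n \<mu> \<nu>) = vnorm n (\<lambda>i. \<nu> i - \<mu> i) / sqrt (real n)"
  using vnorm_scale[of n "1 / sqrt (real n)" "\<lambda>i. \<nu> i - \<mu> i"] by (simp add: ndis_def)

lemma ip_ndis: "ip n h (ndis n \<mu> \<nu>) = ip n h (\<lambda>i. \<nu> i - \<mu> i) / sqrt (real n)"
  using ip_scale_right[of n h "1 / sqrt (real n)" "\<lambda>i. \<nu> i - \<mu> i"] by (simp add: ndis_def)

lemma mat_vec_diff: "mat_vec n A (\<lambda>i. x i - y i) i = mat_vec n A x i - mat_vec n A y i"
  by (simp add: mat_vec_def right_diff_distrib sum_subtractf)

lemma mat_vec_add: "mat_vec n A (\<lambda>i. x i + y i) i = mat_vec n A x i + mat_vec n A y i"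
  by (simp add: mat_vec_def distrib_left sum.distrib)

lemma mat_vec_scale: "mat_vec n A (\<lambda>i. c * x i) i = c * mat_vec n A x i"
  by (simp add: mat_vec_def sum_distrib_left mult_ac)

lemma mat_vec_segment: "mat_vec n A (\<lambda>i. x i + t * (y i - x i)) i = mat_vec n A x i + t * (mat_vec n A y i - mat_vec n A x i)"
  unfolding mat_vec_add mat_vec_scale mat_vec_diff ..

lemma continuous_on_mat_vec [continuous_intros]:
  "continuous_on UNIV (\<lambda>w. mat_vec n A w i)"
  unfolding mat_vec_def by (intro continuous_intros)

lemma vnorm_aux:
  assumes m: "m \<ge> 1"
  shows "vnorm m (\<lambda>i. s * g i - \<xi> i) = sqrt (real m) * sqrt (s\<^sup>2 * ((vnorm m g)\<^sup>2 / real m) - 2 * s * (ip m g \<xi> / real m) + (vnorm m \<xi>)\<^sup>2 / real m)"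
    "0 \<le> s\<^sup>2 * ((vnorm m g)\<^sup>2 / real m) - 2 * s * (ip m g \<xi> / real m) + (vnorm m \<xi>)\<^sup>2 / real m"
proof -
  let ?e = "s\<^sup>2 * ((vnorm m g)\<^sup>2 / real m) - 2 * s * (ip m g \<xi> / real m) + (vnorm m \<xi>)\<^sup>2 / real m"
  have "(vnorm m (\<lambda>i. s * g i - \<xi> i))\<^sup>2 = s\<^sup>2 * (vnorm m g)\<^sup>2 - 2 * s * ip m g \<xi> + (vnorm m \<xi>)\<^sup>2"
    unfolding vnorm_sq_diff by (simp add: vnorm_scale power_mult_distrib ip_scale_left)
  moreover have "real m * ?e = s\<^sup>2 * (vnorm m g)\<^sup>2 - 2 * s * ip m g \<xi> + (vnorm m \<xi>)\<^sup>2"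
    using m by (simp add: right_diff_distrib distrib_left)
  ultimately have e: "(vnorm m (\<lambda>i. s * g i - \<xi> i))\<^sup>2 = real m * ?e" by simp
  show "0 \<le> ?e" using m e zero_le_power2[of "vnorm m (\<lambda>i. s * g i - \<xi> i)"] by (simp add: zero_le_mult_iff)
  have "vnorm m (\<lambda>i. s * g i - \<xi> i) = sqrt ((vnorm m (\<lambda>i. s * g i - \<xi> i))\<^sup>2)" by simp
  then show "vnorm m (\<lambda>i. s * g i - \<xi> i) = sqrt (real m) * sqrt ?e" unfolding e real_sqrt_mult .
qed

text \<open>One problem instance. The separation bounds and \<open>\<phi>\<close> enter as
  assumptions because their constants must be fixed before \<open>n\<close>. \<open>TS\<close> is
  dense in the part of the ball of radius \<open>r + \<epsilon> * b\<close> that lies at distance at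
  least \<open>\<epsilon> * b\<close> from the sphere of radius \<open>r\<close>, where the loss
  must be large; \<open>TU\<close> is dense in the whole ball, where a small loss must
  occur.\<close>

locale cgmt =
  fixes n m :: nat and K :: "(nat \<Rightarrow> real) set" and \<mu> :: "nat \<Rightarrow> real"
    and \<sigma> r b \<epsilon> k \<gamma> \<phi> :: real and TS TU U :: "(nat \<Rightarrow> real) set"
  assumes n: "n \<ge> 1" and m: "m \<ge> 1" and K: "closed_convex n K" and mu: "\<mu> \<in> K"
    and pos: "\<sigma> > 0" "r > 0" "r \<le> b" "0 < \<epsilon>" "\<epsilon> \<le> 1" "0 < k" "k \<le> \<epsilon>" "\<gamma> > 0" "\<phi> > 0"
    and sep_low: "\<And>v p l G x s. aux_good k \<sigma> r b (E_lrt n K \<mu> (noise_level \<sigma> (real m / real n) r) / real n) v p l G x \<Longrightarrow>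
        0 \<le> s \<Longrightarrow> s \<le> r + \<epsilon> * b \<Longrightarrow> \<bar>s - r\<bar> \<ge> \<epsilon> * b \<Longrightarrow> s\<^sup>2 * G - 2 * s * x + v \<ge> 0 \<Longrightarrow>
        aux_min \<sigma> r (E_lrt n K \<mu> (noise_level \<sigma> (real m / real n) r) / real n) v + 4 * \<gamma> * b\<^sup>2
          \<le> sqrt (s\<^sup>2 * G - 2 * s * x + v) - (l + 2 * s * p - p\<^sup>2) / (2 * sqrt (r\<^sup>2 + \<sigma>\<^sup>2))"
    and sep_up: "\<And>v p l G x. aux_good k \<sigma> r b (E_lrt n K \<mu> (noise_level \<sigma> (real m / real n) r) / real n) v p l G x \<Longrightarrow>
        p\<^sup>2 * G - 2 * p * x + v \<ge> 0 \<Longrightarrow>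
        sqrt (p\<^sup>2 * G - 2 * p * x + v) - (l + p\<^sup>2) / (2 * sqrt (r\<^sup>2 + \<sigma>\<^sup>2))
          \<le> aux_min \<sigma> r (E_lrt n K \<mu> (noise_level \<sigma> (real m / real n) r) / real n) v + \<gamma> * b\<^sup>2"
    and phi: "\<And>v. \<bar>v - \<sigma>\<^sup>2\<bar> \<le> k \<Longrightarrow> \<phi> \<le> aux_min \<sigma> r (E_lrt n K \<mu> (noise_level \<sigma> (real m / real n) r) / real n) v"
    and TS: "dense_in TS {w. \<exists>\<nu>\<in>K. w = ndis n \<mu> \<nu> \<and> vnorm n w \<le> r + \<epsilon> * b \<and> \<bar>vnorm n w - r\<bar> \<ge> \<epsilon> * b}"
    and TU: "dense_in TU {w. \<exists>\<nu>\<in>K. w = ndis n \<mu> \<nu> \<and> vnorm n w \<le> r + \<epsilon> * b}"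
    and U: "dense_sphere m U"
begin

definition \<tau> :: real where "\<tau> = noise_level \<sigma> (real m / real n) r"
definition l0 :: real where "l0 = E_lrt n K \<mu> \<tau> / real n"
definition D :: real where "D = sqrt (r\<^sup>2 + \<sigma>\<^sup>2)"
definition \<Phi> :: "(nat \<Rightarrow> real) \<Rightarrow> real" where "\<Phi> \<xi> = aux_min \<sigma> r l0 ((vnorm m \<xi>)\<^sup>2 / real m)"

definition phat :: "(nat \<Rightarrow> real) \<Rightarrow> real" where "phat h = sqrt (seq_err n K \<mu> \<tau> h / real n)"
definition lhat :: "(nat \<Rightarrow> real) \<Rightarrow> real" where "lhat h = seq_lrt n K \<mu> \<tau> h / real n"

definition good_h :: "(nat \<Rightarrow> real) \<Rightarrow> bool" where
  "good_h h \<longleftrightarrow> \<bar>phat h - r\<bar> \<le> k * b \<and> \<bar>lhat h - l0\<bar> \<le> k * b\<^sup>2"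
definition good_g :: "(nat \<Rightarrow> real) \<Rightarrow> bool" where
  "good_g g \<longleftrightarrow> \<bar>(vnorm m g)\<^sup>2 / real m - 1\<bar> \<le> k"
definition good_gx :: "(nat \<Rightarrow> real) \<Rightarrow> (nat \<Rightarrow> real) \<Rightarrow> bool" where
  "good_gx \<xi> g \<longleftrightarrow> \<bar>ip m g \<xi> / real m\<bar> \<le> k * b"
definition good_xi :: "(nat \<Rightarrow> real) \<Rightarrow> bool" where
  "good_xi \<xi> \<longleftrightarrow> \<bar>(vnorm m \<xi>)\<^sup>2 / real m - \<sigma>\<^sup>2\<bar> \<le> k"

lemma bpos: "b > 0" using pos by linarith
lemma Dpos: "D > 0" "D\<^sup>2 = r\<^sup>2 + \<sigma>\<^sup>2" using pos by (simp_all add: D_def add_pos_pos)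

lemma tau_eq: "\<tau> = D * sqrt (real n) / sqrt (real m)"
  using n m by (simp add: \<tau>_def noise_level_def D_def real_sqrt_divide real_sqrt_mult)

lemma aux_goodI: "good_xi \<xi> \<Longrightarrow> good_h h \<Longrightarrow> good_g g \<Longrightarrow> good_gx \<xi> g \<Longrightarrow>
   aux_good k \<sigma> r b l0 ((vnorm m \<xi>)\<^sup>2 / real m) (phat h) (lhat h) ((vnorm m g)\<^sup>2 / real m) (ip m g \<xi> / real m)"
  by (simp add: aux_good_def good_xi_def good_h_def good_g_def good_gx_def phat_def seq_err_dis)

lemma phat_eq: "phat h = vnorm n (dis n K \<mu> \<tau> h) / sqrt (real n)"
  by (simp add: phat_def seq_err_dis real_sqrt_divide)

text \<open>In \<open>dis_optimal\<close> the distance to the maximizer is at least the difference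
  of the two norms. What remains depends on \<open>w\<close> only through its norm, and this reduces
  the decoupled problem to one real variable.\<close>

lemma ip_ndis_le:
  assumes \<nu>: "\<nu> \<in> K" and w: "w = ndis n \<mu> \<nu>"
  shows "ip n h w \<le> sqrt (real m) * ((lhat h + 2 * vnorm n w * phat h - (phat h)\<^sup>2) / (2 * D))"
proof -
  define u where "u = (\<lambda>i. \<nu> i - \<mu> i)"
  define N where "N = sqrt (real n)"
  have N: "N > 0" "N\<^sup>2 = real n" using n by (auto simp: N_def)
  define s p where "s = vnorm n w" and "p = phat h"
  have us: "vnorm n u = N * s" using N by (simp add: s_def w vnorm_ndis u_def N_def)
  have dp: "vnorm n (dis n K \<mu> \<tau> h) = N * p" using N by (simp add: p_def phat_eq N_def)
  have lr: "seq_lrt n K \<mu> \<tau> h = N\<^sup>2 * lhat h" using n by (simp add: lhat_def N)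
  have "(vnorm n u - vnorm n (dis n K \<mu> \<tau> h))\<^sup>2 \<le> (vnorm n (\<lambda>i. u i - dis n K \<mu> \<tau> h i))\<^sup>2"
    using power_mono[OF abs_vnorm_diff_le[of n u "dis n K \<mu> \<tau> h"], of 2] by simp
  then have "2 * \<tau> * ip n h u - (N * s)\<^sup>2 \<le> N\<^sup>2 * lhat h - (N * s - N * p)\<^sup>2"
    using dis_optimal'(1)[OF K mu \<nu> u_def, of \<tau> h] unfolding us dp lr by linarith
  then have 1: "2 * \<tau> * ip n h u \<le> N\<^sup>2 * (lhat h + 2 * s * p - p\<^sup>2)" by (simp add: power2_eq_square algebra_simps)
  have i: "ip n h w = ip n h u / N" by (simp add: w ip_ndis u_def N_def)
  have t: "\<tau> * sqrt (real m) = D * N" using m by (simp add: tau_eq N_def)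
  have "2 * D * ip n h w * N\<^sup>2 = 2 * (D * N) * ip n h u" unfolding i using N(1) by (simp add: power2_eq_square)
  also have "\<dots> = sqrt (real m) * (2 * \<tau> * ip n h u)" unfolding t[symmetric] by simp
  also have "\<dots> \<le> sqrt (real m) * (N\<^sup>2 * (lhat h + 2 * s * p - p\<^sup>2))" using 1 by (intro mult_left_mono) auto
  finally have "(2 * D * ip n h w) * N\<^sup>2 \<le> (sqrt (real m) * (lhat h + 2 * s * p - p\<^sup>2)) * N\<^sup>2" by (simp add: mult_ac)
  then have "2 * D * ip n h w \<le> sqrt (real m) * (lhat h + 2 * s * p - p\<^sup>2)" using N n by simp
  then show ?thesis using Dpos by (simp add: s_def p_def field_simps)
qed

text \<open>The displacement of the sequence estimator attains the bound of
  \<open>ip_ndis_le\<close>, so it witnesses the upper bound of the scalar problem.\<close>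

lemma ip_ndis_opt:
  assumes \<nu>: "\<nu> \<in> K" "dis n K \<mu> \<tau> h = (\<lambda>i. \<nu> i - \<mu> i)" and w: "w = ndis n \<mu> \<nu>"
  shows "ip n h w = sqrt (real m) * ((lhat h + (phat h)\<^sup>2) / (2 * D))" "vnorm n w = phat h"
proof -
  define N where "N = sqrt (real n)"
  have N: "N > 0" "N\<^sup>2 = real n" using n by (auto simp: N_def)
  show "vnorm n w = phat h" by (simp add: w vnorm_ndis \<nu>(2)[symmetric] phat_eq)
  have dp: "vnorm n (dis n K \<mu> \<tau> h) = N * phat h" using N by (simp add: phat_eq N_def)
  have lr: "seq_lrt n K \<mu> \<tau> h = N\<^sup>2 * lhat h" using n by (simp add: lhat_def N)
  define j where "j = ip n h (dis n K \<mu> \<tau> h)"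
  have 1: "2 * \<tau> * j = N\<^sup>2 * (lhat h + (phat h)\<^sup>2)"
    using lr unfolding seq_lrt_dis dp j_def by (simp add: power_mult_distrib algebra_simps)
  have i: "ip n h w = j / N" by (simp add: w ip_ndis \<nu>(2)[symmetric] N_def j_def)
  have t: "\<tau> * sqrt (real m) = D * N" using m by (simp add: tau_eq N_def)
  have "2 * D * ip n h w * N\<^sup>2 = 2 * (D * N) * j" unfolding i using N(1) by (simp add: power2_eq_square)
  also have "\<dots> = sqrt (real m) * (2 * \<tau> * j)" unfolding t[symmetric] by simp
  also have "\<dots> = (sqrt (real m) * (lhat h + (phat h)\<^sup>2)) * N\<^sup>2" unfolding 1 by simp
  finally have "2 * D * ip n h w = sqrt (real m) * (lhat h + (phat h)\<^sup>2)" using N n by simp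
  then show "ip n h w = sqrt (real m) * ((lhat h + (phat h)\<^sup>2) / (2 * D))" using Dpos by (simp add: field_simps)
qed

abbreviation Gam :: "((nat \<times> nat) \<Rightarrow> real) measure" where "Gam \<equiv> gauss (arr m n)"
abbreviation gg :: "((nat \<times> nat) \<Rightarrow> real) \<Rightarrow> nat \<Rightarrow> real" where "gg x \<equiv> (\<lambda>i. x (i, n))"
abbreviation hh :: "((nat \<times> nat) \<Rightarrow> real) \<Rightarrow> nat \<Rightarrow> real" where "hh x \<equiv> (\<lambda>j. x (m, j))"
abbreviation XX :: "((nat \<times> nat) \<Rightarrow> real) \<Rightarrow> nat \<Rightarrow> nat \<Rightarrow> real" where "XX x \<equiv> (\<lambda>i j. x (i, j))"
abbreviation "sm \<equiv> sqrt (real m)"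

definition good_B :: "(nat \<Rightarrow> real) \<Rightarrow> ((nat \<times> nat) \<Rightarrow> real) \<Rightarrow> bool" where
  "good_B \<xi> x \<longleftrightarrow> good_h (hh x) \<and> good_g (gg x) \<and> good_gx \<xi> (gg x)"

lemma smpos: "sm > 0" using m by simp

lemma good_B_low:
  assumes "good_xi \<xi>" "good_B \<xi> x" "w \<in> TS"
  shows "sm * (\<Phi> \<xi> + 7/2 * \<gamma> * b\<^sup>2) < vnorm m (\<lambda>i. vnorm n w * x (i, n) - \<xi> i) - ip n (hh x) w"
proof -
  obtain \<nu> where w: "\<nu> \<in> K" "w = ndis n \<mu> \<nu>" "vnorm n w \<le> r + \<epsilon> * b" "\<bar>vnorm n w - r\<bar> \<ge> \<epsilon> * b"
    using assms(3) dense_inD(2)[OF TS] by auto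
  define s where "s = vnorm n w"
  define q where "q = sqrt (s\<^sup>2 * ((vnorm m (gg x))\<^sup>2 / real m) - 2 * s * (ip m (gg x) \<xi> / real m) + (vnorm m \<xi>)\<^sup>2 / real m)"
  define h where "h = (lhat (hh x) + 2 * s * phat (hh x) - (phat (hh x))\<^sup>2) / (2 * D)"
  have "\<Phi> \<xi> + 4 * \<gamma> * b\<^sup>2 \<le> q - h"
    unfolding q_def h_def \<Phi>_def D_def
    using sep_low[folded \<tau>_def, folded l0_def, OF aux_goodI[of \<xi> "hh x" "gg x"], of s] assms w vnorm_aux(2)[OF m, of s "gg x" \<xi>]
    by (simp add: s_def good_B_def)
  then have "\<Phi> \<xi> + 7/2 * \<gamma> * b\<^sup>2 < q - h" using mult_pos_pos[OF pos(8) zero_less_power[OF bpos, of 2]] by linarith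
  then have "sm * (\<Phi> \<xi> + 7/2 * \<gamma> * b\<^sup>2) < sm * (q - h)" using smpos by (intro mult_strict_left_mono)
  also have "\<dots> = sm * q - sm * h" by (simp add: right_diff_distrib)
  also have "sm * q = vnorm m (\<lambda>i. vnorm n w * x (i, n) - \<xi> i)" unfolding q_def s_def by (rule vnorm_aux(1)[OF m, symmetric])
  finally show ?thesis using ip_ndis_le[OF w(1,2), of "hh x"] unfolding h_def s_def by linarith
qed

lemma good_B_up:
  assumes "good_xi \<xi>" "good_B \<xi> x"
  shows "\<exists>w\<in>TU. vnorm m (\<lambda>i. vnorm n w * x (i, n) - \<xi> i) - ip n (hh x) w < sm * (\<Phi> \<xi> + 3/2 * \<gamma> * b\<^sup>2)"
proof -
  obtain \<nu> where nu: "\<nu> \<in> K" "dis n K \<mu> \<tau> (hh x) = (\<lambda>i. \<nu> i - \<mu> i)" using dis_in[OF K mu] by blast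
  define w where "w = ndis n \<mu> \<nu>"
  note w = ip_ndis_opt[OF nu w_def]
  define p where "p = phat (hh x)"
  have "p \<le> r + k * b" using assms(2) unfolding good_B_def good_h_def p_def by linarith
  \<comment> \<open>Here \<open>k \<le> \<epsilon>\<close> keeps the displacement of the estimator
    inside the ball covered by \<open>TU\<close>.\<close>
  also have "\<dots> \<le> r + \<epsilon> * b" using pos bpos by (intro add_left_mono mult_right_mono) auto
  finally have wS: "w \<in> {w. \<exists>\<nu>\<in>K. w = ndis n \<mu> \<nu> \<and> vnorm n w \<le> r + \<epsilon> * b}" using nu w w_def by (auto simp: p_def)
  define q where "q = sqrt (p\<^sup>2 * ((vnorm m (gg x))\<^sup>2 / real m) - 2 * p * (ip m (gg x) \<xi> / real m) + (vnorm m \<xi>)\<^sup>2 / real m)"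
  define h where "h = (lhat (hh x) + p\<^sup>2) / (2 * D)"
  have "q - h \<le> \<Phi> \<xi> + \<gamma> * b\<^sup>2"
    unfolding q_def h_def \<Phi>_def D_def p_def
    using sep_up[folded \<tau>_def, folded l0_def, OF aux_goodI[of \<xi> "hh x" "gg x"]] assms vnorm_aux(2)[OF m, of p "gg x" \<xi>]
    by (simp add: p_def good_B_def)
  then have "q - h < \<Phi> \<xi> + 3/2 * \<gamma> * b\<^sup>2" using mult_pos_pos[OF pos(8) zero_less_power[OF bpos, of 2]] by linarith
  then have "sm * (q - h) < sm * (\<Phi> \<xi> + 3/2 * \<gamma> * b\<^sup>2)" using smpos by (intro mult_strict_left_mono)
  also have "sm * (q - h) = sm * q - sm * h" by (simp add: right_diff_distrib)
  also have "sm * q = vnorm m (\<lambda>i. vnorm n w * x (i, n) - \<xi> i)" unfolding q_def w(2) p_def by (rule vnorm_aux(1)[OF m, symmetric])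
  also have "sm * h = ip n (hh x) w" unfolding w(1) h_def p_def ..
  finally have lt: "vnorm m (\<lambda>i. vnorm n w * x (i, n) - \<xi> i) - ip n (hh x) w < sm * (\<Phi> \<xi> + 3/2 * \<gamma> * b\<^sup>2)" .
  have "continuous_on UNIV (\<lambda>w. vnorm m (\<lambda>i. vnorm n w * x (i, n) - \<xi> i) - ip n (hh x) w)"
    by (intro continuous_intros)
  from dense_inD(3)[OF TU this wS lt] show ?thesis .
qed

text \<open>Budget in units of \<open>\<gamma> * b\<^sup>2\<close>. From below: 4 by separation, 7/2
  after passing to a strict bound, 13/4 after the corner scalar takes 1/4. From above: 1 by
  separation, 3/2 for strictness, 7/4 after the corner scalar, 2 after the exchange of quantifiers,
  and 9/4 in \<open>up_ok\<close> to be strict again. One full unit remains between the two.\<close>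

definition low_ok :: "(nat \<Rightarrow> nat \<Rightarrow> real) \<Rightarrow> (nat \<Rightarrow> real) \<Rightarrow> bool" where
  "low_ok A \<xi> \<longleftrightarrow> (\<forall>w\<in>TS. sm * (\<Phi> \<xi> + 13/4 * \<gamma> * b\<^sup>2) \<le> vnorm m (\<lambda>i. mat_vec n A w i - \<xi> i))"

definition up_ok :: "(nat \<Rightarrow> nat \<Rightarrow> real) \<Rightarrow> (nat \<Rightarrow> real) \<Rightarrow> bool" where
  "up_ok A \<xi> \<longleftrightarrow> (\<exists>w\<in>TU. vnorm m (\<lambda>i. mat_vec n A w i - \<xi> i) < sm * (\<Phi> \<xi> + 9/4 * \<gamma> * b\<^sup>2))"

lemma corner_small:
  assumes z: "\<bar>z\<bar> \<le> \<gamma> * b * sm / 8" and w: "0 \<le> s" "s \<le> r + \<epsilon> * b"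
  shows "\<bar>z * s\<bar> \<le> sm * (1/4 * \<gamma> * b\<^sup>2)"
proof -
  have "\<epsilon> * b \<le> b" using pos bpos by (simp add: mult_left_le_one_le)
  then have "s \<le> 2 * b" using w pos by linarith
  then have "\<bar>z * s\<bar> \<le> (\<gamma> * b * sm / 8) * (2 * b)" unfolding abs_mult using z w pos bpos by (intro mult_mono) auto
  then show ?thesis by (simp add: power2_eq_square algebra_simps)
qed

lemma low_ok_if:
  assumes "\<And>w. w \<in> TS \<Longrightarrow> sm * (\<Phi> \<xi> + 7/2 * \<gamma> * b\<^sup>2) \<le> vnorm m (\<lambda>i. mat_vec n A w i - \<xi> i) + z * vnorm n w"
    and z: "\<bar>z\<bar> \<le> \<gamma> * b * sm / 8"
  shows "low_ok A \<xi>"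
  unfolding low_ok_def
proof
  fix w assume w: "w \<in> TS"
  then have "vnorm n w \<le> r + \<epsilon> * b" using dense_inD(2)[OF TS] by auto
  from corner_small[OF z vnorm_nonneg this] assms(1)[OF w]
  have "sm * (\<Phi> \<xi> + 7/2 * \<gamma> * b\<^sup>2) - sm * (1/4 * \<gamma> * b\<^sup>2) \<le> vnorm m (\<lambda>i. mat_vec n A w i - \<xi> i)" by linarith
  then show "sm * (\<Phi> \<xi> + 13/4 * \<gamma> * b\<^sup>2) \<le> vnorm m (\<lambda>i. mat_vec n A w i - \<xi> i)" by (simp add: algebra_simps)
qed

lemma ndis_convex:
  assumes "\<nu> \<in> K" "\<nu>' \<in> K" "0 \<le> t" "t \<le> 1"
  shows "\<exists>\<nu>''\<in>K. (\<lambda>i. ndis n \<mu> \<nu> i + t * (ndis n \<mu> \<nu>' i - ndis n \<mu> \<nu> i)) = ndis n \<mu> \<nu>''"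
proof (rule bexI)
  show "(\<lambda>i. (1 - t) * \<nu> i + t * \<nu>' i) \<in> K" by (rule closed_convexD(3)[OF K assms])
  show "(\<lambda>i. ndis n \<mu> \<nu> i + t * (ndis n \<mu> \<nu>' i - ndis n \<mu> \<nu> i)) = ndis n \<mu> (\<lambda>i. (1 - t) * \<nu> i + t * \<nu>' i)"
    using n by (auto simp: ndis_def fun_eq_iff divide_simps) (simp add: algebra_simps)
qed

lemma vnorm_segment:
  assumes "0 \<le> t" "t \<le> 1"
  shows "vnorm d (\<lambda>i. x i + t * (y i - x i)) \<le> (1 - t) * vnorm d x + t * vnorm d y"
proof -
  have "(\<lambda>i. x i + t * (y i - x i)) = (\<lambda>i. (1 - t) * x i + t * y i)" by (auto simp: algebra_simps)
  then show ?thesis using vnorm_triangle[of d "\<lambda>i. (1 - t) * x i" "\<lambda>i. t * y i"] assms by (simp add: vnorm_scale)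
qed

text \<open>The residual map is affine, so the image of the ball inside \<open>K\<close> is a
  bounded convex set. It reaches below the level \<open>c\<close> in every direction of
  \<open>U\<close>, hence \<open>convex_small_norm\<close> finds one point of small norm. The level
  is nonnegative because \<open>\<Phi> \<xi>\<close> is at least \<open>\<phi>\<close>.\<close>

lemma up_ok_if:
  assumes xi: "good_xi \<xi>"
    and up: "\<And>u. u \<in> U \<Longrightarrow> \<exists>w\<in>TU. ip m u (\<lambda>i. mat_vec n A w i - \<xi> i) \<le> sm * (\<Phi> \<xi> + 3/2 * \<gamma> * b\<^sup>2) + z * vnorm n w"
    and z: "\<bar>z\<bar> \<le> \<gamma> * b * sm / 8"
  shows "up_ok A \<xi>"
proof -
  let ?S = "{w. \<exists>\<nu>\<in>K. w = ndis n \<mu> \<nu> \<and> vnorm n w \<le> r + \<epsilon> * b}"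
  define f where "f w = (\<lambda>i. mat_vec n A w i - \<xi> i)" for w
  define c where "c = sm * (\<Phi> \<xi> + 7/4 * \<gamma> * b\<^sup>2)"
  have gb: "\<gamma> * b\<^sup>2 > 0" using pos bpos by simp
  have Ph: "\<Phi> \<xi> \<ge> \<phi>" using phi[folded \<tau>_def, folded l0_def] xi by (simp add: \<Phi>_def good_xi_def)
  have c0: "c \<ge> 0" using Ph pos gb smpos by (simp add: c_def add_nonneg_nonneg)
  have mvb: "vnorm m (f w) \<le> (\<Sum>i<m. \<Sum>j<n. \<bar>A i j\<bar>) * (r + \<epsilon> * b) + vnorm m \<xi>" if w: "vnorm n w \<le> r + \<epsilon> * b" for w
  proof -
    have "\<bar>mat_vec n A w i\<bar> \<le> (\<Sum>j<n. \<bar>A i j\<bar>) * (r + \<epsilon> * b)" for i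
      unfolding mat_vec_def sum_distrib_right
      by (rule order_trans[OF sum_abs]) (auto simp: abs_mult intro!: sum_mono mult_left_mono order_trans[OF abs_coord_le_vnorm w])
    then have "(\<Sum>i<m. \<bar>mat_vec n A w i\<bar>) \<le> (\<Sum>i<m. \<Sum>j<n. \<bar>A i j\<bar>) * (r + \<epsilon> * b)"
      unfolding sum_distrib_right[of _ "{..<m}"] by (intro sum_mono)
    moreover have "vnorm m (\<lambda>i. mat_vec n A w i) \<le> (\<Sum>i<m. \<bar>mat_vec n A w i\<bar>)"
      unfolding vnorm_def by (rule L2_set_le_sum_abs)
    moreover have "vnorm m (f w) \<le> vnorm m (\<lambda>i. mat_vec n A w i) + vnorm m \<xi>"
      using vnorm_triangle[of m "\<lambda>i. mat_vec n A w i" "\<lambda>i. - \<xi> i"] vnorm_scale[of m "-1" \<xi>] by (simp add: f_def)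
    ultimately show ?thesis by linarith
  qed
  have ndis_mu: "ndis n \<mu> \<mu> = (\<lambda>_. 0)" by (simp add: ndis_def)
  have z0: "vnorm n (\<lambda>_. 0) = 0" by (simp add: vnorm_def L2_set_def)
  have "\<exists>y\<in>f ` ?S. vnorm m y \<le> c + sm * (1/4 * \<gamma> * b\<^sup>2)"
  proof (rule convex_small_norm[OF U])
    have "(\<lambda>_. 0) \<in> ?S" using mu pos bpos by (auto simp: ndis_mu z0 intro!: bexI[of _ \<mu>])
    then show "f ` ?S \<noteq> {}" by blast
    fix x y :: "nat \<Rightarrow> real" and t :: real
    assume "x \<in> f ` ?S" "y \<in> f ` ?S" and t: "0 \<le> t" "t \<le> 1"
    then obtain \<nu>1 \<nu>2 where x: "\<nu>1 \<in> K" "x = f (ndis n \<mu> \<nu>1)" "vnorm n (ndis n \<mu> \<nu>1) \<le> r + \<epsilon> * b"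
      and y: "\<nu>2 \<in> K" "y = f (ndis n \<mu> \<nu>2)" "vnorm n (ndis n \<mu> \<nu>2) \<le> r + \<epsilon> * b" by auto
    let ?w = "\<lambda>i. ndis n \<mu> \<nu>1 i + t * (ndis n \<mu> \<nu>2 i - ndis n \<mu> \<nu>1 i)"
    obtain \<nu>3 where 3: "\<nu>3 \<in> K" "?w = ndis n \<mu> \<nu>3" using ndis_convex[OF x(1) y(1) t] by blast
    have "vnorm n ?w \<le> (1 - t) * (r + \<epsilon> * b) + t * (r + \<epsilon> * b)"
      using x(3) y(3) t by (intro order_trans[OF vnorm_segment[OF t]] add_mono mult_left_mono) auto
    also have "\<dots> = r + \<epsilon> * b" by (simp add: algebra_simps)
    finally have "?w \<in> ?S" using 3 by auto
    moreover have "f ?w = (\<lambda>i. x i + t * (y i - x i))"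
      unfolding x(2) y(2) f_def mat_vec_segment by (rule ext) (simp add: algebra_simps)
    ultimately show "(\<lambda>i. x i + t * (y i - x i)) \<in> f ` ?S" using imageI[of ?w ?S f] by simp
  next
    fix y assume "y \<in> f ` ?S" then show "vnorm m y \<le> (\<Sum>i<m. \<Sum>j<n. \<bar>A i j\<bar>) * (r + \<epsilon> * b) + vnorm m \<xi>" using mvb by auto
  next
    fix u assume u: "u \<in> U"
    obtain w where w: "w \<in> TU" "ip m u (f w) \<le> sm * (\<Phi> \<xi> + 3/2 * \<gamma> * b\<^sup>2) + z * vnorm n w" using up[OF u] by (auto simp: f_def)
    have wS: "w \<in> ?S" using dense_inD(2)[OF TU] w(1) by blast
    then have "\<bar>z * vnorm n w\<bar> \<le> sm * (1/4 * \<gamma> * b\<^sup>2)" by (intro corner_small[OF z]) auto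
    then have "ip m u (f w) \<le> sm * (\<Phi> \<xi> + 3/2 * \<gamma> * b\<^sup>2) + sm * (1/4 * \<gamma> * b\<^sup>2)" using w(2) by linarith
    also have "\<dots> = c" by (simp add: c_def algebra_simps)
    finally show "\<exists>y\<in>f ` ?S. ip m u y \<le> c" using wS by blast
  qed (use c0 smpos gb in auto)
  then obtain w where w: "w \<in> ?S" "vnorm m (f w) \<le> c + sm * (1/4 * \<gamma> * b\<^sup>2)" by auto
  have "vnorm m (f w) < sm * (\<Phi> \<xi> + 9/4 * \<gamma> * b\<^sup>2)"
  proof -
    have "sm * (1/4 * \<gamma> * b\<^sup>2) > 0" using smpos gb by simp
    then show ?thesis using w(2) by (simp add: c_def algebra_simps)
  qed
  moreover have "continuous_on UNIV (\<lambda>w. vnorm m (f w))" unfolding f_def by (intro continuous_intros)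
  ultimately show ?thesis unfolding up_ok_def using dense_inD(3)[OF TU _ w(1)] by (simp add: f_def)
qed

end

section \<open>Probabilities of the good events\<close>

lemma gauss_second_moment_tail:
  assumes I: "finite I" and c: "c > 0"
  shows "measure (gauss I) {x \<in> space (gauss I). \<bar>lin I a x\<bar> \<ge> c} \<le> (\<Sum>i\<in>I. (a i)\<^sup>2) / c\<^sup>2"
proof -
  note L = gauss_lin(3,4)[OF I, of a a]
  have "{x \<in> space (gauss I). \<bar>lin I a x\<bar> \<ge> c} = {x \<in> space (gauss I). c\<^sup>2 \<le> lin I a x * lin I a x}"
    using c by (auto simp: power2_eq_square[symmetric] abs_le_square_iff[symmetric])
  then have "measure (gauss I) {x \<in> space (gauss I). \<bar>lin I a x\<bar> \<ge> c} \<le> (\<integral>x. lin I a x * lin I a x \<partial>gauss I) / c\<^sup>2"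
    using integral_Markov_inequality_measure[OF L(1) sets.empty_sets, of "c\<^sup>2"] c by simp
  then show ?thesis unfolding L(2) by (simp add: power2_eq_square)
qed

lemma tail_frac:
  fixes N K S B M :: real
  assumes "N \<noteq> 0" "K \<noteq> 0" "B \<noteq> 0" "M \<noteq> 0"
  shows "40 * ((B + S) * B * N\<^sup>2 / M) / (N\<^sup>2 * K * (B * B) / 256) = 10240 / K * ((B + S) / (M * B))"
    "20 * ((B + S) * B * N\<^sup>2 / M) / (N\<^sup>2 * K * (B * B)) = 20 / K * ((B + S) / (M * B))"
  using assms by (simp_all add: field_simps)

lemma pred_le_less_real:
  fixes f g :: "'a \<Rightarrow> real"
  assumes [measurable]: "f \<in> borel_measurable M" "g \<in> borel_measurable M"
  shows "Measurable.pred M (\<lambda>x. f x < g x)" "Measurable.pred M (\<lambda>x. f x \<le> g x)"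
  by measurable

lemma pred_Bex_Ball_countable:
  fixes f g :: "'b \<Rightarrow> 'a \<Rightarrow> real"
  assumes T: "countable T" and f: "\<And>w. f w \<in> borel_measurable M" and g: "\<And>w. g w \<in> borel_measurable M"
  shows "Measurable.pred M (\<lambda>x. \<exists>w\<in>T. f w x < g w x)" "Measurable.pred M (\<lambda>x. \<exists>w\<in>T. f w x \<le> g w x)"
    "Measurable.pred M (\<lambda>x. \<forall>w\<in>T. f w x < g w x)" "Measurable.pred M (\<lambda>x. \<forall>w\<in>T. f w x \<le> g w x)"
  by (rule measurable_pred_countable[OF T], rule pred_le_less_real, rule f, rule g)+

lemma sets_not_pred: "Measurable.pred M Q \<Longrightarrow> {x \<in> space M. \<not> Q x} \<in> sets M"
  by measurable

lemma sets_pred: "Measurable.pred M Q \<Longrightarrow> {x \<in> space M. Q x} \<in> sets M"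
  by measurable

context cgmt
begin

definition ph :: real where "ph = measure (gauss {..<n}) {h \<in> space (gauss {..<n}). \<not> good_h h}"
definition pg :: real where "pg = measure (gauss {..<m}) {g \<in> space (gauss {..<m}). \<not> good_g g}"
text \<open>The last summand is the Chebyshev bound for \<open>good_gx\<close>: for good noise
  \<open>ip m g \<xi>\<close> has variance at most \<open>real m * (\<sigma>\<^sup>2 + k)\<close>
  and threshold \<open>k * b * real m\<close>. Likewise \<open>pz\<close> bounds the tail of the
  corner scalar at \<open>\<gamma> * b * sm / 8\<close>.\<close>

definition pB :: real where "pB = ph + pg + (\<sigma>\<^sup>2 + k) / (real m * (k * b)\<^sup>2)"
definition pz :: real where "pz = 64 / (real m * (\<gamma> * b)\<^sup>2)"

lemma coordm: "j < d \<Longrightarrow> (\<lambda>h. h j) \<in> borel_measurable (gauss {..<d})"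
  by (intro measurable_gauss_coord) simp

lemma sets_good_h: "{h \<in> space (gauss {..<n}). \<not> good_h h} \<in> sets (gauss {..<n})"
proof -
  have [measurable]: "phat \<in> borel_measurable (gauss {..<n})" "lhat \<in> borel_measurable (gauss {..<n})"
    unfolding phat_def[abs_def] lhat_def[abs_def]
    by (intro measurable_compose[OF _ borel_measurable_sqrt] borel_measurable_divide borel_measurable_const
        measurable_seq_err[OF K mu] measurable_seq_lrt[OF K mu] coordm; assumption)+
  show ?thesis unfolding good_h_def by measurable
qed

lemma sets_good_g: "{g \<in> space (gauss {..<m}). \<not> good_g g} \<in> sets (gauss {..<m})"
proof -
  have [measurable]: "(\<lambda>g. vnorm m g) \<in> borel_measurable (gauss {..<m})"
    by (intro measurable_vnorm coordm)
  show ?thesis unfolding good_g_def by measurable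
qed

lemma sets_good_gx: "{g \<in> space (gauss {..<m}). \<not> good_gx \<xi> g} \<in> sets (gauss {..<m})"
proof -
  have [measurable]: "(\<lambda>g. ip m g \<xi>) \<in> borel_measurable (gauss {..<m})"
    by (intro measurable_ip coordm borel_measurable_const)
  show ?thesis unfolding good_gx_def by measurable
qed

lemma good_h_cong: "(\<And>i. i < n \<Longrightarrow> h i = h' i) \<Longrightarrow> good_h h = good_h h'"
  unfolding good_h_def phat_def lhat_def using seq_err_cong[OF K mu, of h h'] seq_lrt_cong[OF K mu, of h h'] by simp
lemma good_g_cong: "(\<And>i. i < m \<Longrightarrow> g i = g' i) \<Longrightarrow> good_g g = good_g g'"
  unfolding good_g_def using vnorm_cong[of m g g'] by simp
lemma good_gx_cong: "(\<And>i. i < m \<Longrightarrow> g i = g' i) \<Longrightarrow> good_gx \<xi> g = good_gx \<xi> g'"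
  unfolding good_gx_def using ip_cong[of m g g' \<xi> \<xi>] by simp

lemma good_B_prob:
  assumes xi: "good_xi \<xi>"
  shows "measure Gam {x \<in> space Gam. \<not> good_B \<xi> x} \<le> pB" "{x \<in> space Gam. \<not> good_B \<xi> x} \<in> sets Gam"
proof -
  interpret prob_space Gam by (rule prob_space_gauss)
  have row: "inj_on (\<lambda>j. (m, j)) {..<n}" "(\<lambda>j. (m, j)) ` {..<n} \<subseteq> arr m n"
    and col: "inj_on (\<lambda>i. (i, n)) {..<m}" "(\<lambda>i. (i, n)) ` {..<m} \<subseteq> arr m n"
    by (auto simp: inj_on_def arr_def)
  let ?H = "{x \<in> space Gam. \<not> good_h (hh x)}" and ?G = "{x \<in> space Gam. \<not> good_g (gg x)}"
    and ?X = "{x \<in> space Gam. \<not> good_gx \<xi> (gg x)}"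
  have H: "measure Gam ?H = ph" "?H \<in> sets Gam"
    using gauss_marginal[OF row sets_good_h] good_h_cong[of "\<lambda>j\<in>{..<n}. x (m, j)" "\<lambda>j. x (m, j)" for x] by (simp_all add: ph_def)
  have G: "measure Gam ?G = pg" "?G \<in> sets Gam"
    using gauss_marginal[OF col sets_good_g] good_g_cong[of "\<lambda>i\<in>{..<m}. x (i, n)" "\<lambda>i. x (i, n)" for x] by (simp_all add: pg_def)
  have X: "measure Gam ?X = measure (gauss {..<m}) {g \<in> space (gauss {..<m}). \<not> good_gx \<xi> g}" "?X \<in> sets Gam"
    using gauss_marginal[OF col sets_good_gx[of \<xi>]] good_gx_cong[of "\<lambda>i\<in>{..<m}. x (i, n)" "\<lambda>i. x (i, n)" \<xi> for x] by simp_all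
  have X2: "measure Gam ?X \<le> (\<sigma>\<^sup>2 + k) / (real m * (k * b)\<^sup>2)"
  proof -
    interpret g: prob_space "gauss {..<m}" by (rule prob_space_gauss)
    have kb: "k * b * real m > 0" using pos bpos m by simp
    have "measure Gam ?X \<le> measure (gauss {..<m}) {g \<in> space (gauss {..<m}). \<bar>lin {..<m} \<xi> g\<bar> \<ge> k * b * real m}"
      unfolding X(1)
    proof (rule g.finite_measure_mono)
      show "{g \<in> space (gauss {..<m}). \<not> good_gx \<xi> g} \<subseteq> {g \<in> space (gauss {..<m}). \<bar>lin {..<m} \<xi> g\<bar> \<ge> k * b * real m}"
      proof
        fix g assume g: "g \<in> {g \<in> space (gauss {..<m}). \<not> good_gx \<xi> g}"
        then have "k * b < \<bar>ip m g \<xi>\<bar> / real m" using m by (simp add: good_gx_def)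
        then have "k * b * real m < \<bar>ip m g \<xi>\<bar>" using m by (simp add: pos_less_divide_eq)
        then show "g \<in> {g \<in> space (gauss {..<m}). \<bar>lin {..<m} \<xi> g\<bar> \<ge> k * b * real m}"
          using g by (simp add: lin_def ip_def mult.commute)
      qed
      show "{g \<in> space (gauss {..<m}). \<bar>lin {..<m} \<xi> g\<bar> \<ge> k * b * real m} \<in> g.events" by measurable
    qed
    also have "\<dots> \<le> (\<Sum>i<m. (\<xi> i)\<^sup>2) / (k * b * real m)\<^sup>2" by (rule gauss_second_moment_tail[OF finite_lessThan kb])
    also have "(\<Sum>i<m. (\<xi> i)\<^sup>2) = (vnorm m \<xi>)\<^sup>2" unfolding vnorm_def L2_set_def by (simp add: sum_nonneg)
    also have "(vnorm m \<xi>)\<^sup>2 / (k * b * real m)\<^sup>2 \<le> (real m * (\<sigma>\<^sup>2 + k)) / (k * b * real m)\<^sup>2"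
    proof (rule divide_right_mono)
      have "(vnorm m \<xi>)\<^sup>2 / real m \<le> \<sigma>\<^sup>2 + k" using xi unfolding good_xi_def by linarith
      then show "(vnorm m \<xi>)\<^sup>2 \<le> real m * (\<sigma>\<^sup>2 + k)" using m by (simp add: pos_divide_le_eq mult.commute)
    qed simp
    also have "\<dots> = (\<sigma>\<^sup>2 + k) / (real m * (k * b)\<^sup>2)" using m by (simp add: power2_eq_square)
    finally show ?thesis .
  qed
  have eq: "{x \<in> space Gam. \<not> good_B \<xi> x} = (?H \<union> ?G) \<union> ?X" by (auto simp: good_B_def)
  show "{x \<in> space Gam. \<not> good_B \<xi> x} \<in> sets Gam" unfolding eq using H G X by auto
  have "measure Gam {x \<in> space Gam. \<not> good_B \<xi> x} \<le> measure Gam (?H \<union> ?G) + measure Gam ?X"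
    unfolding eq using H G X by (intro measure_Un_le) auto
  also have "measure Gam (?H \<union> ?G) \<le> measure Gam ?H + measure Gam ?G" using H G by (intro measure_Un_le)
  finally show "measure Gam {x \<in> space Gam. \<not> good_B \<xi> x} \<le> pB" using H(1) G(1) X2 by (simp add: pB_def)
qed

lemma corner_prob:
  shows "measure Gam {x \<in> space Gam. \<not> \<bar>x (m, n)\<bar> \<le> \<gamma> * b * sm / 8} \<le> pz"
    "{x \<in> space Gam. \<not> \<bar>x (m, n)\<bar> \<le> \<gamma> * b * sm / 8} \<in> sets Gam"
proof -
  interpret prob_space Gam by (rule prob_space_gauss)
  have [measurable]: "(\<lambda>x. x (m, n)) \<in> borel_measurable Gam" by (intro measurable_gauss_coord) (simp add: arr_def)
  define c where "c = \<gamma> * b * sm / 8"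
  have c: "c > 0" using pos bpos smpos by (simp add: c_def)
  define a :: "nat \<times> nat \<Rightarrow> real" where "a i = (if i = (m, n) then 1 else 0)" for i
  have la: "lin (arr m n) a x = x (m, n)" for x
    by (simp add: lin_def a_def arr_def if_distrib[of "\<lambda>t. t * _"] cong: if_cong)
  show s: "{x \<in> space Gam. \<not> \<bar>x (m, n)\<bar> \<le> \<gamma> * b * sm / 8} \<in> sets Gam" by measurable
  have "measure Gam {x \<in> space Gam. \<not> \<bar>x (m, n)\<bar> \<le> c} \<le> measure Gam {x \<in> space Gam. \<bar>lin (arr m n) a x\<bar> \<ge> c}"
    unfolding la by (intro finite_measure_mono) auto
  also have "\<dots> \<le> (\<Sum>i\<in>arr m n. (a i)\<^sup>2) / c\<^sup>2" by (rule gauss_second_moment_tail[OF finite_arr c])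
  also have "(\<Sum>i\<in>arr m n. (a i)\<^sup>2) = 1"
    by (simp add: a_def arr_def if_distrib[of "\<lambda>t. t\<^sup>2"] cong: if_cong)
  also have "1 / c\<^sup>2 = pz" using pos bpos m by (simp add: c_def pz_def power_mult_distrib power_divide mult_ac)
  finally show "measure Gam {x \<in> space Gam. \<not> \<bar>x (m, n)\<bar> \<le> \<gamma> * b * sm / 8} \<le> pz" by (simp add: c_def)
qed

lemma low_up_prob_array:
  assumes xi: "good_xi \<xi>"
  shows "measure Gam {x \<in> space Gam. \<not> low_ok (XX x) \<xi>} \<le> pB + pz" "measure Gam {x \<in> space Gam. \<not> up_ok (XX x) \<xi>} \<le> pB + pz"
    "{x \<in> space Gam. \<not> low_ok (XX x) \<xi>} \<in> sets Gam" "{x \<in> space Gam. \<not> up_ok (XX x) \<xi>} \<in> sets Gam"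
proof -
  interpret prob_space Gam by (rule prob_space_gauss)
  have cm: "(\<lambda>x. x (i, j)) \<in> borel_measurable Gam" if "i \<le> m" "j \<le> n" for i j
    using that by (intro measurable_gauss_coord) (auto simp: arr_def)
  have c1: "countable TS" "countable TU" using dense_inD(1)[OF TS] dense_inD(1)[OF TU] by auto
  have c2: "countable U" using U by (simp add: dense_sphere_def)
  have mv: "(\<lambda>x. vnorm m (\<lambda>i. mat_vec n (XX x) w i - \<xi> i)) \<in> borel_measurable Gam"
      "(\<lambda>x. ip m u (\<lambda>i. mat_vec n (XX x) w i - \<xi> i)) \<in> borel_measurable Gam" for w u
    unfolding mat_vec_def
    by (intro measurable_vnorm measurable_ip borel_measurable_diff borel_measurable_sum
        borel_measurable_times borel_measurable_const cm; simp)+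
  have mg: "(\<lambda>x. vnorm m (\<lambda>i. vnorm n w * x (i, n) - \<xi> i)) \<in> borel_measurable Gam" for w
    by (intro measurable_vnorm borel_measurable_diff borel_measurable_times borel_measurable_const cm) auto
  have mh: "(\<lambda>x. ip n (hh x) w) \<in> borel_measurable Gam" for w
    by (intro measurable_ip borel_measurable_const cm) auto
  have mc: "(\<lambda>x. x (m, n)) \<in> borel_measurable Gam" by (intro cm) auto
  note meas = mv mg mh mc borel_measurable_diff borel_measurable_add borel_measurable_times borel_measurable_const
  let ?Z = "{x \<in> space Gam. \<not> \<bar>x (m, n)\<bar> \<le> \<gamma> * b * sm / 8}" and ?B = "{x \<in> space Gam. \<not> good_B \<xi> x}"
  \<comment> \<open>Gordon's inequality bounds the event of interest from below by the decoupled
    one, which holds whenever \<open>good_B\<close> does. Passing to complements bounds both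
    failures by that of \<open>good_B\<close>.\<close>
  have cpl: "prob {x \<in> space Gam. Q x} \<le> prob ?B" if sub: "\<And>x. x \<in> space Gam \<Longrightarrow> good_B \<xi> x \<Longrightarrow> P' x" 
    and le: "prob {x \<in> space Gam. P' x} \<le> prob {x \<in> space Gam. \<not> Q x}" and s: "{x \<in> space Gam. P' x} \<in> events" "{x \<in> space Gam. Q x} \<in> events" for P' Q
  proof -
    have "1 - prob ?B = prob (space Gam - ?B)" using good_B_prob(2)[OF xi] by (simp add: prob_compl)
    also have "\<dots> \<le> prob {x \<in> space Gam. P' x}" using s sub by (intro finite_measure_mono) auto
    also have "\<dots> \<le> prob {x \<in> space Gam. \<not> Q x}" by (rule le)
    also have "{x \<in> space Gam. \<not> Q x} = space Gam - {x \<in> space Gam. Q x}" by auto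
    also have "prob \<dots> = 1 - prob {x \<in> space Gam. Q x}" using s by (simp add: prob_compl)
    finally show ?thesis by simp
  qed
  show sl: "{x \<in> space Gam. \<not> low_ok (XX x) \<xi>} \<in> sets Gam" unfolding low_ok_def by (intro sets_not_pred pred_Bex_Ball_countable c1 meas)
  show su: "{x \<in> space Gam. \<not> up_ok (XX x) \<xi>} \<in> sets Gam" unfolding up_ok_def by (intro sets_not_pred pred_Bex_Ball_countable c1 meas)
  let ?cl = "sm * (\<Phi> \<xi> + 7/2 * \<gamma> * b\<^sup>2)" and ?cu = "sm * (\<Phi> \<xi> + 3/2 * \<gamma> * b\<^sup>2)"
  let ?AL = "{x \<in> space Gam. \<not> (\<forall>w\<in>TS. ?cl \<le> vnorm m (\<lambda>i. mat_vec n (XX x) w i - \<xi> i) + x (m, n) * vnorm n w)}"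
  let ?AU = "{x \<in> space Gam. \<not> (\<forall>u\<in>U. \<exists>w\<in>TU. ip m u (\<lambda>i. mat_vec n (XX x) w i - \<xi> i) \<le> ?cu + x (m, n) * vnorm n w)}"
  have mAL: "?AL \<in> events" by (intro sets_not_pred pred_Bex_Ball_countable c1 meas)
  have mAU: "?AU \<in> events"
    by (intro sets_not_pred measurable_pred_countable(1)[OF c2] pred_Bex_Ball_countable c1 meas)
  have AL: "prob ?AL \<le> prob ?B"
  proof (rule cpl[of "\<lambda>x. \<forall>w\<in>TS. ?cl < vnorm m (\<lambda>i. vnorm n w * x (i, n) - \<xi> i) - ip n (hh x) w"])
    show "\<forall>w\<in>TS. ?cl < vnorm m (\<lambda>i. vnorm n w * x (i, n) - \<xi> i) - ip n (hh x) w" if "good_B \<xi> x" for x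
      using good_B_low[OF xi that] by blast
    show "prob {x \<in> space Gam. \<forall>w\<in>TS. ?cl < vnorm m (\<lambda>i. vnorm n w * x (i, n) - \<xi> i) - ip n (hh x) w}
      \<le> prob {x \<in> space Gam. \<not> \<not> (\<forall>w\<in>TS. ?cl \<le> vnorm m (\<lambda>i. mat_vec n (XX x) w i - \<xi> i) + x (m, n) * vnorm n w)}"
      unfolding not_not by (rule gordon_lower[OF c1(1) m])
  next
    show "{x \<in> space Gam. \<forall>w\<in>TS. ?cl < vnorm m (\<lambda>i. vnorm n w * x (i, n) - \<xi> i) - ip n (hh x) w} \<in> events"
      by (intro sets_pred pred_Bex_Ball_countable c1 meas)
  qed (rule mAL)
  have AU: "prob ?AU \<le> prob ?B"
  proof (rule cpl[of "\<lambda>x. \<exists>w\<in>TU. vnorm m (\<lambda>i. vnorm n w * x (i, n) - \<xi> i) - ip n (hh x) w < ?cu"])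
    show "\<exists>w\<in>TU. vnorm m (\<lambda>i. vnorm n w * x (i, n) - \<xi> i) - ip n (hh x) w < ?cu" if "good_B \<xi> x" for x
      using good_B_up[OF xi that] by blast
    show "prob {x \<in> space Gam. \<exists>w\<in>TU. vnorm m (\<lambda>i. vnorm n w * x (i, n) - \<xi> i) - ip n (hh x) w < ?cu}
      \<le> prob {x \<in> space Gam. \<not> \<not> (\<forall>u\<in>U. \<exists>w\<in>TU. ip m u (\<lambda>i. mat_vec n (XX x) w i - \<xi> i) \<le> ?cu + x (m, n) * vnorm n w)}"
      unfolding not_not by (rule gordon_upper[OF c1(2) U])
  next
    show "{x \<in> space Gam. \<exists>w\<in>TU. vnorm m (\<lambda>i. vnorm n w * x (i, n) - \<xi> i) - ip n (hh x) w < ?cu} \<in> events"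
      by (intro sets_pred pred_Bex_Ball_countable c1 meas)
  qed (rule mAU)
  have "{x \<in> space Gam. \<not> low_ok (XX x) \<xi>} \<subseteq> ?AL \<union> ?Z" using low_ok_if by blast
  then have "prob {x \<in> space Gam. \<not> low_ok (XX x) \<xi>} \<le> prob (?AL \<union> ?Z)"
    using mAL corner_prob(2) by (intro finite_measure_mono) auto
  also have "\<dots> \<le> prob ?AL + prob ?Z" using mAL corner_prob(2) by (intro measure_Un_le)
  finally show "prob {x \<in> space Gam. \<not> low_ok (XX x) \<xi>} \<le> pB + pz"
    using AL good_B_prob(1)[OF xi] corner_prob(1) by linarith
  have "{x \<in> space Gam. \<not> up_ok (XX x) \<xi>} \<subseteq> ?AU \<union> ?Z" using up_ok_if[OF xi] by blast
  then have "prob {x \<in> space Gam. \<not> up_ok (XX x) \<xi>} \<le> prob (?AU \<union> ?Z)"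
    using mAU corner_prob(2) by (intro finite_measure_mono) auto
  also have "\<dots> \<le> prob ?AU + prob ?Z" using mAU corner_prob(2) by (intro measure_Un_le)
  finally show "prob {x \<in> space Gam. \<not> up_ok (XX x) \<xi>} \<le> pB + pz"
    using AU good_B_prob(1)[OF xi] corner_prob(1) by linarith
qed

abbreviation blk :: "(nat \<times> nat) set" where "blk \<equiv> {..<m} \<times> {..<n}"

lemma mat_vec_cong: "(\<And>j. j < n \<Longrightarrow> A i j = A' i j) \<Longrightarrow> mat_vec n A w i = mat_vec n A' w i"
  by (simp add: mat_vec_def)

lemma low_ok_cong: "(\<And>i j. i < m \<Longrightarrow> j < n \<Longrightarrow> A i j = A' i j) \<Longrightarrow> (\<And>i. i < m \<Longrightarrow> \<xi> i = \<xi>' i) \<Longrightarrow> low_ok A \<xi> = low_ok A' \<xi>'"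
  unfolding low_ok_def \<Phi>_def
  using vnorm_cong[of m \<xi> \<xi>'] vnorm_cong[of m "\<lambda>i. mat_vec n A w i - \<xi> i" "\<lambda>i. mat_vec n A' w i - \<xi>' i" for w] mat_vec_cong[of A _ A'] by simp

lemma up_ok_cong: "(\<And>i j. i < m \<Longrightarrow> j < n \<Longrightarrow> A i j = A' i j) \<Longrightarrow> (\<And>i. i < m \<Longrightarrow> \<xi> i = \<xi>' i) \<Longrightarrow> up_ok A \<xi> = up_ok A' \<xi>'"
  unfolding up_ok_def \<Phi>_def
  using vnorm_cong[of m \<xi> \<xi>'] vnorm_cong[of m "\<lambda>i. mat_vec n A w i - \<xi> i" "\<lambda>i. mat_vec n A' w i - \<xi>' i" for w] mat_vec_cong[of A _ A'] by simp

definition all_ok :: "((nat \<times> nat) \<Rightarrow> real) \<Rightarrow> (nat \<Rightarrow> real) \<Rightarrow> bool" where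
  "all_ok y \<xi> \<longleftrightarrow> good_xi \<xi> \<and> low_ok (\<lambda>i j. y (i, j)) \<xi> \<and> up_ok (\<lambda>i j. y (i, j)) \<xi>"

lemma sets_all_ok:
  assumes y: "\<And>i j. i < m \<Longrightarrow> j < n \<Longrightarrow> (\<lambda>p. f p (i, j)) \<in> borel_measurable M"
    and x: "\<And>i. i < m \<Longrightarrow> (\<lambda>p. g p i) \<in> borel_measurable M"
  shows "{p \<in> space M. \<not> all_ok (f p) (g p)} \<in> sets M"
proof -
  have c1: "countable TS" "countable TU" using dense_inD(1)[OF TS] dense_inD(1)[OF TU] by auto
  have mx: "(\<lambda>p. (vnorm m (g p))\<^sup>2 / real m) \<in> borel_measurable M"
    by (intro borel_measurable_divide borel_measurable_power borel_measurable_const measurable_vnorm x)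
  then have mP: "(\<lambda>p. \<Phi> (g p)) \<in> borel_measurable M"
    unfolding \<Phi>_def aux_min_def by measurable
  have mv: "(\<lambda>p. vnorm m (\<lambda>i. mat_vec n (\<lambda>i j. f p (i, j)) w i - g p i)) \<in> borel_measurable M" for w
    unfolding mat_vec_def
    by (intro measurable_vnorm borel_measurable_diff borel_measurable_sum borel_measurable_times borel_measurable_const y x; simp)
  have "Measurable.pred M (\<lambda>p. good_xi (g p))" unfolding good_xi_def using mx by measurable
  moreover have "Measurable.pred M (\<lambda>p. low_ok (\<lambda>i j. f p (i, j)) (g p))" unfolding low_ok_def
    by (intro pred_Bex_Ball_countable c1 mv borel_measurable_times borel_measurable_add borel_measurable_const mP)
  moreover have "Measurable.pred M (\<lambda>p. up_ok (\<lambda>i j. f p (i, j)) (g p))" unfolding up_ok_def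
    by (intro pred_Bex_Ball_countable c1 mv borel_measurable_times borel_measurable_add borel_measurable_const mP)
  ultimately show ?thesis unfolding all_ok_def by (intro sets_not_pred pred_intros_logic)
qed

lemma all_ok_prob_block:
  assumes xi: "good_xi \<xi>"
  shows "measure (gauss blk) {y \<in> space (gauss blk). \<not> all_ok y \<xi>} \<le> 2 * (pB + pz)"
proof -
  interpret prob_space Gam by (rule prob_space_gauss)
  have sb: "{y \<in> space (gauss blk). \<not> all_ok y \<xi>} \<in> sets (gauss blk)"
    by (intro sets_all_ok borel_measurable_const measurable_gauss_coord) simp
  have inj: "inj_on (\<lambda>q. q) blk" "(\<lambda>q. q) ` blk \<subseteq> arr m n" by (auto simp: arr_def)
  have rs: "all_ok (\<lambda>j\<in>blk. x j) \<xi> = (low_ok (XX x) \<xi> \<and> up_ok (XX x) \<xi>)" for x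
    unfolding all_ok_def using xi
      low_ok_cong[of "\<lambda>i j. (\<lambda>j\<in>blk. x j) (i, j)" "XX x" \<xi> \<xi>] up_ok_cong[of "\<lambda>i j. (\<lambda>j\<in>blk. x j) (i, j)" "XX x" \<xi> \<xi>] by simp
  have "measure (gauss blk) {y \<in> space (gauss blk). \<not> all_ok y \<xi>} = prob {x \<in> space Gam. \<not> all_ok (\<lambda>j\<in>blk. x j) \<xi>}"
    by (rule gauss_marginal(1)[OF inj sb, symmetric])
  also have "{x \<in> space Gam. \<not> all_ok (\<lambda>j\<in>blk. x j) \<xi>} = {x \<in> space Gam. \<not> low_ok (XX x) \<xi>} \<union> {x \<in> space Gam. \<not> up_ok (XX x) \<xi>}"
    unfolding rs by auto
  also have "prob \<dots> \<le> prob {x \<in> space Gam. \<not> low_ok (XX x) \<xi>} + prob {x \<in> space Gam. \<not> up_ok (XX x) \<xi>}"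
    by (intro measure_Un_le low_up_prob_array xi)
  also have "\<dots> \<le> (pB + pz) + (pB + pz)" by (intro add_mono low_up_prob_array(1,2)[OF xi])
  also have "\<dots> = 2 * (pB + pz)" by simp
  finally show ?thesis .
qed

lemma ph_bound:
  assumes fp: "E_err n K \<mu> \<tau> / real n = r\<^sup>2"
  shows "ph \<le> (10240 / k^8 + 20 / k\<^sup>2) * (b\<^sup>2 + \<sigma>\<^sup>2) / (real m * b\<^sup>2)"
proof -
  let ?g = "gauss {..<n}"
  interpret prob_space ?g by (rule prob_space_gauss)
  define V where "V = E_err n K \<mu> \<tau>"
  have n0: "real n > 0" using n by simp
  have V: "V = real n * r\<^sup>2" using fp n0 by (simp add: V_def field_simps)
  have rb: "r\<^sup>2 \<le> b\<^sup>2" using pos by (intro power_mono) auto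
  have t2: "\<tau>\<^sup>2 = (r\<^sup>2 + \<sigma>\<^sup>2) * real n / real m" unfolding tau_eq using Dpos by (simp add: power_divide power_mult_distrib)
  have tV: "\<tau>\<^sup>2 * V \<le> (b\<^sup>2 + \<sigma>\<^sup>2) * b\<^sup>2 * (real n)\<^sup>2 / real m"
  proof -
    have "\<tau>\<^sup>2 * V = ((r\<^sup>2 + \<sigma>\<^sup>2) * r\<^sup>2) * (real n)\<^sup>2 / real m" unfolding t2 V by (simp add: power2_eq_square)
    also have "\<dots> \<le> ((b\<^sup>2 + \<sigma>\<^sup>2) * b\<^sup>2) * (real n)\<^sup>2 / real m" using rb by (intro divide_right_mono mult_right_mono mult_mono) auto
    finally show ?thesis .
  qed
  \<comment> \<open>With these values \<open>\<kappa> * V\<close> is at most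
    \<open>real n * (k\<^sup>2 * b\<^sup>2 / 2)\<close> and \<open>4 * t / \<kappa>\<close> equals
    it, so \<open>seq_err\<close> deviates by less than
    \<open>real n * (k * b)\<^sup>2\<close>.\<close>
  define \<kappa> where "\<kappa> = k\<^sup>2 / 2"
  define t where "t = real n * k^4 * b\<^sup>2 / 16"
  define t' where "t' = real n * (k * b\<^sup>2)"
  have k1: "k \<le> 1" using pos by linarith
  have kap: "\<kappa> > 0" "\<kappa> \<le> 1" using pos k1 power_le_one[of k 2] by (auto simp: \<kappa>_def)
  have tp: "t > 0" "t' > 0" using n0 pos bpos by (auto simp: t_def t'_def)
  let ?E = "{h \<in> space ?g. \<bar>seq_err n K \<mu> \<tau> h - V\<bar> \<ge> \<kappa> * V + 4 * t / \<kappa>}"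
  let ?L = "{h \<in> space ?g. \<bar>seq_lrt n K \<mu> \<tau> h - E_lrt n K \<mu> \<tau>\<bar> \<ge> t'}"
  have m1: "seq_err n K \<mu> \<tau> \<in> borel_measurable ?g" "seq_lrt n K \<mu> \<tau> \<in> borel_measurable ?g"
    by (intro measurable_seq_err[OF K mu] measurable_seq_lrt[OF K mu] coordm; assumption)+
  have EL: "?E \<in> events" "?L \<in> events" using m1 by measurable
  have "{h \<in> space ?g. \<not> good_h h} \<subseteq> ?E \<union> ?L"
  proof
    fix h assume h: "h \<in> {h \<in> space ?g. \<not> good_h h}"
    show "h \<in> ?E \<union> ?L"
    proof (rule ccontr)
      assume "h \<notin> ?E \<union> ?L"
      then have 1: "\<bar>seq_err n K \<mu> \<tau> h - V\<bar> < \<kappa> * V + 4 * t / \<kappa>" and 2: "\<bar>seq_lrt n K \<mu> \<tau> h - E_lrt n K \<mu> \<tau>\<bar> < t'" using h by auto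
      have "k\<^sup>2 / 2 * (real n * r\<^sup>2) \<le> k\<^sup>2 / 2 * (real n * b\<^sup>2)" using rb n0 by (intro mult_left_mono) auto
      then have "\<kappa> * V \<le> real n * (k\<^sup>2 * b\<^sup>2 / 2)" by (simp add: V \<kappa>_def mult_ac)
      moreover have "4 * t / \<kappa> = real n * (k\<^sup>2 * b\<^sup>2 / 2)"
      proof -
        have "4 * t = real n * (k\<^sup>2 * b\<^sup>2 / 2) * \<kappa>" by (simp add: t_def \<kappa>_def power_def numeral_eq_Suc)
        then show ?thesis using kap by (simp add: nonzero_divide_eq_eq)
      qed
      ultimately have "\<bar>seq_err n K \<mu> \<tau> h - V\<bar> < real n * (k * b)\<^sup>2" using 1 by (simp add: power_mult_distrib)
      moreover have "seq_err n K \<mu> \<tau> h = real n * (phat h)\<^sup>2"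
        using n0 by (simp add: phat_def seq_err_dis)
      ultimately have "real n * \<bar>(phat h)\<^sup>2 - r\<^sup>2\<bar> < real n * (k * b)\<^sup>2"
        using n0 by (simp add: V right_diff_distrib[symmetric] abs_mult)
      then have A: "\<bar>(phat h)\<^sup>2 - r\<^sup>2\<bar> < (k * b)\<^sup>2" using n0 by simp
      have p0: "phat h \<ge> 0" by (simp add: phat_def seq_err_dis)
      \<comment> \<open>The square of the difference is at most the difference of the squares for
        nonnegative numbers. This loses precision but needs no lower bound on
        \<open>r\<close>.\<close>
      have "\<bar>phat h - r\<bar> * \<bar>phat h - r\<bar> \<le> \<bar>phat h - r\<bar> * \<bar>phat h + r\<bar>" using p0 pos by (intro mult_left_mono) auto
      also have "\<dots> = \<bar>(phat h)\<^sup>2 - r\<^sup>2\<bar>" by (simp add: abs_mult[symmetric] power2_eq_square algebra_simps)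
      finally have "\<bar>phat h - r\<bar>\<^sup>2 < (k * b)\<^sup>2" using A by (simp add: power2_eq_square)
      then have g1: "\<bar>phat h - r\<bar> < k * b" by (rule power2_less_imp_less) (use pos bpos in simp)
      have "lhat h - l0 = (seq_lrt n K \<mu> \<tau> h - E_lrt n K \<mu> \<tau>) / real n" by (simp add: lhat_def l0_def diff_divide_distrib)
      then have "\<bar>lhat h - l0\<bar> < k * b\<^sup>2" using 2 n0 by (simp add: t'_def pos_divide_less_eq mult.commute)
      with g1 h show False by (simp add: good_h_def)
    qed
  qed
  then have "ph \<le> prob (?E \<union> ?L)" unfolding ph_def by (rule finite_measure_mono[OF _ sets.Un[OF EL]])
  also have "\<dots> \<le> prob ?E + prob ?L" by (rule measure_Un_le[OF EL])
  finally have e1: "ph \<le> prob ?E + prob ?L" .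
  have e2: "prob ?E \<le> 40 * \<tau>\<^sup>2 * V / t\<^sup>2" unfolding V_def by (rule err_deviation[OF K mu tp(1) kap])
  have e3: "prob ?L \<le> 20 * \<tau>\<^sup>2 * V / t'\<^sup>2" unfolding V_def by (rule lrt_deviation[OF K mu tp(2)])
  have e4: "40 * \<tau>\<^sup>2 * V / t\<^sup>2 \<le> 10240 / k^8 * ((b\<^sup>2 + \<sigma>\<^sup>2) / (real m * b\<^sup>2))"
  proof -
    have "40 * \<tau>\<^sup>2 * V / t\<^sup>2 \<le> 40 * ((b\<^sup>2 + \<sigma>\<^sup>2) * b\<^sup>2 * (real n)\<^sup>2 / real m) / t\<^sup>2"
      using tV by (intro divide_right_mono) auto
    also have "\<dots> = 10240 / k^8 * ((b\<^sup>2 + \<sigma>\<^sup>2) / (real m * b\<^sup>2))"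
    proof -
      have tq: "t\<^sup>2 = (real n)\<^sup>2 * k^8 * (b\<^sup>2 * b\<^sup>2) / 256"
        unfolding t_def by (simp add: power_divide power_mult_distrib power_mult[symmetric] power_add[symmetric])
      show ?thesis unfolding tq by (rule tail_frac(1)) (use n0 bpos pos m in auto)
    qed
    finally show ?thesis .
  qed
  have e5: "20 * \<tau>\<^sup>2 * V / t'\<^sup>2 \<le> 20 / k\<^sup>2 * ((b\<^sup>2 + \<sigma>\<^sup>2) / (real m * b\<^sup>2))"
  proof -
    have "20 * \<tau>\<^sup>2 * V / t'\<^sup>2 \<le> 20 * ((b\<^sup>2 + \<sigma>\<^sup>2) * b\<^sup>2 * (real n)\<^sup>2 / real m) / t'\<^sup>2"
      using tV by (intro divide_right_mono) auto
    also have "\<dots> = 20 / k\<^sup>2 * ((b\<^sup>2 + \<sigma>\<^sup>2) / (real m * b\<^sup>2))"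
    proof -
      have tq: "t'\<^sup>2 = (real n)\<^sup>2 * k\<^sup>2 * (b\<^sup>2 * b\<^sup>2)"
        unfolding t'_def by (simp add: power_mult_distrib power_mult[symmetric] power_add[symmetric])
      show ?thesis unfolding tq by (rule tail_frac(2)) (use n0 bpos pos m in auto)
    qed
    finally show ?thesis .
  qed
  have e6: "(X + Y) * c / d = X * (c / d) + Y * (c / d)" for X Y c d :: real
    by (simp add: distrib_right add_divide_distrib)
  show ?thesis unfolding e6
    by (rule order_trans[OF e1 add_mono[OF order_trans[OF e2 e4] order_trans[OF e3 e5]]])
qed

end

section \<open>Transfer to the model and localization of the estimator\<close>

text \<open>Integrating over the second component, bad values contribute at most their own
  probability and all others at most \<open>c\<close>.\<close>

lemma measure_pair_le:
  assumes M1: "prob_space M1" and M2: "prob_space M2"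
    and R: "{p \<in> space (M1 \<Otimes>\<^sub>M M2). R (fst p) (snd p)} \<in> sets (M1 \<Otimes>\<^sub>M M2)"
    and B: "{y \<in> space M2. bad y} \<in> sets M2" and c: "c \<ge> 0"
    and le: "\<And>y. y \<in> space M2 \<Longrightarrow> \<not> bad y \<Longrightarrow> measure M1 {x \<in> space M1. R x y} \<le> c"
  shows "measure (M1 \<Otimes>\<^sub>M M2) {p \<in> space (M1 \<Otimes>\<^sub>M M2). R (fst p) (snd p)} \<le> measure M2 {y \<in> space M2. bad y} + c"
proof -
  interpret M1: prob_space M1 by (rule M1)
  interpret M2: prob_space M2 by (rule M2)
  interpret pair_prob_space M1 M2 ..
  let ?A = "{p \<in> space (M1 \<Otimes>\<^sub>M M2). R (fst p) (snd p)}" and ?B = "{y \<in> space M2. bad y}"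
  have "emeasure (M1 \<Otimes>\<^sub>M M2) ?A = (\<integral>\<^sup>+ y. emeasure M1 ((\<lambda>x. (x, y)) -` ?A) \<partial>M2)"
    by (rule emeasure_pair_measure_alt2[OF R])
  also have "\<dots> \<le> (\<integral>\<^sup>+ y. indicator ?B y + ennreal c \<partial>M2)"
  proof (rule nn_integral_mono)
    fix y assume y: "y \<in> space M2"
    have e: "(\<lambda>x. (x, y)) -` ?A = {x \<in> space M1. R x y}" using y by (auto simp: space_pair_measure)
    show "emeasure M1 ((\<lambda>x. (x, y)) -` ?A) \<le> indicator ?B y + ennreal c"
    proof (cases "bad y")
      case True
      have "emeasure M1 ((\<lambda>x. (x, y)) -` ?A) \<le> 1" by (rule M1.emeasure_le_1)
      also have "\<dots> \<le> indicator ?B y + ennreal c" using True y by simp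
      finally show ?thesis .
    next
      case False
      then show ?thesis using le[OF y False] unfolding e by (simp add: M1.emeasure_eq_measure ennreal_leI)
    qed
  qed
  also have "\<dots> = emeasure M2 ?B + ennreal c" using B by (subst nn_integral_add) (simp_all add: M2.emeasure_space_1)
  also have "\<dots> = ennreal (measure M2 ?B + c)" using c by (simp add: M2.emeasure_eq_measure)
  finally show ?thesis using c by (simp add: emeasure_eq_measure del: ennreal_plus)
qed

text \<open>It suffices to compare rectangles. Independence is given for the sigma-algebras
  generated by the unscaled design and the noise, and the scaled design is a function of the
  unscaled one, so its preimages stay in the first of them. The marginals are product measures by
  independence of the entries, the scaling giving each design entry standard deviation 1.\<close>

lemma gaussian_linear_model_law:
  fixes X :: "'a \<Rightarrow> nat \<Rightarrow> nat \<Rightarrow> real" and \<xi> :: "'a \<Rightarrow> nat \<Rightarrow> real"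
  assumes model: "gaussian_linear_model P m n X \<xi> N" and n: "n \<ge> 1" and m: "m \<ge> 1"
    and N: "prob_space N" "sets N = sets borel"
  defines "T1 \<equiv> \<lambda>\<omega>. \<lambda>p\<in>{..<m} \<times> {..<n}. sqrt (real n) * X \<omega> (fst p) (snd p)"
    and "T2 \<equiv> \<lambda>\<omega>. \<lambda>i\<in>{..<m}. \<xi> \<omega> i"
  shows "distr P (gauss ({..<m} \<times> {..<n}) \<Otimes>\<^sub>M Pi\<^sub>M {..<m} (\<lambda>_. N)) (\<lambda>\<omega>. (T1 \<omega>, T2 \<omega>))
     = gauss ({..<m} \<times> {..<n}) \<Otimes>\<^sub>M Pi\<^sub>M {..<m} (\<lambda>_. N)" (is "?D = ?G \<Otimes>\<^sub>M ?N")
    "T1 \<in> P \<rightarrow>\<^sub>M gauss ({..<m} \<times> {..<n})" "T2 \<in> P \<rightarrow>\<^sub>M Pi\<^sub>M {..<m} (\<lambda>_. N)"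
proof -
  let ?blk = "{..<m} \<times> {..<n}"
  interpret prob_space P using model by (simp add: gaussian_linear_model_def)
  have dX: "distributed P lborel (\<lambda>\<omega>. X \<omega> i j) (normal_density 0 (1 / sqrt (real n)))" if "i < m" "j < n" for i j
    using model that by (simp add: gaussian_linear_model_def)
  have iX: "indep_vars (\<lambda>_. borel) (\<lambda>p \<omega>. X \<omega> (fst p) (snd p)) ?blk"
    and iN: "indep_vars (\<lambda>_. borel) (\<lambda>i \<omega>. \<xi> \<omega> i) {..<m}"
    using model by (simp_all add: gaussian_linear_model_def)
  have xm: "(\<lambda>\<omega>. \<xi> \<omega> i) \<in> borel_measurable P" and xd: "distr P borel (\<lambda>\<omega>. \<xi> \<omega> i) = N" if "i < m" for i
    using model that by (simp_all add: gaussian_linear_model_def)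
  define R1 where "R1 = (\<lambda>\<omega>. \<lambda>p\<in>?blk. X \<omega> (fst p) (snd p))"
  define S where "S = (\<lambda>x::nat \<times> nat \<Rightarrow> real. \<lambda>p\<in>?blk. sqrt (real n) * x p)"
  have ind: "indep_set (sets (vimage_algebra (space P) R1 (Pi\<^sub>M ?blk (\<lambda>_. borel))))
       (sets (vimage_algebra (space P) T2 (Pi\<^sub>M {..<m} (\<lambda>_. borel))))"
    using model by (simp add: gaussian_linear_model_def R1_def T2_def)
  have sG: "sets ?G = sets (Pi\<^sub>M ?blk (\<lambda>_. borel))" by (intro sets_PiM_cong) auto
  have sN: "sets ?N = sets (Pi\<^sub>M {..<m} (\<lambda>_. borel))" by (intro sets_PiM_cong) (auto simp: N)
  have Xm: "(\<lambda>\<omega>. X \<omega> i j) \<in> borel_measurable P" if "i < m" "j < n" for i j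
    using distributed_measurable[OF dX[OF that]] by simp
  have R1: "R1 \<in> P \<rightarrow>\<^sub>M Pi\<^sub>M ?blk (\<lambda>_. borel)" unfolding R1_def by (rule measurable_restrict) (use Xm in auto)
  have S: "S \<in> Pi\<^sub>M ?blk (\<lambda>_. borel) \<rightarrow>\<^sub>M Pi\<^sub>M ?blk (\<lambda>_. borel)"
    unfolding S_def by (intro measurable_restrict borel_measurable_times borel_measurable_const measurable_component_singleton)
  have T1S: "T1 = (\<lambda>\<omega>. S (R1 \<omega>))" by (auto simp: T1_def S_def R1_def fun_eq_iff restrict_def)
  have T1b: "T1 \<in> P \<rightarrow>\<^sub>M Pi\<^sub>M ?blk (\<lambda>_. borel)" unfolding T1S by (rule measurable_compose[OF R1 S])
  then show T1: "T1 \<in> P \<rightarrow>\<^sub>M ?G" using measurable_cong_sets[OF refl sG] by blast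
  have T2b: "T2 \<in> P \<rightarrow>\<^sub>M Pi\<^sub>M {..<m} (\<lambda>_. borel)" unfolding T2_def by (rule measurable_restrict) (use xm in auto)
  then show T2: "T2 \<in> P \<rightarrow>\<^sub>M ?N" using measurable_cong_sets[OF refl sN] by blast
  have law1: "distr P ?G T1 = ?G"
  proof -
    have "indep_vars (\<lambda>_. borel) (\<lambda>p \<omega>. sqrt (real n) * X \<omega> (fst p) (snd p)) ?blk"
      by (rule indep_vars_compose2[OF iX, where Y = "\<lambda>_ x. sqrt (real n) * x"]) simp
    then have "distr P (Pi\<^sub>M ?blk (\<lambda>_. borel)) T1 = Pi\<^sub>M ?blk (\<lambda>p. distr P borel (\<lambda>\<omega>. sqrt (real n) * X \<omega> (fst p) (snd p)))"
      unfolding T1_def by (subst (asm) indep_vars_iff_distr_eq_PiM') (use n m Xm in \<open>auto simp: lessThan_empty_iff\<close>)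
    also have "\<dots> = ?G"
    proof (rule PiM_cong[OF refl])
      fix p assume p: "p \<in> ?blk"
      have "distributed P lborel (\<lambda>\<omega>. 0 + sqrt (real n) * X \<omega> (fst p) (snd p)) (normal_density (0 + sqrt (real n) * 0) (\<bar>sqrt (real n)\<bar> * (1 / sqrt (real n))))"
        by (rule normal_density_affine[OF dX]) (use p n in auto)
      then have "distributed P lborel (\<lambda>\<omega>. sqrt (real n) * X \<omega> (fst p) (snd p)) std_normal_density" using n by simp
      from distributed_distr_eq_density[OF this]
      show "distr P borel (\<lambda>\<omega>. sqrt (real n) * X \<omega> (fst p) (snd p)) = N01" by (simp cong: distr_cong)
    qed
    finally show ?thesis using sG by (simp cong: distr_cong)
  qed
  have law2: "distr P ?N T2 = ?N"
  proof -
    have "distr P (Pi\<^sub>M {..<m} (\<lambda>_. borel)) T2 = Pi\<^sub>M {..<m} (\<lambda>i. distr P borel (\<lambda>\<omega>. \<xi> \<omega> i))"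
      using iN unfolding T2_def by (subst (asm) indep_vars_iff_distr_eq_PiM') (use m xm in \<open>auto simp: lessThan_empty_iff\<close>)
    also have "\<dots> = ?N" by (rule PiM_cong) (use xd in auto)
    finally show ?thesis using sN by (simp cong: distr_cong)
  qed
  interpret G: prob_space ?G by (rule prob_space_gauss)
  interpret Nn: prob_space ?N by (rule prob_space_PiM) (rule N)
  have "?G \<Otimes>\<^sub>M ?N = ?D"
  proof (rule pair_measure_eqI)
    show "sigma_finite_measure ?G" "sigma_finite_measure ?N" by unfold_locales
    show "sets (?G \<Otimes>\<^sub>M ?N) = sets ?D" by simp
    fix A B assume A: "A \<in> sets ?G" and B: "B \<in> sets ?N"
    have T12: "(\<lambda>\<omega>. (T1 \<omega>, T2 \<omega>)) \<in> P \<rightarrow>\<^sub>M ?G \<Otimes>\<^sub>M ?N" by (rule measurable_Pair[OF T1 T2])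
    define A' where "A' = T1 -` A \<inter> space P"
    define B' where "B' = T2 -` B \<inter> space P"
    have "A' = R1 -` (S -` A \<inter> space (Pi\<^sub>M ?blk (\<lambda>_. borel))) \<inter> space P"
    proof (rule set_eqI)
      fix \<omega>
      show "\<omega> \<in> A' \<longleftrightarrow> \<omega> \<in> R1 -` (S -` A \<inter> space (Pi\<^sub>M ?blk (\<lambda>_. borel))) \<inter> space P"
        using measurable_space[OF R1, of \<omega>] unfolding A'_def T1S by blast
    qed
    then have A': "A' \<in> sets (vimage_algebra (space P) R1 (Pi\<^sub>M ?blk (\<lambda>_. borel)))"
      using in_vimage_algebra[OF measurable_sets[OF S A[unfolded sG]]] by simp
    have B': "B' \<in> sets (vimage_algebra (space P) T2 (Pi\<^sub>M {..<m} (\<lambda>_. borel)))"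
      unfolding B'_def by (rule in_vimage_algebra[OF B[unfolded sN]])
    have eAB: "(\<lambda>\<omega>. (T1 \<omega>, T2 \<omega>)) -` (A \<times> B) \<inter> space P = A' \<inter> B'" unfolding A'_def B'_def by blast
    have "emeasure ?D (A \<times> B) = emeasure P (A' \<inter> B')"
      using emeasure_distr[OF T12 pair_measureI[OF A B]] unfolding eAB .
    also have "\<dots> = ennreal (prob A') * ennreal (prob B')"
      using indep_setD[OF ind A' B'] by (simp add: emeasure_eq_measure ennreal_mult)
    also have "\<dots> = emeasure (distr P ?G T1) A * emeasure (distr P ?N T2) B"
      using A B T1 T2 by (simp add: emeasure_distr A'_def B'_def emeasure_eq_measure)
    finally show "emeasure ?G A * emeasure ?N B = emeasure ?D (A \<times> B)" unfolding law1 law2 by simp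
  qed
  then show "?D = ?G \<Otimes>\<^sub>M ?N" ..
qed

context cgmt
begin

lemma all_ok_cong:
  assumes "\<And>i j. i < m \<Longrightarrow> j < n \<Longrightarrow> y (i, j) = y' (i, j)" "\<And>i. i < m \<Longrightarrow> \<xi> i = \<xi>' i"
  shows "all_ok y \<xi> = all_ok y' \<xi>'"
  unfolding all_ok_def good_xi_def
  using vnorm_cong[of m \<xi> \<xi>'] low_ok_cong[of "\<lambda>i j. y (i, j)" "\<lambda>i j. y' (i, j)" \<xi> \<xi>']
    up_ok_cong[of "\<lambda>i j. y (i, j)" "\<lambda>i j. y' (i, j)" \<xi> \<xi>'] assms by simp

definition px :: "real measure \<Rightarrow> real" where
  "px N = measure (Pi\<^sub>M {..<m} (\<lambda>_. N)) {x \<in> space (Pi\<^sub>M {..<m} (\<lambda>_. N)). \<not> good_xi x}"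

text \<open>The Gordon bounds hold for each fixed noise vector satisfying \<open>good_xi\<close>.
  Since design and noise are independent, Fubini carries them over, and exceptional noise vectors
  contribute \<open>px N\<close>.\<close>

lemma all_ok_prob:
  fixes X :: "'a \<Rightarrow> nat \<Rightarrow> nat \<Rightarrow> real" and \<xi> :: "'a \<Rightarrow> nat \<Rightarrow> real"
  assumes model: "gaussian_linear_model P m n X \<xi> N"
    and N: "prob_space N" "sets N = sets borel"
  shows "measure P {\<omega> \<in> space P. \<not> all_ok (\<lambda>p. sqrt (real n) * X \<omega> (fst p) (snd p)) (\<xi> \<omega>)} \<le> px N + 2 * (pB + pz)" (is "measure P ?E \<le> _")
    "{\<omega> \<in> space P. \<not> all_ok (\<lambda>p. sqrt (real n) * X \<omega> (fst p) (snd p)) (\<xi> \<omega>)} \<in> sets P"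
proof -
  define T1 where "T1 = (\<lambda>\<omega>. \<lambda>p\<in>blk. sqrt (real n) * X \<omega> (fst p) (snd p))"
  define T2 where "T2 = (\<lambda>\<omega>. \<lambda>i\<in>{..<m}. \<xi> \<omega> i)"
  let ?G = "gauss blk" and ?N = "Pi\<^sub>M {..<m} (\<lambda>_. N)"
  have law: "distr P (?G \<Otimes>\<^sub>M ?N) (\<lambda>\<omega>. (T1 \<omega>, T2 \<omega>)) = ?G \<Otimes>\<^sub>M ?N"
    "T1 \<in> P \<rightarrow>\<^sub>M ?G" "T2 \<in> P \<rightarrow>\<^sub>M ?N"
    unfolding T1_def T2_def by (rule gaussian_linear_model_law[OF model n m N])+
  interpret Nn: prob_space ?N by (rule prob_space_PiM) (rule N)
  have xN: "(\<lambda>x. x i) \<in> borel_measurable ?N" if "i < m" for i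
    using measurable_component_singleton[of i "{..<m}" "\<lambda>_. N"] that measurable_cong_sets[OF refl N(2), of ?N] by auto
  have xG: "(\<lambda>y. y (i, j)) \<in> borel_measurable ?G" if "i < m" "j < n" for i j
    by (rule measurable_gauss_coord) (use that in simp)
  let ?R = "{p \<in> space (?G \<Otimes>\<^sub>M ?N). \<not> all_ok (fst p) (snd p)}"
  have R: "?R \<in> sets (?G \<Otimes>\<^sub>M ?N)"
    by (intro sets_all_ok measurable_compose[OF measurable_fst xG] measurable_compose[OF measurable_snd xN])
  have B: "{x \<in> space ?N. \<not> good_xi x} \<in> sets ?N"
  proof -
    have [measurable]: "vnorm m \<in> borel_measurable ?N" by (rule measurable_vnorm) (rule xN)
    show ?thesis unfolding good_xi_def by measurable
  qed
  have T12: "(\<lambda>\<omega>. (T1 \<omega>, T2 \<omega>)) \<in> P \<rightarrow>\<^sub>M ?G \<Otimes>\<^sub>M ?N" by (rule measurable_Pair[OF law(2,3)])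
  have e: "(\<lambda>\<omega>. (T1 \<omega>, T2 \<omega>)) -` ?R \<inter> space P = ?E"
  proof -
    have "all_ok (T1 \<omega>) (T2 \<omega>) = all_ok (\<lambda>p. sqrt (real n) * X \<omega> (fst p) (snd p)) (\<xi> \<omega>)" for \<omega>
      by (rule all_ok_cong) (simp_all add: T1_def T2_def)
    then show ?thesis using measurable_space[OF T12] by auto
  qed
  show "?E \<in> sets P" using measurable_sets[OF T12 R] unfolding e .
  have c: "2 * (pB + pz) \<ge> 0" using pos by (simp add: pB_def pz_def ph_def pg_def)
  have "measure P ?E = measure (?G \<Otimes>\<^sub>M ?N) ?R" using measure_distr[OF T12 R] unfolding e law(1) by simp
  also have "\<dots> \<le> px N + 2 * (pB + pz)" unfolding px_def
    by (rule measure_pair_le[OF prob_space_gauss Nn.prob_space_axioms R B c]) (rule all_ok_prob_block, simp)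
  finally show "measure P ?E \<le> px N + 2 * (pB + pz)" .
qed

text \<open>A near minimizer beyond the outer sphere is joined to the good point \<open>w'\<close> by a segment along which
  the loss stays small; the segment crosses the sphere, where the loss is large.\<close>

lemma near_min_localized:
  assumes ok: "good_xi \<xi>" "low_ok A \<xi>" "up_ok A \<xi>" and nu: "\<nu> \<in> K"
    and near: "(vnorm m (\<lambda>i. mat_vec n A (ndis n \<mu> \<nu>) i - \<xi> i))\<^sup>2 / real m
      \<le> (INF \<nu>\<in>K. (vnorm m (\<lambda>i. mat_vec n A (ndis n \<mu> \<nu>) i - \<xi> i))\<^sup>2 / real m) + sl"
    and sl: "sl \<le> \<phi> * \<gamma> * b\<^sup>2"
  shows "\<bar>vnorm n (ndis n \<mu> \<nu>) - r\<bar> < \<epsilon> * b"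
proof -
  define F where "F w = vnorm m (\<lambda>i. mat_vec n A w i - \<xi> i)" for w
  let ?S = "{w. \<exists>\<nu>\<in>K. w = ndis n \<mu> \<nu> \<and> vnorm n w \<le> r + \<epsilon> * b \<and> \<bar>vnorm n w - r\<bar> \<ge> \<epsilon> * b}"
  define q where "q = \<gamma> * b\<^sup>2"
  define c where "c = sm * (\<Phi> \<xi> + 13/4 * q)"
  have q: "q > 0" using pos bpos by (simp add: q_def)
  have Ph: "\<Phi> \<xi> \<ge> \<phi>" using phi[folded \<tau>_def, folded l0_def] ok(1) by (simp add: \<Phi>_def good_xi_def)
  have low: "c \<le> F w" if "w \<in> ?S" for w
  proof (rule ccontr)
    assume "\<not> c \<le> F w"
    then have "F w < c" by simp
    moreover have "continuous_on UNIV F" unfolding F_def by (intro continuous_intros)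
    ultimately have "\<exists>w\<in>TS. F w < c" using dense_inD(3)[OF TS _ that] by blast
    then show False using ok(2) unfolding low_ok_def F_def c_def q_def by (auto simp: mult.assoc not_le[symmetric])
  qed
  obtain w' where w': "w' \<in> TU" "F w' < sm * (\<Phi> \<xi> + 9/4 * q)"
    using ok(3) unfolding up_ok_def F_def q_def by (auto simp: mult.assoc)
  obtain \<nu>' where nu': "\<nu>' \<in> K" "w' = ndis n \<mu> \<nu>'" "vnorm n w' \<le> r + \<epsilon> * b" using dense_inD(2)[OF TU] w'(1) by auto
  define w where "w = ndis n \<mu> \<nu>"
  have F0: "F w \<ge> 0" for w by (simp add: F_def)
  have w'c: "F w' < c"
  proof -
    have "sm * (\<Phi> \<xi> + 9/4 * q) \<le> c" unfolding c_def using q smpos by (intro mult_left_mono) auto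
    then show ?thesis using w'(2) by linarith
  qed
  \<comment> \<open>The value \<open>\<Phi> \<xi> \<ge> \<phi>\<close> turns the gap
    \<open>q\<close> between norms into a gap of at least \<open>2 * \<Phi> \<xi> * q\<close>
    between squares, while the slack is at most \<open>\<Phi> \<xi> * q\<close>. This is where (R2),
    through \<open>\<phi> > 0\<close>, takes effect.\<close>
  have wc: "F w < c"
  proof -
    have "bdd_below ((\<lambda>\<nu>. (F (ndis n \<mu> \<nu>))\<^sup>2 / real m) ` K)" by (rule bdd_belowI[of _ 0]) auto
    then have "(INF \<nu>\<in>K. (F (ndis n \<mu> \<nu>))\<^sup>2 / real m) \<le> (F w')\<^sup>2 / real m"
      unfolding nu'(2) by (rule cINF_lower[OF _ nu'(1)])
    then have 1: "(F w)\<^sup>2 / real m \<le> (F w')\<^sup>2 / real m + sl" using near unfolding F_def w_def by linarith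
    have "(F w')\<^sup>2 < (sm * (\<Phi> \<xi> + 9/4 * q))\<^sup>2" by (rule power_strict_mono[OF w'(2) F0]) simp
    also have "\<dots> = real m * (\<Phi> \<xi> + 9/4 * q)\<^sup>2" by (simp add: power_mult_distrib)
    finally have "(F w')\<^sup>2 / real m < (\<Phi> \<xi> + 9/4 * q)\<^sup>2" using m by (simp add: pos_divide_less_eq mult.commute)
    moreover have "sl \<le> \<Phi> \<xi> * q" using sl mult_right_mono[OF Ph, of q] q by (simp add: q_def mult.assoc)
    moreover have "(\<Phi> \<xi> + 13/4 * q)\<^sup>2 = (\<Phi> \<xi> + 9/4 * q)\<^sup>2 + 2 * (\<Phi> \<xi> * q) + 11/2 * (q * q)"
      by (simp add: power2_eq_square algebra_simps)
    moreover have "q * q > 0" "\<Phi> \<xi> * q > 0" using q Ph pos by auto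
    ultimately have "(F w)\<^sup>2 / real m < (\<Phi> \<xi> + 13/4 * q)\<^sup>2" using 1 by linarith
    then have "(F w)\<^sup>2 < real m * (\<Phi> \<xi> + 13/4 * q)\<^sup>2" using m by (simp add: pos_divide_less_eq mult.commute)
    also have "\<dots> = c\<^sup>2" by (simp add: power_mult_distrib c_def)
    finally show ?thesis
      by (rule power2_less_imp_less) (use Ph pos q in \<open>simp add: c_def\<close>)
  qed
  have s': "vnorm n w' < r + \<epsilon> * b"
  proof -
    have "\<not> \<bar>vnorm n w' - r\<bar> \<ge> \<epsilon> * b" using low[of w'] w'c nu' by auto
    then show ?thesis by linarith
  qed
  have "vnorm n w \<le> r + \<epsilon> * b"
  proof (rule ccontr)
    assume big: "\<not> vnorm n w \<le> r + \<epsilon> * b"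
    define z where "z t = (\<lambda>i. w' i + t * (w i - w' i))" for t
    have z01: "z 0 = w'" "z 1 = w" by (simp_all add: z_def)
    \<comment> \<open>The crossing point has norm exactly \<open>r + \<epsilon> * b\<close>, hence
      distance \<open>\<epsilon> * b\<close> from the radius \<open>r\<close>, and belongs to the
      region of large loss.\<close>
    have "continuous_on {0..1} (\<lambda>t. vnorm n (z t))" unfolding z_def vnorm_def L2_set_def by (intro continuous_intros)
    then have "\<exists>t\<ge>0. t \<le> 1 \<and> vnorm n (z t) = r + \<epsilon> * b"
      using IVT'[of "\<lambda>t. vnorm n (z t)" 0 "r + \<epsilon> * b" 1] s' big unfolding z01 by simp
    then obtain t where t: "0 \<le> t" "t \<le> 1" "vnorm n (z t) = r + \<epsilon> * b" by blast
    obtain \<nu>'' where nu'': "\<nu>'' \<in> K" "z t = ndis n \<mu> \<nu>''"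
      using ndis_convex[OF nu'(1) nu t(1,2)] unfolding z_def nu'(2) w_def by blast
    have "z t \<in> ?S" using nu'' t(3) pos bpos by (auto intro!: bexI[of _ \<nu>''])
    then have "c \<le> F (z t)" by (rule low)
    also have "F (z t) = vnorm m (\<lambda>i. (mat_vec n A w' i - \<xi> i) + t * ((mat_vec n A w i - \<xi> i) - (mat_vec n A w' i - \<xi> i)))"
      unfolding F_def z_def mat_vec_segment by (simp add: algebra_simps)
    also have "\<dots> \<le> (1 - t) * F w' + t * F w" unfolding F_def by (rule vnorm_segment[OF t(1,2)])
    also have "\<dots> < c"
    proof (cases "t = 0")
      case False
      have "(1 - t) * F w' \<le> (1 - t) * c" using w'c t by (intro mult_left_mono) auto
      moreover have "t * F w < t * c" using wc t False by (intro mult_strict_left_mono) auto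
      ultimately show ?thesis by (simp add: left_diff_distrib)
    qed (use w'c in simp)
    finally show False by simp
  qed
  moreover have "\<not> (vnorm n w \<le> r + \<epsilon> * b \<and> \<bar>vnorm n w - r\<bar> \<ge> \<epsilon> * b)" using low[of w] wc nu unfolding w_def by auto
  ultimately show ?thesis unfolding w_def by auto
qed

lemma sq_loss_ndis:
  assumes Y: "\<And>i. i < m \<Longrightarrow> Y i = mat_vec n X \<mu> i + \<xi> i"
  shows "sq_loss m n X Y \<nu> = (vnorm m (\<lambda>i. mat_vec n (\<lambda>i j. sqrt (real n) * X i j) (ndis n \<mu> \<nu>) i - \<xi> i))\<^sup>2 / real m"
proof -
  have "vnorm m (\<lambda>i. Y i - mat_vec n X \<nu> i) = vnorm m (\<lambda>i. - 1 * (mat_vec n (\<lambda>i j. sqrt (real n) * X i j) (ndis n \<mu> \<nu>) i - \<xi> i))"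
  proof (rule vnorm_cong)
    fix i assume i: "i < m"
    have "mat_vec n (\<lambda>i j. sqrt (real n) * X i j) (ndis n \<mu> \<nu>) i = mat_vec n X (\<lambda>j. \<nu> j - \<mu> j) i"
      using n by (simp add: mat_vec_def ndis_def)
    then show "Y i - mat_vec n X \<nu> i = - 1 * (mat_vec n (\<lambda>i j. sqrt (real n) * X i j) (ndis n \<mu> \<nu>) i - \<xi> i)"
      unfolding mat_vec_diff by (simp add: Y[OF i])
  qed
  then show ?thesis unfolding sq_loss_def vnorm_scale by (simp add: power_mult_distrib)
qed

end

section \<open>Asymptotics\<close>

lemma tendsto_coordinate:
  fixes p :: "'b \<Rightarrow> 'i::countable \<Rightarrow> real"
  assumes "(p \<longlongrightarrow> x) F"
  shows "((\<lambda>j. p j i) \<longlongrightarrow> x i) F"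
  using continuous_on_tendsto_compose[OF continuous_on_product_coordinates[of i] assms] by simp

lemma tangent_cone_iff:
  "x \<in> tangent_cone n K \<mu> \<longleftrightarrow> (\<forall>i\<ge>n. x i = 0) \<and>
     (\<exists>s. (\<forall>j. s j \<in> {(\<lambda>i. \<alpha> * (\<nu> i - \<mu> i)) | \<alpha> \<nu>. \<alpha> \<ge> 0 \<and> \<nu> \<in> K} \<and> (\<forall>i\<ge>n. s j i = 0)) \<and> s \<longlonglongrightarrow> x)"
proof -
  let ?C = "{(\<lambda>i. \<alpha> * (\<nu> i - \<mu> i)) | \<alpha> \<nu>. \<alpha> \<ge> 0 \<and> \<nu> \<in> K}" and ?E = "{x::nat \<Rightarrow> real. \<forall>i\<ge>n. x i = 0}"
  have eq: "tangent_cone n K \<mu> = ?E \<inter> closure (?E \<inter> ?C)"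
    unfolding tangent_cone_def Euclidean_space_def closure_of_subtopology
    by (simp add: euclidean_product_topology euclidean_closure_of)
  have "x \<in> ?E \<inter> closure (?E \<inter> ?C) \<longleftrightarrow> (\<forall>i\<ge>n. x i = 0) \<and> (\<exists>s. (\<forall>j. s j \<in> ?E \<inter> ?C) \<and> s \<longlonglongrightarrow> x)"
    unfolding Int_iff[of x] closure_sequential mem_Collect_eq ..
  also have "\<dots> \<longleftrightarrow> (\<forall>i\<ge>n. x i = 0) \<and> (\<exists>s. (\<forall>j. s j \<in> ?C \<and> (\<forall>i\<ge>n. s j i = 0)) \<and> s \<longlonglongrightarrow> x)"
    unfolding Int_iff mem_Collect_eq[of _ "\<lambda>x. \<forall>i\<ge>n. x i = 0"] conj_commute[of "\<forall>i\<ge>n. _ i = 0"] ..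
  finally show ?thesis unfolding eq .
qed

text \<open>The generating set is already convex, and convex combinations pass to limits
  coordinatewise by the sequential description of the closure.\<close>

lemma tangent_cone_closed_convex:
  assumes K: "closed_convex n K"
  shows "closed_convex n (tangent_cone n K \<mu>)"
  unfolding closed_convex_def
proof (intro conjI ballI)
  show "closedin (Euclidean_space n) (tangent_cone n K \<mu>)" unfolding tangent_cone_def by (rule closedin_closure_of)
  let ?C = "{(\<lambda>i. \<alpha> * (\<nu> i - \<mu> i)) | \<alpha> \<nu>. \<alpha> \<ge> 0 \<and> \<nu> \<in> K}"
  fix x y and t :: real assume x: "x \<in> tangent_cone n K \<mu>" and y: "y \<in> tangent_cone n K \<mu>" and t: "t \<in> {0..1}"
  have C: "(\<lambda>i. (1 - t) * a i + t * b i) \<in> ?C" if a: "a \<in> ?C" and b: "b \<in> ?C" for a b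
  proof -
    obtain \<alpha> \<nu> where 1: "a = (\<lambda>i. \<alpha> * (\<nu> i - \<mu> i))" "\<alpha> \<ge> 0" "\<nu> \<in> K" using a by auto
    obtain \<beta> \<nu>' where 2: "b = (\<lambda>i. \<beta> * (\<nu>' i - \<mu> i))" "\<beta> \<ge> 0" "\<nu>' \<in> K" using b by auto
    define c where "c = (1 - t) * \<alpha> + t * \<beta>"
    have nn: "(1 - t) * \<alpha> \<ge> 0" "t * \<beta> \<ge> 0" using t 1 2 by auto
    show ?thesis
    proof (cases "c = 0")
      case True
      then have "(1 - t) * \<alpha> = 0" "t * \<beta> = 0" using nn unfolding c_def by linarith+
      then have "(\<lambda>i. (1 - t) * a i + t * b i) = (\<lambda>i. 0 * (\<nu> i - \<mu> i))" unfolding 1 2 by auto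
      then show ?thesis using 1(3) by (intro CollectI exI[of _ 0] exI[of _ \<nu>]) simp
    next
      case False
      then have c: "c > 0" using nn unfolding c_def by linarith
      \<comment> \<open>A combination of two rays is a ray again: its length is \<open>c\<close>,
        and \<open>u\<close> is the weight of \<open>\<nu>'\<close> in the new point of
        \<open>K\<close>. Length zero is treated separately.\<close>
      define u where "u = t * \<beta> / c"
      have u: "0 \<le> u" "u \<le> 1" using nn c by (auto simp: u_def c_def)
      have cu: "c * u = t * \<beta>" "c * (1 - u) = (1 - t) * \<alpha>" using c by (auto simp: u_def right_diff_distrib) (simp add: c_def)
      have "(\<lambda>i. (1 - u) * \<nu> i + u * \<nu>' i) \<in> K" by (rule closed_convexD(3)[OF K 1(3) 2(3) u])
      moreover have "(\<lambda>i. (1 - t) * a i + t * b i) = (\<lambda>i. c * (((1 - u) * \<nu> i + u * \<nu>' i) - \<mu> i))"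
      proof
        fix i
        have "c * (((1 - u) * \<nu> i + u * \<nu>' i) - \<mu> i) = (c * (1 - u)) * (\<nu> i - \<mu> i) + (c * u) * (\<nu>' i - \<mu> i)" by (simp add: algebra_simps)
        then show "(1 - t) * a i + t * b i = c * (((1 - u) * \<nu> i + u * \<nu>' i) - \<mu> i)" unfolding cu 1(1) 2(1) by simp
      qed
      ultimately show ?thesis using c by (intro CollectI exI[of _ c] exI[of _ "\<lambda>i. (1 - u) * \<nu> i + u * \<nu>' i"]) simp
    qed
  qed
  obtain p where p: "\<And>j. p j \<in> ?C" "\<And>j i. i \<ge> n \<Longrightarrow> p j i = 0" "p \<longlonglongrightarrow> x" and x0: "\<forall>i\<ge>n. x i = 0"
    using x unfolding tangent_cone_iff by blast
  obtain q where q: "\<And>j. q j \<in> ?C" "\<And>j i. i \<ge> n \<Longrightarrow> q j i = 0" "q \<longlonglongrightarrow> y" and y0: "\<forall>i\<ge>n. y i = 0"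
    using y unfolding tangent_cone_iff by blast
  have cw: "(\<lambda>j. p j i) \<longlonglongrightarrow> x i" "(\<lambda>j. q j i) \<longlonglongrightarrow> y i" for i
    by (rule tendsto_coordinate[OF p(3)], rule tendsto_coordinate[OF q(3)])
  have "(\<lambda>j i. (1 - t) * p j i + t * q j i) \<longlonglongrightarrow> (\<lambda>i. (1 - t) * x i + t * y i)"
    by (intro tendsto_funI tendsto_intros cw)
  moreover have "(\<lambda>i. (1 - t) * p j i + t * q j i) \<in> ?C \<and> (\<forall>i\<ge>n. (1 - t) * p j i + t * q j i = 0)" for j
    using C[OF p(1) q(1), of j j] p(2) q(2) by simp
  ultimately show "(\<lambda>i. (1 - t) * x i + t * y i) \<in> tangent_cone n K \<mu>"
    unfolding tangent_cone_iff using x0 y0 by (intro conjI exI[of _ "\<lambda>j i. (1 - t) * p j i + t * q j i"]) auto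
qed

lemma tangent_cone_scale:
  assumes x: "x \<in> tangent_cone n K \<mu>" and c: "c \<ge> 0"
  shows "(\<lambda>i. c * x i) \<in> tangent_cone n K \<mu>"
proof -
  let ?C = "{(\<lambda>i. \<alpha> * (\<nu> i - \<mu> i)) | \<alpha> \<nu>. \<alpha> \<ge> 0 \<and> \<nu> \<in> K}"
  obtain p where p: "\<And>j. p j \<in> ?C" "\<And>j i. i \<ge> n \<Longrightarrow> p j i = 0" "p \<longlonglongrightarrow> x" and x0: "\<forall>i\<ge>n. x i = 0"
    using x unfolding tangent_cone_iff by blast
  have cw: "(\<lambda>j. p j i) \<longlonglongrightarrow> x i" for i by (rule tendsto_coordinate[OF p(3)])
  have "(\<lambda>i. c * p j i) \<in> ?C" for j
  proof -
    obtain \<alpha> \<nu> where "p j = (\<lambda>i. \<alpha> * (\<nu> i - \<mu> i))" "\<alpha> \<ge> 0" "\<nu> \<in> K" using p(1)[of j] by auto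
    then show ?thesis using c by (intro CollectI exI[of _ "c * \<alpha>"] exI[of _ \<nu>]) (simp add: mult.assoc)
  qed
  moreover have "(\<lambda>j i. c * p j i) \<longlonglongrightarrow> (\<lambda>i. c * x i)" by (intro tendsto_funI tendsto_intros cw)
  ultimately show ?thesis unfolding tangent_cone_iff using x0 p(2)
    by (intro conjI exI[of _ "\<lambda>j i. c * p j i"]) auto
qed

text \<open>Scaling by \<open>t\<close> maps the cone onto itself and multiplies all distances by
  \<open>t\<close>.\<close>

lemma metric_proj_cone_scale:
  assumes T: "closed_convex n T" "T \<noteq> {}" and cone: "\<And>x c. x \<in> T \<Longrightarrow> c \<ge> 0 \<Longrightarrow> (\<lambda>i. c * x i) \<in> T" and t: "t > 0"
  shows "metric_proj n T (\<lambda>i. t * h i) = (\<lambda>i. t * metric_proj n T h i)"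
proof (rule metric_proj_eqI[OF T(1)])
  show "(\<lambda>i. t * metric_proj n T h i) \<in> T" using t by (intro cone metric_proj_in(1)[OF T]) simp
  fix y assume y: "y \<in> T"
  have "vnorm n (\<lambda>i. t * h i - t * metric_proj n T h i) = t * vnorm n (\<lambda>i. h i - metric_proj n T h i)"
    using vnorm_scale[of n t "\<lambda>i. h i - metric_proj n T h i"] t by (simp add: right_diff_distrib)
  also have "\<dots> \<le> t * vnorm n (\<lambda>i. h i - 1 / t * y i)"
    using t y by (intro mult_left_mono metric_proj_in(2)[OF T] cone) auto
  also have "\<dots> = vnorm n (\<lambda>i. t * h i - y i)"
    using vnorm_scale[of n t "\<lambda>i. h i - 1 / t * y i"] t by (simp add: right_diff_distrib)
  finally show "vnorm n (\<lambda>i. t * h i - t * metric_proj n T h i) \<le> vnorm n (\<lambda>i. t * h i - y i)" .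
qed

text \<open>For a cone the quotient in \<open>stat_dim\<close> does not depend on the noise level,
  so the limit exists and equals a nonnegative integral. Without an existing limit
  \<open>Lim\<close> would have no usable value.\<close>

lemma log_factor_ge:
  assumes K: "closed_convex n K" and mu: "\<mu> \<in> K"
  shows "log_factor n K \<mu> \<ge> ln (ln (16 * real n))"
proof -
  let ?T = "tangent_cone n K \<mu>"
  have T: "closed_convex n ?T" by (rule tangent_cone_closed_convex[OF K])
  have "(\<lambda>_. 0) \<in> ?T" unfolding tangent_cone_iff using mu
    by (intro conjI exI[of _ "\<lambda>_ _. 0"]) (auto intro!: exI[of _ 0])
  then have ne: "?T \<noteq> {}" by blast
  define d where "d = (\<integral>h. (vnorm n (metric_proj n ?T h))\<^sup>2 \<partial>std_gaussian n)"
  have "(\<integral>h. (vnorm n (metric_proj n ?T (\<lambda>i. \<tau> * h i)))\<^sup>2 \<partial>std_gaussian n) / \<tau>\<^sup>2 = d" if "\<tau> > 0" for \<tau>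
  proof -
    have "metric_proj n ?T (\<lambda>i. \<tau> * h i) = (\<lambda>i. \<tau> * metric_proj n ?T h i)" for h
      by (rule metric_proj_cone_scale[OF T ne _ that]) (rule tangent_cone_scale)
    then show ?thesis using that by (simp add: vnorm_scale power_mult_distrib d_def)
  qed
  then have "((\<lambda>\<tau>. (\<integral>h. (vnorm n (metric_proj n ?T (\<lambda>i. \<tau> * h i)))\<^sup>2 \<partial>std_gaussian n) / \<tau>\<^sup>2) \<longlongrightarrow> d) at_top"
    by (intro tendsto_eventually eventually_mono[OF eventually_gt_at_top[of 0]])
  then have "stat_dim n ?T = d" unfolding stat_dim_def by (intro tendsto_Lim) simp
  moreover have "d \<ge> 0" unfolding d_def by simp
  ultimately show ?thesis by (simp add: log_factor_def)
qed

lemma aux_good_mono: "aux_good k' \<sigma> r b l0 v p l G x \<Longrightarrow> k' \<le> k \<Longrightarrow> b \<ge> 0 \<Longrightarrow> aux_good k \<sigma> r b l0 v p l G x"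
  unfolding aux_good_def using mult_right_mono[of k' k b] mult_right_mono[of k' k "b\<^sup>2"] by (auto intro: order_trans)

text \<open>Since \<open>l0 + r\<^sup>2 = 2 * r\<^sup>2 + (l0 - r\<^sup>2)\<close>, the bound in (R2) makes the value of the auxiliary problem
  positive.\<close>
lemma aux_min_pos:
  assumes sg: "\<sigma> > 0" and r: "0 < r" "r \<le> M" and e: "\<eta> > 0" and l0: "(l0 - r\<^sup>2) / (2 * \<sigma>\<^sup>2) \<le> 1 - \<eta>"
    and v: "\<bar>v - \<sigma>\<^sup>2\<bar> \<le> k" and k: "k \<le> \<sigma>^3 * \<eta> / (4 * (M + \<sigma>))" "k \<le> \<sigma>\<^sup>2"
  shows "\<sigma>\<^sup>2 * \<eta> / (4 * (M + \<sigma>)) \<le> aux_min \<sigma> r l0 v"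
proof -
  define D where "D = sqrt (r\<^sup>2 + \<sigma>\<^sup>2)"
  have D: "D > 0" "D\<^sup>2 = r\<^sup>2 + \<sigma>\<^sup>2" "D \<ge> \<sigma>" using sg r by (auto simp: D_def add_pos_pos real_le_rsqrt)
  have DM: "D \<le> M + \<sigma>" 
  proof -
    have "r\<^sup>2 \<le> M\<^sup>2" using r by (intro power_mono) auto
    moreover have "M * \<sigma> \<ge> 0" using sg r by simp
    moreover have "(M + \<sigma>)\<^sup>2 = M\<^sup>2 + \<sigma>\<^sup>2 + 2 * (M * \<sigma>)" by (simp add: power2_sum)
    ultimately have "r\<^sup>2 + \<sigma>\<^sup>2 \<le> (M + \<sigma>)\<^sup>2" by linarith
    then show ?thesis unfolding D_def using sg r by (intro real_le_lsqrt) auto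
  qed
  have "\<bar>sqrt (r\<^sup>2 + v) - D\<bar> \<le> \<bar>(r\<^sup>2 + v) - (r\<^sup>2 + \<sigma>\<^sup>2)\<bar> / \<sigma>"
    unfolding D_def by (rule sqrt_diff_le) (use sg v k r in \<open>auto simp: abs_le_iff intro: add_nonneg_nonneg\<close>)
  also have "\<dots> \<le> k / \<sigma>" using v sg by (intro divide_right_mono) auto
  also have "\<dots> \<le> (\<sigma>^3 * \<eta> / (4 * (M + \<sigma>))) / \<sigma>" using k sg by (intro divide_right_mono) auto
  also have "\<dots> = \<sigma>\<^sup>2 * \<eta> / (4 * (M + \<sigma>))" using sg r by (simp add: power3_eq_cube power2_eq_square)
  finally have 1: "sqrt (r\<^sup>2 + v) \<ge> D - \<sigma>\<^sup>2 * \<eta> / (4 * (M + \<sigma>))" by linarith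
  have "l0 - r\<^sup>2 \<le> (1 - \<eta>) * (2 * \<sigma>\<^sup>2)" using l0 sg by (simp add: pos_divide_le_eq)
  \<comment> \<open>Since \<open>2 * D\<^sup>2 = 2 * r\<^sup>2 + 2 * \<sigma>\<^sup>2\<close>, the
    margin \<open>\<eta>\<close> in (R2) leaves \<open>\<eta> * \<sigma>\<^sup>2 / D\<close>.
    Replacing \<open>\<sigma>\<^sup>2\<close> by \<open>v\<close> takes at most a quarter of its
    lower bound.\<close>
  then have "(l0 + r\<^sup>2) / (2 * D) \<le> (2 * D\<^sup>2 - 2 * \<eta> * \<sigma>\<^sup>2) / (2 * D)"
    using D by (intro divide_right_mono) (auto simp: algebra_simps)
  also have "\<dots> = D - \<eta> * \<sigma>\<^sup>2 / D"
  proof -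
    have "(2 * d\<^sup>2 - 2 * \<eta> * c) / (2 * d) = d - \<eta> * c / d" if "d > 0" for c d :: real
      using that by (simp add: field_simps power2_eq_square)
    then show ?thesis using D(1) .
  qed
  also have "\<dots> \<le> D - \<eta> * \<sigma>\<^sup>2 / (M + \<sigma>)" using DM D e by (intro diff_left_mono divide_left_mono) auto
  finally have 2: "(l0 + r\<^sup>2) / (2 * D) \<le> D - \<eta> * \<sigma>\<^sup>2 / (M + \<sigma>)" .
  define z where "z = \<sigma>\<^sup>2 * \<eta> / (M + \<sigma>)"
  have z: "z > 0" "\<eta> * \<sigma>\<^sup>2 / (M + \<sigma>) = z" "\<sigma>\<^sup>2 * \<eta> / (4 * (M + \<sigma>)) = z / 4" using sg r e by (auto simp: z_def)
  show ?thesis using 1 2 z unfolding aux_min_def D_def[symmetric] z(2,3) by linarith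
qed


section \<open>Failure probability of one instance and passage to the limit\<close>

lemma abs_sq_diff_le:
  fixes s r b \<epsilon> :: real
  assumes "\<bar>s - r\<bar> < \<epsilon> * b" "0 \<le> s" "0 < r" "r \<le> b" "0 < \<epsilon>" "\<epsilon> \<le> 1"
  shows "\<bar>s\<^sup>2 - r\<^sup>2\<bar> \<le> 3 * \<epsilon> * b\<^sup>2"
proof -
  have "\<epsilon> * b \<le> b" using assms by (simp add: mult_left_le_one_le)
  then have "s + r \<le> 3 * b" using assms by linarith
  then have "\<bar>s - r\<bar> * (s + r) \<le> (\<epsilon> * b) * (3 * b)" using assms by (intro mult_mono) auto
  moreover have "s\<^sup>2 - r\<^sup>2 = (s - r) * (s + r)" by (simp add: power2_eq_square algebra_simps)
  ultimately show ?thesis using assms by (simp add: abs_mult power2_eq_square mult_ac)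
qed

lemma sum_bound_arith:
  fixes B E S x h g c d a a' :: real
  assumes "B \<le> E + S" "E \<le> x + 2 * ((h + g + c) + d)" "h \<le> a" "a \<le> a'"
  shows "B \<le> x + 2 * g + (2 * a' + 2 * c + 2 * d) + S"
proof -
  have "2 * ((h + g + c) + d) = 2 * h + 2 * g + 2 * c + 2 * d" by (simp add: distrib_left)
  then have "B \<le> x + (2 * h + 2 * g + 2 * c + 2 * d) + S" using assms(1,2) by simp
  moreover have "2 * h \<le> 2 * a'" using assms(3,4) by simp
  ultimately show ?thesis by simp
qed

text \<open>Collects every source of failure in a form ready for the limit. The constant in front of
  \<open>1 / (real m * b\<^sup>2)\<close> depends only on \<open>M\<close>, \<open>\<sigma>\<close>,
  \<open>k\<close> and \<open>\<gamma>\<close>; the other terms are two laws of large numbers and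
  the slack.\<close>

lemma instance_bound:
  fixes P :: "'a measure" and X :: "'a \<Rightarrow> nat \<Rightarrow> nat \<Rightarrow> real" and \<xi> Y \<mu>hat :: "'a \<Rightarrow> nat \<Rightarrow> real"
  assumes n: "n \<ge> 1" and m: "m \<ge> 1" and K: "closed_convex n K" and mu: "\<mu> \<in> K"
    and pos: "\<sigma> > 0" "r > 0" "r \<le> b" "b \<le> M" "0 < \<epsilon>" "\<epsilon> \<le> 1" "0 < k" "k \<le> \<epsilon>" "\<gamma> > 0" "\<phi> > 0" "k \<le> k0"
    and sep: "\<forall>r b l0 v p l G x. 0 < r \<and> r \<le> b \<and> b \<le> M \<and> aux_good k0 \<sigma> r b l0 v p l G x \<longrightarrow>
     (\<forall>s. 0 \<le> s \<and> s \<le> r + \<epsilon> * b \<and> \<bar>s - r\<bar> \<ge> \<epsilon> * b \<and> s\<^sup>2 * G - 2 * s * x + v \<ge> 0 \<longrightarrow>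
        aux_min \<sigma> r l0 v + 4 * \<gamma> * b\<^sup>2 \<le> sqrt (s\<^sup>2 * G - 2 * s * x + v) - (l + 2 * s * p - p\<^sup>2) / (2 * sqrt (r\<^sup>2 + \<sigma>\<^sup>2))) \<and>
     (p\<^sup>2 * G - 2 * p * x + v \<ge> 0 \<longrightarrow>
        sqrt (p\<^sup>2 * G - 2 * p * x + v) - (l + p\<^sup>2) / (2 * sqrt (r\<^sup>2 + \<sigma>\<^sup>2)) \<le> aux_min \<sigma> r l0 v + \<gamma> * b\<^sup>2)"
    and phi: "\<And>v. \<bar>v - \<sigma>\<^sup>2\<bar> \<le> k \<Longrightarrow> \<phi> \<le> aux_min \<sigma> r (E_lrt n K \<mu> (noise_level \<sigma> (real m / real n) r) / real n) v"
    and fp: "E_err n K \<mu> (noise_level \<sigma> (real m / real n) r) / real n = r\<^sup>2"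
    and model: "gaussian_linear_model P m n X \<xi> N" and N: "prob_space N" "sets N = sets borel"
    and Y: "\<And>\<omega> i. \<omega> \<in> space P \<Longrightarrow> i < m \<Longrightarrow> Y \<omega> i = mat_vec n (X \<omega>) \<mu> i + \<xi> \<omega> i"
    and muhat: "\<And>\<omega>. \<omega> \<in> space P \<Longrightarrow> \<mu>hat \<omega> \<in> K"
    and near: "AE \<omega> in P. sq_loss m n (X \<omega>) (Y \<omega>) (\<mu>hat \<omega>) \<le> (INF \<nu>\<in>K. sq_loss m n (X \<omega>) (Y \<omega>) \<nu>) + slack \<omega>"
    and slack: "slack \<in> borel_measurable P"
  shows "measure P {\<omega> \<in> space P. \<bar>(vnorm n (\<lambda>i. \<mu>hat \<omega> i - \<mu> i))\<^sup>2 / real n - r\<^sup>2\<bar> > 3 * \<epsilon> * b\<^sup>2} \<le>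
    measure (Pi\<^sub>M {..<m} (\<lambda>_. N)) {x \<in> space (Pi\<^sub>M {..<m} (\<lambda>_. N)). \<not> \<bar>(vnorm m x)\<^sup>2 / real m - \<sigma>\<^sup>2\<bar> \<le> k} +
    2 * measure (gauss {..<m}) {x \<in> space (gauss {..<m}). \<not> \<bar>(vnorm m x)\<^sup>2 / real m - 1\<bar> \<le> k} +
    2 * ((10240 / k^8 + 20 / k\<^sup>2) * (M\<^sup>2 + \<sigma>\<^sup>2) + (\<sigma>\<^sup>2 + k) / k\<^sup>2 + 64 / \<gamma>\<^sup>2) / (real m * b\<^sup>2) +
    measure P {\<omega> \<in> space P. \<bar>slack \<omega>\<bar> > \<phi> * \<gamma> * \<bar>r\<^sup>2\<bar>}"
proof -
  interpret prob_space P using model by (simp add: gaussian_linear_model_def)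
  define l0 where "l0 = E_lrt n K \<mu> (noise_level \<sigma> (real m / real n) r) / real n"
  obtain TS where TS: "dense_in TS {w. \<exists>\<nu>\<in>K. w = ndis n \<mu> \<nu> \<and> vnorm n w \<le> r + \<epsilon> * b \<and> \<bar>vnorm n w - r\<bar> \<ge> \<epsilon> * b}"
    using dense_in_exists by blast
  obtain TU where TU: "dense_in TU {w. \<exists>\<nu>\<in>K. w = ndis n \<mu> \<nu> \<and> vnorm n w \<le> r + \<epsilon> * b}"
    using dense_in_exists by blast
  obtain U where U: "dense_sphere m U" using dense_sphere_exists by blast
  have b0: "b > 0" using pos by linarith
  \<comment> \<open>The separation was obtained for the tolerance \<open>k0\<close>. The smaller
    \<open>k\<close> also has to make the value of the auxiliary problem positive.\<close>
  have good: "0 < r \<and> r \<le> b \<and> b \<le> M \<and> aux_good k0 \<sigma> r b l0 v p l G x" if "aux_good k \<sigma> r b l0 v p l G x" for v p l G x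
    using aux_good_mono[OF that pos(11)] b0 pos by simp
  interpret C: cgmt n m K \<mu> \<sigma> r b \<epsilon> k \<gamma> \<phi> TS TU U
  proof (unfold_locales, goal_cases)
    case (14 v p l G x s)
    then show ?case using sep[rule_format, OF good[of v p l G x]] unfolding l0_def by blast
  next
    case (15 v p l G x)
    then show ?case using sep[rule_format, OF good[of v p l G x]] unfolding l0_def by blast
  next
    case (16 v)
    then show ?case by (rule phi)
  qed (fact n m K mu pos TS TU U)+
  let ?V = "\<lambda>\<omega>. (vnorm n (\<lambda>i. \<mu>hat \<omega> i - \<mu> i))\<^sup>2 / real n"
  let ?E = "{\<omega> \<in> space P. \<not> C.all_ok (\<lambda>p. sqrt (real n) * X \<omega> (fst p) (snd p)) (\<xi> \<omega>)}"
  let ?S = "{\<omega> \<in> space P. \<bar>slack \<omega>\<bar> > \<phi> * \<gamma> * \<bar>r\<^sup>2\<bar>}"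
  let ?B = "{\<omega> \<in> space P. \<bar>?V \<omega> - r\<^sup>2\<bar> > 3 * \<epsilon> * b\<^sup>2}"
  have Em: "?E \<in> events" by (rule C.all_ok_prob(2)[OF model N])
  have Sm: "?S \<in> events" using slack by measurable
  have key: "AE \<omega> in P. \<omega> \<in> ?B \<longrightarrow> \<omega> \<in> ?E \<union> ?S"
    using near AE_space
  proof eventually_elim
    fix \<omega> assume nm: "sq_loss m n (X \<omega>) (Y \<omega>) (\<mu>hat \<omega>) \<le> (INF \<nu>\<in>K. sq_loss m n (X \<omega>) (Y \<omega>) \<nu>) + slack \<omega>" and sp: "\<omega> \<in> space P"
    show "\<omega> \<in> ?B \<longrightarrow> \<omega> \<in> ?E \<union> ?S"
    proof (rule impI, rule ccontr)
      assume bad: "\<omega> \<in> ?B" and "\<omega> \<notin> ?E \<union> ?S"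
      then have ok: "C.all_ok (\<lambda>p. sqrt (real n) * X \<omega> (fst p) (snd p)) (\<xi> \<omega>)" and sl: "slack \<omega> \<le> \<phi> * \<gamma> * r\<^sup>2" using sp by auto
      have "r\<^sup>2 \<le> b\<^sup>2" using pos by (intro power_mono) auto
      then have "\<phi> * \<gamma> * r\<^sup>2 \<le> \<phi> * \<gamma> * b\<^sup>2" using pos by (intro mult_left_mono) auto
      with sl have sl: "slack \<omega> \<le> \<phi> * \<gamma> * b\<^sup>2" by linarith
      have eq: "sq_loss m n (X \<omega>) (Y \<omega>) \<nu> = (vnorm m (\<lambda>i. mat_vec n (\<lambda>i j. sqrt (real n) * X \<omega> i j) (ndis n \<mu> \<nu>) i - \<xi> \<omega> i))\<^sup>2 / real m" for \<nu>
        by (rule C.sq_loss_ndis) (rule Y[OF sp])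
      have "\<bar>vnorm n (ndis n \<mu> (\<mu>hat \<omega>)) - r\<bar> < \<epsilon> * b"
        using ok nm unfolding C.all_ok_def eq fst_conv snd_conv
        by (elim conjE) (rule C.near_min_localized[OF _ _ _ muhat[OF sp] _ sl])
      then have "\<bar>(vnorm n (ndis n \<mu> (\<mu>hat \<omega>)))\<^sup>2 - r\<^sup>2\<bar> \<le> 3 * \<epsilon> * b\<^sup>2" using pos by (intro abs_sq_diff_le) auto
      then show False using bad n by (simp add: vnorm_ndis power_divide)
    qed
  qed
  have "prob ?B \<le> prob (?E \<union> ?S)" by (rule finite_measure_mono_AE[OF key sets.Un[OF Em Sm]])
  also have "\<dots> \<le> prob ?E + prob ?S" by (rule measure_Un_le[OF Em Sm])
  finally have 1: "prob ?B \<le> prob ?E + prob ?S" .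
  have 2: "prob ?E \<le> C.px N + 2 * (C.pB + C.pz)" by (rule C.all_ok_prob(1)[OF model N])
  have 3: "C.ph \<le> (10240 / k^8 + 20 / k\<^sup>2) * (b\<^sup>2 + \<sigma>\<^sup>2) / (real m * b\<^sup>2)"
    by (rule C.ph_bound) (simp add: C.\<tau>_def fp)
  have "b\<^sup>2 \<le> M\<^sup>2" using pos b0 by (intro power_mono) auto
  then have 4: "(10240 / k^8 + 20 / k\<^sup>2) * (b\<^sup>2 + \<sigma>\<^sup>2) / (real m * b\<^sup>2) \<le> (10240 / k^8 + 20 / k\<^sup>2) * (M\<^sup>2 + \<sigma>\<^sup>2) / (real m * b\<^sup>2)"
    using pos by (intro divide_right_mono mult_left_mono) auto
  have 5: "(\<sigma>\<^sup>2 + k) / (real m * (k * b)\<^sup>2) = (\<sigma>\<^sup>2 + k) / k\<^sup>2 / (real m * b\<^sup>2)" "C.pz = 64 / \<gamma>\<^sup>2 / (real m * b\<^sup>2)"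
    by (simp_all add: C.pz_def power_mult_distrib mult_ac)
  have 6: "2 * (A + B + G) / d = 2 * (A / d) + 2 * (B / d) + 2 * (G / d)" for A B G d :: real
    by (simp add: add_divide_distrib)
  show ?thesis
    using sum_bound_arith[OF 1 2[unfolded C.pB_def 5] 3 4] unfolding 6 C.px_def C.good_xi_def C.pg_def C.good_g_def .
qed

lemma weak_law_vnorm:
  fixes \<nu> :: "real measure"
  assumes nu: "prob_space \<nu>" "sets \<nu> = sets borel" and sq: "integrable \<nu> (\<lambda>x. x\<^sup>2)" "(\<integral>x. x\<^sup>2 \<partial>\<nu>) = v" and e: "e > 0"
  shows "(\<lambda>d. measure (Pi\<^sub>M {..<d} (\<lambda>_. \<nu>)) {x \<in> space (Pi\<^sub>M {..<d} (\<lambda>_. \<nu>)). \<not> \<bar>(vnorm d x)\<^sup>2 / real d - v\<bar> \<le> e}) \<longlonglongrightarrow> 0"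
proof (rule tendsto_sandwich[OF _ _ tendsto_const weak_law_squares[OF nu sq(1) e]])
  show "\<forall>\<^sub>F d in sequentially. measure (Pi\<^sub>M {..<d} (\<lambda>_. \<nu>)) {x \<in> space (Pi\<^sub>M {..<d} (\<lambda>_. \<nu>)). \<not> \<bar>(vnorm d x)\<^sup>2 / real d - v\<bar> \<le> e}
    \<le> measure (Pi\<^sub>M {..<d} (\<lambda>_. \<nu>)) {x \<in> space (Pi\<^sub>M {..<d} (\<lambda>_. \<nu>)). \<bar>(\<Sum>i<d. (x i)\<^sup>2) / real d - (\<integral>x. x\<^sup>2 \<partial>\<nu>)\<bar> \<ge> e}"
  proof (rule always_eventually, rule allI)
    fix d :: nat
    let ?N = "Pi\<^sub>M {..<d} (\<lambda>_. \<nu>)"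
    interpret prob_space ?N by (rule prob_space_PiM) (rule nu)
    have [measurable]: "(\<lambda>x. x i) \<in> borel_measurable ?N" if "i < d" for i
      using measurable_component_singleton[of i "{..<d}" "\<lambda>_. \<nu>"] that measurable_cong_sets[OF refl nu(2), of ?N] by auto
    have s: "(\<lambda>x. \<Sum>i<d. (x i)\<^sup>2) \<in> borel_measurable ?N" by (intro borel_measurable_sum borel_measurable_power) auto
    show "measure ?N {x \<in> space ?N. \<not> \<bar>(vnorm d x)\<^sup>2 / real d - v\<bar> \<le> e}
      \<le> measure ?N {x \<in> space ?N. \<bar>(\<Sum>i<d. (x i)\<^sup>2) / real d - (\<integral>x. x\<^sup>2 \<partial>\<nu>)\<bar> \<ge> e}"
    proof (rule finite_measure_mono)
      show "{x \<in> space ?N. \<bar>(\<Sum>i<d. (x i)\<^sup>2) / real d - (\<integral>x. x\<^sup>2 \<partial>\<nu>)\<bar> \<ge> e} \<in> events" using s by measurable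
    qed (auto simp: sq(2) vnorm_def L2_set_def sum_nonneg)
  qed
qed (simp add: always_eventually)

text \<open>The decomposition divides by \<open>1 + \<theta>\<close>, so it is used only for
  \<open>\<bar>\<theta>\<bar> \<le> 1/2\<close>, where \<open>\<bar>Z\<bar> \<le> a\<close> and the
  constant 1 works in \<open>big_O_P\<close> for every probability level. On the complement, whose
  probability vanishes, \<open>W\<close> is 0 and \<open>Z\<close> takes the whole
  deviation.\<close>

lemma stochastic_representation:
  fixes P :: "nat \<Rightarrow> 'a measure" and V :: "nat \<Rightarrow> 'a \<Rightarrow> real" and r a :: "nat \<Rightarrow> real"
  assumes P: "\<And>n. n \<ge> 1 \<Longrightarrow> prob_space (P n)" and V: "\<And>n. n \<ge> 1 \<Longrightarrow> V n \<in> borel_measurable (P n)"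
    and a: "\<And>n. n \<ge> 1 \<Longrightarrow> a n > 0"
    and conv: "\<And>e. e > 0 \<Longrightarrow> (\<lambda>n. measure (P n) {\<omega> \<in> space (P n). \<bar>V n \<omega> - (r n)\<^sup>2\<bar> > e * ((r n)\<^sup>2 + a n)}) \<longlonglongrightarrow> 0"
  shows "\<exists>W Z. small_o_P P W (\<lambda>_. 1) \<and> big_O_P P Z a \<and>
    (\<forall>n\<ge>1. \<forall>\<omega>\<in>space (P n). V n \<omega> = (1 + W n \<omega>) * ((r n)\<^sup>2 + Z n \<omega>))"
proof -
  define \<theta> where "\<theta> n \<omega> = (V n \<omega> - (r n)\<^sup>2) / ((r n)\<^sup>2 + a n)" for n \<omega>
  \<comment> \<open>Nothing is assumed at index 0, but the order symbols demand measurability for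
    every \<open>n\<close>; the value 0 there secures it.\<close>
  define W where "W n \<omega> = (if n \<ge> 1 \<and> \<bar>\<theta> n \<omega>\<bar> \<le> 1/2 then \<theta> n \<omega> else 0)" for n \<omega>
  define Z where "Z n \<omega> = (if n \<ge> 1 then (if \<bar>\<theta> n \<omega>\<bar> \<le> 1/2 then a n * \<theta> n \<omega> / (1 + \<theta> n \<omega>) else V n \<omega> - (r n)\<^sup>2) else 0)" for n \<omega>
  have b: "(r n)\<^sup>2 + a n > 0" if "n \<ge> 1" for n using a[OF that] by (simp add: add_nonneg_pos)
  have th: "\<theta> n \<in> borel_measurable (P n)" if "n \<ge> 1" for n
    using V[OF that] unfolding \<theta>_def[abs_def] by measurable
  have Wm: "W n \<in> borel_measurable (P n)" for n
  proof (cases "n \<ge> 1")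
    case True
    note [measurable] = th[OF True]
    show ?thesis unfolding W_def[abs_def] by measurable
  qed (simp add: W_def[abs_def])
  have Zm: "Z n \<in> borel_measurable (P n)" for n
  proof (cases "n \<ge> 1")
    case True
    note [measurable] = th[OF True] V[OF True]
    show ?thesis unfolding Z_def[abs_def] by measurable
  qed (simp add: Z_def[abs_def])
  have Bm: "{\<omega> \<in> space (P n). \<bar>V n \<omega> - (r n)\<^sup>2\<bar> > e * ((r n)\<^sup>2 + a n)} \<in> sets (P n)" if "n \<ge> 1" for n e
    using V[OF that] by measurable
  have thgt: "\<bar>V n \<omega> - (r n)\<^sup>2\<bar> > e * ((r n)\<^sup>2 + a n) \<longleftrightarrow> \<bar>\<theta> n \<omega>\<bar> > e" if "n \<ge> 1" for n \<omega> e
    using b[OF that] by (simp add: \<theta>_def pos_less_divide_eq)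
  have "small_o_P P W (\<lambda>_. 1)"
    unfolding small_o_P_def
  proof (intro conjI allI impI Wm)
    fix e :: real assume e: "e > 0"
    show "(\<lambda>n. measure (P n) {\<omega> \<in> space (P n). \<bar>W n \<omega>\<bar> > e * \<bar>1\<bar>}) \<longlonglongrightarrow> 0"
    proof (rule tendsto_sandwich[OF _ _ tendsto_const conv[OF e]])
      show "\<forall>\<^sub>F n in sequentially. measure (P n) {\<omega> \<in> space (P n). \<bar>W n \<omega>\<bar> > e * \<bar>1\<bar>}
        \<le> measure (P n) {\<omega> \<in> space (P n). \<bar>V n \<omega> - (r n)\<^sup>2\<bar> > e * ((r n)\<^sup>2 + a n)}"
        using eventually_ge_at_top[of 1]
      proof eventually_elim
        fix n :: nat assume n: "n \<ge> 1"
        interpret prob_space "P n" by (rule P[OF n])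
        show "measure (P n) {\<omega> \<in> space (P n). \<bar>W n \<omega>\<bar> > e * \<bar>1\<bar>}
          \<le> measure (P n) {\<omega> \<in> space (P n). \<bar>V n \<omega> - (r n)\<^sup>2\<bar> > e * ((r n)\<^sup>2 + a n)}"
          by (rule finite_measure_mono[OF _ Bm[OF n]]) (use e n in \<open>auto simp: thgt[OF n] W_def split: if_splits\<close>)
      qed
    qed (simp add: always_eventually)
  qed
  moreover have "big_O_P P Z a"
    unfolding big_O_P_def
  proof (intro conjI allI impI Zm)
    fix e :: real assume e: "e > 0"
    have Zb: "\<bar>Z n \<omega>\<bar> \<le> \<bar>a n\<bar>" if n: "n \<ge> 1" and t: "\<bar>\<theta> n \<omega>\<bar> \<le> 1/2" for n \<omega>
    proof -
      have "1/2 \<le> 1 + \<theta> n \<omega>" using t by linarith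
      then have "\<bar>\<theta> n \<omega>\<bar> / (1 + \<theta> n \<omega>) \<le> 1" using t by (simp add: pos_divide_le_eq)
      then have "a n * (\<bar>\<theta> n \<omega>\<bar> / (1 + \<theta> n \<omega>)) \<le> a n * 1" using a[OF n] by (intro mult_left_mono) auto
      moreover have "\<bar>Z n \<omega>\<bar> = a n * (\<bar>\<theta> n \<omega>\<bar> / (1 + \<theta> n \<omega>))"
        using n t a[OF n] \<open>1/2 \<le> 1 + \<theta> n \<omega>\<close> by (simp add: Z_def abs_mult)
      ultimately show ?thesis by simp
    qed
    have half: "(1/2::real) > 0" by simp
    have "\<forall>\<^sub>F n in sequentially. measure (P n) {\<omega> \<in> space (P n). \<bar>Z n \<omega>\<bar> > 1 * \<bar>a n\<bar>} \<le> e"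
      using eventually_ge_at_top[of 1] order_tendstoD(2)[OF conv[OF half] e]
    proof eventually_elim
      fix n :: nat assume n: "n \<ge> 1" 
        and lt: "measure (P n) {\<omega> \<in> space (P n). 1/2 * ((r n)\<^sup>2 + a n) < \<bar>V n \<omega> - (r n)\<^sup>2\<bar>} < e"
      interpret prob_space "P n" by (rule P[OF n])
      have "measure (P n) {\<omega> \<in> space (P n). \<bar>Z n \<omega>\<bar> > 1 * \<bar>a n\<bar>}
          \<le> measure (P n) {\<omega> \<in> space (P n). \<bar>V n \<omega> - (r n)\<^sup>2\<bar> > 1/2 * ((r n)\<^sup>2 + a n)}"
      proof (rule finite_measure_mono[OF _ Bm[OF n]], rule subsetI)
        fix \<omega> assume "\<omega> \<in> {\<omega> \<in> space (P n). \<bar>Z n \<omega>\<bar> > 1 * \<bar>a n\<bar>}"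
        then show "\<omega> \<in> {\<omega> \<in> space (P n). \<bar>V n \<omega> - (r n)\<^sup>2\<bar> > 1/2 * ((r n)\<^sup>2 + a n)}"
          using Zb[OF n, of \<omega>] unfolding mem_Collect_eq thgt[OF n] by linarith
      qed
      then show "measure (P n) {\<omega> \<in> space (P n). \<bar>Z n \<omega>\<bar> > 1 * \<bar>a n\<bar>} \<le> e" using lt by linarith
    qed
    then show "\<exists>C>0. \<forall>\<^sub>F n in sequentially. measure (P n) {\<omega> \<in> space (P n). \<bar>Z n \<omega>\<bar> > C * \<bar>a n\<bar>} \<le> e"
      by (intro exI[of _ 1]) simp
  qed
  moreover have "V n \<omega> = (1 + W n \<omega>) * ((r n)\<^sup>2 + Z n \<omega>)" if n: "n \<ge> 1" for n \<omega>
  proof (cases "\<bar>\<theta> n \<omega>\<bar> \<le> 1/2")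
    case True
    then have p: "1 + \<theta> n \<omega> \<noteq> 0" by (auto simp: abs_le_iff)
    have "(1 + W n \<omega>) * ((r n)\<^sup>2 + Z n \<omega>) = (1 + \<theta> n \<omega>) * (r n)\<^sup>2 + a n * \<theta> n \<omega>"
      using True n p by (simp add: W_def Z_def distrib_left)
    also have "\<dots> = (r n)\<^sup>2 + \<theta> n \<omega> * ((r n)\<^sup>2 + a n)" by (simp add: algebra_simps)
    also have "\<dots> = V n \<omega>" using b[OF n] by (simp add: \<theta>_def)
    finally show ?thesis ..
  next
    case False
    then show ?thesis using n by (simp add: W_def Z_def)
  qed
  ultimately show ?thesis by blast
qed

lemma E_err_zero:
  assumes K: "closed_convex n K" and mu: "\<mu> \<in> K"
  shows "E_err n K \<mu> 0 = 0"
proof -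
  have "metric_proj n K \<mu> = \<mu>" by (rule metric_proj_eqI[OF K mu]) (simp add: vnorm_def L2_set_def sum_nonneg)
  then show ?thesis by (simp add: E_err_def seq_err_def seq_lse_def vnorm_def L2_set_def)
qed

lemma integral_N01_square: "integrable N01 (\<lambda>x. x\<^sup>2)" "(\<integral>x. x\<^sup>2 \<partial>N01) = 1"
proof -
  have "has_bochner_integral lborel (\<lambda>x. std_normal_density x * x\<^sup>2) 1"
    using std_normal_moment_even[of 1] by (simp add: fact_numeral)
  then show "integrable N01 (\<lambda>x. x\<^sup>2)" "(\<integral>x. x\<^sup>2 \<partial>N01) = 1"
    by (simp_all add: integrable_density integral_density has_bochner_integral_iff)
qed

theorem theorem2p2:
  fixes P :: "nat \<Rightarrow> 'a measure"
    and m :: "nat \<Rightarrow> nat"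
    and K :: "nat \<Rightarrow> (nat \<Rightarrow> real) set"
    and \<mu>0 :: "nat \<Rightarrow> nat \<Rightarrow> real"
    and X :: "nat \<Rightarrow> 'a \<Rightarrow> nat \<Rightarrow> nat \<Rightarrow> real"
    and \<xi> Y :: "nat \<Rightarrow> 'a \<Rightarrow> nat \<Rightarrow> real"
    and noise_law :: "real measure"
    and \<sigma> :: real
    and r :: "nat \<Rightarrow> real"
    and \<mu>hat :: "nat \<Rightarrow> 'a \<Rightarrow> nat \<Rightarrow> real"
    and slack :: "nat \<Rightarrow> 'a \<Rightarrow> real"
  defines "L \<equiv> \<lambda>n. log_factor n (K n) (\<mu>0 n)"
    and "\<omega>n \<equiv> \<lambda>n. noise_level \<sigma> (real (m n) / real n) (r n)"
  assumes sigma_pos: "\<sigma> > 0"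
    and noise_law: "prob_space noise_law" "sets noise_law = sets borel"
    and noise_mean: "integrable noise_law (\<lambda>x. x)" "(\<integral>x. x \<partial>noise_law) = 0"
    and noise_var: "integrable noise_law (\<lambda>x. x\<^sup>2)" "prob_space.variance noise_law (\<lambda>x. x) = \<sigma>\<^sup>2"
    and convex_K: "\<And>n. n \<ge> 1 \<Longrightarrow> closed_convex n (K n)"
    and mu0_in_K: "\<And>n. n \<ge> 1 \<Longrightarrow> \<mu>0 n \<in> K n"
    and model: "\<And>n. n \<ge> 1 \<Longrightarrow> gaussian_linear_model (P n) (m n) n (X n) (\<xi> n) noise_law"
    and Y_eq: "\<And>n \<omega> i. n \<ge> 1 \<Longrightarrow> \<omega> \<in> space (P n) \<Longrightarrow> i < m n \<Longrightarrow>
                 Y n \<omega> i = mat_vec n (X n \<omega>) (\<mu>0 n) i + \<xi> n \<omega> i"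
    and m_gt: "\<And>n. n \<ge> 1 \<Longrightarrow> real (m n) > stat_dim n (K n)"
    and r_pos: "\<And>n. n \<ge> 1 \<Longrightarrow> r n > 0"
    and r_fixed_point: "\<And>n. n \<ge> 1 \<Longrightarrow>
          E_err n (K n) (\<mu>0 n) (noise_level \<sigma> (real (m n) / real n) (r n)) / real n = (r n)\<^sup>2"
    and R1: "(\<lambda>n. (r n)\<^sup>2) \<in> O(\<lambda>_. 1)"
            "filterlim (\<lambda>n. real (m n) / L n) at_top sequentially"
    and R2: "limsup (\<lambda>n. ereal ((E_lrt n (K n) (\<mu>0 n) (\<omega>n n) - E_err n (K n) (\<mu>0 n) (\<omega>n n))
                                 / (2 * real n * \<sigma>\<^sup>2))) < 1"
    and muhat_measurable: "\<And>n i. n \<ge> 1 \<Longrightarrow> i < n \<Longrightarrow> (\<lambda>\<omega>. \<mu>hat n \<omega> i) \<in> borel_measurable (P n)"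
    and muhat_in_K: "\<And>n \<omega>. n \<ge> 1 \<Longrightarrow> \<omega> \<in> space (P n) \<Longrightarrow> \<mu>hat n \<omega> \<in> K n"
    and slack: "small_o_P P slack (\<lambda>n. (r n)\<^sup>2)"
    and near_min: "\<And>n. n \<ge> 1 \<Longrightarrow> AE \<omega> in P n.
          sq_loss (m n) n (X n \<omega>) (Y n \<omega>) (\<mu>hat n \<omega>)
            \<le> (INF \<mu>\<in>K n. sq_loss (m n) n (X n \<omega>) (Y n \<omega>) \<mu>) + slack n \<omega>"
  shows "\<exists>W Z. small_o_P P W (\<lambda>_. 1) \<and> big_O_P P Z (\<lambda>n. L n / real (m n)) \<and>
           (\<forall>n\<ge>1. \<forall>\<omega>\<in>space (P n).
              (vnorm n (\<lambda>i. \<mu>hat n \<omega> i - \<mu>0 n i))\<^sup>2 / real n = (1 + W n \<omega>) * ((r n)\<^sup>2 + Z n \<omega>))"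
proof -
  define a where "a n = L n / real (m n)" for n
  define b where "b n = sqrt ((r n)\<^sup>2 + a n)" for n
  define V where "V n \<omega> = (vnorm n (\<lambda>i. \<mu>hat n \<omega> i - \<mu>0 n i))\<^sup>2 / real n" for n \<omega>
  have P: "prob_space (P n)" if "n \<ge> 1" for n using model[OF that] by (simp add: gaussian_linear_model_def)
  \<comment> \<open>For \<open>m n = 0\<close> the noise level would be a quotient by zero, which is
    0. The error would then vanish, against \<open>r n > 0\<close>.\<close>
  have m1: "m n \<ge> 1" if n: "n \<ge> 1" for n
  proof (rule ccontr)
    assume "\<not> m n \<ge> 1"
    then have "noise_level \<sigma> (real (m n) / real n) (r n) = 0" by (simp add: noise_level_def)
    then show False using r_fixed_point[OF n] r_pos[OF n] E_err_zero[OF convex_K[OF n] mu0_in_K[OF n]] by simp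
  qed
  have Lge: "L n \<ge> ln (ln (16 * real n))" if n: "n \<ge> 1" for n
    unfolding L_def by (rule log_factor_ge[OF convex_K[OF n] mu0_in_K[OF n]])
  \<comment> \<open>The constant 16 makes the inner logarithm exceed 1, so the iterated logarithm is
    positive from \<open>n = 1\<close> on.\<close>
  have Lpos: "L n > 0" if n: "n \<ge> 1" for n
  proof -
    have "exp 1 < (16 * real n)" using exp_le n by simp
    then have "ln (exp 1) < ln (16 * real n)" using n by (subst ln_less_cancel_iff) auto
    then have "1 < ln (16 * real n)" by simp
    then show ?thesis using Lge[OF n] ln_gt_zero[of "ln (16 * real n)"] by linarith
  qed
  have apos: "a n > 0" if "n \<ge> 1" for n using Lpos[OF that] m1[OF that] by (simp add: a_def)
  have b2: "(b n)\<^sup>2 = (r n)\<^sup>2 + a n" if "n \<ge> 1" for n using apos[OF that] by (simp add: b_def add_nonneg_nonneg)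
  have rb: "r n \<le> b n" if "n \<ge> 1" for n using apos[OF that] by (simp add: b_def real_le_rsqrt)
  have "filterlim (\<lambda>n. ln (ln (16 * real n))) at_top sequentially" by real_asymp
  then have Ltop: "filterlim L at_top sequentially"
    by (rule filterlim_at_top_mono) (use Lge in \<open>auto intro: eventually_mono[OF eventually_ge_at_top[of 1]]\<close>)
  \<comment> \<open>Eventually \<open>L n \<ge> 1\<close>, so \<open>real (m n)\<close> dominates
    the quotient that diverges by (R1).\<close>
  have mtop: "filterlim (\<lambda>n. real (m n)) at_top sequentially"
  proof (rule filterlim_at_top_mono[OF R1(2)])
    have "\<forall>\<^sub>F n in sequentially. L n \<ge> 1" using Ltop by (simp add: filterlim_at_top)
    then show "\<forall>\<^sub>F n in sequentially. real (m n) / L n \<le> real (m n)"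
      by eventually_elim (simp add: divide_le_eq mult_le_cancel_left1)
  qed
  then have mseq: "filterlim m sequentially sequentially" by (simp add: filterlim_sequentially_iff_filterlim_real)
  have a0: "a \<longlonglongrightarrow> 0"
    using tendsto_inverse_0_at_top[OF R1(2)] by (simp add: a_def[abs_def])
  obtain c where c: "c > 0" "\<forall>\<^sub>F n in sequentially. norm ((r n)\<^sup>2) \<le> c * norm (1::real)" using R1(1) by (elim landau_o.bigE)
  define M where "M = sqrt (c + 1)"
  have M: "M > 0" "M\<^sup>2 = c + 1" using c by (simp_all add: M_def)
  have bM: "\<forall>\<^sub>F n in sequentially. b n \<le> M"
    using c(2) order_tendstoD(2)[OF a0 zero_less_one]
    by eventually_elim (simp add: b_def M_def)
  \<comment> \<open>A number strictly between the limit superior and 1 turns (R2) into a margin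
    \<open>\<eta>\<close> that holds for all large \<open>n\<close>.\<close>
  obtain y where y: "limsup (\<lambda>n. ereal ((E_lrt n (K n) (\<mu>0 n) (\<omega>n n) - E_err n (K n) (\<mu>0 n) (\<omega>n n))
                                 / (2 * real n * \<sigma>\<^sup>2))) < ereal y" "ereal y < 1"
    using ereal_dense2[OF R2] by blast
  define \<eta> where "\<eta> = 1 - y"
  have eta: "\<eta> > 0" using y(2) by (simp add: \<eta>_def)
  define l0 where "l0 n = E_lrt n (K n) (\<mu>0 n) (noise_level \<sigma> (real (m n) / real n) (r n)) / real n" for n
  have l0: "\<forall>\<^sub>F n in sequentially. (l0 n - (r n)\<^sup>2) / (2 * \<sigma>\<^sup>2) \<le> 1 - \<eta>"
    using Limsup_lessD[OF y(1)] eventually_ge_at_top[of 1]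
  proof eventually_elim
    fix n :: nat assume n: "n \<ge> 1" and lt: "ereal ((E_lrt n (K n) (\<mu>0 n) (\<omega>n n) - E_err n (K n) (\<mu>0 n) (\<omega>n n)) / (2 * real n * \<sigma>\<^sup>2)) < ereal y"
    have "(l0 n - (r n)\<^sup>2) / (2 * \<sigma>\<^sup>2) = (E_lrt n (K n) (\<mu>0 n) (\<omega>n n) - E_err n (K n) (\<mu>0 n) (\<omega>n n)) / (2 * real n * \<sigma>\<^sup>2)"
      unfolding r_fixed_point[OF n, symmetric] l0_def \<omega>n_def diff_divide_distrib[symmetric] by (simp add: mult_ac)
    then show "(l0 n - (r n)\<^sup>2) / (2 * \<sigma>\<^sup>2) \<le> 1 - \<eta>" using lt by (simp add: \<eta>_def)
  qed
  have Vm: "V n \<in> borel_measurable (P n)" if n: "n \<ge> 1" for n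
    unfolding V_def[abs_def]
    by (intro borel_measurable_divide borel_measurable_power borel_measurable_const measurable_vnorm borel_measurable_diff muhat_measurable[OF n])
  have conv: "(\<lambda>n. measure (P n) {\<omega> \<in> space (P n). \<bar>V n \<omega> - (r n)\<^sup>2\<bar> > e * ((r n)\<^sup>2 + a n)}) \<longlonglongrightarrow> 0" if e: "e > 0" for e
  proof -
    \<comment> \<open>Localizing the norm within \<open>\<epsilon> * b\<close> localizes its square
      within \<open>3 * \<epsilon> * b\<^sup>2\<close>.\<close>
    define \<epsilon> where "\<epsilon> = min 1 (e / 3)"
    have eps: "0 < \<epsilon>" "\<epsilon> \<le> 1" "3 * \<epsilon> \<le> e" using e by (auto simp: \<epsilon>_def)
    from aux_separation[OF sigma_pos M(1) eps(1,2)] obtain \<gamma> k0 where gk: "\<gamma> > 0" "k0 > 0" "k0 \<le> \<epsilon>" and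
      sep: "\<forall>r b l0 v p l G x. 0 < r \<and> r \<le> b \<and> b \<le> M \<and> aux_good k0 \<sigma> r b l0 v p l G x \<longrightarrow>
     (\<forall>s. 0 \<le> s \<and> s \<le> r + \<epsilon> * b \<and> \<bar>s - r\<bar> \<ge> \<epsilon> * b \<and> s\<^sup>2 * G - 2 * s * x + v \<ge> 0 \<longrightarrow>
        aux_min \<sigma> r l0 v + 4 * \<gamma> * b\<^sup>2 \<le> sqrt (s\<^sup>2 * G - 2 * s * x + v) - (l + 2 * s * p - p\<^sup>2) / (2 * sqrt (r\<^sup>2 + \<sigma>\<^sup>2))) \<and>
     (p\<^sup>2 * G - 2 * p * x + v \<ge> 0 \<longrightarrow>
        sqrt (p\<^sup>2 * G - 2 * p * x + v) - (l + p\<^sup>2) / (2 * sqrt (r\<^sup>2 + \<sigma>\<^sup>2)) \<le> aux_min \<sigma> r l0 v + \<gamma> * b\<^sup>2)"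
      by (elim exE conjE)
    \<comment> \<open>Reduced below \<open>k0\<close> so that \<open>aux_min_pos\<close> applies
      with lower bound \<open>\<phi>\<close>. None of \<open>\<epsilon>\<close>,
      \<open>\<gamma>\<close>, \<open>k\<close>, \<open>\<phi>\<close> depends on
      \<open>n\<close>.\<close>
    define k where "k = min k0 (min (\<sigma>^3 * \<eta> / (4 * (M + \<sigma>))) (\<sigma>\<^sup>2))"
    define \<phi> where "\<phi> = \<sigma>\<^sup>2 * \<eta> / (4 * (M + \<sigma>))"
    have "\<sigma>^3 * \<eta> / (4 * (M + \<sigma>)) > 0" "\<phi> > 0" using sigma_pos eta M by (simp_all add: \<phi>_def)
    then have k: "k > 0" "k \<le> k0" "k \<le> \<epsilon>" "k \<le> \<sigma>^3 * \<eta> / (4 * (M + \<sigma>))" "k \<le> \<sigma>\<^sup>2" and ph: "\<phi> > 0"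
      using gk sigma_pos by (auto simp: k_def)
    define C where "C = 2 * ((10240 / k^8 + 20 / k\<^sup>2) * (M\<^sup>2 + \<sigma>\<^sup>2) + (\<sigma>\<^sup>2 + k) / k\<^sup>2 + 64 / \<gamma>\<^sup>2)"
    define p1 where "p1 d = measure (Pi\<^sub>M {..<d} (\<lambda>_. noise_law)) {x \<in> space (Pi\<^sub>M {..<d} (\<lambda>_. noise_law)). \<not> \<bar>(vnorm d x)\<^sup>2 / real d - \<sigma>\<^sup>2\<bar> \<le> k}" for d
    define p2 where "p2 d = measure (gauss {..<d}) {x \<in> space (gauss {..<d}). \<not> \<bar>(vnorm d x)\<^sup>2 / real d - 1\<bar> \<le> k}" for d
    define p3 where "p3 n = measure (P n) {\<omega> \<in> space (P n). \<bar>slack n \<omega>\<bar> > \<phi> * \<gamma> * \<bar>(r n)\<^sup>2\<bar>}" for n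
    have le: "\<forall>\<^sub>F n in sequentially. measure (P n) {\<omega> \<in> space (P n). \<bar>V n \<omega> - (r n)\<^sup>2\<bar> > e * ((r n)\<^sup>2 + a n)}
       \<le> p1 (m n) + 2 * p2 (m n) + C / (real (m n) * (b n)\<^sup>2) + p3 n"
      using bM l0 eventually_ge_at_top[of 1]
    proof eventually_elim
      fix n :: nat assume bM: "b n \<le> M" and l0: "(l0 n - (r n)\<^sup>2) / (2 * \<sigma>\<^sup>2) \<le> 1 - \<eta>" and n: "n \<ge> 1"
      interpret prob_space "P n" by (rule P[OF n])
      have B: "measure (P n) {\<omega> \<in> space (P n). \<bar>V n \<omega> - (r n)\<^sup>2\<bar> > 3 * \<epsilon> * (b n)\<^sup>2}
         \<le> p1 (m n) + 2 * p2 (m n) + C / (real (m n) * (b n)\<^sup>2) + p3 n"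
        unfolding V_def p1_def p2_def p3_def C_def
      proof (rule instance_bound[OF n m1[OF n] convex_K[OF n] mu0_in_K[OF n] sigma_pos r_pos[OF n] rb[OF n] bM eps(1,2) k(1,3) gk(1) ph k(2) sep _
          r_fixed_point[OF n] model[OF n] noise_law Y_eq[OF n] muhat_in_K[OF n] near_min[OF n]])
        show "slack n \<in> borel_measurable (P n)" using slack by (simp add: small_o_P_def)
        fix v assume v: "\<bar>v - \<sigma>\<^sup>2\<bar> \<le> k"
        have "r n \<le> M" using rb[OF n] bM by linarith
        from aux_min_pos[OF sigma_pos r_pos[OF n] this eta l0 v k(4,5)]
        show "\<phi> \<le> aux_min \<sigma> (r n) (E_lrt n (K n) (\<mu>0 n) (noise_level \<sigma> (real (m n) / real n) (r n)) / real n) v"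
          unfolding \<phi>_def l0_def .
      qed
      have "3 * \<epsilon> * (b n)\<^sup>2 \<le> e * ((r n)\<^sup>2 + a n)" unfolding b2[OF n] using eps(3) apos[OF n] by (intro mult_right_mono) auto
      then have sub: "{\<omega> \<in> space (P n). \<bar>V n \<omega> - (r n)\<^sup>2\<bar> > e * ((r n)\<^sup>2 + a n)} \<subseteq> {\<omega> \<in> space (P n). \<bar>V n \<omega> - (r n)\<^sup>2\<bar> > 3 * \<epsilon> * (b n)\<^sup>2}"
        by auto
      have "{\<omega> \<in> space (P n). \<bar>V n \<omega> - (r n)\<^sup>2\<bar> > 3 * \<epsilon> * (b n)\<^sup>2} \<in> events" using Vm[OF n] by measurable
      from finite_measure_mono[OF sub this] B
      show "measure (P n) {\<omega> \<in> space (P n). \<bar>V n \<omega> - (r n)\<^sup>2\<bar> > e * ((r n)\<^sup>2 + a n)}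
       \<le> p1 (m n) + 2 * p2 (m n) + C / (real (m n) * (b n)\<^sup>2) + p3 n" by (rule order_trans)
    qed
    have "(\<integral>x. x\<^sup>2 \<partial>noise_law) = \<sigma>\<^sup>2" using noise_var(2) noise_mean(2) by simp
    then have "p1 \<longlonglongrightarrow> 0" unfolding p1_def[abs_def] by (intro weak_law_vnorm noise_law noise_var(1) k(1))
    then have t1: "(\<lambda>n. p1 (m n)) \<longlonglongrightarrow> 0" using mseq by (rule filterlim_compose)
    have "p2 \<longlonglongrightarrow> 0" unfolding p2_def[abs_def]
      by (intro weak_law_vnorm prob_space_N01 integral_N01_square k(1)) simp
    then have t2: "(\<lambda>n. p2 (m n)) \<longlonglongrightarrow> 0" using mseq by (rule filterlim_compose)
    have t3: "p3 \<longlonglongrightarrow> 0" using slack ph gk(1) unfolding small_o_P_def p3_def[abs_def] by simp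
    \<comment> \<open>The summand \<open>a n = L n / real (m n)\<close> in the scale guarantees
      \<open>real (m n) * (b n)\<^sup>2 \<ge> L n\<close> even when \<open>r n\<close> tends to 0,
      and the iterated logarithm forces \<open>L\<close> to infinity.\<close>
    have "filterlim (\<lambda>n. real (m n) * (b n)\<^sup>2) at_top sequentially"
    proof (rule filterlim_at_top_mono[OF Ltop])
      show "\<forall>\<^sub>F n in sequentially. L n \<le> real (m n) * (b n)\<^sup>2" using eventually_ge_at_top[of 1]
      proof eventually_elim
        fix n :: nat assume n: "n \<ge> 1"
        have "real (m n) * (b n)\<^sup>2 = real (m n) * (r n)\<^sup>2 + L n" unfolding b2[OF n] using m1[OF n] by (simp add: a_def distrib_left)
        then show "L n \<le> real (m n) * (b n)\<^sup>2" by simp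
      qed
    qed
    then have t4: "(\<lambda>n. C / (real (m n) * (b n)\<^sup>2)) \<longlonglongrightarrow> 0" by (rule real_tendsto_divide_at_top[OF tendsto_const])
    have "(\<lambda>n. p1 (m n) + 2 * p2 (m n) + C / (real (m n) * (b n)\<^sup>2) + p3 n) \<longlonglongrightarrow> 0 + 2 * 0 + 0 + 0"
      by (intro tendsto_intros t1 t2 t3 t4)
    then show ?thesis
      by (intro tendsto_sandwich[OF _ le tendsto_const]) (simp_all add: always_eventually)
  qed
  show ?thesis using stochastic_representation[OF P Vm apos conv] unfolding V_def a_def .
qed

end
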